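(* For all nonnegative integers $m,n$, $HH_0(\mathrm{Hom}(m,n))$ and $R_{(m,n)}$ are isomorphic as $\mathbb{Z}$-modules.
   Context: $HH_0(A)=A/[A,A]$ with $[A,A]$ the additive span of commutators. The ground ring is $\mathbb{Z}$. Arc rings. Let $\mathcal{A}=\mathbb{Z}[X]/(X^2)$ with $\Delta(1)=1\otimes X+X\otimes1$, $\Delta(X)=X\otimes X$, $\epsilon(1)=0$, $\epsilon(X)=1$, and $\mathcal{F}$ the corresponding two-dimensional TQFT (circle $\mapsto\mathcal{A}$). Let $B^n$ be the set of crossingless matchings (cups) of $2n$ points and $W$ denote reflection in a horizontal line. $H^n=\bigoplus_{a,b\in B^n}{}_b(H^n)_a$, ${}_b(H^n)_a=\mathcal{F}(W(b)a)$, with product ${}_d(H^n)_c\cdot{}_b(H^n)_a=0$ for $c\ne b$, and for $c=b$ given by $\mathcal{F}$ of the minimal saddle cobordism $W(d)bW(b)a\to W(d)a$ induced by the $n$ saddles turning $bW(b)$ into $2n$ vertical lines. A generator of ${}_b(H^n)_a$ is drawn as $W(b)a$ with a dot on each circle whose tensor factor is $X$. Tangles. $B^m_n$ is the set of isotopy classes of planar tangles with $2m$ top and $2n$ bottom endpoints and without closed components. For a planar $(2m,2n)$-tangle $T$, $\mathcal{F}(T)=\bigoplus_{a\in B^n,b\in B^m}\mathcal{F}(W(b)Ta)$ is an $(H^m,H^n)$-bimodule, with actions induced by the minimal saddle cobordisms. A dotted cobordism $S:T_1\to T_2$ (a dot acting as multiplication by $X$) induces a bimodule homomorphism $\mathcal{F}(S)$.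 Gradings are ignored. $\mathrm{Hom}_{BN}(T_1,T_2)$ is the $\mathbb{Z}$-module generated by dotted tangle cobordisms up to isotopy, modulo the local Bar-Natan relations: a sphere is $0$; a sphere with one dot is $1$; two dots on a component give $0$; neck-cutting: a tube equals the sum of the two ways of replacing it by two discs one of which carries a dot. $\mathrm{Hom}_{BN}(m,n)=\bigoplus_{T_1,T_2\in B^m_n}\mathrm{Hom}_{BN}(T_1,T_2)$ and $\mathrm{Hom}(m,n)=\bigoplus_{T_1,T_2\in B^m_n}\mathrm{Hom}_{(H^m,H^n)}(\mathcal{F}(T_1),\mathcal{F}(T_2))$ (bimodule homomorphisms) are rings under stacking, resp. composition, and $\phi_{m,n}:\mathrm{Hom}_{BN}(m,n)\to\mathrm{Hom}(m,n)$ is the ring homomorphism $S\mapsto\mathcal{F}(S)$. Ring isomorphism $\gamma:H^{m+n}\to\mathrm{Hom}_{BN}(m,n)$: given a generator of ${}_b(H^{m+n})_a$ drawn as $W(b)a$ with dots on circles, cap off each of the circles with a disc (dotted if the circle is), slice where $W(b)$ meets $a$ and bend $a$ to the bottom of the cobordism, so that the result is a cobordism between matchings with $2(m+n)$ endpoints, and then bend the first $2m$ endpoints over to the other side, turning the matchings into planar tangles with $2m$ top and $2n$ bottom endpoints. The module $R_{(m,n)}$ is the $\mathbb{Z}$-module generated by crossingless matchings of $2(m+n)$ points, each arc carrying at most one dot, modulo: (1) for $a<b<c<d$ and diagrams identical away from arcs ending at $a,b,c,d$ (a bar marks a dotted arc), Type I: $[\overline{ab},cd]+[ab,\overline{cd}]=[\overline{ad},bc]+[ad,\overline{bc}]$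 and Type II: $[\overline{ab},\overline{cd}]=[\overline{ad},\overline{bc}]$; (2) for each generator of $\ker(\phi_{m,n})$ over $\mathbb{Z}$, pass to an element of $H^{m+n}$ via $\gamma^{-1}$, slide all dots to the bottom half of the diagram and cut off the top half, leaving a (sum of) dotted crossingless matchings; this sum is set equal to zero.
   Formalization: In relation (2), sliding dots and cutting is applied only to the diagonal summands of H^{m+n}; off-diagonal kernel parts, where a circle can meet several bottom arcs and the slide is not well defined, contribute zero. *)

theory Defs
  imports "HOL-Algebra.Algebra" "HOL-Algebra.Free_Abelian_Groups"
    "HOL-Library.Disjoint_Sets" "HOL-Library.Multiset"
begin

section \<open>Crossingless matchings, planar tangles and their closures\<close>

text \<open>
  A 1-manifold is encoded by the set of its arcs, an arc by the set of its two endpoints.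
  The map \<open>pos\<close> lists the endpoints in the order in which they occur along the boundary
  of the disc (cut open at one place).
\<close>

definition crossingless_on :: "('p \<Rightarrow> nat) \<Rightarrow> 'p set \<Rightarrow> 'p set set \<Rightarrow> bool" where
  "crossingless_on pos V M \<longleftrightarrow>
     partition_on V M \<and> (\<forall>\<alpha>\<in>M. card \<alpha> = 2) \<and>
     (\<forall>p\<in>V. \<forall>q\<in>V. \<forall>r\<in>V. \<forall>s\<in>V.
        pos p < pos q \<and> pos q < pos r \<and> pos r < pos s \<longrightarrow> \<not> ({p, r} \<in> M \<and> {q, s} \<in> M))"

definition matchings :: "nat \<Rightarrow> nat set set set" where
  "matchings n = {M. crossingless_on (\<lambda>i. i) {1..2 * n} M}"

text \<open>
  \<open>Top i\<close> and \<open>Bot j\<close> are the \<open>i\<close>-th top and the \<open>j\<close>-th bottom endpoint of a planar tangle,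
  both counted from left to right.  \<open>boundary_pos m\<close> runs along the top line from right to left
  and then along the bottom line from left to right.  A planar tangle without closed components
  is determined up to isotopy by its crossingless arcs.
\<close>

datatype endpoint = Top nat | Bot nat

definition endpoints :: "nat \<Rightarrow> nat \<Rightarrow> endpoint set" where
  "endpoints m n = Top ` {1..2 * m} \<union> Bot ` {1..2 * n}"

fun boundary_pos :: "nat \<Rightarrow> endpoint \<Rightarrow> nat" where
  "boundary_pos m (Top i) = 2 * m + 1 - i"
| "boundary_pos m (Bot j) = 2 * m + j"

type_synonym tangle = "endpoint set set"

definition tangles :: "nat \<Rightarrow> nat \<Rightarrow> tangle set" where
  "tangles m n = {T. crossingless_on (boundary_pos m) (endpoints m n) T}"

text \<open>
  Bending the first \<open>2 * m\<close> of \<open>2 * (m + n)\<close> points on a line over to the other side;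
  on \<open>{1..2 * (m + n)}\<close> this is the inverse of \<open>boundary_pos m\<close>.
\<close>

definition bend_point :: "nat \<Rightarrow> nat \<Rightarrow> endpoint" where
  "bend_point m i = (if i \<le> 2 * m then Top (2 * m + 1 - i) else Bot (i - 2 * m))"

definition bend :: "nat \<Rightarrow> nat set set \<Rightarrow> tangle" where
  "bend m M = (`) (bend_point m) ` M"

text \<open>
  The vertex sets of the connected components of the union of the members of a family of
  sets.  A circle of a closed 1-manifold is encoded by the set of the marked points on it.  For
  matchings \<open>a\<close> and \<open>b\<close> of the same points the circles of \<open>W(b)a\<close> are
  \<open>conn_components (b \<union> a)\<close>; this is also correct when \<open>b\<close> and \<open>a\<close> share arcs, since such an
  arc and its mirror image close up to a circle through just two marked points.
\<close>

definition conn_components :: "'v set set \<Rightarrow> 'v set set" where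
  "conn_components \<V> = \<Union>\<V> // {(x, y). \<exists>V\<in>\<V>. x \<in> V \<and> y \<in> V}\<^sup>*"

definition closed_up :: "nat set set \<Rightarrow> tangle \<Rightarrow> nat set set \<Rightarrow> tangle" where
  \<comment> \<open>the closed 1-manifold \<open>W(b) T a\<close>\<close>
  "closed_up b T a = (`) Top ` b \<union> T \<union> (`) Bot ` a"


section \<open>The Frobenius algebra and the value of the TQFT on a connected surface\<close>

text \<open>The pair \<open>(a, b)\<close> stands for \<open>a + b X\<close> in \<open>\<int>[X]/(X\<^sup>2)\<close>.\<close>

type_synonym frob = "int \<times> int"

definition frob_one :: frob where "frob_one = (1, 0)"

definition frob_X :: frob where "frob_X = (0, 1)"

fun frob_add :: "frob \<Rightarrow> frob \<Rightarrow> frob" where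
  "frob_add (a, b) (c, d) = (a + c, b + d)"

fun frob_scale :: "int \<Rightarrow> frob \<Rightarrow> frob" where
  "frob_scale k (a, b) = (k * a, k * b)"

fun frob_mult :: "frob \<Rightarrow> frob \<Rightarrow> frob" where
  "frob_mult (a, b) (c, d) = (a * c, a * d + b * c)"

fun frob_counit :: "frob \<Rightarrow> int" where
  "frob_counit (a, b) = b"

text \<open>
  A basis vector \<open>1\<close> or \<open>X\<close> is indexed by \<open>False\<close> or \<open>True\<close> (undotted, dotted);
  \<open>frob_comult z e f\<close> is the coefficient of the tensor product of the basis vectors
  \<open>e\<close> and \<open>f\<close> in \<open>\<Delta>(z)\<close>.
\<close>

definition frob_basis :: "bool \<Rightarrow> frob" where
  "frob_basis e = (if e then frob_X else frob_one)"

fun frob_comult :: "frob \<Rightarrow> bool \<Rightarrow> bool \<Rightarrow> int" where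
  "frob_comult (a, b) False False = 0"
| "frob_comult (a, b) False True = a"
| "frob_comult (a, b) True False = a"
| "frob_comult (a, b) True True = b"

text \<open>The operator of a one-holed handle, the composite of comultiplication and multiplication.\<close>

definition frob_handle :: "frob \<Rightarrow> frob" where
  "frob_handle z =
     frob_add
       (frob_add (frob_scale (frob_comult z False False) (frob_mult (frob_basis False) (frob_basis False)))
                 (frob_scale (frob_comult z False True) (frob_mult (frob_basis False) (frob_basis True))))
       (frob_add (frob_scale (frob_comult z True False) (frob_mult (frob_basis True) (frob_basis False)))
                 (frob_scale (frob_comult z True True) (frob_mult (frob_basis True) (frob_basis True))))"

text \<open>
  \<open>iter_comult z es\<close> is the coefficient of the tensor product of the basis vectors \<open>es\<close>
  in the image of \<open>z\<close> under the iterated comultiplication with \<open>length es\<close> tensor factors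
  (the counit if there are none).
\<close>

primrec iter_comult :: "frob \<Rightarrow> bool list \<Rightarrow> int" where
  "iter_comult z [] = frob_counit z"
| "iter_comult z (e # es) = iter_comult (frob_comult z e False, frob_comult z e True) es"

text \<open>
  Normal form of a connected surface of genus \<open>g\<close>: multiply the incoming factors and the dots
  on the surface, apply the handle operator \<open>g\<close> times, and comultiply.  Here \<open>p\<close> is the number
  of dots on the surface plus the number of incoming circles labelled \<open>X\<close>; the result is the
  coefficient of a basis vector with \<open>u\<close> outgoing circles labelled \<open>1\<close> and \<open>v\<close> labelled \<open>X\<close>.
  Their order is irrelevant by cocommutativity.
\<close>

definition surface_coeff :: "nat \<Rightarrow> nat \<Rightarrow> nat \<Rightarrow> nat \<Rightarrow> int" where
  "surface_coeff g p u v =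
     iter_comult ((frob_handle ^^ g) ((frob_mult frob_X ^^ p) frob_one))
       (replicate u False @ replicate v True)"

lemma surface_coeff_eq: "surface_coeff g p u v = (if p + g + u = 1 then 2 ^ g else 0)"
proof -
  have handle: "frob_handle (a, b) = (0, 2 * a)" for a b
    by (simp add: frob_handle_def frob_basis_def frob_one_def frob_X_def)
  have handles: "(frob_handle ^^ g) (a, b) =
      (if g = 0 then (a, b) else if g = 1 then (0, 2 * a) else (0, 0))" for a b
  proof (induction g)
    case 0
    show ?case by simp
  next
    case (Suc g)
    then show ?case by (auto simp: handle)
  qed
  have dots: "(frob_mult frob_X ^^ p) frob_one =
      (if p = 0 then (1, 0) else if p = 1 then (0, 1) else (0, 0))"
    by (induction p) (auto simp: frob_X_def frob_one_def)
  have dotted: "iter_comult (a, b) (replicate v True) = b" for a b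
    by (induction v arbitrary: a b) auto
  have "iter_comult (a, b) (replicate u False @ replicate v True) =
      (if u = 0 then b else if u = 1 then a else 0)" for a b
    by (induction u arbitrary: a b) (auto simp: dotted)
  then show ?thesis
    by (auto simp: surface_coeff_def dots handles)
qed


section \<open>Surfaces glued from pieces\<close>

text \<open>
  A cobordism between closed 1-manifolds is presented as being glued from pieces along vertical
  intervals, one interval for each vertex \<open>v\<close>.  A piece \<open>(V, \<chi>, k)\<close> is a connected surface with
  Euler characteristic \<open>\<chi>\<close> and \<open>k\<close> dots, whose vertical edges are the intervals over \<open>V\<close>;
  every vertex belongs to exactly two pieces, and \<open>V = {}\<close> means a closed surface.  Each gluing
  along an interval lowers the Euler characteristic by one.  The incoming circles \<open>In\<close> and the
  outgoing circles \<open>Out\<close> are sets of vertices, \<open>D \<subseteq> In\<close> and \<open>E \<subseteq> Out\<close> the circles labelled \<open>X\<close>;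
  then \<open>cob_coeff Q In Out D E\<close> is the entry at \<open>(D, E)\<close> of the matrix of the TQFT.
\<close>

type_synonym 'v piece = "'v set \<times> int \<times> nat"

fun piece_verts :: "'v piece \<Rightarrow> 'v set" where "piece_verts (V, \<chi>, k) = V"
fun piece_euler :: "'v piece \<Rightarrow> int" where "piece_euler (V, \<chi>, k) = \<chi>"
fun piece_dots :: "'v piece \<Rightarrow> nat" where "piece_dots (V, \<chi>, k) = k"

definition component_coeff ::
  "'v piece multiset \<Rightarrow> 'v set set \<Rightarrow> 'v set set \<Rightarrow> 'v set set \<Rightarrow> 'v set set \<Rightarrow> 'v set \<Rightarrow> int" where
  "component_coeff Q In Out D E K =
     (let P = filter_mset (\<lambda>q. piece_verts q \<noteq> {} \<and> piece_verts q \<subseteq> K) Q;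
          euler = (\<Sum>q\<in>#P. piece_euler q) - int (card K);
          boundary = card {c \<in> In. c \<subseteq> K} + card {c \<in> Out. c \<subseteq> K};
          genus = nat ((2 - euler - int boundary) div 2);
          dots = (\<Sum>q\<in>#P. piece_dots q) + card {c \<in> D. c \<subseteq> K}
      in surface_coeff genus dots (card {c \<in> Out - E. c \<subseteq> K}) (card {c \<in> E. c \<subseteq> K}))"

definition cob_coeff ::
  "'v piece multiset \<Rightarrow> 'v set set \<Rightarrow> 'v set set \<Rightarrow> 'v set set \<Rightarrow> 'v set set \<Rightarrow> int" where
  "cob_coeff Q In Out D E =
     (\<Prod>K\<in>conn_components (piece_verts ` set_mset Q). component_coeff Q In Out D E K) *
     (\<Prod>q\<in>#filter_mset (\<lambda>q. piece_verts q = {}) Q.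
        surface_coeff (nat ((2 - piece_euler q) div 2)) (piece_dots q) 0 0)"

text \<open>
  The value of the TQFT on the basis vector \<open>D\<close>.  The outgoing circles are named by their marked
  points, \<open>\<iota>\<close> says at which vertices of the surface these lie, and \<open>lab\<close> turns a set of dotted
  outgoing circles into a basis vector of the target.
\<close>

definition tqft ::
  "'v piece multiset \<Rightarrow> 'v set set \<Rightarrow> 'v set set \<Rightarrow> ('w \<Rightarrow> 'v) \<Rightarrow> 'w set set \<Rightarrow> ('w set set \<Rightarrow> 'g)
     \<Rightarrow> 'g \<Rightarrow>\<^sub>0 int" where
  "tqft Q In D \<iota> Out lab =
     (\<Sum>E\<in>Pow Out. frag_cmul (cob_coeff Q In ((`) \<iota> ` Out) D ((`) \<iota> ` E)) (frag_of (lab E)))"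

text \<open>
  \<open>strips f M\<close>: the discs arc \<open>\<times>\<close> interval over the arcs of \<open>M\<close>, with endpoints placed by \<open>f\<close>.
  \<open>saddles f g b\<close>: one saddle for each arc of \<open>b\<close>, turning this arc (placed by \<open>f\<close>) and its
  mirror image in \<open>W(b)\<close> (placed by \<open>g\<close>) into two vertical lines; a saddle is a disc with four
  vertical edges.
\<close>

definition strips :: "('p \<Rightarrow> 'v) \<Rightarrow> 'p set set \<Rightarrow> 'v piece multiset" where
  "strips f M = image_mset (\<lambda>\<alpha>. (f ` \<alpha>, 1, 0)) (mset_set M)"

definition saddles :: "('p \<Rightarrow> 'v) \<Rightarrow> ('p \<Rightarrow> 'v) \<Rightarrow> 'p set set \<Rightarrow> 'v piece multiset" where
  "saddles f g b = image_mset (\<lambda>\<alpha>. (f ` \<alpha> \<union> g ` \<alpha>, 1, 0)) (mset_set b)"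

definition bilinear_extend ::
  "('a \<Rightarrow> 'b \<Rightarrow> 'c \<Rightarrow>\<^sub>0 int) \<Rightarrow> ('a \<Rightarrow>\<^sub>0 int) \<Rightarrow> ('b \<Rightarrow>\<^sub>0 int) \<Rightarrow> 'c \<Rightarrow>\<^sub>0 int" where
  "bilinear_extend f x y = frag_extend (\<lambda>p. frag_extend (f p) y) x"


section \<open>Arc rings\<close>

text \<open>
  The basis vector \<open>(b, a, D)\<close> is the diagram \<open>W(b)a\<close> with a dot on each circle in \<open>D\<close>.
\<close>

type_synonym arc_gen = "nat set set \<times> nat set set \<times> nat set set"

definition arc_gens :: "nat \<Rightarrow> arc_gen set" where
  "arc_gens n = {(b, a, D). b \<in> matchings n \<and> a \<in> matchings n \<and> D \<subseteq> conn_components (b \<union> a)}"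

fun arc_mult_gen :: "arc_gen \<Rightarrow> arc_gen \<Rightarrow> arc_gen \<Rightarrow>\<^sub>0 int" where
  "arc_mult_gen (d, c, D) (b, a, E) =
     (if c = b
      then tqft (strips Inl d + saddles Inl Inr b + strips Inr a)
             ((`) Inl ` conn_components (d \<union> b) \<union> (`) Inr ` conn_components (b \<union> a))
             ((`) Inl ` D \<union> (`) Inr ` E)
             Inr (conn_components (d \<union> a)) (\<lambda>D'. (d, a, D'))
      else 0)"

definition arc_ring :: "nat \<Rightarrow> (arc_gen \<Rightarrow>\<^sub>0 int) ring" where
  "arc_ring n =
     \<lparr>carrier = carrier (free_Abelian_group (arc_gens n)),
      monoid.mult = bilinear_extend arc_mult_gen,
      monoid.one = (\<Sum>a\<in>matchings n. frag_of (a, a, {})),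
      ring.zero = 0,
      ring.add = (+)\<rparr>"


section \<open>Tangle bimodules and the ring of bimodule homomorphisms\<close>

text \<open>
  The basis vector \<open>(b, a, D)\<close> of the bimodule of a planar tangle \<open>T\<close> is the diagram \<open>W(b)Ta\<close>
  with a dot on each circle in \<open>D\<close>.
\<close>

type_synonym tangle_gen = "nat set set \<times> nat set set \<times> endpoint set set"

definition tangle_gens :: "nat \<Rightarrow> nat \<Rightarrow> tangle \<Rightarrow> tangle_gen set" where
  "tangle_gens m n T =
     {(b, a, D). b \<in> matchings m \<and> a \<in> matchings n \<and> D \<subseteq> conn_components (closed_up b T a)}"

definition tangle_module :: "nat \<Rightarrow> nat \<Rightarrow> tangle \<Rightarrow> (tangle_gen \<Rightarrow>\<^sub>0 int) monoid" where
  "tangle_module m n T = free_Abelian_group (tangle_gens m n T)"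

fun left_action_gen :: "tangle \<Rightarrow> arc_gen \<Rightarrow> tangle_gen \<Rightarrow> tangle_gen \<Rightarrow>\<^sub>0 int" where
  "left_action_gen T (d, c, D) (b, a, E) =
     (if c = b
      then tqft (strips Inl d + saddles Inl (Inr \<circ> Top) b + strips Inr T + strips (Inr \<circ> Bot) a)
             ((`) Inl ` conn_components (d \<union> b) \<union> (`) Inr ` conn_components (closed_up b T a))
             ((`) Inl ` D \<union> (`) Inr ` E)
             Inr (conn_components (closed_up d T a)) (\<lambda>D'. (d, a, D'))
      else 0)"

fun right_action_gen :: "tangle \<Rightarrow> tangle_gen \<Rightarrow> arc_gen \<Rightarrow> tangle_gen \<Rightarrow>\<^sub>0 int" where
  "right_action_gen T (b, a, E) (d, c, D) =
     (if a = d
      then tqft (strips (Inr \<circ> Top) b + strips Inr T + saddles (Inr \<circ> Bot) Inl a + strips Inl c)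
             ((`) Inr ` conn_components (closed_up b T a) \<union> (`) Inl ` conn_components (a \<union> c))
             ((`) Inr ` E \<union> (`) Inl ` D)
             Inr (conn_components (closed_up b T c)) (\<lambda>D'. (b, c, D'))
      else 0)"

definition left_action ::
  "tangle \<Rightarrow> (arc_gen \<Rightarrow>\<^sub>0 int) \<Rightarrow> (tangle_gen \<Rightarrow>\<^sub>0 int) \<Rightarrow> tangle_gen \<Rightarrow>\<^sub>0 int" where
  "left_action T = bilinear_extend (left_action_gen T)"

definition right_action ::
  "tangle \<Rightarrow> (tangle_gen \<Rightarrow>\<^sub>0 int) \<Rightarrow> (arc_gen \<Rightarrow>\<^sub>0 int) \<Rightarrow> tangle_gen \<Rightarrow>\<^sub>0 int" where
  "right_action T = bilinear_extend (right_action_gen T)"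

text \<open>
  Functions are made canonical by the value \<open>0\<close> outside the carrier; likewise, in the direct
  sum \<open>Hom_ring\<close>, for indices that are not tangles.
\<close>

definition bimodule_homs ::
  "nat \<Rightarrow> nat \<Rightarrow> tangle \<Rightarrow> tangle \<Rightarrow> ((tangle_gen \<Rightarrow>\<^sub>0 int) \<Rightarrow> (tangle_gen \<Rightarrow>\<^sub>0 int)) set" where
  "bimodule_homs m n T1 T2 =
     {f \<in> hom (tangle_module m n T1) (tangle_module m n T2).
        (\<forall>h\<in>carrier (arc_ring m). \<forall>x\<in>carrier (tangle_module m n T1).
           f (left_action T1 h x) = left_action T2 h (f x)) \<and>
        (\<forall>h\<in>carrier (arc_ring n). \<forall>x\<in>carrier (tangle_module m n T1).
           f (right_action T1 x h) = right_action T2 (f x) h) \<and>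
        (\<forall>x. x \<notin> carrier (tangle_module m n T1) \<longrightarrow> f x = 0)}"

type_synonym hom_family = "tangle \<Rightarrow> tangle \<Rightarrow> (tangle_gen \<Rightarrow>\<^sub>0 int) \<Rightarrow> (tangle_gen \<Rightarrow>\<^sub>0 int)"

text \<open>The component \<open>f T1 T2\<close> goes from the bimodule of \<open>T1\<close> to that of \<open>T2\<close>.\<close>

definition Hom_ring :: "nat \<Rightarrow> nat \<Rightarrow> hom_family ring" where
  "Hom_ring m n =
     \<lparr>carrier = {f. \<forall>T1 T2. if T1 \<in> tangles m n \<and> T2 \<in> tangles m n
                            then f T1 T2 \<in> bimodule_homs m n T1 T2 else f T1 T2 = (\<lambda>_. 0)},
      monoid.mult = (\<lambda>g f T1 T3 x. \<Sum>T2\<in>tangles m n. g T2 T3 (f T1 T2 x)),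
      monoid.one = (\<lambda>T1 T2 x. if T1 = T2 \<and> T1 \<in> tangles m n \<and> x \<in> carrier (tangle_module m n T1)
                         then x else 0),
      ring.zero = (\<lambda>T1 T2 x. 0),
      ring.add = (\<lambda>f g T1 T2 x. f T1 T2 x + g T1 T2 x)\<rparr>"

definition HH0 :: "('a, 'b) ring_scheme \<Rightarrow> 'a set monoid" where
  "HH0 R = R A_Mod (generate (add_monoid R)
     {x \<otimes>\<^bsub>R\<^esub> y \<ominus>\<^bsub>R\<^esub> y \<otimes>\<^bsub>R\<^esub> x | x y. x \<in> carrier R \<and> y \<in> carrier R})"


section \<open>Dotted cobordisms modulo the local relations\<close>

text \<open>
  The boundary of a cobordism from \<open>T1\<close> to \<open>T2\<close> consists of the circles formed by \<open>T1\<close>, \<open>T2\<close>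
  and the vertical lines over the endpoints.  A dotted cobordism is recorded by the multiset of
  its components \<open>(B, g, k)\<close>: boundary circles \<open>B\<close>, genus \<open>g\<close> and \<open>k\<close> dots (closed components
  have \<open>B = {}\<close>).  By the classification of surfaces this is a dotted oriented surface (the
  boundary orientation alternates along the endpoints) up to homeomorphism relative to the
  boundary; the embedding is not recorded.  The local relations do not see it: by neck-cutting and the evaluation of closed components every
  cobordism, embedded or not, is a combination of collections of discs bounding the boundary
  circles with at most one dot each, and these form a basis in both settings.
\<close>

type_synonym cobordism = "(endpoint set set \<times> nat \<times> nat) multiset"

definition cobordisms :: "tangle \<Rightarrow> tangle \<Rightarrow> cobordism set" where
  "cobordisms T1 T2 =
     {S. (\<forall>(B, g, k)\<in>#S. B \<subseteq> conn_components (T1 \<union> T2)) \<and>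
         (\<forall>c\<in>conn_components (T1 \<union> T2). size (filter_mset (\<lambda>(B, g, k). c \<in> B) S) = 1)}"

type_synonym bn_gen = "tangle \<times> tangle \<times> cobordism"

definition BN_gens :: "nat \<Rightarrow> nat \<Rightarrow> bn_gen set" where
  "BN_gens m n = {(T1, T2, S). T1 \<in> tangles m n \<and> T2 \<in> tangles m n \<and> S \<in> cobordisms T1 T2}"

text \<open>
  In the order listed: sphere, sphere with one dot, two dots on a component, and cutting
  a neck along a nonseparating and along a separating curve.
\<close>

inductive_set BN_relations :: "nat \<Rightarrow> nat \<Rightarrow> (bn_gen \<Rightarrow>\<^sub>0 int) set" for m n where
  sphere:
    "(T1, T2, S) \<in> BN_gens m n \<Longrightarrow>
     frag_of (T1, T2, add_mset ({}, 0, 0) S) \<in> BN_relations m n"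
| dotted_sphere:
    "(T1, T2, S) \<in> BN_gens m n \<Longrightarrow>
     frag_of (T1, T2, add_mset ({}, 0, 1) S) - frag_of (T1, T2, S) \<in> BN_relations m n"
| two_dots:
    "(T1, T2, add_mset (B, g, k + 2) S) \<in> BN_gens m n \<Longrightarrow>
     frag_of (T1, T2, add_mset (B, g, k + 2) S) \<in> BN_relations m n"
| neck_nonseparating:
    "(T1, T2, add_mset (B, g + 1, k) S) \<in> BN_gens m n \<Longrightarrow>
     frag_of (T1, T2, add_mset (B, g + 1, k) S)
       - (frag_of (T1, T2, add_mset (B, g, k + 1) S) + frag_of (T1, T2, add_mset (B, g, k + 1) S))
     \<in> BN_relations m n"
| neck_separating:
    "(T1, T2, add_mset (B \<union> B', g + g', k + k') S) \<in> BN_gens m n \<Longrightarrow> B \<inter> B' = {} \<Longrightarrow>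
     frag_of (T1, T2, add_mset (B \<union> B', g + g', k + k') S)
       - (frag_of (T1, T2, add_mset (B, g, k + 1) (add_mset (B', g', k') S))
          + frag_of (T1, T2, add_mset (B, g, k) (add_mset (B', g', k' + 1) S)))
     \<in> BN_relations m n"

definition BN_subgroup :: "nat \<Rightarrow> nat \<Rightarrow> (bn_gen \<Rightarrow>\<^sub>0 int) set" where
  "BN_subgroup m n = generate (free_Abelian_group (BN_gens m n)) (BN_relations m n)"

definition Hom_BN :: "nat \<Rightarrow> nat \<Rightarrow> (bn_gen \<Rightarrow>\<^sub>0 int) set monoid" where
  "Hom_BN m n = free_Abelian_group (BN_gens m n) Mod BN_subgroup m n"


section \<open>The maps from dotted cobordisms and from the arc ring\<close>

text \<open>
  \<open>cob_map\<close> is the map induced by a dotted cobordism \<open>S\<close> from \<open>T1\<close> to \<open>T2\<close>: on the summand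
  indexed by \<open>b\<close> and \<open>a\<close>, glue \<open>S\<close> to the strips over \<open>W(b)\<close> and \<open>a\<close>.
\<close>

definition cob_pieces :: "cobordism \<Rightarrow> endpoint piece multiset" where
  "cob_pieces S = image_mset (\<lambda>(B, g, k). (\<Union>B, 2 - 2 * int g - int (card B), k)) S"

fun cob_map_gen :: "tangle \<Rightarrow> tangle \<Rightarrow> cobordism \<Rightarrow> tangle_gen \<Rightarrow> tangle_gen \<Rightarrow>\<^sub>0 int" where
  "cob_map_gen T1 T2 S (b, a, D) =
     tqft (strips Top b + cob_pieces S + strips Bot a)
       (conn_components (closed_up b T1 a)) D
       (\<lambda>v. v) (conn_components (closed_up b T2 a)) (\<lambda>D'. (b, a, D'))"

definition cob_map ::
  "nat \<Rightarrow> nat \<Rightarrow> tangle \<Rightarrow> tangle \<Rightarrow> cobordism \<Rightarrow> (tangle_gen \<Rightarrow>\<^sub>0 int) \<Rightarrow> tangle_gen \<Rightarrow>\<^sub>0 int" where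
  "cob_map m n T1 T2 S x =
     (if x \<in> carrier (tangle_module m n T1) then frag_extend (cob_map_gen T1 T2 S) x else 0)"

definition phi_lift :: "nat \<Rightarrow> nat \<Rightarrow> (bn_gen \<Rightarrow>\<^sub>0 int) \<Rightarrow> hom_family" where
  "phi_lift m n z = (\<lambda>T1 T2 x.
     frag_extend (\<lambda>(U1, U2, S). if U1 = T1 \<and> U2 = T2 then cob_map m n T1 T2 S x else 0) z)"

definition phi :: "nat \<Rightarrow> nat \<Rightarrow> (bn_gen \<Rightarrow>\<^sub>0 int) set \<Rightarrow> hom_family" where
  \<comment> \<open>the map induced by \<open>phi_lift\<close> on cosets\<close>
  "phi m n C = the_elem (phi_lift m n ` C)"

text \<open>
  A generator \<open>W(b)a\<close> goes to the cobordism from the bent \<open>a\<close> to the bent \<open>b\<close> that consists of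
  one disc for each circle, dotted if the circle is.
\<close>

fun gamma_gen :: "nat \<Rightarrow> arc_gen \<Rightarrow> bn_gen" where
  "gamma_gen m (b, a, D) =
     (bend m a, bend m b,
      image_mset (\<lambda>c. ({bend_point m ` c}, 0, if c \<in> D then 1 else 0))
        (mset_set (conn_components (b \<union> a))))"

definition gamma :: "nat \<Rightarrow> nat \<Rightarrow> (arc_gen \<Rightarrow>\<^sub>0 int) \<Rightarrow> (bn_gen \<Rightarrow>\<^sub>0 int) set" where
  "gamma m n x =
     BN_subgroup m n #>\<^bsub>free_Abelian_group (BN_gens m n)\<^esub>
       frag_extend (\<lambda>p. frag_of (gamma_gen m p)) x"


section \<open>The module of dotted crossingless matchings\<close>

text \<open>\<open>(M, E)\<close> is the matching \<open>M\<close> with one dot on each arc in \<open>E\<close>.\<close>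

type_synonym dotted_matching = "nat set set \<times> nat set set"

definition dotted_matchings :: "nat \<Rightarrow> dotted_matching set" where
  "dotted_matchings n = {(M, E). M \<in> matchings n \<and> E \<subseteq> M}"

definition type_I_relations :: "nat \<Rightarrow> (dotted_matching \<Rightarrow>\<^sub>0 int) set" where
  "type_I_relations n =
     {frag_of (M \<union> {{a, b}, {c, d}}, insert {a, b} E) + frag_of (M \<union> {{a, b}, {c, d}}, insert {c, d} E)
        - (frag_of (M \<union> {{a, d}, {b, c}}, insert {a, d} E) + frag_of (M \<union> {{a, d}, {b, c}}, insert {b, c} E))
      | M E a b c d. a < b \<and> b < c \<and> c < d \<and> E \<subseteq> M \<and>
          M \<union> {{a, b}, {c, d}} \<in> matchings n \<and> M \<union> {{a, d}, {b, c}} \<in> matchings n}"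

definition type_II_relations :: "nat \<Rightarrow> (dotted_matching \<Rightarrow>\<^sub>0 int) set" where
  "type_II_relations n =
     {frag_of (M \<union> {{a, b}, {c, d}}, E \<union> {{a, b}, {c, d}})
        - frag_of (M \<union> {{a, d}, {b, c}}, E \<union> {{a, d}, {b, c}})
      | M E a b c d. a < b \<and> b < c \<and> c < d \<and> E \<subseteq> M \<and>
          M \<union> {{a, b}, {c, d}} \<in> matchings n \<and> M \<union> {{a, d}, {b, c}} \<in> matchings n}"

text \<open>
  Sliding the dots of \<open>W(b)a\<close> to \<open>a\<close> and cutting off \<open>W(b)\<close>.  This makes sense for \<open>b = a\<close>, where
  every circle contains exactly one arc of \<open>a\<close>.  For \<open>b \<noteq> a\<close> a circle may contain several arcs
  of \<open>a\<close>, and the arc that should receive the dot is not determined; these summands of the arc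
  ring consist of commutators \<open>x \<cdot> 1\<^sub>a - 1\<^sub>a \<cdot> x\<close> and contribute \<open>0\<close>.
\<close>

fun cut_gen :: "arc_gen \<Rightarrow> dotted_matching \<Rightarrow>\<^sub>0 int" where
  "cut_gen (b, a, D) = (if b = a then frag_of (a, {\<alpha> \<in> a. \<exists>c\<in>D. \<alpha> \<subseteq> c}) else 0)"

definition kernel_relations :: "nat \<Rightarrow> nat \<Rightarrow> (dotted_matching \<Rightarrow>\<^sub>0 int) set" where
  "kernel_relations m n =
     {frag_extend cut_gen x | x. x \<in> carrier (arc_ring (m + n)) \<and>
        gamma m n x \<in> kernel (Hom_BN m n) (add_monoid (Hom_ring m n)) (phi m n)}"

definition R_module :: "nat \<Rightarrow> nat \<Rightarrow> (dotted_matching \<Rightarrow>\<^sub>0 int) set monoid" where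
  "R_module m n =
     free_Abelian_group (dotted_matchings (m + n)) Mod
       generate (free_Abelian_group (dotted_matchings (m + n)))
         (type_I_relations (m + n) \<union> type_II_relations (m + n) \<union> kernel_relations m n)"

end

theory Submission
  imports Defs
begin

text \<open>
  Matchings of the bipartite point set by discs glued along their common circles form an algebra
  with product \<open>**\<close>, whose structure constants evaluate closed surfaces made of three families of
  discs. All arc rings, tangle modules and \<open>Hom\<close> groups of the Bar-Natan category embed into it, so the
  actions and the map \<open>S \<mapsto> F(S)\<close> become multiplications. Every bimodule homomorphism is a right
  multiplication: after surgeries only the arcs joining top and bottom matter, and an induction over
  these arcs reduces the claim to functionals on dotted crossingless matchings satisfying the
  relations of types I and II. Hence \<open>Hom(m, n)\<close> is a quotient of \<open>H\<^sup>m\<^sup>+\<^sup>n\<close> by \<open>ker \<phi>\<close>. Sliding the dots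
  to one half of a diagram and cutting is a trace on the algebra; it identifies commutators with
  combinations of relations of types I and II, and the kernel of \<open>\<phi>\<close> with the third family of relations.
\<close>

text \<open>The obstacle is surjectivity over the integers: every bimodule homomorphism must come
  from a cobordism, without denominators. A generator \<open>W(b) T a\<close> is read as a morphism
  from the closure \<open>cl b a\<close> to \<open>T\<close>; then the left and the right action
  both become left multiplications, whence the double centralizer form of the claim. Merging two
  circles and splitting them again multiplies by the sum of their dots, which is not invertible. An
  integral remedy is \<open>pdiff\<close>, differentiation by the \<open>X\<close> of one circle,
  which caps this circle off and creates it anew. When all horizontal arcs have been used up, a
  linear system remains; it is triangular with leading coefficients 1 and hence solvable over the
  integers. Endpoints are coloured by the parity of their position along the boundary. Arcs join
  points of opposite colour, so all surfaces are orientable and a surgery always merges two circles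
  or splits one; the evaluation of surfaces rests on this, while planarity enters through the supply
  of surgeries.\<close>

abbreviation (input) "keys \<equiv> Poly_Mapping.keys"
abbreviation (input) "lookup \<equiv> Poly_Mapping.lookup"
abbreviation (input) "ccs \<equiv> conn_components"

section \<open>Connected components of set families\<close>

definition conn :: "'v set set => 'v => 'v => bool" where
 "conn VV x y \<longleftrightarrow> (x, y) : {(x, y). EX V:VV. x : V & y : V}\<^sup>*"

definition cls :: "'v set set => 'v => 'v set" where
 "cls VV x = {y. conn VV x y}"

lemma conn_refl [simp]: "conn VV x x" by (simp add: conn_def)

lemma conn_trans [trans]: "conn VV x y ==> conn VV y z ==> conn VV x z" unfolding conn_def by (rule rtrancl_trans)

lemma conn_sym: "conn VV x y ==> conn VV y x"
proof -
 have "sym {(x, y). EX V:VV. x : V & y : V}" by (auto simp: sym_def)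
 thus "conn VV x y ==> conn VV y x" unfolding conn_def by (meson symD sym_rtrancl)
qed

lemma conn_commute: "conn VV x y \<longleftrightarrow> conn VV y x" using conn_sym by metis

lemma conn_step: "V : VV ==> x : V ==> y : V ==> conn VV x y" unfolding conn_def by (rule r_into_rtrancl) auto

lemma conn_induct [consumes 1, case_names refl step]: assumes "conn VV x y" "P x"
  and "!!y z V. conn VV x y ==> P y ==> V : VV ==> y : V ==> z : V ==> P z"
 shows "P y" using assms(1) unfolding conn_def
proof (induction rule: rtrancl_induct)
 case base
 show ?case by fact
next
 case (step y z)
 then obtain V where "V : VV" "y : V" "z : V" by blast
 with step.hyps(1) step.IH show ?case by (intro assms(3)[of y V z]) (simp_all add: conn_def)
qed

lemma conn_in_Union: "conn VV x y ==> x : \<Union>VV ==> y : \<Union>VV" by (induction rule: conn_induct) auto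

lemma conn_closed: assumes "conn VV x y" "x : S" "!!V. V : VV ==> V Int S ~= {} ==> V <= S" shows "y : S"
 using assms(1,2)
proof (induction rule: conn_induct)
 case refl
 thus ?case by simp
next
 case (step y z V)
 thus ?case using assms(3)[of V] by blast
qed

lemma conn_le: assumes "conn VV x y" "!!V x y. V : VV ==> x : V ==> y : V ==> conn WW x y" shows "conn WW x y"
 using assms(1)
proof (induction rule: conn_induct)
 case (step y z V)
 thus ?case using assms(2)[of V y z] conn_trans by metis
qed simp

lemma conn_mono: "conn VV x y ==> VV <= WW ==> conn WW x y" by (rule conn_le) (auto intro: conn_step)

lemma in_cls [simp]: "y : cls VV x \<longleftrightarrow> conn VV x y" by (simp add: cls_def)

lemma cls_eq_iff: "cls VV x = cls VV y \<longleftrightarrow> conn VV x y"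
 unfolding cls_def by (metis (mono_tags, lifting) Collect_cong conn_refl conn_sym conn_trans mem_Collect_eq)

lemma conn_components_eq: "ccs VV = cls VV ` \<Union>VV"
 unfolding conn_components_def quotient_def cls_def conn_def by (auto simp: Image_def)

lemma cls_in_cc: "x : \<Union>VV ==> cls VV x : ccs VV" by (auto simp: conn_components_eq)

lemma ccE: assumes "K : ccs VV"
 obtains x where "x : \<Union>VV" "K = cls VV x"
 using assms by (auto simp: conn_components_eq)

lemma cc_eq_cls: "K : ccs VV ==> x : K ==> K = cls VV x" by (metis ccE cls_eq_iff in_cls)

lemma cc_nonempty: "K : ccs VV ==> K ~= {}" by (metis ccE conn_refl empty_iff in_cls)

lemma Union_cc [simp]: "\<Union>(ccs VV) = \<Union>VV"
proof
 show "\<Union>(ccs VV) <= \<Union>VV"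
 proof
  fix y assume "y : \<Union>(ccs VV)"
  then obtain x where "x : \<Union>VV" "conn VV x y" by (metis UnionE ccE in_cls)
  thus "y : \<Union>VV" by (metis conn_in_Union)
 qed
 show "\<Union>VV <= \<Union>(ccs VV)"
 proof
  fix x assume "x : \<Union>VV"
  hence "cls VV x : ccs VV" by (rule cls_in_cc)
  thus "x : \<Union>(ccs VV)" by (rule UnionI) simp
 qed
qed

lemma cc_subset: "K : ccs VV ==> K <= \<Union>VV" using Union_upper[of K "ccs VV"] by simp

lemma cc_disjoint:
 "K : ccs VV ==> L : ccs VV ==> x : K ==> x : L ==> K = L"
 using cc_eq_cls by metis

lemma partition_cc: "partition_on (\<Union>VV) (ccs VV)"
proof (rule partition_onI)
 show "disjnt K L" if "K : ccs VV" "L : ccs VV" "K ~= L" for K L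
  using that cc_disjoint unfolding disjnt_iff by metis
 show "{} ~: ccs VV" using cc_nonempty by metis
qed simp

lemma finite_cc: "finite (\<Union>VV) ==> finite (ccs VV)" by (simp add: conn_components_eq)

lemma finite_cc_member: "finite (\<Union>VV) ==> K : ccs VV ==> finite K" by (meson cc_subset finite_subset)

lemma cc_conn: "K : ccs VV ==> x : K ==> y : K ==> conn VV x y" using cc_eq_cls in_cls by metis

lemma cc_closed: "K : ccs VV ==> x : K ==> conn VV x y ==> y : K" using cc_eq_cls in_cls by metis

lemma cc_absorb: "K : ccs VV ==> V : VV ==> V Int K ~= {} ==> V <= K"
 by (meson cc_closed conn_step disjoint_iff subsetI)

lemma member_subset_cc: assumes "V : VV" "V ~= {}"
 obtains K where "K : ccs VV" "V <= K"
 using assms cls_in_cc conn_step by fastforce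

lemma cc_eqI:
 assumes "\<Union>VV = \<Union>WW" "!!x y. x : \<Union>VV ==> conn VV x y \<longleftrightarrow> conn WW x y"
 shows "ccs VV = ccs WW" unfolding conn_components_eq assms(1)[symmetric]
 by (rule image_cong) (use assms(2) in "auto simp: cls_def")

lemma cc_eqI2: assumes "\<Union>VV = \<Union>WW" and "!!V x y. V : VV ==> x : V ==> y : V ==> conn WW x y"
  and "!!V x y. V : WW ==> x : V ==> y : V ==> conn VV x y"
 shows "ccs VV = ccs WW"
proof (rule cc_eqI[OF assms(1)])
 show "conn VV x y \<longleftrightarrow> conn WW x y" for x y
  using conn_le[of VV x y WW] conn_le[of WW x y VV] assms(2,3) by blast
qed

lemma conn_cc [simp]: "conn (ccs VV) x y \<longleftrightarrow> conn VV x y"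
proof
 show "conn (ccs VV) x y ==> conn VV x y" by (erule conn_le) (rule cc_conn)
 show "conn VV x y ==> conn (ccs VV) x y"
 proof (erule conn_le)
  fix V x y assume "V : VV" "x : V" "y : V"
  then obtain K where "K : ccs VV" "V <= K" using member_subset_cc by blast
  with `x : V` `y : V` show "conn (ccs VV) x y" by (metis conn_step subsetD)
 qed
qed

lemma cc_partition_id: assumes "partition_on V P" shows "ccs P = P"
proof -
 have *: "cls P x = N" if "N : P" "x : N" for x N
 proof -
  have "conn P x y \<longleftrightarrow> y : N" for y
  proof
   assume "conn P x y"
   thus "y : N"
   proof (rule conn_closed)
    show "V <= N" if "V : P" "V Int N ~= {}" for V
     using that `N : P` partition_onD2[OF assms] disjointD by fastforce
   qed (rule `x : N`)
  next
   show "y : N ==> conn P x y" using that by (metis conn_step)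
  qed
  thus ?thesis by (intro Set.set_eqI) simp
 qed
 show ?thesis
 proof
  show "ccs P <= P" using * by (metis UnionE ccE subsetI)
  show "P <= ccs P"
  proof
   fix N assume "N : P"
   hence "N ~= {}" using partition_onD3[OF assms] by blast
   then obtain x where "x : N" by blast
   with `N : P` have "x : \<Union>P" by blast
   hence "cls P x : ccs P" by (rule cls_in_cc)
   with *[OF `N : P` `x : N`] show "N : ccs P" by simp
  qed
 qed
qed

lemma cc_sub_cc: assumes "L : ccs VV" "!!x y. conn VV x y ==> conn WW x y" "\<Union>VV <= \<Union>WW"
 obtains K where "K : ccs WW" "L <= K"
proof -
 from assms(1) obtain x where x: "x : \<Union>VV" "L = cls VV x" by (rule ccE)
 with assms have "cls WW x : ccs WW" "L <= cls WW x" by (auto intro!: cls_in_cc)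
 thus ?thesis by (rule that)
qed

text \<open>A path that uses the new edge repeatedly can be shortened, so it crosses this edge at
  most once, in one of the two directions.\<close>

lemma conn_insert: assumes "conn (insert {u, v} VV) x y"
 shows "conn VV x y | conn VV x u & conn VV v y | conn VV x v & conn VV u y" using assms
proof (induction rule: conn_induct)
 case refl
 thus ?case by simp
next
 case (step y z V)
 show ?case
 proof (cases "V = {u, v}")
  case True
  hence "y = u | y = v" "z = u | z = v" using step by auto
  with step.IH show ?thesis by (auto intro: conn_trans conn_sym)
 next
  case False
  hence "conn VV y z" using step conn_step by (metis insertE)
  with step.IH show ?thesis by (meson conn_trans)
 qed
qed

lemma cc_insert_same: assumes "conn VV u v" "u : \<Union>VV" shows "ccs (insert {u, v} VV) = ccs VV"
proof (rule cc_eqI2)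
 have "v : \<Union>VV" using assms conn_in_Union by metis
 with assms show "\<Union>(insert {u, v} VV) = \<Union>VV" by auto
 show "conn VV x y" if "V : insert {u, v} VV" "x : V" "y : V" for V x y
  using that assms conn_step conn_sym by (metis conn_refl insertE singletonD)
 show "conn (insert {u, v} VV) x y" if "V : VV" "x : V" "y : V" for V x y using that conn_step by (metis insertI2)
qed

lemma cls_insert_merge: "cls (insert {u, v} VV) u = cls VV u Un cls VV v"
proof -
 have "conn (insert {u, v} VV) u y \<longleftrightarrow> conn VV u y | conn VV v y" for y
 proof
  show "conn (insert {u, v} VV) u y ==> conn VV u y | conn VV v y" by (drule conn_insert) auto
  have "conn (insert {u, v} VV) u v" by (rule conn_step[of "{u, v}"]) auto
  thus "conn VV u y | conn VV v y ==> conn (insert {u, v} VV) u y" by (meson conn_mono conn_trans subset_insertI)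
 qed
 thus ?thesis by (intro Set.set_eqI) simp
qed

lemma cls_insert_other: assumes "~ conn VV x u" "~ conn VV x v" shows "cls (insert {u, v} VV) x = cls VV x"
proof -
 have "conn (insert {u, v} VV) x y \<longleftrightarrow> conn VV x y" for y
  using conn_insert[of u v VV x y] assms by (meson conn_mono subset_insertI)
 thus ?thesis by (intro Set.set_eqI) simp
qed

lemma cc_insert_merge: assumes "u : \<Union>VV" "v : \<Union>VV" shows "ccs (insert {u, v} VV) =
  ccs VV - {cls VV u, cls VV v} Un {cls VV u Un cls VV v}" (is "?L = ?R")
proof -
 let ?W = "insert {u, v} VV"
 have U: "\<Union>?W = \<Union>VV" using assms by auto
 have v: "cls ?W v = cls VV u Un cls VV v"
  using cls_insert_merge[of v u VV] by (simp add: insert_commute Un_commute)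
 have cl: "cls ?W x = (if conn VV u x | conn VV v x then cls VV u Un cls VV v else cls VV x)" for x
 proof -
  have "cls ?W x = cls ?W u" if "conn VV u x" using that cls_eq_iff conn_mono conn_sym by (metis subset_insertI)
  moreover have "cls ?W x = cls ?W v" if "conn VV v x"
   using that cls_eq_iff conn_mono conn_sym by (metis subset_insertI)
  ultimately show ?thesis using v cls_insert_merge[of u v VV] cls_insert_other[of VV x u v] conn_sym by metis
 qed
 show ?thesis
 proof
  show "?L <= ?R"
  proof
   fix K assume "K : ?L"
   then obtain x where x: "x : \<Union>VV" "K = cls ?W x" using U by (metis ccE)
   show "K : ?R"
   proof (cases "conn VV u x | conn VV v x")
    case False
    hence "K = cls VV x" "cls VV x ~= cls VV u" "cls VV x ~= cls VV v"
     using x(2) cl[of x] by (simp_all add: cls_eq_iff conn_commute[of VV x])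
    with x(1) show ?thesis by (auto intro: cls_in_cc)
   qed (use x cl in auto)
  qed
  show "?R <= ?L"
  proof
   fix K assume "K : ?R"
   then consider "K : ccs VV" "K ~= cls VV u" "K ~= cls VV v" | "K = cls VV u Un cls VV v" by blast
   thus "K : ?L" by (metis ccE cl cls_eq_iff U cls_in_cc assms)
  qed
 qed
qed

lemma card_cc_insert_ge: assumes "finite (\<Union>VV)" "u : \<Union>VV" "v : \<Union>VV"
 shows "card (ccs VV) <= card (ccs (insert {u, v} VV)) + 1"
proof (cases "conn VV u v")
 case True
 thus ?thesis using cc_insert_same assms by fastforce
next
 case False
 have fin: "finite (ccs VV)" using assms finite_cc by blast
 have ne: "cls VV u ~= cls VV v" using False cls_eq_iff by metis
 have new: "cls VV u Un cls VV v ~: ccs VV"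
 proof
  assume "cls VV u Un cls VV v : ccs VV"
  hence "conn VV u v" by (rule cc_conn) auto
  with False show False ..
 qed
 have "card (ccs (insert {u, v} VV)) = Suc (card (ccs VV - {cls VV u, cls VV v}))"
  unfolding cc_insert_merge[OF assms(2,3)] using fin new by simp
 moreover have "card (ccs VV - {cls VV u, cls VV v}) = card (ccs VV) - 2"
  using ne assms by (subst card_Diff_subset) (auto intro: cls_in_cc)
 ultimately show ?thesis by simp
qed

text \<open>Starting from isolated points, each edge lowers the number of components by at most one.
  The singletons keep points without edges in the family.\<close>

lemma card_cc_edges: assumes "finite U" "finite F" "!!e. e : F ==> EX u:U. EX v:U. e = {u, v}"
 shows "card U <= card (ccs ((%x. {x}) ` U Un F)) + card F" using assms(2,3)
proof (induction F rule: finite_induct)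
 case empty
 have "partition_on U ((%x. {x}) ` U)" by (auto simp: partition_on_def disjoint_def)
 hence "ccs ((%x. {x}) ` U) = (%x. {x}) ` U" by (rule cc_partition_id)
 thus ?case by (simp add: card_image)
next
 case (insert e F)
 then obtain u v where e: "u : U" "v : U" "e = {u, v}" by blast
 have U: "\<Union>((%x. {x}) ` U Un F) = U" using insert.prems by auto
 have "card (ccs ((%x. {x}) ` U Un F)) <= card (ccs (insert {u, v} ((%x. {x}) ` U Un F))) + 1"
  by (rule card_cc_insert_ge) (use U e assms(1) in auto)
 with insert e show ?case by simp
qed

text \<open>No path of \<open>VV\<close> leaves a component of the coarser family \<open>WW\<close>.
  This reduces global counts, such as the Euler characteristic, to single components.\<close>

lemma cc_restrict: assumes K: "K : ccs WW" and sub: "!!x y. conn VV x y ==> conn WW x y"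
 shows "ccs {V : VV. V <= K} = {L : ccs VV. L <= K}"
proof -
 let ?R = "{V : VV. V <= K}"
 have c: "conn ?R x y \<longleftrightarrow> conn VV x y" if "x : K" for x y
 proof
  show "conn ?R x y ==> conn VV x y" by (erule conn_mono) auto
  assume "conn VV x y"
  thus "conn ?R x y"
  proof (induction rule: conn_induct)
   case (step y z V)
   have "conn WW x w" if "w : V" for w using step.hyps that by (meson conn_step conn_trans sub)
   hence "V <= K" using cc_closed[OF K `x : K`] by blast
   with step show ?case by (metis (mono_tags, lifting) conn_step conn_trans mem_Collect_eq)
  qed simp
 qed
 have U: "\<Union>?R = K Int \<Union>VV"
 proof
  show "K Int \<Union>VV <= \<Union>?R"
  proof
   fix x assume "x : K Int \<Union>VV"
   then obtain V where V: "V : VV" "x : V" "x : K" by blast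
   hence "V <= K" using cc_closed[OF K] sub conn_step by (metis subsetI)
   with V show "x : \<Union>?R" by blast
  qed
 qed auto
 show ?thesis
 proof
  show "ccs ?R <= {L : ccs VV. L <= K}"
  proof
   fix L assume L: "L : ccs ?R"
   then obtain x where x: "x : \<Union>?R" "L = cls ?R x" by (rule ccE)
   hence "L = cls VV x" "x : \<Union>VV" using c U by (auto simp: cls_def)
   moreover have "L <= K" using L cc_subset U by fastforce
   ultimately show "L : {L : ccs VV. L <= K}" by (auto intro!: cls_in_cc)
  qed
  show "{L : ccs VV. L <= K} <= ccs ?R"
  proof clarify
   fix L assume L: "L : ccs VV" "L <= K"
   then obtain x where x: "x : \<Union>VV" "L = cls VV x" by (metis ccE)
   hence "x : K" using L by auto
   hence "x : \<Union>?R" using U x by blast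
   moreover have "L = cls ?R x" using c[OF `x : K`] x by (simp add: cls_def)
   ultimately show "L : ccs ?R" by (auto intro!: cls_in_cc)
  qed
 qed
qed

lemma cc_image_inj: assumes "inj_on f (\<Union>VV)" shows "ccs ((`) f ` VV) = (`) f ` ccs VV"
proof -
 have U: "\<Union>((`) f ` VV) = f ` \<Union>VV" by auto
 have 1: "conn ((`) f ` VV) (f x) (f y)" if "conn VV x y" for x y using that
 proof (induction rule: conn_induct)
  case (step y z V)
  hence "conn ((`) f ` VV) (f y) (f z)" by (intro conn_step[of "f ` V"]) auto
  with step show ?case by (meson conn_trans)
 qed simp
 have 2: "EX y. w = f y & conn VV x y" if "conn ((`) f ` VV) (f x) w" "x : \<Union>VV" for x w using that(1)
 proof (induction rule: conn_induct)
  case (step w z W)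
  then obtain V where V: "V : VV" "W = f ` V" by auto
  obtain y where y: "w = f y" "conn VV x y" using step by blast
  have "y : \<Union>VV" using y that conn_in_Union by metis
  obtain y' where y': "y' : V" "w = f y'" using V step by auto
  have "y = y'" using assms y y' V `y : \<Union>VV` by (metis UnionI inj_onD)
  obtain z' where "z' : V" "z = f z'" using V step by auto
  thus ?case using y y' `y = y'` V by (metis conn_step conn_trans)
 qed auto
 have "cls ((`) f ` VV) (f x) = f ` cls VV x" if "x : \<Union>VV" for x
 proof (rule Set.set_eqI)
  show "w : cls ((`) f ` VV) (f x) \<longleftrightarrow> w : f ` cls VV x" for w
   using 1[of x] 2[OF _ that, of w] unfolding in_cls image_iff Bex_def by metis
 qed
 thus ?thesis unfolding conn_components_eq U image_image by (intro image_cong) auto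
qed

lemma cc_disjoint_Un: assumes "\<Union>VV Int \<Union>WW = {}" shows "ccs (VV Un WW) = ccs VV Un ccs WW"
proof -
 have *: "cls (VV Un WW) x = cls VV x" if "x : \<Union>VV" "\<Union>VV Int \<Union>WW = {}" for VV WW :: "'a set set" and x
 proof -
  have "conn (VV Un WW) x y ==> conn VV x y" for y
  proof (induction rule: conn_induct)
   case (step y z V)
   hence "y : \<Union>VV" using that conn_in_Union by metis
   hence "y ~: \<Union>WW" using that(2) by blast
   hence "V : VV" using step.hyps(2,3) by blast
   hence "conn VV y z" using step.hyps(3,4) by (rule conn_step)
   with step.IH show ?case by (rule conn_trans)
  qed simp
  moreover have "conn VV x y ==> conn (VV Un WW) x y" for y by (erule conn_mono) simp
  ultimately show ?thesis by (intro Set.set_eqI) (metis in_cls)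
 qed
 have "cls (VV Un WW) ` \<Union>VV = cls VV ` \<Union>VV" using assms by (intro image_cong refl *) auto
 moreover have "cls (VV Un WW) ` \<Union>WW = cls WW ` \<Union>WW"
  unfolding Un_commute[of VV] using assms by (intro image_cong refl *) auto
 ultimately show ?thesis unfolding conn_components_eq Union_Un_distrib image_Un by simp
qed

lemma finite_cc_eq: "\<Union>VV = V ==> finite V ==> finite (ccs VV)" using finite_cc by metis

lemma finite_cc_member_eq: "\<Union>VV = V ==> finite V ==> K : ccs VV ==> finite K"
 using finite_cc_member by metis

lemma cls_in_cc_eq: "\<Union>VV = V ==> p : V ==> cls VV p : ccs VV" using cls_in_cc by metis

section \<open>Bipartite perfect matchings and surgeries\<close>

text \<open>The colours alternate along every circle formed by two such matchings. They play the
  role of an orientation: surfaces glued from these matchings by discs are orientable.\<close>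

definition pmatch :: "('p => bool) => 'p set => 'p set set => bool" where
 "pmatch col V x \<longleftrightarrow> partition_on V x & (ALL al:x. EX u v. al = {u, v} & col u & ~ col v)"

abbreviation circ :: "'p set set => 'p set set => 'p set set" where
 "circ x y \<equiv> ccs (x Un y)"

lemma pmatchD: assumes "pmatch col V x" shows "partition_on V x" "\<Union>x = V"
 using assms by (auto simp: pmatch_def partition_on_def)

lemma pmatch_arcE: assumes "pmatch col V x" "al : x"
 obtains u v where "al = {u, v}" "col u" "~ col v"
 using assms by (auto simp: pmatch_def)

lemma pmatch_unique: assumes "pmatch col V x" "al : x" "be : x" "p : al" "p : be" shows "al = be"
 using assms partition_onD2[OF pmatchD(1)[OF assms(1)]] by (auto dest: disjointD)

lemma pmatch_disjoint:
 "pmatch col V x ==> al : x ==> be : x ==> al ~= be ==> disjnt al be"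
 unfolding disjnt_iff using pmatch_unique by metis

lemma pmatch_arc_at: assumes "pmatch col V x" "p : V"
 obtains al where "al : x" "p : al"
 using assms pmatchD(2) by blast

lemma pmatch_nonempty: "pmatch col V x ==> al : x ==> al ~= {}" by (auto simp: pmatch_def)

lemma pmatch_finite: "pmatch col V x ==> finite V ==> finite x" by (auto simp: pmatch_def intro: finite_elements)

lemma pmatch_Union2: "pmatch col V x ==> pmatch col V y ==> \<Union>(x Un y) = V" by (simp add: pmatchD(2))

lemma circ_commute: "circ x y = circ y x" by (simp add: Un_commute)

lemma card_pmatch: assumes "pmatch col V x" "finite V"
 shows "card {v : V. col v} = card x" "card {v : V. ~ col v} = card x" "card V = 2 * card x"
proof -
 have fx: "finite x" using pmatch_finite assms by blast
 have *: "card {v : V. R v} = card x" if R: "!!al. al : x ==> EX u. {v : al. R v} = {u}" for R :: "'a => bool"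
 proof -
  have "{v : V. R v} = (UN al:x. {v : al. R v})" using pmatchD(2)[OF assms(1)] by auto
  hence "card {v : V. R v} = card (UN al:x. {v : al. R v})" by simp
  also have "... = (SUM al:x. card {v : al. R v})"
  proof (rule card_UN_disjoint[OF fx])
   show "ALL al:x. finite {v : al. R v}" using R by fastforce
   show "ALL al:x. ALL be:x. al ~= be --> {v : al. R v} Int {v : be. R v} = {}"
    using pmatch_unique[OF assms(1)] by blast
  qed
  also have "... = (SUM al:x. 1)"
  proof (rule sum.cong[OF refl])
   fix al assume "al : x"
   then obtain u where "{v : al. R v} = {u}" using R by blast
   thus "card {v : al. R v} = 1" by simp
  qed
  finally show ?thesis by simp
 qed
 show c: "card {v : V. col v} = card x"
 proof (rule *)
  fix al assume "al : x"
  then obtain u v where "al = {u, v}" "col u" "~ col v" using pmatch_arcE[OF assms(1)] by metis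
  hence "{v : al. col v} = {u}" by auto
  thus "EX u. {v : al. col v} = {u}" by blast
 qed
 show d: "card {v : V. ~ col v} = card x"
 proof (rule *)
  fix al assume "al : x"
  then obtain u v where "al = {u, v}" "col u" "~ col v" using pmatch_arcE[OF assms(1)] by metis
  hence "{v : al. ~ col v} = {v}" by auto
  thus "EX u. {v : al. ~ col v} = {u}" by blast
 qed
 have "V = {v : V. col v} Un {v : V. ~ col v}" by auto
 hence "card V = card {v : V. col v} + card {v : V. ~ col v}"
  using assms(2) by (metis (no_types, lifting) card_Un_disjoint disjoint_iff finite_Un mem_Collect_eq)
 with c d show "card V = 2 * card x" by simp
qed

lemma pmatch_restrict: assumes "pmatch col V x" "K <= V" "!!al. al : x ==> al Int K ~= {} ==> al <= K"
 shows "pmatch col K {al : x. al <= K}"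
proof -
 have "partition_on K {al : x. al <= K}"
 proof (rule partition_onI)
  show "\<Union>{al : x. al <= K} = K"
  proof
   show "K <= \<Union>{al : x. al <= K}"
   proof
    fix p assume p: "p : K"
    then obtain al where "al : x" "p : al" using pmatch_arc_at[OF assms(1)] assms(2) by blast
    with p assms(3)[of al] show "p : \<Union>{al : x. al <= K}" by blast
   qed
  qed auto
  show "disjnt al be" if "al : {al : x. al <= K}" "be : {al : x. al <= K}" "al ~= be" for al be
   using that pmatch_disjoint[OF assms(1)] by blast
  show "{} ~: {al : x. al <= K}" using pmatch_nonempty[OF assms(1), of "{}"] by blast
 qed
 moreover have "ALL al:{al : x. al <= K}. EX u v. al = {u, v} & col u & ~ col v"
  using assms(1) by (simp add: pmatch_def)
 ultimately show ?thesis by (simp add: pmatch_def)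
qed

lemma pmatch_restrict_cc: assumes "pmatch col V x" "K : ccs VV" "x <= VV" "\<Union>VV = V"
 shows "pmatch col K {al : x. al <= K}"
proof (rule pmatch_restrict[OF assms(1)])
 show "K <= V" using cc_subset assms by metis
 show "al <= K" if "al : x" "al Int K ~= {}" for al using that assms cc_absorb[of K VV al] by blast
qed

text \<open>The coloured points \<open>a\<close> and \<open>c\<close> exchange their partners.
  Joining coloured to uncoloured points again is the reconnection compatible with the orientation,
  that is, an orientable saddle.\<close>

definition surg :: "('p => bool) => 'p set set => 'p set set => 'p => 'p => 'p => 'p => bool" where
 "surg col x x' a b c d \<longleftrightarrow>
  {a, b} : x & {c, d} : x & a ~= c & col a & col c & ~ col b & ~ col d &
  x' = x - {{a, b}, {c, d}} Un {{a, d}, {c, b}}"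

lemma surg_distinct: assumes "surg col x x' a b c d" "pmatch col V x"
 shows "a ~= b" "a ~= c" "a ~= d" "b ~= c" "b ~= d" "c ~= d" "{a, b} ~= {c, d}"
proof -
 note s = assms(1)[unfolded surg_def]
 show "a ~= b" "a ~= c" "a ~= d" "b ~= c" "c ~= d" using s by auto
 show "b ~= d" using s pmatch_unique[OF assms(2), of "{a, b}" "{c, d}" b] by (auto simp: doubleton_eq_iff)
 show "{a, b} ~= {c, d}" using s by (auto simp: doubleton_eq_iff)
qed

lemma surg_in_V: assumes "surg col x x' a b c d" "pmatch col V x" shows "a : V" "b : V" "c : V" "d : V"
 using assms pmatchD(2)[OF assms(2)] by (auto simp: surg_def)

lemma surg_not_in: assumes "surg col x x' a b c d" "pmatch col V x" shows "{a, d} ~: x" "{c, b} ~: x"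
proof -
 note s = assms(1)[unfolded surg_def] surg_distinct[OF assms]
 show "{a, d} ~: x" using s pmatch_unique[OF assms(2), of "{a, b}" "{a, d}" a] by (auto simp: doubleton_eq_iff)
 show "{c, b} ~: x" using s pmatch_unique[OF assms(2), of "{c, d}" "{c, b}" c] by (auto simp: doubleton_eq_iff)
qed

lemma surg_pmatch: assumes "surg col x x' a b c d" "pmatch col V x" shows "pmatch col V x'"
proof -
 note s = assms(1)[unfolded surg_def]
 note dist = surg_distinct[OF assms]
 have x': "x' = x - {{a, b}, {c, d}} Un {{a, d}, {c, b}}" using s by simp
 have off: "al Int {a, b, c, d} = {}" if al: "al : x - {{a, b}, {c, d}}" for al
  using al s pmatch_unique[OF assms(2), of al "{a, b}"] pmatch_unique[OF assms(2), of al "{c, d}"] by auto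
 have "partition_on V x'"
 proof (rule partition_onI)
  have "\<Union>x' = \<Union>x" using s by auto
  thus "\<Union>x' = V" using pmatchD(2)[OF assms(2)] by simp
  show "disjnt al be" if ab: "al : x'" "be : x'" "al ~= be" for al be
  proof -
   consider "al : x - {{a, b}, {c, d}}" "be : x - {{a, b}, {c, d}}"
    | "al : x - {{a, b}, {c, d}}" "be : {{a, d}, {c, b}}"
    | "be : x - {{a, b}, {c, d}}" "al : {{a, d}, {c, b}}"
    | "al : {{a, d}, {c, b}}" "be : {{a, d}, {c, b}}"
    using ab(1,2) unfolding x' Un_iff by metis
   thus ?thesis
   proof cases
    case 1
    thus ?thesis using ab(3) pmatch_disjoint[OF assms(2), of al be] by blast
   next
    case 2
    thus ?thesis using off[OF 2(1)] unfolding disjnt_def by blast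
   next
    case 3
    thus ?thesis using off[OF 3(1)] unfolding disjnt_def by blast
   next
    case 4
    thus ?thesis using ab(3) dist by (auto simp: disjnt_iff)
   qed
  qed
  show "{} ~: x'" using pmatch_nonempty[OF assms(2), of "{}"] x' by auto
 qed
 moreover have "ALL al:x'. EX u v. al = {u, v} & col u & ~ col v" using s assms pmatch_def by auto
 ultimately show ?thesis by (simp add: pmatch_def)
qed

lemma surg_sym: assumes "surg col x x' a b c d" "pmatch col V x" shows "surg col x' x a d c b"
proof -
 note s = assms(1)[unfolded surg_def]
 have x': "x' = x - {{a, b}, {c, d}} Un {{a, d}, {c, b}}" using s by simp
 have "x = x' - {{a, d}, {c, b}} Un {{a, b}, {c, d}}" using surg_not_in[OF assms] s unfolding x' by blast
 thus ?thesis using s x' unfolding surg_def by blast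
qed

lemma surg_sym2: "surg col x x' a b c d ==> surg col x x' c d a b"
 unfolding surg_def by (auto simp: insert_commute)

text \<open>The graph has \<open>card K\<close> vertices but at most \<open>card K - 2\<close>
  edges: half of \<open>card K\<close> from \<open>z\<close> and two less than that from
  \<open>R\<close>.\<close>

lemma card_cc_pmatch2: assumes "finite K" "pmatch col K z" "pmatch col (K - {a, b, c, d}) R"
  and "{a, b, c, d} <= K" "distinct [a, b, c, d]"
 shows "card (ccs (R Un z)) >= 2"
proof -
 have UK: "\<Union>(R Un z) = K" using pmatchD(2)[OF assms(2)] pmatchD(2)[OF assms(3)] by auto
 have arcs: "EX u:K. EX v:K. e = {u, v}" if "e : R Un z" for e
 proof -
  have "e <= K" using that UK by blast
  moreover have "EX u v. e = {u, v}"
   using that pmatch_arcE[OF assms(2), of e] pmatch_arcE[OF assms(3), of e] by (metis Un_iff)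
  ultimately show ?thesis by auto
 qed
 have "finite z" "finite R" using pmatch_finite assms(1-3) by (blast, metis finite_Diff pmatch_finite)
 have "ccs ((%x. {x}) ` K Un (R Un z)) = ccs (R Un z)"
 proof (rule cc_eqI2)
  show "\<Union>((%x. {x}) ` K Un (R Un z)) = \<Union>(R Un z)" using UK by auto
  show "conn (R Un z) x y" if "V : (%x. {x}) ` K Un (R Un z)" "x : V" "y : V" for V x y
  proof (cases "V : R Un z")
   case True
   thus ?thesis using that(2,3) by (rule conn_step)
  next
   case False
   with that have "x = y" by auto
   thus ?thesis by simp
  qed
  show "conn ((%x. {x}) ` K Un (R Un z)) x y" if "V : R Un z" "x : V" "y : V" for V x y
   by (rule conn_step[OF _ that(2,3)]) (use that(1) in blast)
 qed
 hence "card K <= card (ccs (R Un z)) + card (R Un z)"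
  using card_cc_edges[OF assms(1), of "R Un z"] arcs `finite z` `finite R` by simp
 moreover have "card (R Un z) <= card R + card z" by (rule card_Un_le)
 moreover have "card K = 2 * card z" using card_pmatch(3) assms(1,2) by blast
 moreover have "card (K - {a, b, c, d}) = 2 * card R" using card_pmatch(3) assms(1,3) by blast
 moreover have "card (K - {a, b, c, d}) = card K - 4" using assms(4,5) by (subst card_Diff_subset) auto
 moreover have "card K >= 4" using card_mono[OF assms(1,4)] assms(5) by auto
 ultimately show ?thesis by linarith
qed

text \<open>Without the two arcs there remain paths whose ends are the four points. The component of
  \<open>a\<close> is perfectly matched by \<open>z\<close> and, up to the four points, by the rest
  of \<open>x\<close>, so it contains equally many of them in both colours. That it contains all
  four is excluded by counting edges.\<close>

lemma surg_link:
 assumes s: "surg col x x' a b c d" and px: "pmatch col V x" and pz: "pmatch col V z" and fV: "finite V"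
  and G: "G = (x - {{a, b}, {c, d}}) Un z"
 shows "~ conn G a c" "conn G a b & ~ conn G a d | conn G a d & ~ conn G a b"
proof -
 define R where "R = x - {{a, b}, {c, d}}"
 note sd = s[unfolded surg_def]
 note dist = surg_distinct[OF s px]
 have UG: "\<Union>G = V" using pmatchD(2)[OF pz] pmatchD(2)[OF px] unfolding G by auto
 define K where "K = cls G a"
 have aV: "a : V" using surg_in_V[OF s px] by simp
 have K: "K : ccs G" unfolding K_def using aV UG cls_in_cc by metis
 have fK: "finite K" using finite_cc_member[of G K] UG fV K by simp
 have "z <= G" unfolding G by simp
 have pzK: "pmatch col K {al : z. al <= K}" by (rule pmatch_restrict_cc[OF pz K `z <= G` UG])
 have off: "al Int {a, b, c, d} = {}" if al: "al : R" for al
  using al sd pmatch_unique[OF px, of al "{a, b}"] pmatch_unique[OF px, of al "{c, d}"] unfolding R_def by auto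
 have Req: "{al : x. al <= K - {a, b, c, d}} = {al : R. al <= K}" using off unfolding R_def by auto
 have "pmatch col (K - {a, b, c, d}) {al : x. al <= K - {a, b, c, d}}"
 proof (rule pmatch_restrict[OF px])
  show "K - {a, b, c, d} <= V" using cc_subset[OF K] UG by blast
  fix al assume al: "al : x" "al Int (K - {a, b, c, d}) ~= {}"
  hence "al : R" unfolding R_def by auto
  moreover have "al <= K" using cc_absorb[OF K, of al] al `al : R` unfolding G R_def by auto
  ultimately show "al <= K - {a, b, c, d}" using off by blast
 qed
 hence pRK: "pmatch col (K - {a, b, c, d}) {al : R. al <= K}" using Req by simp
 let ?S = "{a, b, c, d}"
 have split: "card {v : K. Q v} = card {v : K - ?S. Q v} + card {v : K Int ?S. Q v}" for Q
 proof -
  have "{v : K. Q v} = {v : K - ?S. Q v} Un {v : K Int ?S. Q v}" by auto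
  moreover have "{v : K - ?S. Q v} Int {v : K Int ?S. Q v} = {}" by auto
  ultimately show ?thesis using fK by (metis (no_types, lifting) card_Un_disjoint finite_Un finite_subset mem_Collect_eq subsetI)
 qed
 have bal: "card {v : K Int ?S. col v} = card {v : K Int ?S. ~ col v}"
  using split[of col] split[of "%v. ~ col v"] card_pmatch(1,2)[OF pzK fK] card_pmatch(1,2)[OF pRK] fK by simp
 have aK: "a : K" by (simp add: K_def)
 have c1: "{v : K Int ?S. col v} = (if c : K then {a, c} else {a})" using aK sd by auto
 have c2: "{v : K Int ?S. ~ col v} = (if b : K then {b} else {}) Un (if d : K then {d} else {})" using sd by auto
 have notall: "~ (b : K & c : K & d : K)"
 proof
  assume all: "b : K & c : K & d : K"
  hence "card (ccs ({al : R. al <= K} Un {al : z. al <= K})) >= 2"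
   using aK dist by (intro card_cc_pmatch2[OF fK pzK pRK]) auto
  moreover have "{al : R. al <= K} Un {al : z. al <= K} = {al : G. al <= K}" unfolding G R_def by auto
  moreover have "ccs {al : G. al <= K} = {L : ccs G. L <= K}" by (rule cc_restrict[OF K])
  moreover have "{L : ccs G. L <= K} = {K}" using K cc_disjoint[of _ G K] cc_nonempty[of _ G] by blast
  ultimately show False by simp
 qed
 have "c ~: K & (b : K \<longleftrightarrow> d ~: K)" using bal c1 c2 notall dist by (auto split: if_splits)
 thus "~ conn G a c" "conn G a b & ~ conn G a d | conn G a d & ~ conn G a b" by (auto simp: K_def)
qed

text \<open>Each of the two remaining paths joins one of \<open>a\<close>, \<open>c\<close> to one
  of \<open>b\<close>, \<open>d\<close>. One of the pairs of arcs closes the paths separately and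
  gives two circles, the other pair gives one. So no surgery preserves the number of circles, as a
  one-sided saddle would.\<close>

lemma conn_surg_cases:
 assumes s: "surg col x x' a b c d" and px: "pmatch col V x" and pz: "pmatch col V z" and fV: "finite V"
 shows "conn (x Un z) a c \<longleftrightarrow> ~ conn (x' Un z) a c"
proof -
 define G where "G = (x - {{a, b}, {c, d}}) Un z"
 note sd = s[unfolded surg_def]
 have G': "G = (x - {{c, d}, {a, b}}) Un z" by (auto simp: G_def)
 note l1 = surg_link[OF s px pz fV G_def]
 note l2 = surg_link[OF surg_sym2[OF s] px pz fV G']
 have xz: "x Un z = insert {a, b} (insert {c, d} G)" unfolding G_def using sd by blast
 have x'z: "x' Un z = insert {a, d} (insert {c, b} G)" unfolding G_def using sd by blast
 have UG: "\<Union>G = V" using pmatchD(2)[OF pz] pmatchD(2)[OF px] unfolding G_def by auto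
 have gx: "conn (x Un z) p q" "conn (x' Un z) p q" if "conn G p q" for p q
  using that conn_mono[of G p q] xz x'z by blast+
 have steps: "conn (x Un z) a b" "conn (x Un z) c d" "conn (x' Un z) a d" "conn (x' Un z) c b"
  by (rule conn_step[of "{a, b}"] conn_step[of "{c, d}"] conn_step[of "{a, d}"] conn_step[of "{c, b}"];
    simp add: xz x'z)+
 show ?thesis
 proof (cases "conn G a b")
  case True
  hence "~ conn G a d" using l1 by blast
  hence "conn G c d" using l2 True conn_trans conn_sym by metis
  have le: "conn G p q" if "conn (x Un z) p q" for p q using that
  proof (rule conn_le)
   fix W p q assume "W : x Un z" "p : W" "q : W"
   thus "conn G p q" unfolding xz using True `conn G c d` conn_sym[of G] conn_step[of W G p q] by auto
  qed
  have "conn (x' Un z) a c" using steps(3) gx(2)[OF `conn G c d`] conn_trans conn_sym by metis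
  thus ?thesis using le l1 by blast
 next
  case False
  hence ad: "conn G a d" using l1 by blast
  hence cb: "conn G c b" using l2 False conn_trans conn_sym by metis
  have le: "conn G p q" if "conn (x' Un z) p q" for p q using that
  proof (rule conn_le)
   fix W p q assume "W : x' Un z" "p : W" "q : W"
   thus "conn G p q" unfolding x'z using ad cb conn_sym[of G] conn_step[of W G p q] by auto
  qed
  have "conn (x Un z) a c" using steps(2) gx(1)[OF ad] conn_trans conn_sym by metis
  thus ?thesis using le l1 by blast
 qed
qed

text \<open>Both sides arise from the common part of \<open>x\<close> and \<open>x'\<close> by linking all four points.\<close>

lemma surg_merge: assumes s: "surg col x x' a b c d" and px: "pmatch col V x"
  and Z: "!!p. p : \<Union>Z ==> p : V" and c: "conn (x' Un Z) a c"
 shows "ccs (x' Un Z) = ccs (insert {a, c} (x Un Z))"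
proof (rule cc_eqI2)
 note sd = s[unfolded surg_def]
 have x': "x' = x - {{a, b}, {c, d}} Un {{a, d}, {c, b}}" using sd by simp
 have px': "pmatch col V x'" by (rule surg_pmatch[OF s px])
 have "\<Union>Z <= V" using Z by blast
 hence "\<Union>(x' Un Z) = V" "\<Union>(x Un Z) = V"
  unfolding Union_Un_distrib pmatchD(2)[OF px] pmatchD(2)[OF px'] by blast+
 thus "\<Union>(x' Un Z) = \<Union>(insert {a, c} (x Un Z))" using surg_in_V[OF s px] by auto
 have st: "conn (insert {a, c} (x Un Z)) a b" "conn (insert {a, c} (x Un Z)) c d"
  "conn (insert {a, c} (x Un Z)) a c"
  by (rule conn_step[of "{a, b}"] conn_step[of "{c, d}"] conn_step[of "{a, c}"]; use sd in simp)+
 have st': "conn (x' Un Z) a d" "conn (x' Un Z) c b"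
  by (rule conn_step[of "{a, d}"] conn_step[of "{c, b}"]; simp add: x')+
 have ad: "conn (insert {a, c} (x Un Z)) a d" using st conn_trans by metis
 have cb: "conn (insert {a, c} (x Un Z)) c b" using st conn_trans conn_sym by metis
 show "conn (insert {a, c} (x Un Z)) p q" if W: "W : x' Un Z" "p : W" "q : W" for W p q
 proof -
  consider "W : x Un Z" | "W = {a, d}" | "W = {c, b}" using W(1) unfolding x' by blast
  thus ?thesis
  proof cases
   case 1
   show ?thesis by (rule conn_step[OF _ W(2,3)]) (use 1 in simp)
  qed (use W ad cb conn_sym[of "insert {a, c} (x Un Z)"] in auto)
 qed
 have ab: "conn (x' Un Z) a b" using c st' conn_trans by metis
 have cd: "conn (x' Un Z) c d" using c st' conn_trans conn_sym by metis
 show "conn (x' Un Z) p q" if W: "W : insert {a, c} (x Un Z)" "p : W" "q : W" for W p q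
 proof -
  consider "W : x' Un Z" | "W = {a, b}" | "W = {c, d}" | "W = {a, c}" using W(1) unfolding x' by blast
  thus ?thesis
  proof cases
   case 1
   show ?thesis by (rule conn_step[OF 1 W(2,3)])
  qed (use W ab cd c conn_sym[of "x' Un Z"] in auto)
 qed
qed

lemma circ_surg_merge:
 assumes s: "surg col x x' a b c d" and px: "pmatch col V x" and pz: "pmatch col V z" and fV: "finite V"
  and n: "~ conn (x Un z) a c"
 shows "circ x' z = circ x z - {cls (x Un z) a, cls (x Un z) c} Un {cls (x Un z) a Un cls (x Un z) c}"
proof -
 have U: "\<Union>(x Un z) = V" by (rule pmatch_Union2[OF px pz])
 have "conn (x' Un z) a c" using conn_surg_cases[OF s px pz fV] n by blast
 hence "circ x' z = ccs (insert {a, c} (x Un z))" using surg_merge[OF s px, of z] pmatchD(2)[OF pz] by blast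
 also have "... = circ x z - {cls (x Un z) a, cls (x Un z) c} Un {cls (x Un z) a Un cls (x Un z) c}"
  by (rule cc_insert_merge) (use U surg_in_V[OF s px] in auto)
 finally show ?thesis .
qed

lemma card_circ_surg_merge:
 assumes s: "surg col x x' a b c d" and px: "pmatch col V x" and pz: "pmatch col V z" and fV: "finite V"
  and n: "~ conn (x Un z) a c"
 shows "card (circ x z) = card (circ x' z) + 1"
proof -
 let ?A = "cls (x Un z) a" and ?C = "cls (x Un z) c"
 have U: "\<Union>(x Un z) = V" by (rule pmatch_Union2[OF px pz])
 have fin: "finite (circ x z)" by (rule finite_cc_eq[OF U fV])
 have ne: "?A ~= ?C" using n cls_eq_iff by metis
 have mem: "?A : circ x z" "?C : circ x z" using surg_in_V[OF s px] by (auto intro: cls_in_cc_eq[OF U])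
 have new: "?A Un ?C ~: circ x z"
 proof
  assume "?A Un ?C : circ x z"
  hence "conn (x Un z) a c" by (rule cc_conn) auto
  with n show False ..
 qed
 have "card (circ x' z) = Suc (card (circ x z - {?A, ?C}))"
  unfolding circ_surg_merge[OF assms] using fin new by simp
 moreover have "card (circ x z - {?A, ?C}) = card (circ x z) - 2" using ne mem by (subst card_Diff_subset) auto
 moreover have "card {?A, ?C} <= card (circ x z)" by (rule card_mono[OF fin]) (use mem in auto)
 ultimately show ?thesis using ne by simp
qed

lemma circ_common_arc: assumes "pmatch col V x" "pmatch col V z" "al : x" "al : z" shows "al : circ x z"
proof -
 obtain p where p: "p : al" using pmatch_nonempty assms(1,3) by blast
 have "cls (x Un z) p = al"
 proof (rule Set.set_eqI)
  fix q
  have "q : al" if "conn (x Un z) p q"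
  proof (rule conn_closed[OF that p])
   show "W <= al" if "W : x Un z" "W Int al ~= {}" for W
    using that assms pmatch_unique[OF assms(1), of W al] pmatch_unique[OF assms(2), of W al] by blast
  qed
  moreover have "q : al ==> conn (x Un z) p q" using conn_step[of al "x Un z" p q] assms(3) p by blast
  ultimately show "q : cls (x Un z) p \<longleftrightarrow> q : al" by auto
 qed
 moreover have "p : \<Union>(x Un z)" using p assms(3) by blast
 ultimately show ?thesis using cls_in_cc by metis
qed

lemma circ_self: "pmatch col V x ==> circ x x = x" using cc_partition_id[OF pmatchD(1)] by simp

text \<open>
 Closing up three matchings pairwise with discs gives a closed oriented surface; this is the
 statement that its Euler characteristic is even and at most twice the number of its components.
\<close>

lemma euler_total: assumes "finite V" "pmatch col V x" "pmatch col V y" "pmatch col V z"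
 shows "EX g. card (circ x y) + card (circ y z) + card (circ x z) + 2 * g =
      card x + 2 * card (ccs (x Un y Un z))"
 using assms(2)
proof (induction "card (y - x)" arbitrary: x rule: less_induct)
 case less
 note px = less.prems and py = assms(3) and pz = assms(4) and fV = assms(1)
 have fx: "finite x" "finite y" using pmatch_finite fV px py by blast+
 have cxy: "card x = card y" using card_pmatch(3)[OF px fV] card_pmatch(3)[OF py fV] by simp
 show ?case
 proof (cases "y <= x")
  case True
  hence "x = y" using cxy fx card_subset_eq by metis
  thus ?thesis using circ_self[OF py] by auto
 next
  case False
  then obtain ka where ka: "ka : y" "ka ~: x" by blast
  then obtain a d where ad: "ka = {a, d}" "col a" "~ col d" using pmatch_arcE[OF py] by metis
  have aV: "a : V" "d : V" using pmatchD(2)[OF py] ka ad by auto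
  obtain b where ab: "{a, b} : x" "~ col b"
  proof -
   obtain al where "al : x" "a : al" using pmatch_arc_at[OF px aV(1)] .
   moreover then obtain u v where "al = {u, v}" "col u" "~ col v" using pmatch_arcE[OF px] by metis
   ultimately show ?thesis using that ad by auto
  qed
  obtain c where cd: "{c, d} : x" "col c"
  proof -
   obtain al where "al : x" "d : al" using pmatch_arc_at[OF px aV(2)] .
   moreover then obtain u v where "al = {u, v}" "col u" "~ col v" using pmatch_arcE[OF px] by metis
   ultimately show ?thesis using that ad by auto
  qed
  have ac: "a ~= c" using ka ad cd by auto
  \<comment> \<open>This surgery creates the arc \<open>{a, d}\<close> of \<open>y\<close>. The arc
    becomes a circle of its own together with \<open>y\<close>, so the measure drops and
    \<open>x' y\<close> has one circle more than \<open>x y\<close>.\<close>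
  define x' where "x' = x - {{a, b}, {c, d}} Un {{a, d}, {c, b}}"
  have s: "surg col x x' a b c d" unfolding surg_def x'_def using ab cd ac ad by simp
  have px': "pmatch col V x'" by (rule surg_pmatch[OF s px])
  have s': "surg col x' x a d c b" by (rule surg_sym[OF s px])
  have notin: "{a, b} ~: y" "{c, d} ~: y"
   using ka ad ab cd ac surg_distinct[OF s px] pmatch_unique[OF py, of "{a, d}" "{a, b}" a]
    pmatch_unique[OF py, of "{a, d}" "{c, d}" d] by (auto simp: doubleton_eq_iff)
  have "y - x' \<subset> y - x" using ka ad notin unfolding x'_def by blast
  hence "card (y - x') < card (y - x)" using fx by (simp add: psubset_card_mono)
  from less.hyps[OF this px'] obtain g where g: "card (circ x' y) + card (circ y z) + card (circ x' z) + 2 * g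
   = card x' + 2 * card (ccs (x' Un y Un z))" by blast
  have cx': "card x' = card x" using card_pmatch(3)[OF px fV] card_pmatch(3)[OF px' fV] by simp
  have kin: "{a, d} : x'" "{a, d} : y" using ka ad unfolding x'_def by auto
  hence "{a, d} : circ x' y" using circ_common_arc[OF px' py] by blast
  hence "~ conn (x' Un y) a c" using cc_closed[of "{a, d}" "x' Un y" a c] ac surg_distinct[OF s px] by blast
  hence xy: "card (circ x' y) = card (circ x y) + 1" by (rule card_circ_surg_merge[OF s' px' py fV])
  have U3: "\<Union>(x Un y Un z) = V" "\<Union>(x' Un y Un z) = V"
   using pmatchD(2)[OF px] pmatchD(2)[OF px'] pmatchD(2)[OF py] pmatchD(2)[OF pz] by auto
  have c3: "conn (x Un y Un z) a c"
  proof -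
   have "conn (x Un y Un z) a d" by (rule conn_step[of "{a, d}"]) (use kin in auto)
   moreover have "conn (x Un y Un z) d c" by (rule conn_step[of "{c, d}"]) (use cd in auto)
   ultimately show ?thesis by (rule conn_trans)
  qed
  have cc3: "ccs (x Un y Un z) = ccs (insert {a, c} (x' Un y Un z))"
   using surg_merge[OF s' px', of "y Un z"] c3 pmatchD(2)[OF py] pmatchD(2)[OF pz] by (auto simp: Un_assoc)
  show ?thesis
  proof (cases "conn (x Un z) a c")
   case True
   have "~ conn (x' Un z) a c" using conn_surg_cases[OF s px pz fV] True by blast
   hence xz: "card (circ x' z) = card (circ x z) + 1" by (rule card_circ_surg_merge[OF s' px' pz fV])
   have "card (ccs (x' Un y Un z)) <= card (ccs (x Un y Un z)) + 1"
    unfolding cc3 by (rule card_cc_insert_ge) (use U3 fV surg_in_V[OF s px] in auto)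
   \<comment> \<open>\<open>k = 0\<close> if passing to \<open>x'\<close> disconnects a component,
     and \<open>k = 1\<close> if it cuts a handle; in the second case the genus of the original
     surface is larger by one.\<close>
   then obtain k where k: "card (ccs (x' Un y Un z)) + k = card (ccs (x Un y Un z)) + 1" using le_Suc_ex by metis
   have "card (circ x y) + card (circ y z) + card (circ x z) + 2 * (g + k) =
      card x + 2 * card (ccs (x Un y Un z))"
    using g k xy xz cx' by simp
   thus ?thesis by blast
  next
   case False
   have xz: "card (circ x z) = card (circ x' z) + 1" by (rule card_circ_surg_merge[OF s px pz fV False])
   have "conn (x' Un z) a c" using conn_surg_cases[OF s px pz fV] False by blast
   hence "conn (x' Un y Un z) a c" by (rule conn_mono) auto
   hence "ccs (x Un y Un z) = ccs (x' Un y Un z)"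
    unfolding cc3 by (rule cc_insert_same) (use U3 surg_in_V[OF s px] in auto)
   hence "card (circ x y) + card (circ y z) + card (circ x z) + 2 * g =
      card x + 2 * card (ccs (x Un y Un z))"
    using g xy xz cx' by simp
   thus ?thesis by blast
  qed
 qed
qed

definition faces :: "'p set set => 'p set set => 'p set => nat" where
 "faces x y K = card {c : circ x y. c <= K}"

lemma faces_commute: "faces x y K = faces y x K" by (simp add: faces_def Un_commute)

text \<open>The restrictions of the matchings to \<open>K\<close> have a single component, so the
  total count specializes to it.\<close>

lemma euler_component: assumes "finite V" "pmatch col V x" "pmatch col V y" "pmatch col V z"
  and K: "K : ccs (x Un y Un z)"
 shows "EX g. faces x y K + faces y z K + faces x z K + 2 * g = card K div 2 + 2"
proof -
 let ?r = "%x. {al : x. al <= K}"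
 have U3: "\<Union>(x Un y Un z) = V"
  using pmatchD(2)[OF assms(2)] pmatchD(2)[OF assms(3)] pmatchD(2)[OF assms(4)] by auto
 have fK: "finite K" by (rule finite_cc_member_eq[OF U3 assms(1) K])
 have p: "pmatch col K (?r x)" "pmatch col K (?r y)" "pmatch col K (?r z)"
  by (rule pmatch_restrict_cc[OF _ K _ U3]; use assms in blast)+
 have f: "card (circ (?r u) (?r v)) = faces u v K" if "u <= x Un y Un z" "v <= x Un y Un z" for u v
 proof -
  have "?r u Un ?r v = {al : u Un v. al <= K}" by auto
  moreover have "ccs {al : u Un v. al <= K} = {L : circ u v. L <= K}"
  proof (rule cc_restrict[OF K])
   show "conn (u Un v) p q ==> conn (x Un y Un z) p q" for p q by (erule conn_mono) (use that in auto)
  qed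
  ultimately show ?thesis by (simp add: faces_def)
 qed
 have "?r x Un ?r y Un ?r z = {al : x Un y Un z. al <= K}" by auto
 moreover have "ccs {al : x Un y Un z. al <= K} = {L : ccs (x Un y Un z). L <= K}" by (rule cc_restrict[OF K])
 moreover have "{L : ccs (x Un y Un z). L <= K} = {K}"
  using K cc_disjoint[of _ "x Un y Un z" K] cc_nonempty[of _ "x Un y Un z"] by blast
 ultimately have "card (ccs (?r x Un ?r y Un ?r z)) = 1" by simp
 moreover have "card K div 2 = card (?r x)" using card_pmatch(3)[OF p(1) fK] by simp
 moreover have "card (circ (?r x) (?r y)) = faces x y K" "card (circ (?r y) (?r z)) = faces y z K"
  "card (circ (?r x) (?r z)) = faces x z K"
  by (rule f; blast)+
 ultimately show ?thesis using euler_total[OF fK p] by simp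
qed

section \<open>Gluing along circles\<close>

text \<open>The value of a closed connected surface of genus \<open>g\<close> with \<open>k\<close>
  dots: 1 for the sphere with one dot, 2 for the torus without dots, and 0 otherwise.\<close>

definition ev :: "nat => nat => int" where
 "ev g k = (if g + k = 1 then 2 ^ g else 0)"

lemma surface_coeff_ev: "surface_coeff g p u v = ev g (p + u)" by (simp add: surface_coeff_eq ev_def add_ac)

text \<open>This identity and \<open>ev_neck\<close> are neck-cutting along a nonseparating and
  along a separating curve.\<close>

lemma ev_handle: "ev (Suc g) k = 2 * ev g (Suc k)" by (simp add: ev_def)

lemma ev_neck: "ev (g + g') (k + k') = ev g (Suc k) * ev g' k' + ev g k * ev g' (Suc k')"
 by (auto simp: ev_def power_add)

lemma ev_0: "ev 0 k = (if k = 1 then 1 else 0)" by (simp add: ev_def)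

lemma sum_Pow_insert: assumes "finite A" "a ~: A"
 shows "(SUM B:Pow (insert a A). f B) = (SUM B:Pow A. f B) + (SUM B:Pow A. f (insert a B))"
proof -
 have "(SUM B:Pow (insert a A). f B) = (SUM B:Pow A. f B) + (SUM B:insert a ` Pow A. f B)"
  unfolding Pow_insert using assms by (intro sum.union_disjoint) auto
 also have "(SUM B:insert a ` Pow A. f B) = (SUM B:Pow A. f (insert a B))"
  using assms by (subst sum.reindex) (auto simp: inj_on_def intro: insert_ident[THEN iffD1])
 finally show ?thesis .
qed

lemma sum_fun_upd_Suc: fixes p :: "'a => nat" assumes "finite K"
 shows "sum (p(u := Suc (p u))) K = sum p K + (if u : K then 1 else 0)"
proof (cases "u : K")
 case True
 have "sum (p(u := Suc (p u))) K = Suc (p u) + sum (p(u := Suc (p u))) (K - {u})"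
  using sum.remove[OF assms True, of "p(u := Suc (p u))"] by simp
 also have "sum (p(u := Suc (p u))) (K - {u}) = sum p (K - {u})" by (rule sum.cong) auto
 finally show ?thesis using sum.remove[OF assms True, of p] True by simp
next
 case False
 hence "sum (p(u := Suc (p u))) K = sum p K" by (intro sum.cong) auto
 with False show ?thesis by simp
qed

text \<open>Nodes are the pieces, edges the gluing circles; singletons keep the pieces to which
  nothing is glued. Parallel edges coincide in this family, hence edges are always counted through
  the index set \<open>F\<close>.\<close>

definition glue_graph :: "'n set => ('e => 'n) => ('e => 'n) => 'e set => 'n set set" where
 "glue_graph U s t F = (%x. {x}) ` U Un (%e. {s e, t e}) ` F"

text \<open>
 Neck-cutting in a surface glued from the pieces \<open>U\<close> along circles \<open>F\<close>: every circle is replaced by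
 a dot on one of the two pieces that it joins.
\<close>

lemma glue_graph_eval: fixes g p :: "'n => nat" and F :: "'a set"
 assumes "finite F" "finite U" "s ` F <= U" "t ` F <= U"
 shows "(ALL K:ccs (glue_graph U s t F). card K <= card {e : F. s e : K} + 1) &
  (SUM A:Pow F. PROD x:U. ev (g x) (p x + card {e : F - A. s e = x} + card {e : A. t e = x})) =
  (PROD K:ccs (glue_graph U s t F).
   ev (sum g K + card {e : F. s e : K} + 1 - card K) (sum p K))"
 using assms(1,3,4)
proof (induction F arbitrary: p rule: finite_induct)
 case empty
 have "partition_on U ((%x. {x}) ` U)" by (auto simp: partition_on_def disjoint_def)
 hence "ccs (glue_graph U s t {}) = (%x. {x}) ` U" unfolding glue_graph_def by (simp add: cc_partition_id)
 thus ?case by (simp add: prod.reindex)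
next
 case (insert e F)
 let ?u = "s e" and ?v = "t e" and ?G = "glue_graph U s t F"
 let ?C = "ccs ?G" and ?C' = "ccs (glue_graph U s t (insert e F))"
 define cn where "cn F K = card {e : F. s e : K}" for F K
 let ?gen = "%F K. sum g K + cn F K + 1 - card K"
 have uv: "?u : U" "?v : U" using insert.prems by auto
 have UG: "\<Union>?G = U" unfolding glue_graph_def using insert.prems by auto
 have G': "glue_graph U s t (insert e F) = insert {?u, ?v} ?G" unfolding glue_graph_def by simp
 have finC: "finite ?C" by (rule finite_cc_eq[OF UG assms(2)])
 have finK: "finite K" if "K : ?C" for K by (rule finite_cc_member_eq[OF UG assms(2) that])
 \<comment> \<open>A connected graph has at most one vertex more than it has edges, so the
   subtraction in the genus of the glued surface is not truncated.\<close>
 have IH1: "card K <= cn F K + 1" if "K : ?C" for K using insert.IH insert.prems that unfolding cn_def by auto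
 have IH2: "(SUM A:Pow F. PROD x:U. ev (g x) (q x + card {e : F - A. s e = x} + card {e : A. t e = x})) =
  (PROD K:?C. ev (?gen F K) (sum q K))" for q
  using insert.IH insert.prems unfolding cn_def by auto
 let ?f = "%A. PROD x:U. ev (g x) (p x + card {e' : insert e F - A. s e' = x} + card {e' : A. t e' = x})"
 have ins: "card {e' : insert e S. h e' = x} = card {e' : S. h e' = x} + (if x = h e then 1 else 0)"
  if "e ~: S" "finite S" for S x and h :: "'a => 'n"
 proof -
  have "{e' : insert e S. h e' = x} = (if h e = x then insert e {e' : S. h e' = x} else {e' : S. h e' = x})" by auto
  thus ?thesis using that by auto
 qed
 \<comment> \<open>A circle outside of \<open>A\<close> puts its dot on the piece
   \<open>s e\<close>, one in \<open>A\<close> on \<open>t e\<close>. The two halves of the sum are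
   the two terms of neck-cutting at the new circle.\<close>
 have f1: "?f A = (PROD x:U. ev (g x) ((p(?u := Suc (p ?u))) x + card {e : F - A. s e = x} + card {e : A. t e = x}))"
  if A: "A : Pow F" for A
 proof (rule prod.cong[OF refl])
  have "insert e F - A = insert e (F - A)" using A insert.hyps by auto
  thus "ev (g x) (p x + card {e' : insert e F - A. s e' = x} + card {e' : A. t e' = x}) =
   ev (g x) ((p(?u := Suc (p ?u))) x + card {e : F - A. s e = x} + card {e : A. t e = x})" for x
   using ins[of "F - A" s x] insert.hyps by simp
 qed
 have f2: "?f (insert e A) = (PROD x:U. ev (g x) ((p(?v := Suc (p ?v))) x + card {e : F - A. s e = x} + card {e : A. t e = x}))"
  if A: "A : Pow F" for A
 proof (rule prod.cong[OF refl])
  have e: "e ~: A" "finite A" "insert e F - insert e A = F - A" using A insert.hyps finite_subset by auto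
  show "ev (g x) (p x + card {e' : insert e F - insert e A. s e' = x} + card {e' : insert e A. t e' = x}) =
   ev (g x) ((p(?v := Suc (p ?v))) x + card {e : F - A. s e = x} + card {e : A. t e = x})" for x
   unfolding e(3) using ins[OF e(1,2), of t x] by simp
 qed
 have "(SUM A:Pow (insert e F). ?f A) = (SUM A:Pow F. ?f A) + (SUM A:Pow F. ?f (insert e A))"
  by (rule sum_Pow_insert) (use insert.hyps in auto)
 also have "... = (PROD K:?C. ev (?gen F K) (sum (p(?u := Suc (p ?u))) K)) + (PROD K:?C. ev (?gen F K) (sum (p(?v := Suc (p ?v))) K))"
  unfolding IH2[symmetric] using f1 f2 by simp
 also have "... = (PROD K:?C. ev (?gen F K) (sum p K + (if ?u : K then 1 else 0))) + (PROD K:?C. ev (?gen F K) (sum p K + (if ?v : K then 1 else 0)))"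
  by (intro arg_cong2[of _ _ _ _ "(+)"] prod.cong refl; simp only: sum_fun_upd_Suc finK)
 finally have LHS: "(SUM A:Pow (insert e F). ?f A) = ..." .
 have cnt: "cn (insert e F) K = cn F K + (if ?u : K then 1 else 0)" for K
 proof -
  have "{e' : insert e F. s e' : K} = (if ?u : K then insert e {e' : F. s e' : K} else {e' : F. s e' : K})" by auto
  thus ?thesis using insert.hyps unfolding cn_def by auto
 qed
 define Ku where "Ku = cls ?G ?u"
 define Kv where "Kv = cls ?G ?v"
 have Kin: "Ku : ?C" "Kv : ?C" unfolding Ku_def Kv_def using uv by (auto intro: cls_in_cc_eq[OF UG])
 have uK: "?u : K \<longleftrightarrow> K = Ku" if "K : ?C" for K
  using that Kin cc_eq_cls[of K ?G ?u] by (auto simp: Ku_def)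
 have vK: "?v : K \<longleftrightarrow> K = Kv" if "K : ?C" for K
  using that Kin cc_eq_cls[of K ?G ?v] by (auto simp: Kv_def)
 have uKu: "?u : Ku" "?v : Kv" by (simp_all add: Ku_def Kv_def)
 have "(ALL K:?C'. card K <= cn (insert e F) K + 1) &
  (SUM A:Pow (insert e F). ?f A) = (PROD K:?C'. ev (?gen (insert e F) K) (sum p K))"
 \<comment> \<open>An edge inside a component closes a cycle of the graph, which is a new handle; an
   edge between two components joins their surfaces, whose genera and dots add.\<close>
 proof (cases "conn ?G ?u ?v")
  case True
  hence eq: "Kv = Ku" by (simp add: Ku_def Kv_def cls_eq_iff conn_commute)
  have C': "?C' = ?C" unfolding G' by (rule cc_insert_same) (use True UG uv in auto)
  have "(PROD K:?C. ev (?gen F K) (sum p K + (if ?u : K then 1 else 0))) =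
    ev (?gen F Ku) (Suc (sum p Ku)) * (PROD K:?C - {Ku}. ev (?gen F K) (sum p K))"
   by (subst prod.remove[OF finC Kin(1)], intro arg_cong2[of _ _ _ _ "(*)"] refl prod.cong)
    (simp_all add: uK uKu)
  moreover have "(PROD K:?C. ev (?gen F K) (sum p K + (if ?v : K then 1 else 0))) =
    ev (?gen F Ku) (Suc (sum p Ku)) * (PROD K:?C - {Ku}. ev (?gen F K) (sum p K))"
   by (subst prod.remove[OF finC Kin(1)], intro arg_cong2[of _ _ _ _ "(*)"] refl prod.cong)
    (simp_all add: vK uKu eq uKu(2)[unfolded eq])
  moreover have "(PROD K:?C. ev (?gen (insert e F) K) (sum p K)) =
    ev (?gen (insert e F) Ku) (sum p Ku) * (PROD K:?C - {Ku}. ev (?gen F K) (sum p K))"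
   by (subst prod.remove[OF finC Kin(1)], intro arg_cong2[of _ _ _ _ "(*)"] refl prod.cong)
    (simp add: cnt uK)
  moreover have "?gen (insert e F) Ku = Suc (?gen F Ku)" using IH1[OF Kin(1)] by (simp add: cnt uKu)
  ultimately have "(SUM A:Pow (insert e F). ?f A) = (PROD K:?C. ev (?gen (insert e F) K) (sum p K))"
   using LHS by (simp add: ev_handle)
  moreover have "card K <= cn (insert e F) K + 1" if "K : ?C" for K using IH1[OF that] unfolding cnt by simp
  ultimately show ?thesis unfolding C' by blast
 next
  case False
  hence ne: "Ku ~= Kv" by (simp add: Ku_def Kv_def cls_eq_iff)
  have C': "?C' = ?C - {Ku, Kv} Un {Ku Un Kv}"
   unfolding G' Ku_def Kv_def by (rule cc_insert_merge) (use UG uv in auto)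
  have dis: "Ku Int Kv = {}" using cc_disjoint[OF Kin] ne by blast
  have new: "Ku Un Kv ~: ?C"
  proof
   assume "Ku Un Kv : ?C"
   hence "Ku Un Kv = Ku" using uK[of "Ku Un Kv"] by (simp add: Ku_def)
   hence "Kv <= {}" using dis by blast
   thus False using cc_nonempty[OF Kin(2)] by blast
  qed
  let ?D = "?C - {Ku, Kv}"
  let ?pD = "PROD K:?D. ev (?gen F K) (sum p K)"
  have CD: "?C = insert Ku (insert Kv ?D)" using Kin by blast
  have prodC: "(PROD K:?C. h K) = h Ku * (h Kv * (PROD K:?D. h K))" for h :: "'n set => int"
   by (subst CD) (use finC ne in simp)
  have su: "ev (?gen F Ku) (Suc (sum p Ku)) * (ev (?gen F Kv) (sum p Kv) * ?pD) =
   (PROD K:?C. ev (?gen F K) (sum p K + (if ?u : K then 1 else 0)))"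
   unfolding prodC using ne Kin by (auto simp: uK intro!: prod.cong arg_cong2[of _ _ _ _ "(*)"])
  have sv: "ev (?gen F Ku) (sum p Ku) * (ev (?gen F Kv) (Suc (sum p Kv)) * ?pD) =
   (PROD K:?C. ev (?gen F K) (sum p K + (if ?v : K then 1 else 0)))"
   unfolding prodC using ne Kin by (auto simp: vK intro!: prod.cong arg_cong2[of _ _ _ _ "(*)"])
  have c2: "cn F (Ku Un Kv) = cn F Ku + cn F Kv"
  proof -
   have "{e' : F. s e' : Ku Un Kv} = {e' : F. s e' : Ku} Un {e' : F. s e' : Kv}" by auto
   thus ?thesis using insert.hyps dis unfolding cn_def by (simp add: card_Un_disjoint disjoint_iff)
  qed
  have cK: "card (Ku Un Kv) = card Ku + card Kv" using finK Kin dis by (simp add: card_Un_disjoint)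
  have gK: "sum g (Ku Un Kv) = sum g Ku + sum g Kv" "sum p (Ku Un Kv) = sum p Ku + sum p Kv"
   using finK Kin dis by (simp_all add: sum.union_disjoint)
  have uin: "?u : Ku Un Kv" by (simp add: Ku_def)
  have gen: "?gen (insert e F) (Ku Un Kv) = ?gen F Ku + ?gen F Kv"
   using IH1[OF Kin(1)] IH1[OF Kin(2)] uin by (simp del: Un_iff add: cnt c2 cK gK)
  have "(PROD K:?C'. ev (?gen (insert e F) K) (sum p K)) =
    ev (?gen (insert e F) (Ku Un Kv)) (sum p (Ku Un Kv)) * (PROD K:?D. ev (?gen (insert e F) K) (sum p K))"
   unfolding C' using finC new by simp
  also have "(PROD K:?D. ev (?gen (insert e F) K) (sum p K)) = ?pD" by (intro prod.cong refl) (simp add: cnt uK)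
  finally have R: "(PROD K:?C'. ev (?gen (insert e F) K) (sum p K)) =
   ev (?gen F Ku + ?gen F Kv) (sum p Ku + sum p Kv) * ?pD"
   unfolding gen gK(2) .
  have "(SUM A:Pow (insert e F). ?f A) = (PROD K:?C'. ev (?gen (insert e F) K) (sum p K))"
   unfolding R LHS su[symmetric] sv[symmetric] ev_neck by (simp add: algebra_simps)
  moreover have "card K <= cn (insert e F) K + 1" if "K : ?C'" for K
  proof (cases "K = Ku Un Kv")
   case True
   thus ?thesis using IH1[OF Kin(1)] IH1[OF Kin(2)] uin by (simp del: Un_iff add: cnt c2 cK)
  next
   case False
   hence "K : ?C" using that C' by blast
   thus ?thesis using IH1[of K] by (simp add: cnt)
  qed
  ultimately show ?thesis by blast
 qed
 thus ?case unfolding cn_def .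
qed

lemma partition_blockE: assumes "partition_on V P" "v : V"
 obtains N where "N : P" "v : N"
 using assms by (auto simp: partition_on_def)

lemma partition_block_ex: assumes "partition_on V P" "N : P"
 obtains v where "v : N"
 using partition_onD3[OF assms(1)] assms(2) by (metis ex_in_conv)

lemma partition_block_unique: assumes "partition_on V P" "N : P" "N' : P" "v : N" "v : N'" shows "N = N'"
 using partition_onD2[OF assms(1)] assms(2-5) by (auto dest: disjointD)

text \<open>The same evaluation for surfaces over a vertex set: pieces are the blocks of two
  partitions, and each gluing circle lies in one block of either. Blocks are tagged by the sum type
  because one set may occur as a piece on both sides.\<close>

lemma glue_partitions: fixes g1 g2 p1 p2 :: "'v set => nat"
 assumes fV: "finite V" and P1: "partition_on V P1" and P2: "partition_on V P2" and F: "partition_on V F"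
  and F1: "!!e. e : F ==> EX N:P1. e <= N" and F2: "!!e. e : F ==> EX N:P2. e <= N"
 shows "K : ccs (P1 Un P2) ==>
   card {N : P1. N <= K} + card {N : P2. N <= K} <= card {e : F. e <= K} + 1"
  and "(SUM A:Pow F. (PROD N:P1. ev (g1 N) (p1 N + card {e : F - A. e <= N})) *
           (PROD N:P2. ev (g2 N) (p2 N + card {e : A. e <= N}))) =
   (PROD K:ccs (P1 Un P2).
    ev (sum g1 {N : P1. N <= K} + sum g2 {N : P2. N <= K} + card {e : F. e <= K} + 1
       - (card {N : P1. N <= K} + card {N : P2. N <= K}))
      (sum p1 {N : P1. N <= K} + sum p2 {N : P2. N <= K}))"
proof -
 let ?W = "P1 Un P2"
 have fP: "finite P1" "finite P2" "finite F" using finite_elements fV P1 P2 F by blast+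
 have UW: "\<Union>?W = V" using P1 P2 by (auto simp: partition_on_def)
 have ne: "e ~= {}" if "e : F" for e using that partition_onD3[OF F] by blast
 have block: "EX b. ALL e:F. b e : P & (ALL N:P. b e = N \<longleftrightarrow> e <= N)"
  if P: "partition_on V P" and sub: "!!e. e : F ==> EX N:P. e <= N" for P
 proof (intro bchoice ballI)
  fix e assume e: "e : F"
  obtain v where "v : e" using ne[OF e] by blast
  thus "EX N. N : P & (ALL N':P. N = N' \<longleftrightarrow> e <= N')"
   using sub[OF e] partition_block_unique[OF P, of _ _ v] by blast
 qed
 obtain b1 where b1: "!!e. e : F ==> b1 e : P1" "!!e N. e : F ==> N : P1 ==> b1 e = N \<longleftrightarrow> e <= N"
  using block[OF P1 F1] by metis
 obtain b2 where b2: "!!e. e : F ==> b2 e : P2" "!!e N. e : F ==> N : P2 ==> b2 e = N \<longleftrightarrow> e <= N"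
  using block[OF P2 F2] by metis
 define s :: "'v set => 'v set + 'v set" where "s = (%e. Inl (b1 e))"
 define t :: "'v set => 'v set + 'v set" where "t = (%e. Inr (b2 e))"
 define U where "U = Inl ` P1 Un Inr ` P2"
 define \<sigma> :: "'v set + 'v set => 'v set" where "\<sigma> = case_sum (%N. N) (%N. N)"
 \<comment> \<open>The pieces lying over \<open>K\<close>. This gives the bijection between the
   components of the vertex set and those of the graph of pieces.\<close>
 define \<Phi> where "\<Phi> K = {a : U. \<sigma> a <= K}" for K
 let ?G = "glue_graph U s t F"
 have fU: "finite U" unfolding U_def using fP by simp
 have stU: "s ` F <= U" "t ` F <= U" unfolding s_def t_def U_def using b1 b2 by auto
 have UG: "\<Union>?G = U" unfolding glue_graph_def using stU by auto
 have node: "\<sigma> a : ?W" "\<sigma> a ~= {}" if "a : U" for a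
  using that partition_onD3[OF P1] partition_onD3[OF P2] by (auto simp: U_def \<sigma>_def)
 have surj: "EX a:U. \<sigma> a = B" if "B : ?W" for B using that by (force simp: U_def \<sigma>_def)
 have edge: "conn ?G (Inl N) (Inr N')" if N: "N : P1" "N' : P2" "v : N" "v : N'" for N N' v
 proof -
  obtain e where e: "e : F" "v : e" using partition_blockE[OF F, of v] N UW by blast
  have "v : b1 e" "v : b2 e" using b1[OF e(1)] b2[OF e(1)] e(2) by blast+
  hence "b1 e = N" "b2 e = N'"
   using partition_block_unique[OF P1 b1(1)[OF e(1)] N(1) _ N(3)] partition_block_unique[OF P2 b2(1)[OF e(1)] N(2) _ N(4)]
   by blast+
  hence "{Inl N, Inr N'} : ?G" unfolding glue_graph_def s_def t_def using e by blast
  thus ?thesis by (rule conn_step) auto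
 qed
 have same1: "conn ?G (Inl N) (Inl N')" if "N : P1" "N' : P1" "v : N" "v : N'" for N N' v
  using partition_block_unique[OF P1 that] by simp
 have same2: "conn ?G (Inr N) (Inr N')" if "N : P2" "N' : P2" "v : N" "v : N'" for N N' v
  using partition_block_unique[OF P2 that] by simp
 have meet: "conn ?G a b" if "a : U" "b : U" "v : \<sigma> a" "v : \<sigma> b" for a b v
  using that same1[of _ _ v] same2[of _ _ v] edge[of _ _ v] conn_sym[OF edge[of _ _ v]]
  by (cases a; cases b) (auto simp: U_def \<sigma>_def)
 have lift: "conn ?G a b" if "conn ?W v w" "a : U" "b : U" "v : \<sigma> a" "w : \<sigma> b" for v w a b using that
 proof (induction arbitrary: b rule: conn_induct)
  case refl
  thus ?case by (rule meet)
 next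
  case (step y z B)
  obtain c where c: "c : U" "\<sigma> c = B" using surj[OF step.hyps(2)] by blast
  have "conn ?G a c" using step c by simp
  moreover have "conn ?G c b" using meet[of c b z] step c by simp
  ultimately show ?case by (rule conn_trans)
 qed
 have absorb: "\<sigma> a <= K" if "a : U" "K : ccs ?W" "v : \<sigma> a" "v : K" for a K v
  using cc_absorb[OF that(2) node(1)[OF that(1)]] that(3,4) by blast
 have same: "K = L" if "K : ccs ?W" "L : ccs ?W" "a : \<Phi> K" "a : \<Phi> L" for K L a
  using that node(2)[of a] cc_disjoint[OF that(1,2)] by (auto simp: \<Phi>_def)
 have ex: "\<Phi> K ~= {}" if K: "K : ccs ?W" for K
 proof -
  obtain v where v: "v : K" using cc_nonempty[OF K] by blast
  then obtain B where "B : ?W" "v : B" using cc_subset[OF K] by blast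
  thus ?thesis using surj[of B] absorb[OF _ K _ v] by (auto simp: \<Phi>_def)
 qed
 have inj: "inj_on \<Phi> (ccs ?W)" by (rule inj_onI) (metis ex same ex_in_conv)
 have CC: "ccs ?G = \<Phi> ` ccs ?W"
 proof -
  have cover: "EX K:ccs ?W. a : \<Phi> K" if "a : U" for a
   using member_subset_cc[OF node[OF that]] that unfolding \<Phi>_def by blast
  have "ccs ?G = ccs (\<Phi> ` ccs ?W)"
  proof (rule cc_eqI2)
   show "\<Union>?G = \<Union>(\<Phi> ` ccs ?W)" unfolding UG using cover by (auto simp: \<Phi>_def)
   show "conn ?G a b" if L: "L : \<Phi> ` ccs ?W" "a : L" "b : L" for L a b
   proof -
    obtain K where K: "K : ccs ?W" "a : \<Phi> K" "b : \<Phi> K" using L by blast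
    then obtain v w where "v : \<sigma> a" "w : \<sigma> b" "v : K" "w : K" using node(2)[of a] node(2)[of b] by (auto simp: \<Phi>_def)
    thus ?thesis using lift[OF cc_conn[OF K(1), of v w]] K by (auto simp: \<Phi>_def)
   qed
   show "conn (\<Phi> ` ccs ?W) a b" if B: "B : ?G" "a : B" "b : B" for B a b
   proof (cases "a = b")
    case False
    then obtain e where e: "e : F" "{a, b} = {s e, t e}" using B unfolding glue_graph_def by auto
    obtain v where v: "v : e" using ne[OF e(1)] by blast
    have "v : \<sigma> (s e)" "v : \<sigma> (t e)" "s e : U" "t e : U"
     using b1[OF e(1)] b2[OF e(1)] v e(1) stU by (auto simp: s_def t_def \<sigma>_def)
    hence "a : U" "b : U" "v : \<sigma> a" "v : \<sigma> b" using e(2) by (auto simp: doubleton_eq_iff)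
    moreover obtain K where K: "K : ccs ?W" "a : \<Phi> K" using cover[OF `a : U`] by blast
    ultimately have "b : \<Phi> K" using absorb[OF _ K(1), of b v] by (auto simp: \<Phi>_def)
    with K show ?thesis using conn_step[of "\<Phi> K"] by blast
   qed simp
  qed
  also have "... = \<Phi> ` ccs ?W"
  proof (rule cc_partition_id[OF partition_onI, OF refl])
   show "{} ~: \<Phi> ` ccs ?W" using ex by (metis imageE)
  qed (use same in "auto simp: disjnt_iff")
  finally show ?thesis .
 qed
 define g where "g = case_sum g1 g2"
 define p where "p = case_sum p1 p2"
 note main = glue_graph_eval[OF fP(3) fU stU, of g p]
 have fin: "finite {N : P1. N <= K}" "finite {N : P2. N <= K}" for K using fP by simp_all
 have \<Phi>_eq: "\<Phi> K = Inl ` {N : P1. N <= K} Un Inr ` {N : P2. N <= K}" for K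
  by (auto simp: \<Phi>_def U_def \<sigma>_def)
 have sum\<Phi>: "sum h (\<Phi> K) = (SUM N:{N : P1. N <= K}. h (Inl N)) + (SUM N:{N : P2. N <= K}. h (Inr N))"
  for h :: "'v set + 'v set => nat" and K
  unfolding \<Phi>_eq using fin by (subst sum.union_disjoint) (auto simp: sum.reindex)
 have card\<Phi>: "card (\<Phi> K) = card {N : P1. N <= K} + card {N : P2. N <= K}" for K
  unfolding \<Phi>_eq using fin by (subst card_Un_disjoint) (auto simp: card_image)
 have edges: "{e : F. s e : \<Phi> K} = {e : F. e <= K}" if K: "K : ccs ?W" for K
 proof (rule Collect_cong, rule conj_cong[OF refl])
  fix e assume e: "e : F"
  obtain v where v: "v : e" using ne[OF e] by blast
  have "s e : U" "e <= \<sigma> (s e)" using b1[OF e] e stU by (auto simp: s_def \<sigma>_def)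
  thus "s e : \<Phi> K \<longleftrightarrow> e <= K" using absorb[OF _ K, of "s e" v] v by (auto simp: \<Phi>_def)
 qed
 show "card {N : P1. N <= K} + card {N : P2. N <= K} <= card {e : F. e <= K} + 1" if K: "K : ccs ?W" for K
 proof -
  have "\<Phi> K : ccs ?G" unfolding CC using K by blast
  hence "card (\<Phi> K) <= card {e : F. s e : \<Phi> K} + 1" using main by blast
  thus ?thesis unfolding card\<Phi> edges[OF K] .
 qed
 have L: "(PROD x:U. ev (g x) (p x + card {e : F - A. s e = x} + card {e : A. t e = x})) =
  (PROD N:P1. ev (g1 N) (p1 N + card {e : F - A. e <= N})) * (PROD N:P2. ev (g2 N) (p2 N + card {e : A. e <= N}))"
  if A: "A : Pow F" for A
 proof -
  let ?h = "%x. ev (g x) (p x + card {e : F - A. s e = x} + card {e : A. t e = x})"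
  have "(PROD x:U. ?h x) = (PROD N:P1. ?h (Inl N)) * (PROD N:P2. ?h (Inr N))"
   unfolding U_def using fP by (subst prod.union_disjoint) (auto simp: prod.reindex)
  moreover have "?h (Inl N) = ev (g1 N) (p1 N + card {e : F - A. e <= N})" if "N : P1" for N
  proof -
   have 1: "{e : F - A. s e = Inl N} = {e : F - A. e <= N}" using b1(2)[OF _ that] by (auto simp: s_def)
   have 2: "{e : A. t e = Inl N} = {}" by (auto simp: t_def)
   show ?thesis unfolding 1 2 g_def p_def by simp
  qed
  moreover have "?h (Inr N) = ev (g2 N) (p2 N + card {e : A. e <= N})" if "N : P2" for N
  proof -
   have 1: "{e : A. t e = Inr N} = {e : A. e <= N}" using b2(2)[OF _ that] A by (auto simp: t_def)
   have 2: "{e : F - A. s e = Inr N} = {}" by (auto simp: s_def)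
   show ?thesis unfolding 1 2 g_def p_def by simp
  qed
  ultimately show ?thesis by simp
 qed
 have "(SUM A:Pow F. (PROD N:P1. ev (g1 N) (p1 N + card {e : F - A. e <= N})) *
           (PROD N:P2. ev (g2 N) (p2 N + card {e : A. e <= N}))) =
  (SUM A:Pow F. PROD x:U. ev (g x) (p x + card {e : F - A. s e = x} + card {e : A. t e = x}))"
  by (rule sum.cong[OF refl], rule L[symmetric])
 also have "... = (PROD K:ccs ?G. ev (sum g K + card {e : F. s e : K} + 1 - card K) (sum p K))" using main by blast
 also have "... = (PROD K:ccs ?W. ev (sum g (\<Phi> K) + card {e : F. s e : \<Phi> K} + 1 - card (\<Phi> K)) (sum p (\<Phi> K)))"
  unfolding CC using inj by (simp add: prod.reindex)
 also have "... = (PROD K:ccs (P1 Un P2).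
    ev (sum g1 {N : P1. N <= K} + sum g2 {N : P2. N <= K} + card {e : F. e <= K} + 1
       - (card {N : P1. N <= K} + card {N : P2. N <= K}))
      (sum p1 {N : P1. N <= K} + sum p2 {N : P2. N <= K}))"
  by (rule prod.cong[OF refl]) (simp only: sum\<Phi> card\<Phi> edges g_def p_def sum.case)
 finally show "(SUM A:Pow F. (PROD N:P1. ev (g1 N) (p1 N + card {e : F - A. e <= N})) *
           (PROD N:P2. ev (g2 N) (p2 N + card {e : A. e <= N}))) = ..." .
qed

section \<open>Evaluation of three matchings closed up by discs\<close>

definition dots :: "'p set set => 'p set => nat" where
 "dots D K = card {c : D. c <= K}"

text \<open>The Euler characteristic solved for the genus: there are \<open>card K\<close> vertices,
  three arcs to every two vertices, and the discs are the faces, so that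
  \<open>2 - 2 g = faces - card K / 2\<close>.\<close>

definition genus3 :: "'p set set => 'p set set => 'p set set => 'p set => nat" where
 "genus3 x y z K = (card K div 2 + 2 - (faces x y K + faces y z K + faces x z K)) div 2"

text \<open>\<open>A\<close>, \<open>B\<close>, \<open>C\<close> are the dotted discs bounded by the circles of \<open>x y\<close>, \<open>y z\<close> and \<open>x z\<close>.\<close>

definition theta ::
 "'p set set => 'p set set => 'p set set => 'p set set => 'p set set => 'p set set => int" where
 "theta x y z A B C =
  (PROD K:ccs (x Un y Un z). ev (genus3 x y z K) (dots A K + dots B K + dots C K))"

text \<open>The closed surface of four matchings in cyclic order, with discs between consecutive
  ones; here \<open>2 - 2 g = faces - card K\<close>. Cutting it along the circles of either
  diagonal leaves two surfaces of three matchings, which is the source of associativity.\<close>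

definition quad ::
 "'p set set => 'p set set => 'p set set => 'p set set =>
 'p set set => 'p set set => 'p set set => 'p set set => int" where
 "quad x y z w A B C D =
  (PROD K:ccs (x Un y Un z Un w).
    ev ((card K + 2 - (faces x y K + faces y z K + faces z w K + faces w x K)) div 2)
     (dots A K + dots B K + dots C K + dots D K))"

lemma theta_reverse: "theta x y z A B C = theta z y x B A C"
 unfolding theta_def genus3_def faces_commute[of z y] faces_commute[of y x] faces_commute[of z x]
 by (simp add: Un_ac add_ac)

lemma theta_rotate: "theta x y z A B C = theta y z x B C A"
 unfolding theta_def genus3_def faces_commute[of z x] faces_commute[of y x] by (simp add: Un_ac add_ac)

lemma quad_rotate: "quad x y z w A B C D = quad y z w x B C D A" unfolding quad_def by (simp add: Un_ac add_ac)

text \<open>Since the Euler characteristic is even and bounded by 2, neither the subtraction nor the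
  division in \<open>genus3\<close> loses anything.\<close>

lemma genus3_eq: assumes "finite V" "pmatch col V x" "pmatch col V y" "pmatch col V z" and "K : ccs (x Un y Un z)"
 shows "faces x y K + faces y z K + faces x z K + 2 * genus3 x y z K = card K div 2 + 2"
proof -
 obtain g where g: "faces x y K + faces y z K + faces x z K + 2 * g = card K div 2 + 2"
  using euler_component[OF assms] by blast
 hence "card K div 2 + 2 - (faces x y K + faces y z K + faces x z K) = 2 * g" by linarith
 hence "genus3 x y z K = g" by (simp add: genus3_def)
 with g show ?thesis by simp
qed

lemma cc_Un_cc: "ccs (ccs VV Un ccs WW) = ccs (VV Un WW)"
proof (rule cc_eqI2)
 show "conn (VV Un WW) x y" if "B : ccs VV Un ccs WW" "x : B" "y : B" for B x y
 proof (cases "B : ccs VV")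
  case True
  hence "conn VV x y" using that cc_conn by metis
  thus ?thesis by (rule conn_mono) simp
 next
  case False
  hence "conn WW x y" using that cc_conn by (metis UnE)
  thus ?thesis by (rule conn_mono) simp
 qed
 show "conn (ccs VV Un ccs WW) x y" if "B : VV Un WW" "x : B" "y : B" for B x y
 proof (cases "B : VV")
  case True
  hence "conn (ccs VV) x y" using that conn_step[of B VV] by simp
  thus ?thesis by (rule conn_mono) simp
 next
  case False
  hence "conn (ccs WW) x y" using that conn_step[of B WW] by simp
  thus ?thesis by (rule conn_mono) simp
 qed
qed simp

lemma count_blocks: assumes "finite P" "partition_on V P" "!!N. N : P ==> N Int K ~= {} ==> N <= K"
  and "finite Q" "!!c. c : Q ==> c ~= {}" "!!c. c : Q ==> EX N:P. c <= N"
 shows "card {c : Q. c <= K} = (SUM N:{N : P. N <= K}. card {c : Q. c <= N})"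
proof -
 have eq: "{c : Q. c <= K} = (UN N:{N : P. N <= K}. {c : Q. c <= N})"
 proof
  show "{c : Q. c <= K} <= (UN N:{N : P. N <= K}. {c : Q. c <= N})"
  proof clarify
   fix c assume c: "c : Q" "c <= K"
   then obtain N where N: "N : P" "c <= N" using assms(6) by blast
   have "N Int K ~= {}" using assms(5)[OF c(1)] c N by blast
   hence "N <= K" by (rule assms(3)[OF N(1)])
   with N c show "c : (UN N:{N : P. N <= K}. {c : Q. c <= N})" by blast
  qed
 qed auto
 show ?thesis unfolding eq
 proof (rule card_UN_disjoint)
  show "ALL M:{N : P. N <= K}. ALL N:{N : P. N <= K}. M ~= N --> {c : Q. c <= M} Int {c : Q. c <= N} = {}"
  proof (intro ballI impI)
   fix M N assume MN: "M : {N : P. N <= K}" "N : {N : P. N <= K}" "M ~= N"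
   hence "M Int N = {}" using partition_block_unique[OF assms(2), of M N] by blast
   show "{c : Q. c <= M} Int {c : Q. c <= N} = {}"
   proof (rule equals0I)
    fix c assume "c : {c : Q. c <= M} Int {c : Q. c <= N}"
    hence "c : Q" "c <= M Int N" by auto
    with assms(5)[of c] `M Int N = {}` show False by simp
   qed
  qed
 qed (use assms(1,4) in auto)
qed

lemma card_blocks:
 assumes "finite P" "partition_on V P" "!!N. N : P ==> N Int K ~= {} ==> N <= K" "K <= V" "finite V"
 shows "card K = (SUM N:{N : P. N <= K}. card N)"
proof -
 have eq: "K = \<Union>{N : P. N <= K}"
 proof
  show "K <= \<Union>{N : P. N <= K}"
  proof
   fix v assume v: "v : K"
   then obtain N where "N : P" "v : N" using partition_blockE[OF assms(2)] assms(4) by blast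
   thus "v : \<Union>{N : P. N <= K}" using assms(3)[of N] v by blast
  qed
 qed auto
 have "card K = card (\<Union>{N : P. N <= K})" by (rule arg_cong[OF eq])
 also have "... = (SUM N:{N : P. N <= K}. card N)"
 proof (rule card_Union_disjoint)
  show "pairwise disjnt {N : P. N <= K}"
   using partition_onD2[OF assms(2)] by (auto simp: pairwise_def disjnt_def disjoint_def)
  show "finite N" if "N : {N : P. N <= K}" for N using that finite_subset[OF _ assms(5), of N] assms(4) by blast
 qed
 finally show ?thesis .
qed

lemma sub_cc: assumes "c : ccs VV" "VV <= WW" shows "EX N:ccs WW. c <= N"
 using cc_sub_cc[OF assms(1), of WW] assms(2) conn_mono[of VV] by (metis Union_mono)

text \<open>Dots and Euler characteristics are additive over the components of \<open>x\<close>,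
  \<open>y\<close>, \<open>z\<close> inside a component \<open>K\<close> of a larger surface.
  Evenness of \<open>card K\<close> is recorded to make the halves exact.\<close>

lemma three_matchings_blocks:
 assumes fV: "finite V" and x: "pmatch col V x" and y: "pmatch col V y" and z: "pmatch col V z" and KV: "K <= V"
  and K: "K : ccs WW" "ccs (x Un y Un z) <= WW"
 defines "S \<equiv> {N : ccs (x Un y Un z). N <= K}"
 shows sum_dots: "Q <= circ x y | Q <= circ y z | Q <= circ x z ==> sum (dots Q) S = dots Q K"
  and sum_genus3: "card K = 2 * (card K div 2) &
   faces x y K + faces y z K + faces x z K + 2 * sum (genus3 x y z) S = card K div 2 + 2 * card S"
proof -
 let ?P = "ccs (x Un y Un z)"
 have cl: "N <= K" if "N : ?P" "N Int K ~= {}" for N using cc_absorb[OF K(1), of N] K(2) that by blast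
 have U: "\<Union>(x Un y Un z) = V" using pmatchD(2)[OF x] pmatchD(2)[OF y] pmatchD(2)[OF z] by auto
 have P: "finite ?P" "partition_on V ?P" using finite_cc_eq[OF U fV] partition_cc[of "x Un y Un z"] U by auto
 have fin: "finite (circ x y)" "finite (circ y z)" "finite (circ x z)"
  using finite_cc_eq[OF pmatch_Union2 fV] x y z by blast+
 have d: "sum (dots Q) S = dots Q K" if Q: "Q <= circ x y | Q <= circ y z | Q <= circ x z" for Q
  unfolding dots_def S_def
 proof (rule count_blocks[OF P cl, symmetric])
  show "finite Q" using Q fin finite_subset by blast
  show "c ~= {}" if "c : Q" for c using that Q cc_nonempty by blast
  show "EX N:?P. c <= N" if "c : Q" for c
  proof -
   have "EX t. c : ccs t & t <= x Un y Un z" using that Q by blast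
   thus ?thesis using sub_cc by blast
  qed
 qed
 thus "sum (dots Q) S = dots Q K" if "Q <= circ x y | Q <= circ y z | Q <= circ x z" using that .
 have f: "faces u v N = dots (circ u v) N" for u v N by (simp add: faces_def dots_def)
 have "2 * (faces x y N + faces y z N + faces x z N) + 4 * genus3 x y z N = card N + 4" if "N : S" for N
 proof -
  have N: "N : ?P" using that by (simp add: S_def)
  have "card N = 2 * (card N div 2)"
   using card_pmatch(3)[OF pmatch_restrict_cc[OF x N _ U] finite_cc_member_eq[OF U fV N]] by (simp add: Un_assoc)
  moreover have "2 * p + 4 * q = k + 4" if "k = 2 * (k div 2)" "p + 2 * q = k div 2 + 2" for k p q :: nat
   using that by presburger
  ultimately show ?thesis using genus3_eq[OF fV x y z N] by blast
 qed
 hence "(SUM N:S. 2 * (faces x y N + faces y z N + faces x z N) + 4 * genus3 x y z N) = (SUM N:S. card N + 4)"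
  by (rule sum.cong[OF refl])
 hence "2 * (faces x y K + faces y z K + faces x z K) + 4 * sum (genus3 x y z) S = card K + 4 * card S"
  using card_blocks[OF P cl KV fV] unfolding f sum.distrib sum_distrib_left[symmetric] by (simp add: d S_def[symmetric])
 moreover have "k = 2 * (k div 2) & p + 2 * q = k div 2 + 2 * r" if "2 * p + 4 * q = k + 4 * r" for k p q r :: nat
  using that by presburger
 ultimately show "card K = 2 * (card K div 2) &
   faces x y K + faces y z K + faces x z K + 2 * sum (genus3 x y z) S = card K div 2 + 2 * card S" by blast
qed

text \<open>Neck-cutting along all circles of \<open>x\<close> and \<open>z\<close>: a circle
  outside of \<open>E\<close> receives a dot on the one side, a circle in \<open>E\<close> on the
  other, so every cut neck carries exactly one dot.\<close>

lemma theta_glue: assumes fV: "finite V" and x: "pmatch col V x" and y: "pmatch col V y"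
  and z: "pmatch col V z" and w: "pmatch col V w"
  and A: "A <= circ x y" and B: "B <= circ y z" and C: "C <= circ z w" and D: "D <= circ w x"
 shows "(SUM E:Pow (circ x z). theta x y z A B (circ x z - E) * theta x z w E C D) = quad x y z w A B C D"
proof -
 let ?P1 = "ccs (x Un y Un z)" and ?P2 = "ccs (x Un z Un w)" and ?F = "circ x z"
 have U: "\<Union>(x Un y Un z) = V" "\<Union>(x Un z Un w) = V" "\<Union>(x Un z) = V" "\<Union>(x Un y Un z Un (x Un z Un w)) = V"
  unfolding Union_Un_distrib pmatchD(2)[OF x] pmatchD(2)[OF y] pmatchD(2)[OF z] pmatchD(2)[OF w] by auto
 have part: "partition_on V ?P1" "partition_on V ?P2" "partition_on V ?F"
  using partition_cc[of "x Un y Un z"] partition_cc[of "x Un z Un w"] partition_cc[of "x Un z"]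
  unfolding U by blast+
 have F1: "EX N:?P1. e <= N" if "e : ?F" for e using that by (rule sub_cc) blast
 have F2: "EX N:?P2. e <= N" if "e : ?F" for e using that by (rule sub_cc) blast
 have CC: "ccs (?P1 Un ?P2) = ccs (x Un y Un z Un w)" unfolding cc_Un_cc by (rule arg_cong[of _ _ ccs]) blast
 note glue = glue_partitions[OF fV part(1,2,3) F1 F2]
 let ?p1 = "%N. dots A N + dots B N" and ?p2 = "%N. dots C N + dots D N"
 have "(SUM E:Pow ?F. theta x y z A B (?F - E) * theta x z w E C D) =
  (SUM E:Pow ?F. (PROD N:?P1. ev (genus3 x y z N) (?p1 N + card {e : ?F - E. e <= N})) *
           (PROD N:?P2. ev (genus3 x z w N) (?p2 N + card {e : E. e <= N})))"
  unfolding theta_def dots_def by (simp add: add_ac)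
 also have "... = (PROD K:ccs (?P1 Un ?P2).
    ev (sum (genus3 x y z) {N : ?P1. N <= K} + sum (genus3 x z w) {N : ?P2. N <= K} + card {e : ?F. e <= K} + 1
       - (card {N : ?P1. N <= K} + card {N : ?P2. N <= K}))
      (sum ?p1 {N : ?P1. N <= K} + sum ?p2 {N : ?P2. N <= K}))"
  by (rule glue(2))
 also have "... = quad x y z w A B C D" unfolding quad_def CC[symmetric]
 proof (intro prod.cong[OF refl] arg_cong2[of _ _ _ _ ev])
  fix K assume K: "K : ccs (?P1 Un ?P2)"
  have KV: "K <= V" using cc_subset[OF K] part(1,2) by (auto simp: partition_on_def)
  note b1 = three_matchings_blocks[OF fV x y z KV K Un_upper1] and b2 = three_matchings_blocks[OF fV x z w KV K Un_upper2]
  have D': "D <= circ x w" using D by (simp add: Un_commute)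
  show "sum ?p1 {N : ?P1. N <= K} + sum ?p2 {N : ?P2. N <= K} = dots A K + dots B K + dots C K + dots D K"
   using b1(1)[of A] b1(1)[of B] b2(1)[of C] b2(1)[of D] A B C D' by (simp add: sum.distrib)
  have le: "card {N : ?P1. N <= K} + card {N : ?P2. N <= K} <= faces x z K + 1"
   unfolding faces_def by (rule glue(1)[OF _ _ K])
  have fK: "card {e : ?F. e <= K} = faces x z K" by (simp add: faces_def)
  show "sum (genus3 x y z) {N : ?P1. N <= K} + sum (genus3 x z w) {N : ?P2. N <= K} + card {e : ?F. e <= K} + 1
       - (card {N : ?P1. N <= K} + card {N : ?P2. N <= K}) =
    (card K + 2 - (faces x y K + faces y z K + faces z w K + faces w x K)) div 2"
   unfolding fK faces_commute[of w x] using b1(2) b2(2) le by linarith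
 qed
 finally show ?thesis .
qed

section \<open>The algebra of bipartite matchings\<close>

lemma frag_additive_eqI: assumes "keys v <= S" and "!!u v. f (u - v) = f u - f v" "!!u v. g (u - v) = g u - g v"
  and "!!a. a : S ==> f (frag_of a) = (g (frag_of a) :: 'b :: ab_group_add)"
 shows "f v = g v" using assms(1)
proof (induction v rule: frag_induction)
 case zero
 have "f 0 = 0" "g 0 = 0" using assms(2)[of 0 0] assms(3)[of 0 0] by simp_all
 thus ?case by simp
qed (use assms in auto)

lemma bilinear_add_left: "bilinear_extend f (u + v) w = bilinear_extend f u w + bilinear_extend f v w"
 by (simp add: bilinear_extend_def frag_extend_add)

lemma bilinear_diff_left: "bilinear_extend f (u - v) w = bilinear_extend f u w - bilinear_extend f v w"
 by (simp add: bilinear_extend_def frag_extend_diff)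

lemma bilinear_zero_left [simp]: "bilinear_extend f 0 w = 0" by (simp add: bilinear_extend_def)

lemma bilinear_cmul_left: "bilinear_extend f (frag_cmul k u) w = frag_cmul k (bilinear_extend f u w)"
 by (simp add: bilinear_extend_def frag_extend_cmul)

lemma bilinear_of [simp]: "bilinear_extend f (frag_of a) (frag_of c) = f a c" by (simp add: bilinear_extend_def)

lemma bilinear_zero_right [simp]: "bilinear_extend f w 0 = 0" by (simp add: bilinear_extend_def frag_extend_def)

lemma bilinear_diff_right: "bilinear_extend f w (u - v) = bilinear_extend f w u - bilinear_extend f w v"
 by (rule frag_additive_eqI[of w UNIV "%w. bilinear_extend f w (u - v)"
    "%w. bilinear_extend f w u - bilinear_extend f w v"])
  (simp_all add: bilinear_extend_def frag_extend_diff)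

lemma bilinear_minus_right: "bilinear_extend f w (- u) = - bilinear_extend f w u"
 using bilinear_diff_right[of f w 0 u] by simp

lemma bilinear_add_right: "bilinear_extend f w (u + v) = bilinear_extend f w u + bilinear_extend f w v"
 using bilinear_diff_right[of f w u "- v"] bilinear_minus_right[of f w v] by simp

lemma frag_cmul_diff: "frag_cmul k (p - q) = frag_cmul k p - frag_cmul k q"
 by (metis add_diff_cancel diff_add_cancel frag_cmul_distrib2)

lemma bilinear_cmul_right: "bilinear_extend f w (frag_cmul k u) = frag_cmul k (bilinear_extend f w u)"
 by (rule frag_additive_eqI[of w UNIV "%w. bilinear_extend f w (frag_cmul k u)"
    "%w. frag_cmul k (bilinear_extend f w u)"])
  (simp_all add: bilinear_extend_def frag_extend_diff frag_extend_cmul frag_cmul_diff)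

lemma bilinear_sum_left: "bilinear_extend f (SUM i:I. u i) w = (SUM i:I. bilinear_extend f (u i) w)"
 by (induction I rule: infinite_finite_induct) (simp_all add: bilinear_add_left)

lemma bilinear_sum_right: "bilinear_extend f w (SUM i:I. u i) = (SUM i:I. bilinear_extend f w (u i))"
 by (induction I rule: infinite_finite_induct) (simp_all add: bilinear_add_right)

lemma frag_cmul_sum_left: "(SUM i:I. frag_cmul (k i) a) = frag_cmul (SUM i:I. k i) a"
 by (induction I rule: infinite_finite_induct) (simp_all add: frag_cmul_distrib)

type_synonym 'p hgen = "'p set set \<times> 'p set set \<times> 'p set set"

locale marked_points = fixes V :: "'p set" and col :: "'p => bool" assumes finite_V: "finite V"
begin

abbreviation pm :: "'p set set => bool" where
 "pm \<equiv> pmatch col V"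

definition hgens :: "'p hgen set" where
 "hgens = {(x, y, D). pm x & pm y & D <= circ x y}"

text \<open>With respect to the trace, \<open>1\<close> and \<open>X\<close> are dual to each other.
  So the coefficient at \<open>G\<close> is the value of the surface closed up by discs with dots on
  the complement of \<open>G\<close>. Invalid generators multiply to 0, which lets associativity
  hold for all arguments.\<close>

fun hmul_gen :: "'p hgen => 'p hgen => 'p hgen \<Rightarrow>\<^sub>0 int" where
 "hmul_gen (x, y, D) (y', z, E) =
  (if y = y' & (x, y, D) : hgens & (y', z, E) : hgens
   then SUM G:Pow (circ x z). frag_cmul (theta x y z D E (circ x z - G)) (frag_of (x, z, G)) else 0)"

definition hmul :: "('p hgen \<Rightarrow>\<^sub>0 int) => ('p hgen \<Rightarrow>\<^sub>0 int) => 'p hgen \<Rightarrow>\<^sub>0 int" (infixl "**" 70) where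
 "u ** v = bilinear_extend hmul_gen u v"

lemmas hmul_simps =
 bilinear_add_left[of hmul_gen, folded hmul_def] bilinear_diff_left[of hmul_gen, folded hmul_def]
 bilinear_zero_left[of hmul_gen, folded hmul_def] bilinear_zero_right[of hmul_gen, folded hmul_def]
 bilinear_add_right[of hmul_gen, folded hmul_def] bilinear_diff_right[of hmul_gen, folded hmul_def]
 bilinear_sum_left[of hmul_gen, folded hmul_def] bilinear_sum_right[of hmul_gen, folded hmul_def]
 bilinear_cmul_left[of hmul_gen, folded hmul_def] bilinear_cmul_right[of hmul_gen, folded hmul_def]

lemma hmul_of: "frag_of p ** frag_of q = hmul_gen p q" by (simp add: hmul_def)

lemma finite_circ: "pm x ==> pm y ==> finite (circ x y)" using finite_cc_eq[OF pmatch_Union2 finite_V] .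

lemma hmul_gen_eq_0: "p ~: hgens | q ~: hgens | fst (snd p) ~= fst q ==> hmul_gen p q = 0"
 by (cases p; cases q) auto

lemma hmul_assoc_gen: "hmul_gen p q ** frag_of r = frag_of p ** hmul_gen q r"
proof -
 obtain x y D where p: "p = (x, y, D)" by (cases p) auto
 obtain y' z E where q: "q = (y', z, E)" by (cases q) auto
 obtain z' w F where r: "r = (z', w, F)" by (cases r) auto
 show ?thesis
 proof (cases "y = y' & z = z' & p : hgens & q : hgens & r : hgens")
  case False
  have "hmul_gen p q ** frag_of r = 0"
  proof (cases "hmul_gen p q = 0")
   case nz: False
   hence "p : hgens" "q : hgens" "y = y'" using hmul_gen_eq_0[of p q] by (auto simp: p q)
   with False have "hmul_gen (x, z, A) r = 0" for A by (intro hmul_gen_eq_0) (auto simp: r)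
   thus ?thesis unfolding p q hmul_gen.simps by (simp add: hmul_simps hmul_of)
  qed (simp add: hmul_simps)
  moreover have "frag_of p ** hmul_gen q r = 0"
  proof (cases "hmul_gen q r = 0")
   case nz: False
   hence "q : hgens" "r : hgens" "z = z'" using hmul_gen_eq_0[of q r] by (auto simp: q r)
   with False have "hmul_gen p (y', w, A) = 0" for A by (intro hmul_gen_eq_0) (auto simp: p)
   thus ?thesis unfolding q r hmul_gen.simps by (simp add: hmul_simps hmul_of)
  qed (simp add: hmul_simps)
  ultimately show ?thesis by simp
 next
  case True
  hence eq: "y' = y" "z' = z" by auto
  have pms: "pm x" "pm y" "pm z" "pm w" and subs: "D <= circ x y" "E <= circ y z" "F <= circ z w"
   using True by (auto simp: p q r hgens_def)
  have g: "(x, z, A) : hgens \<longleftrightarrow> A : Pow (circ x z)" "(y, w, B) : hgens \<longleftrightarrow> B : Pow (circ y w)" for A B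
   using pms by (auto simp: hgens_def)
  have valid: "(x, y, D) : hgens" "(y, z, E) : hgens" "(z, w, F) : hgens" using pms subs by (auto simp: hgens_def)
  have "hmul_gen p q ** frag_of r =
   (SUM A:Pow (circ x z). SUM G:Pow (circ x w).
    frag_cmul (theta x y z D E (circ x z - A) * theta x z w A F (circ x w - G)) (frag_of (x, w, G)))"
  proof -
   have "hmul_gen p q ** frag_of r = (SUM A:Pow (circ x z). frag_cmul (theta x y z D E (circ x z - A)) (hmul_gen (x, z, A) r))"
    unfolding p q eq hmul_gen.simps using valid by (simp add: hmul_simps hmul_of)
   also have "... = (SUM A:Pow (circ x z). SUM G:Pow (circ x w).
    frag_cmul (theta x y z D E (circ x z - A) * theta x z w A F (circ x w - G)) (frag_of (x, w, G)))"
    using valid by (intro sum.cong[OF refl]) (simp add: r eq g frag_cmul_sum)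
   finally show ?thesis .
  qed
  also have "... = (SUM G:Pow (circ x w). SUM A:Pow (circ x z).
    frag_cmul (theta x y z D E (circ x z - A) * theta x z w A F (circ x w - G)) (frag_of (x, w, G)))"
   by (rule sum.swap)
  also have "... = (SUM G:Pow (circ x w). frag_cmul (quad x y z w D E F (circ x w - G)) (frag_of (x, w, G)))"
   unfolding frag_cmul_sum_left
   by (intro sum.cong[OF refl], subst theta_glue[OF finite_V pms subs]) (auto simp: Un_commute)
  also have "... = (SUM G:Pow (circ x w). frag_cmul (SUM B:Pow (circ y w).
    theta y z w E F (circ y w - B) * theta x y w D B (circ x w - G)) (frag_of (x, w, G)))"
  proof (intro sum.cong[OF refl] arg_cong2[of _ _ _ _ frag_cmul] refl)
   fix G
   \<comment> \<open>Rotation exchanges the diagonals: the same surface is now cut along the circles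
     of \<open>y\<close> and \<open>w\<close>.\<close>
   have "quad x y z w D E F (circ x w - G) = quad y z w x E F (circ x w - G) D" by (rule quad_rotate)
   also have "... = (SUM B:Pow (circ y w). theta y z w E F (circ y w - B) * theta y w x B (circ x w - G) D)"
    by (rule theta_glue[OF finite_V, symmetric]) (use pms subs in "auto simp: Un_commute")
   finally show "quad x y z w D E F (circ x w - G) = (SUM B:Pow (circ y w).
    theta y z w E F (circ y w - B) * theta x y w D B (circ x w - G))"
    by (simp only: theta_rotate[of x y w])
  qed
  also have "... = (SUM B:Pow (circ y w). SUM G:Pow (circ x w).
    frag_cmul (theta y z w E F (circ y w - B) * theta x y w D B (circ x w - G)) (frag_of (x, w, G)))"
   unfolding frag_cmul_sum_left[symmetric] by (rule sum.swap)
  also have "... = frag_of p ** hmul_gen q r"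
  proof -
   have "frag_of p ** hmul_gen q r = (SUM B:Pow (circ y w). frag_cmul (theta y z w E F (circ y w - B)) (hmul_gen p (y, w, B)))"
    unfolding r q eq hmul_gen.simps using valid by (simp add: hmul_simps hmul_of)
   also have "... = (SUM B:Pow (circ y w). SUM G:Pow (circ x w).
    frag_cmul (theta y z w E F (circ y w - B) * theta x y w D B (circ x w - G)) (frag_of (x, w, G)))"
    using valid by (intro sum.cong[OF refl]) (simp add: p eq g frag_cmul_sum)
   finally show ?thesis by simp
  qed
  finally show ?thesis .
 qed
qed

lemma hmul_assoc: "(u ** v) ** w = u ** (v ** w)"
proof (rule frag_additive_eqI[of u UNIV "%u. (u ** v) ** w" "%u. u ** (v ** w)"])
 fix p :: "'p hgen"
 show "(frag_of p ** v) ** w = frag_of p ** (v ** w)"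
 proof (rule frag_additive_eqI[of v UNIV "%v. (frag_of p ** v) ** w" "%v. frag_of p ** (v ** w)"])
  fix q :: "'p hgen"
  show "(frag_of p ** frag_of q) ** w = frag_of p ** (frag_of q ** w)"
   by (rule frag_additive_eqI[of w UNIV "%w. (frag_of p ** frag_of q) ** w" "%w. frag_of p ** (frag_of q ** w)"])
    (simp_all add: hmul_simps hmul_of hmul_assoc_gen)
 qed (simp_all add: hmul_simps)
qed (simp_all add: hmul_simps)

end

section \<open>Products in which all components are spheres\<close>

lemma dots_cc: assumes "D <= ccs VV" "K : ccs VV" shows "dots D K = (if K : D then 1 else 0)"
proof -
 have "c = K" if "c : D" "c <= K" for c
 proof -
  have c: "c : ccs VV" using that assms by blast
  then obtain v where "v : c" using cc_nonempty by blast
  thus ?thesis using cc_disjoint[OF c assms(2), of v] that by blast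
 qed
 hence "{c : D. c <= K} = (if K : D then {K} else {})" by auto
 thus ?thesis by (simp add: dots_def)
qed

lemma faces_one: "K : circ x y ==> faces x y K = 1"
 using dots_cc[of "circ x y" "x Un y" K] by (simp add: dots_def faces_def)

context marked_points
begin

abbreviation bas :: "'p set set => 'p set set => 'p set set => 'p hgen \<Rightarrow>\<^sub>0 int" where
 "bas x y D \<equiv> frag_of (x, y, D)"

lemma pm_Union3: "pm x ==> pm y ==> pm z ==> \<Union>(x Un y Un z) = V" by (simp add: pmatchD(2))

lemma finite_cc3: "pm x ==> pm y ==> pm z ==> finite (ccs (x Un y Un z))"
 using finite_cc_eq[OF pm_Union3 finite_V] .

lemma hmul_bas: assumes "pm x" "pm y" "pm z" "D <= circ x y" "E <= circ y z"
 shows "bas x y D ** bas y z E = (SUM G:Pow (circ x z). frag_cmul (theta x y z D E (circ x z - G)) (bas x z G))"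
 using assms by (simp add: hmul_of hgens_def)

lemma faces_self: assumes "pm x" "K : ccs VV" "x <= VV" "\<Union>VV = V" shows "faces x x K = card K div 2"
 unfolding faces_def circ_self[OF assms(1)]
 using card_pmatch(3)[OF pmatch_restrict_cc[OF assms] finite_cc_member_eq[OF assms(4) finite_V assms(2)]] by simp

lemma theta_genus0: assumes "pm x" "pm y" "pm z" "!!K. K : ccs (x Un y Un z) ==> genus3 x y z K = 0"
 shows "theta x y z A B C =
  (if ALL K:ccs (x Un y Un z). dots A K + dots B K + dots C K = 1 then 1 else 0)"
proof -
 let ?C = "ccs (x Un y Un z)"
 have "theta x y z A B C = (PROD K:?C. if dots A K + dots B K + dots C K = 1 then 1 else 0)"
  unfolding theta_def by (rule prod.cong[OF refl]) (simp only: assms(4) ev_0)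
 also have "... = (if ALL K:?C. dots A K + dots B K + dots C K = 1 then 1 else 0)" using finite_cc3 assms by auto
 finally show ?thesis .
qed

text \<open>A sphere has value 1 if it carries exactly one dot and 0 otherwise. The product is
  therefore the plain sum of those basis elements whose dual discs complete the dots to one on each
  sphere.\<close>

lemma hmul_genus0: assumes "pm x" "pm y" "pm z" "D <= circ x y" "E <= circ y z"
  and "!!K. K : ccs (x Un y Un z) ==> genus3 x y z K = 0"
  and G: "!!G. G <= circ x z ==> (ALL K:ccs (x Un y Un z). dots D K + dots E K + dots (circ x z - G) K = 1) \<longleftrightarrow> G : S"
  and S: "S <= Pow (circ x z)"
 shows "bas x y D ** bas y z E = (SUM G:S. bas x z G)"
proof -
 have fin: "finite (Pow (circ x z))" using finite_circ[OF assms(1,3)] by simp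
 have "bas x y D ** bas y z E = (SUM G:Pow (circ x z). if G : S then bas x z G else 0)"
  unfolding hmul_bas[OF assms(1-5)]
 proof (rule sum.cong[OF refl])
  fix H assume "H : Pow (circ x z)"
  hence H: "H <= circ x z" by simp
  have "theta x y z D E (circ x z - H) = (if ALL K:ccs (x Un y Un z).
    dots D K + dots E K + dots (circ x z - H) K = 1 then 1 else 0)"
   by (rule theta_genus0[OF assms(1-3)]) (rule assms(6))
  hence "theta x y z D E (circ x z - H) = (if H : S then 1 else 0)" by (simp only: G[OF H])
  thus "frag_cmul (theta x y z D E (circ x z - H)) (bas x z H) = (if H : S then bas x z H else 0)" by simp
 qed
 also have "... = (SUM G:S. bas x z G)"
  using sum.inter_restrict[OF fin, of "%G. bas x z G" S] S by (simp add: Int_absorb1)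
 finally show ?thesis .
qed

text \<open>The surface is a collar of the circles of \<open>x z\<close>, so a dot on an arc slides
  to the circle through this arc, and two dots on one circle give 0.\<close>

lemma bas_dots: assumes x: "pm x" and z: "pm z" and S: "S <= x" and D: "D <= circ x z"
 shows "bas x x S ** bas x z D =
  (if ALL K:circ x z. dots S K + dots D K <= 1 then bas x z {K : circ x z. dots S K + dots D K = 1} else 0)"
proof -
 let ?C = "circ x z"
 have C: "ccs (x Un x Un z) = ?C" by simp
 let ?S = "if ALL K:?C. dots S K + dots D K <= 1 then {{K : ?C. dots S K + dots D K = 1}} else {}"
 have "bas x x S ** bas x z D = (SUM G:?S. bas x z G)"
 proof (rule hmul_genus0[OF x x z _ D])
  show "S <= circ x x" using S circ_self[OF x] by simp
  show "genus3 x x z K = 0" if "K : ccs (x Un x Un z)" for K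
  proof -
   have K: "K : ?C" using that by simp
   have "faces x x K = card K div 2" by (rule faces_self[OF x K _ pmatch_Union2[OF x z]]) simp
   thus ?thesis using faces_one[OF K] by (simp add: genus3_def)
  qed
  show "?S <= Pow ?C" by auto
  fix G assume G: "G <= ?C"
  have d: "dots (?C - G) K = (if K : G then 0 else 1)" if "K : ?C" for K
   using dots_cc[of "?C - G" "x Un z" K] that by simp
  have *: "(dots S K + dots D K + dots (?C - G) K = 1) \<longleftrightarrow>
    dots S K + dots D K <= 1 & (K : G \<longleftrightarrow> dots S K + dots D K = 1)" if "K : ?C" for K
   unfolding d[OF that] by auto
  show "(ALL K:ccs (x Un x Un z). dots S K + dots D K + dots (?C - G) K = 1) \<longleftrightarrow> G : ?S"
   unfolding C using * G by (auto split: if_splits)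
 qed
 thus ?thesis by (auto split: if_splits)
qed

lemma bas_unit_left: "pm x ==> pm z ==> D <= circ x z ==> bas x x {} ** bas x z D = bas x z D"
proof -
 assume a: "pm x" "pm z" "D <= circ x z"
 have "dots {} K = 0" for K :: "'p set" by (simp add: dots_def)
 hence "bas x x {} ** bas x z D = bas x z {K : circ x z. dots D K = 1}"
  using bas_dots[OF a(1,2) _ a(3), of "{}"] dots_cc[OF a(3)] by auto
 also have "{K : circ x z. dots D K = 1} = D" using dots_cc[OF a(3)] a(3) by (auto split: if_splits)
 finally show ?thesis .
qed

lemma bas_dot: assumes "pm x" "pm z" "al : x" "D <= circ x z" and K: "K : circ x z" "al <= K"
 shows "bas x x {al} ** bas x z D = (if K : D then 0 else bas x z (insert K D))"
proof -
 have d: "dots {al} L = (if L = K then 1 else 0)" if "L : circ x z" for L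
 proof -
  obtain v where v: "v : al" using pmatch_nonempty[OF assms(1,3)] by blast
  have "al <= L \<longleftrightarrow> L = K" using cc_disjoint[OF that K(1), of v] v K(2) by blast
  hence "{c : {al}. c <= L} = (if L = K then {al} else {})" by auto
  thus ?thesis by (simp add: dots_def)
 qed
 have S: "{al} <= x" using assms by simp
 show ?thesis
 proof (cases "K : D")
  case True
  hence "~ (ALL L:circ x z. dots {al} L + dots D L <= 1)"
   using K d[OF K(1)] dots_cc[OF assms(4) K(1)] by (intro notI) (drule bspec[OF _ K(1)], simp)
  thus ?thesis using bas_dots[OF assms(1,2) S assms(4)] True by simp
 next
  case False
  have "ALL L:circ x z. dots {al} L + dots D L <= 1" using d dots_cc[OF assms(4)] False by auto
  moreover have "{L : circ x z. dots {al} L + dots D L = 1} = insert K D"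
   using d dots_cc[OF assms(4)] False assms(4) K(1) by (auto split: if_splits)
  ultimately show ?thesis using bas_dots[OF assms(1,2) S assms(4)] False by simp
 qed
qed

text \<open>The surface is a collar with one pair of pants. The component where the circles merge
  has one circle of \<open>u z\<close> more, and one circle of \<open>u u'\<close> less, than a
  collar of its size; these cancel in the Euler characteristic.\<close>

lemma surg_genus0: assumes s: "surg col u u' a b c d" and u: "pm u" and z: "pm z"
  and n: "~ conn (u Un z) a c" and K: "K : ccs (u Un u' Un z)"
 shows "ccs (u Un u' Un z) = circ u' z" "genus3 u u' z K = 0"
proof -
 note mrg = circ_surg_merge[OF s u z finite_V n]
 have u': "pm u'" by (rule surg_pmatch[OF s u])
 note sd = s[unfolded surg_def]
 have cc': "conn (u' Un z) a c" using conn_surg_cases[OF s u z finite_V] n by blast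
 show eq: "ccs (u Un u' Un z) = circ u' z"
 proof (rule cc_eqI2)
  show "\<Union>(u Un u' Un z) = \<Union>(u' Un z)" using pmatchD(2)[OF u] pmatchD(2)[OF u'] pmatchD(2)[OF z] by auto
  have st: "conn (u' Un z) a d" "conn (u' Un z) c b"
   by (rule conn_step[of "{a, d}"] conn_step[of "{c, b}"]; use sd in simp)+
  have ab: "conn (u' Un z) a b" using cc' st conn_trans by metis
  have cd: "conn (u' Un z) c d" using cc' st conn_trans conn_sym by metis
  show "conn (u' Un z) p q" if W: "W : u Un u' Un z" "p : W" "q : W" for W p q
  proof -
   consider "W : u' Un z" | "W = {a, b}" | "W = {c, d}" using W(1) sd by blast
   thus ?thesis
   proof cases
    case 1
    show ?thesis by (rule conn_step[OF 1 W(2,3)])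
   qed (use W ab cd conn_sym[of "u' Un z"] in auto)
  qed
  show "conn (u Un u' Un z) p q" if "W : u' Un z" "p : W" "q : W" for W p q
   by (rule conn_step[OF _ that(2,3)]) (use that(1) in blast)
 qed
 let ?A = "cls (u Un z) a" and ?C = "cls (u Un z) c"
 have Kc: "K : circ u' z" using K eq by simp
 have Uz: "\<Union>(u Un z) = V" by (rule pmatch_Union2[OF u z])
 have AC: "?A : circ u z" "?C : circ u z" "?A ~= ?C"
  using cls_in_cc_eq[OF Uz] surg_in_V[OF s u] n by (auto simp: cls_eq_iff)
 have f1: "faces u' z K = 1" by (rule faces_one[OF Kc])
 have f2: "faces u z K = (if K = ?A Un ?C then 2 else 1)"
 proof (cases "K = ?A Un ?C")
  case True
  have "{c : circ u z. c <= K} = {?A, ?C}"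
  proof
   show "{c : circ u z. c <= K} <= {?A, ?C}"
   proof
    fix L assume "L : {c : circ u z. c <= K}"
    hence L: "L : circ u z" "L <= K" by auto
    then obtain v where v: "v : L" using cc_nonempty by blast
    with L True have "v : ?A | v : ?C" by blast
    thus "L : {?A, ?C}" using cc_disjoint[OF L(1) AC(1) v] cc_disjoint[OF L(1) AC(2) v] by blast
   qed
  qed (use True AC in auto)
  thus ?thesis using True AC(3) by (simp add: faces_def)
 next
  case False
  hence "K : circ u z" using Kc mrg by blast
  thus ?thesis using faces_one False by simp
 qed
 have "~ conn (u Un u) a c"
 proof -
  have "u : {u}" by simp
  have "{a, b} : circ u u" using sd circ_self[OF u] by simp
  thus ?thesis using cc_closed[of "{a, b}" "u Un u" a c] surg_distinct[OF s u] by auto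
 qed
 note mu = circ_surg_merge[OF s u u finite_V this]
 have cl: "cls (u Un u) a = {a, b}" "cls (u Un u) c = {c, d}"
  using cc_eq_cls[of "{a, b}" "u Un u" a] cc_eq_cls[of "{c, d}" "u Un u" c] sd circ_self[OF u] by auto
 have cuu: "circ u' u = u - {{a, b}, {c, d}} Un {{a, b, c, d}}"
  using mu unfolding cl circ_self[OF u] by (simp add: insert_commute)
 have uK: "card {al : u. al <= K} = card K div 2"
  using faces_self[OF u K _ pm_Union3[OF u u' z]] circ_self[OF u] by (auto simp: faces_def)
 have finu: "finite {al : u. al <= K}" using pmatch_finite[OF u finite_V] by simp
 have f3: "faces u u' K + (if K = ?A Un ?C then 1 else 0) = card K div 2"
 proof (cases "K = ?A Un ?C")
  case True
  have abK: "{a, b} <= K" "{c, d} <= K"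
   using True sd conn_step[of "{a, b}" "u Un z" a b] conn_step[of "{c, d}" "u Un z" c d] by auto
  have ne: "{a, b} ~= {c, d}" using surg_distinct[OF s u] by simp
  have new: "{a, b, c, d} ~: u"
   using pmatch_unique[OF u, of "{a, b, c, d}" "{a, b}" a] sd surg_distinct[OF s u] by auto
  have "{c : circ u u'. c <= K} = insert {a, b, c, d} ({al : u. al <= K} - {{a, b}, {c, d}})"
   unfolding circ_commute[of u u'] cuu using abK by auto
  hence "faces u u' K = Suc (card ({al : u. al <= K} - {{a, b}, {c, d}}))"
   unfolding faces_def using finu new by simp
  also have "card ({al : u. al <= K} - {{a, b}, {c, d}}) = card {al : u. al <= K} - card {{a, b}, {c, d}}"
   by (rule card_Diff_subset) (use abK sd in auto)
  also have "card {{a, b}, {c, d}} = 2" using ne by simp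
  finally have "faces u u' K = Suc (card {al : u. al <= K} - 2)" .
  moreover have "card {{a, b}, {c, d}} <= card {al : u. al <= K}" by (rule card_mono[OF finu]) (use abK sd in auto)
  ultimately show ?thesis using True uK ne by simp
 next
  case False
  hence Kz: "K : circ u z" "K ~= ?A" "K ~= ?C" using Kc mrg by blast+
  have out: "a ~: K" "c ~: K" using cc_eq_cls[OF Kz(1)] Kz(2,3) by blast+
  have "{c : circ u u'. c <= K} = {al : u. al <= K}" unfolding circ_commute[of u u'] cuu using out by auto
  thus ?thesis using uK False by (simp add: faces_def)
 qed
 show "genus3 u u' z K = 0" unfolding genus3_def using f1 f2 f3 by (auto split: if_splits)
qed

lemma genus3_perm: "genus3 x y z = genus3 y x z"
 unfolding genus3_def by (intro ext) (simp add: faces_commute[of y x] add_ac)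

lemma surg_circles: assumes s: "surg col u u' a b c d" and u: "pm u" and z: "pm z" and n: "~ conn (u Un z) a c"
 defines "A \<equiv> cls (u Un z) a" and "C \<equiv> cls (u Un z) c"
 shows "A : circ u z" "C : circ u z" "A ~= C" "A Un C ~: circ u z" "A Un C : circ u' z"
  "circ u' z = circ u z - {A, C} Un {A Un C}"
  "!!D. D <= circ u z ==> dots D (A Un C) = (if A : D then 1 else 0) + (if C : D then 1 else 0)"
proof -
 have Uz: "\<Union>(u Un z) = V" by (rule pmatch_Union2[OF u z])
 show AC: "A : circ u z" "C : circ u z" "A ~= C"
  using cls_in_cc_eq[OF Uz] surg_in_V[OF s u] n by (auto simp: cls_eq_iff A_def C_def)
 show mrg: "circ u' z = circ u z - {A, C} Un {A Un C}"
  using circ_surg_merge[OF s u z finite_V n] by (simp add: A_def C_def)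
 thus "A Un C : circ u' z" by simp
 show "A Un C ~: circ u z"
 proof
  assume "A Un C : circ u z"
  hence "conn (u Un z) a c" by (rule cc_conn) (auto simp: A_def C_def)
  with n show False ..
 qed
 fix D assume D: "D <= circ u z"
 have "L = A | L = C" if "L : D" "L <= A Un C" for L
 proof -
  have L: "L : circ u z" using that D by blast
  then obtain v where v: "v : L" using cc_nonempty by blast
  thus ?thesis using cc_disjoint[OF L AC(1) v] cc_disjoint[OF L AC(2) v] that by blast
 qed
 hence "{c : D. c <= A Un C} = (if A : D then {A} else {}) Un (if C : D then {C} else {})" by auto
 thus "dots D (A Un C) = (if A : D then 1 else 0) + (if C : D then 1 else 0)" using AC(3) by (simp add: dots_def)
qed

text \<open>This is the multiplication of the Frobenius algebra on the circles \<open>A\<close> and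
  \<open>C\<close>, which merge into \<open>A Un C\<close>.\<close>

lemma bas_merge: assumes s: "surg col u u' a b c d" and u: "pm u" and z: "pm z" and n: "~ conn (u Un z) a c"
  and D: "D <= circ u z"
 defines "A \<equiv> cls (u Un z) a" and "C \<equiv> cls (u Un z) c"
 shows "bas u' u {} ** bas u z D =
  (if A : D & C : D then 0
  else if A : D | C : D then bas u' z (insert (A Un C) (D - {A, C})) else bas u' z D)"
proof -
 have u': "pm u'" by (rule surg_pmatch[OF s u])
 note sc = surg_circles[OF s u z n, folded A_def C_def]
 have CC: "ccs (u' Un u Un z) = circ u' z"
  using surg_genus0(1)[OF s u z n] cls_in_cc_eq[OF pm_Union3[OF u u' z]] surg_in_V[OF s u] by (metis Un_commute)
 let ?S = "if A : D & C : D then {}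
  else if A : D | C : D then {insert (A Un C) (D - {A, C})} else {D}"
 have "bas u' u {} ** bas u z D = (SUM G:?S. bas u' z G)"
 proof (rule hmul_genus0[OF u' u z _ D])
  show "genus3 u' u z K = 0" if "K : ccs (u' Un u Un z)" for K
   using surg_genus0(2)[OF s u z n] that genus3_perm by (metis Un_commute)
  show "?S <= Pow (circ u' z)" using sc(6) D by auto
  fix G assume G: "G <= circ u' z"
  have dG: "dots (circ u' z - G) K = (if K : G then 0 else 1)" if "K : circ u' z" for K
   using dots_cc[of "circ u' z - G" "u' Un z" K] that by simp
  have dD: "dots D K = (if K : D then 1 else 0)" if "K : circ u' z" "K ~= A Un C" for K
   using dots_cc[OF D, of K] that sc(6) by blast
  have d0: "dots {} K = 0" for K :: "'p set" by (simp add: dots_def)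
  have "(ALL K:circ u' z. dots {} K + dots D K + dots (circ u' z - G) K = 1) \<longleftrightarrow>
   (ALL K:circ u z - {A, C}. (K : D \<longleftrightarrow> K : G)) &
   (if A Un C : G then (A : D) ~= (C : D) else A ~: D & C ~: D)"
  proof -
   have "(ALL K:circ u' z. dots {} K + dots D K + dots (circ u' z - G) K = 1) \<longleftrightarrow>
    (ALL K:circ u z - {A, C}. dots {} K + dots D K + dots (circ u' z - G) K = 1) &
    dots {} (A Un C) + dots D (A Un C) + dots (circ u' z - G) (A Un C) = 1"
    using sc(6) by auto
   also have "dots {} (A Un C) + dots D (A Un C) + dots (circ u' z - G) (A Un C) = 1 \<longleftrightarrow>
    (if A Un C : G then (A : D) ~= (C : D) else A ~: D & C ~: D)"
    unfolding d0 sc(7)[OF D] dG[OF sc(5)] by auto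
   also have "(ALL K:circ u z - {A, C}. dots {} K + dots D K + dots (circ u' z - G) K = 1) \<longleftrightarrow>
    (ALL K:circ u z - {A, C}. (K : D \<longleftrightarrow> K : G))"
   proof (rule ball_cong[OF refl])
    fix K assume K: "K : circ u z - {A, C}"
    hence "K : circ u' z" "K ~= A Un C" using sc(4,6) by auto
    thus "dots {} K + dots D K + dots (circ u' z - G) K = 1 \<longleftrightarrow> (K : D \<longleftrightarrow> K : G)"
     unfolding d0 by (simp add: dG dD)
   qed
   finally show ?thesis .
  qed
  also have "... \<longleftrightarrow> G : ?S" (is "?P & ?Q \<longleftrightarrow> _")
  proof -
   have GK: "K : circ u z - {A, C}" if "K : G" "K ~= A Un C" for K using that G sc(6) by blast
   have DK: "K : circ u z - {A, C}" if "K : D - {A, C}" for K using that D by blast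
   have PG: "K : G \<longleftrightarrow> K : D - {A, C}" if P: ?P and K: "K ~= A Un C" for K
   proof
    assume "K : G"
    hence "K : circ u z - {A, C}" using K by (rule GK)
    with P `K : G` show "K : D - {A, C}" by blast
   next
    assume KD: "K : D - {A, C}"
    hence "K : circ u z - {A, C}" by (rule DK)
    with P KD show "K : G" by blast
   qed
   have ne: "A Un C ~: D" using D sc(4) by blast
   consider "A : D" "C : D" | "(A : D) ~= (C : D)" | "A ~: D" "C ~: D" by blast
   thus ?thesis
   proof cases
    case 1
    thus ?thesis by simp
   next
    case 2
    have "?P & ?Q \<longleftrightarrow> G = insert (A Un C) (D - {A, C})"
    proof
     assume l: "?P & ?Q"
     hence "A Un C : G" using 2 by (auto split: if_splits)
     thus "G = insert (A Un C) (D - {A, C})" using PG[OF conjunct1[OF l]] by (intro Set.set_eqI) (metis insert_iff)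
    next
     assume "G = insert (A Un C) (D - {A, C})"
     thus "?P & ?Q" using 2 sc(4) by auto
    qed
    thus ?thesis using 2 by auto
   next
    case 3
    have "?P & ?Q \<longleftrightarrow> G = D"
    proof
     assume l: "?P & ?Q"
     hence "A Un C ~: G" using 3 by (auto split: if_splits)
     moreover have "D - {A, C} = D" using 3 by blast
     ultimately show "G = D" using PG[OF conjunct1[OF l]] ne by (intro Set.set_eqI) metis
    next
     assume "G = D"
     thus "?P & ?Q" using 3 ne by auto
    qed
    thus ?thesis using 3 by auto
   qed
  qed
  finally show "(ALL K:ccs (u' Un u Un z). dots {} K + dots D K + dots (circ u' z - G) K = 1) \<longleftrightarrow> G : ?S"
   unfolding CC .
 qed simp
 thus ?thesis by (auto split: if_splits)
qed

text \<open>This is the comultiplication. By the count of one dot per sphere, one of the new circles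
  is dotted if the old one is undotted, and both are if it is dotted.\<close>

lemma bas_split: assumes s: "surg col u u' a b c d" and u: "pm u" and z: "pm z" and n: "~ conn (u Un z) a c"
  and D: "D <= circ u' z"
 defines "A \<equiv> cls (u Un z) a" and "C \<equiv> cls (u Un z) c"
 shows "bas u u' {} ** bas u' z D =
  (if A Un C : D then bas u z (D - {A Un C} Un {A, C}) else bas u z (insert A D) + bas u z (insert C D))"
proof -
 have u': "pm u'" by (rule surg_pmatch[OF s u])
 note sc = surg_circles[OF s u z n, folded A_def C_def]
 have CC: "ccs (u Un u' Un z) = circ u' z"
  using surg_genus0(1)[OF s u z n] cls_in_cc_eq[OF pm_Union3[OF u u' z]] surg_in_V[OF s u] by metis
 have AD: "A ~: D" "C ~: D" using D sc(1-6) by auto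
 let ?S = "if A Un C : D then {D - {A Un C} Un {A, C}} else {insert A D, insert C D}"
 have "bas u u' {} ** bas u' z D = (SUM G:?S. bas u z G)"
 proof (rule hmul_genus0[OF u u' z _ D])
  show "genus3 u u' z K = 0" if "K : ccs (u Un u' Un z)" for K using surg_genus0(2)[OF s u z n] that by blast
  show "?S <= Pow (circ u z)" using sc D by auto
  fix G assume G: "G <= circ u z"
  have dG: "dots (circ u z - G) K = (if K : G then 0 else 1)" if "K : circ u z" for K
   using dots_cc[of "circ u z - G" "u Un z" K] that by simp
  have dD: "dots D K = (if K : D then 1 else 0)" if "K : circ u' z" for K using dots_cc[OF D, of K] that by blast
  have d0: "dots {} K = 0" for K :: "'p set" by (simp add: dots_def)
  have sub: "circ u z - G <= circ u z" by blast
  have "(ALL K:circ u' z. dots {} K + dots D K + dots (circ u z - G) K = 1) \<longleftrightarrow>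
    (ALL K:circ u z - {A, C}. dots {} K + dots D K + dots (circ u z - G) K = 1) &
    dots {} (A Un C) + dots D (A Un C) + dots (circ u z - G) (A Un C) = 1"
   using sc(6) by auto
  also have "dots {} (A Un C) + dots D (A Un C) + dots (circ u z - G) (A Un C) = 1 \<longleftrightarrow>
    (if A Un C : D then A : G & C : G else (A : G) ~= (C : G))"
   unfolding d0 sc(7)[OF sub] dD[OF sc(5)] using sc(1,2) by auto
  also have "(ALL K:circ u z - {A, C}. dots {} K + dots D K + dots (circ u z - G) K = 1) \<longleftrightarrow>
    (ALL K:circ u z - {A, C}. (K : D \<longleftrightarrow> K : G))"
  proof (rule ball_cong[OF refl])
   fix K assume K: "K : circ u z - {A, C}"
   hence "K : circ u' z" "K : circ u z" using sc(6) by auto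
   thus "dots {} K + dots D K + dots (circ u z - G) K = 1 \<longleftrightarrow> (K : D \<longleftrightarrow> K : G)"
    unfolding d0 by (simp add: dG dD)
  qed
  also have "((ALL K:circ u z - {A, C}. (K : D \<longleftrightarrow> K : G)) &
    (if A Un C : D then A : G & C : G else (A : G) ~= (C : G))) \<longleftrightarrow> G : ?S" (is "?P & ?Q \<longleftrightarrow> _")
  proof -
   have GK: "K : circ u z - {A, C}" if "K : G - {A, C}" for K using that G by blast
   have DK: "K : circ u z - {A, C}" if "K : D - {A Un C}" for K using that D sc(6) by blast
   have ne: "A Un C ~: G" using G sc(4) by blast
   have PG: "K : G \<longleftrightarrow> K : D - {A Un C}" if P: ?P and K: "K ~= A" "K ~= C" for K
   proof
    assume "K : G"
    hence "K : circ u z - {A, C}" "K ~= A Un C" using K GK[of K] ne by auto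
    with P `K : G` show "K : D - {A Un C}" by blast
   next
    assume KD: "K : D - {A Un C}"
    hence "K : circ u z - {A, C}" by (rule DK)
    with P KD show "K : G" by blast
   qed
   show ?thesis
   proof (cases "A Un C : D")
    case True
    have "?P & ?Q \<longleftrightarrow> G = D - {A Un C} Un {A, C}"
    proof
     assume l: "?P & ?Q"
     hence "A : G" "C : G" using True by auto
     thus "G = D - {A Un C} Un {A, C}"
      using PG[OF conjunct1[OF l]] by (intro Set.set_eqI) (metis UnCI UnE insert_iff singletonD)
    next
     assume "G = D - {A Un C} Un {A, C}"
     thus "?P & ?Q" using True sc(4) by auto
    qed
    thus ?thesis using True by simp
   next
    case False
    hence D': "D - {A Un C} = D" by blast
    have "?P & ?Q \<longleftrightarrow> G = insert A D | G = insert C D"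
    proof
     assume l: "?P & ?Q"
     then consider "A : G" "C ~: G" | "A ~: G" "C : G" using False by auto
     thus "G = insert A D | G = insert C D"
     proof cases
      case 1
      have "G = insert A D"
      proof (rule Set.set_eqI)
       fix K show "K : G \<longleftrightarrow> K : insert A D"
        using PG[OF conjunct1[OF l], of K] 1 AD D' by (cases "K = A | K = C") auto
      qed
      thus ?thesis ..
     next
      case 2
      have "G = insert C D"
      proof (rule Set.set_eqI)
       fix K show "K : G \<longleftrightarrow> K : insert C D"
        using PG[OF conjunct1[OF l], of K] 2 AD D' by (cases "K = A | K = C") auto
      qed
      thus ?thesis ..
     qed
    next
     assume "G = insert A D | G = insert C D"
     thus "?P & ?Q" using False sc(3) AD by auto
    qed
    thus ?thesis using False by simp
   qed
  qed
  finally show "(ALL K:ccs (u Un u' Un z). dots {} K + dots D K + dots (circ u z - G) K = 1) \<longleftrightarrow> G : ?S"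
   unfolding CC .
 qed simp
 moreover have "insert A D ~= insert C D" using AD sc(3) by blast
 ultimately show ?thesis by simp
qed

end

section \<open>Reversal, differentiation by a dot, and one-sided inverses of surgeries\<close>

context marked_points
begin

text \<open>Reflection of the surface. It is an anti-involution and transfers statements between
  left and right multiplication.\<close>

definition hrev :: "('p hgen \<Rightarrow>\<^sub>0 int) => 'p hgen \<Rightarrow>\<^sub>0 int" where
 "hrev = frag_extend (%(x, y, D). bas y x D)"

lemma hrev_simps [simp]:
 "hrev 0 = 0" "hrev (u + v) = hrev u + hrev v" "hrev (u - v) = hrev u - hrev v"
 "hrev (bas x y D) = bas y x D" "hrev (frag_cmul k u) = frag_cmul k (hrev u)"
 by (simp_all add: hrev_def frag_extend_add frag_extend_diff frag_extend_cmul)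

lemma hrev_sum: "hrev (SUM i:I. u i) = (SUM i:I. hrev (u i))"
 by (induction I rule: infinite_finite_induct) simp_all

lemma hrev_hmul: "hrev (u ** v) = hrev v ** hrev u"
proof -
 have gen: "hrev (hmul_gen p q) = hrev (frag_of q) ** hrev (frag_of p)" for p q
 proof -
  obtain x y D y' z E where p: "p = (x, y, D)" and q: "q = (y', z, E)" by (cases p; cases q) auto
  show ?thesis by (auto simp: p q hgens_def circ_commute hrev_sum hmul_of theta_reverse)
 qed
 show ?thesis
 proof (rule frag_additive_eqI[of u UNIV "%u. hrev (u ** v)" "%u. hrev v ** hrev u"])
  fix p :: "'p hgen"
  show "hrev (frag_of p ** v) = hrev v ** hrev (frag_of p)"
   by (rule frag_additive_eqI[of v UNIV "%v. hrev (frag_of p ** v)" "%v. hrev v ** hrev (frag_of p)"])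
    (simp_all add: hmul_simps hmul_of gen)
 qed (simp_all add: hmul_simps)
qed

text \<open>The morphisms from \<open>x\<close> to \<open>y\<close> when the algebra is regarded as
  a category whose objects are matchings.\<close>

definition Fs :: "'p set set => 'p set set => ('p hgen \<Rightarrow>\<^sub>0 int) set" where
 "Fs x y = {v. keys v <= {(x, y, D) | D. D <= circ x y}}"

lemma Fs_bas: "D <= circ x y ==> bas x y D : Fs x y" by (simp add: Fs_def)

lemma Fs_0 [simp]: "0 : Fs x y" by (simp add: Fs_def)

lemma Fs_diff: "u : Fs x y ==> v : Fs x y ==> u - v : Fs x y" unfolding Fs_def using keys_diff[of u v] by blast

lemma Fs_add: "u : Fs x y ==> v : Fs x y ==> u + v : Fs x y" unfolding Fs_def using keys_add[of u v] by blast

lemma Fs_cmul: "u : Fs x y ==> frag_cmul k u : Fs x y" unfolding Fs_def using keys_cmul[of k u] by blast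

lemma Fs_sum: "(!!i. i : I ==> u i : Fs x y) ==> sum u I : Fs x y"
 by (induction I rule: infinite_finite_induct) (simp_all add: Fs_add)

lemma Fs_induct [consumes 1, case_names zero bas diff]:
 assumes "v : Fs x y" "P 0" "!!D. D <= circ x y ==> P (bas x y D)"
  "!!u v. u : Fs x y ==> v : Fs x y ==> P u ==> P v ==> P (u - v)"
 shows "P v"
proof -
 have "v : Fs x y & P v" by (rule frag_induction[of v "{(x, y, D) | D. D <= circ x y}"])
   (use assms Fs_bas Fs_diff in "auto simp: Fs_def")
 thus ?thesis ..
qed

lemma Fs_eqI: assumes "v : Fs x y" "!!u v. f (u - v) = f u - f v" "!!u v. g (u - v) = g u - g v"
  and "!!D. D <= circ x y ==> f (bas x y D) = (g (bas x y D) :: 'b :: ab_group_add)"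
 shows "f v = g v" by (rule frag_additive_eqI[of v "{(x, y, D) | D. D <= circ x y}" f g])
  (use assms in "auto simp: Fs_def")

lemma hmul_gen_Fs: "hmul_gen (x, y, D) (y', z, E) : Fs x z" by (auto intro!: Fs_sum Fs_cmul Fs_bas)

lemma Fs_hmul: assumes "u : Fs x y" "v : Fs y' z" shows "u ** v : Fs x z" using assms(1)
proof (induction u rule: Fs_induct)
 case (bas D)
 show ?case using assms(2)
 proof (induction v rule: Fs_induct)
  case (bas E)
  thus ?case by (simp only: hmul_of hmul_gen_Fs)
 qed (simp_all add: hmul_simps Fs_diff)
qed (simp_all add: hmul_simps Fs_diff)

lemma hrev_Fs: "u : Fs x y ==> hrev u : Fs y x"
proof (induction u rule: Fs_induct)
 case (bas D)
 thus ?case by (simp add: Fs_bas circ_commute[of y x])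
qed (simp_all add: Fs_diff)

lemma hrev_hrev: "hrev (hrev u) = u" by (rule frag_additive_eqI[of u UNIV "%u. hrev (hrev u)" "%u. u"]) auto

lemma unit_left: "pm x ==> pm y ==> v : Fs x y ==> bas x x {} ** v = v"
 by (rule Fs_eqI[of v x y "%v. bas x x {} ** v" "%v. v"]) (simp_all add: hmul_simps bas_unit_left)

text \<open>Differentiation by the \<open>X\<close> of the circle \<open>ka\<close>. Geometrically
  it is the counit followed by the unit: the circle is capped off and a new one is created.\<close>

definition pdiff :: "'p set => ('p hgen \<Rightarrow>\<^sub>0 int) => 'p hgen \<Rightarrow>\<^sub>0 int" where
 "pdiff ka = frag_extend (%(x, y, D). if ka : D then bas x y (D - {ka}) else 0)"

lemma pdiff_simps [simp]:
 "pdiff ka 0 = 0" "pdiff ka (u + v) = pdiff ka u + pdiff ka v" "pdiff ka (u - v) = pdiff ka u - pdiff ka v"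
 "pdiff ka (bas x y D) = (if ka : D then bas x y (D - {ka}) else 0)"
 "pdiff ka (frag_cmul k u) = frag_cmul k (pdiff ka u)"
 by (simp_all add: pdiff_def frag_extend_add frag_extend_diff frag_extend_cmul)

lemma pdiff_sum: "pdiff ka (SUM i:I. u i) = (SUM i:I. pdiff ka (u i))"
 by (induction I rule: infinite_finite_induct) simp_all

lemma pdiff_Fs: "u : Fs x y ==> pdiff ka u : Fs x y"
proof (induction u rule: Fs_induct)
 case (bas D)
 hence "bas x y (D - {ka}) : Fs x y" by (intro Fs_bas) blast
 thus ?case by simp
qed (simp_all add: Fs_diff)

lemma pdiff_hrev: "pdiff ka (hrev u) = hrev (pdiff ka u)"
 by (rule frag_additive_eqI[of u UNIV "%u. pdiff ka (hrev u)" "%u. hrev (pdiff ka u)"]) auto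

lemma cc3_common_arc: assumes "pm x" "pm y" "pm z" "ka : x" "ka : y" "ka : z" shows "ka : ccs (x Un y Un z)"
proof -
 obtain p where p: "p : ka" using pmatch_nonempty[OF assms(1,4)] by blast
 have W: "W <= ka" if "W : x Un y Un z" "W Int ka ~= {}" for W
  using that pmatch_unique[OF assms(1) _ assms(4), of W] pmatch_unique[OF assms(2) _ assms(5), of W]
   pmatch_unique[OF assms(3) _ assms(6), of W] by blast
 have "q : cls (x Un y Un z) p \<longleftrightarrow> q : ka" for q
  using conn_closed[of "x Un y Un z" p q ka] p W conn_step[of ka "x Un y Un z" p q] assms(4) by auto
 hence "cls (x Un y Un z) p = ka" by (intro Set.set_eqI)
 moreover have "p : V" using pmatchD(2)[OF assms(1)] p assms(4) by blast
 ultimately show ?thesis using cls_in_cc_eq[OF pm_Union3[OF assms(1-3)]] by metis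
qed

text \<open>An arc common to all three matchings spans a sphere made of three discs. It splits off
  as a factor, which is 1 if exactly one of these discs is dotted and 0 otherwise.\<close>

lemma theta_common_arc: assumes pm: "pm x" "pm y" "pm z" and ka: "ka : x" "ka : y" "ka : z"
  and D: "A <= circ x y" "B <= circ y z" "C <= circ x z" and A: "ka ~: A"
 shows "theta x y z A B C = (if ka : B \<longleftrightarrow> ka ~: C then
  PROD K:ccs (x Un y Un z) - {ka}. ev (genus3 x y z K) (dots A K + dots (B - {ka}) K + dots (C - {ka}) K) else 0)"
proof -
 let ?CC = "ccs (x Un y Un z)"
 have K: "ka : ?CC" by (rule cc3_common_arc[OF pm ka])
 have kc: "ka : circ x y" "ka : circ y z" "ka : circ x z" using circ_common_arc pm ka by blast+
 have d: "dots A ka = 0" "dots B ka = (if ka : B then 1 else 0)" "dots C ka = (if ka : C then 1 else 0)"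
  using dots_cc[OF D(1) kc(1)] dots_cc[OF D(2) kc(2)] dots_cc[OF D(3) kc(3)] A by simp_all
 obtain u v where uv: "ka = {u, v}" "col u" "~ col v" using pmatch_arcE[OF pm(1) ka(1)] .
 hence "card ka = 2" by (cases "u = v") auto
 hence g: "genus3 x y z ka = 0"
  unfolding genus3_def using faces_one[OF kc(1)] faces_one[OF kc(2)] faces_one[OF kc(3)] by simp
 have other: "dots (B - {ka}) K = dots B K" "dots (C - {ka}) K = dots C K" if "K : ?CC - {ka}" for K
 proof -
  have "~ ka <= K" using that K cc_disjoint[of K "x Un y Un z" ka u] uv by auto
  hence "{c : B - {ka}. c <= K} = {c : B. c <= K}" "{c : C - {ka}. c <= K} = {c : C. c <= K}" by auto
  thus "dots (B - {ka}) K = dots B K" "dots (C - {ka}) K = dots C K" by (simp_all only: dots_def)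
 qed
 have "theta x y z A B C = ev 0 (dots A ka + dots B ka + dots C ka) *
  (PROD K:?CC - {ka}. ev (genus3 x y z K) (dots A K + dots B K + dots C K))"
  unfolding theta_def by (subst prod.remove[OF finite_cc3[OF pm] K]) (simp only: g)
 also have "ev 0 (dots A ka + dots B ka + dots C ka) = (if ka : B \<longleftrightarrow> ka ~: C then 1 else 0)"
  unfolding d ev_0 by simp
 also have "(PROD K:?CC - {ka}. ev (genus3 x y z K) (dots A K + dots B K + dots C K)) =
  (PROD K:?CC - {ka}. ev (genus3 x y z K) (dots A K + dots (B - {ka}) K + dots (C - {ka}) K))"
  by (rule prod.cong[OF refl]) (simp only: other)
 finally show ?thesis by simp
qed

text \<open>The circle \<open>ka\<close> is a tensor factor on which multiplication by the undotted
  element is the identity, so an operator on this factor commutes with the multiplication.\<close>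

lemma pdiff_hmul: assumes pm: "pm x" "pm y" "pm z" and ka: "ka : x" "ka : y" "ka : z" and v: "v : Fs y z"
 shows "bas x y {} ** pdiff ka v = pdiff ka (bas x y {} ** v)"
proof (rule Fs_eqI[OF v, of "%v. bas x y {} ** pdiff ka v" "%v. pdiff ka (bas x y {} ** v)"])
 fix E assume E: "E <= circ y z"
 let ?C = "circ x z" and ?C' = "circ x z - {ka}"
 have kc: "ka : ?C" using circ_common_arc[OF pm(1,3) ka(1,3)] .
 have fin: "finite ?C'" using finite_circ[OF pm(1,3)] by simp
 have C: "?C = insert ka ?C'" using kc by blast
 have splitsum: "(SUM G:Pow ?C. h G) = (SUM G:Pow ?C'. h G) + (SUM G:Pow ?C'. h (insert ka G))"
  for h :: "'p set set => 'p hgen \<Rightarrow>\<^sub>0 int" using sum_Pow_insert[OF fin, of ka h] C by auto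
 let ?T = "%B C. PROD K:ccs (x Un y Un z) - {ka}. ev (genus3 x y z K) (dots {} K + dots B K + dots C K)"
 have th: "theta x y z {} B (?C - G) = (if ka : B \<longleftrightarrow> ka : G then ?T (B - {ka}) (?C - G - {ka}) else 0)"
  if "B <= circ y z" "G <= ?C" for B G using theta_common_arc[OF pm ka, of "{}" B "?C - G"] that kc by auto
 have prod: "bas x y {} ** bas y z B = (if ka : B
   then SUM G:Pow ?C'. frag_cmul (?T (B - {ka}) (?C' - G)) (bas x z (insert ka G))
   else SUM G:Pow ?C'. frag_cmul (?T (B - {ka}) (?C' - G)) (bas x z G))" if B: "B <= circ y z" for B
 proof -
  have "bas x y {} ** bas y z B =
   (SUM G:Pow ?C'. frag_cmul (theta x y z {} B (?C - G)) (bas x z G)) +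
   (SUM G:Pow ?C'. frag_cmul (theta x y z {} B (?C - insert ka G)) (bas x z (insert ka G)))"
   unfolding hmul_bas[OF pm _ B, of "{}", simplified] by (rule splitsum)
  also have "(SUM G:Pow ?C'. frag_cmul (theta x y z {} B (?C - G)) (bas x z G)) =
   (if ka : B then 0 else SUM G:Pow ?C'. frag_cmul (?T (B - {ka}) (?C' - G)) (bas x z G))"
  proof (cases "ka : B")
   case True
   have "frag_cmul (theta x y z {} B (?C - G)) (bas x z G) = 0" if "G : Pow ?C'" for G
    using th[OF B, of G] that True by (subst th[OF B]) auto
   thus ?thesis using True by (simp add: sum.neutral)
  next
   case False
   have "theta x y z {} B (?C - G) = ?T (B - {ka}) (?C' - G)" if "G : Pow ?C'" for G
   proof -
    have "?C - G - {ka} = ?C' - G" by blast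
    thus ?thesis using th[OF B, of G] that False by (subst th[OF B]) auto
   qed
   thus ?thesis using False by simp
  qed
  also have "(SUM G:Pow ?C'. frag_cmul (theta x y z {} B (?C - insert ka G)) (bas x z (insert ka G))) =
   (if ka : B then SUM G:Pow ?C'. frag_cmul (?T (B - {ka}) (?C' - G)) (bas x z (insert ka G)) else 0)"
  proof (cases "ka : B")
   case False
   have "frag_cmul (theta x y z {} B (?C - insert ka G)) (bas x z (insert ka G)) = 0" if "G : Pow ?C'" for G
    using that False kc by (subst th[OF B]) auto
   thus ?thesis using False by (simp add: sum.neutral)
  next
   case True
   have "theta x y z {} B (?C - insert ka G) = ?T (B - {ka}) (?C' - G)" if "G : Pow ?C'" for G
   proof -
    have "?C - insert ka G - {ka} = ?C' - G" by blast
    thus ?thesis using that True kc by (subst th[OF B]) auto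
   qed
   thus ?thesis using True by simp
  qed
  finally show ?thesis by simp
 qed
 show "bas x y {} ** pdiff ka (bas y z E) = pdiff ka (bas x y {} ** bas y z E)"
 proof (cases "ka : E")
  case True
  have ins: "insert ka G - {ka} = G" if "G : Pow ?C'" for G using that by blast
  have E': "E - {ka} <= circ y z" using E by blast
  have "pdiff ka (bas x y {} ** bas y z E) = (SUM G:Pow ?C'. frag_cmul (?T (E - {ka}) (?C' - G)) (bas x z G))"
   using True prod[OF E] ins by (simp add: pdiff_sum)
  thus ?thesis using True prod[OF E'] by simp
 next
  case False
  have "pdiff ka (bas x y {} ** bas y z E) = (SUM G:Pow ?C'. 0)"
   unfolding prod[OF E] if_not_P[OF False] pdiff_sum by (rule sum.cong[OF refl]) auto
  thus ?thesis using False by (simp add: hmul_simps)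
 qed
qed (simp_all add: hmul_simps)

lemma common_arc_not_conn: assumes s: "surg col u u' a b c d" and u: "pm u" and z: "pm z" and ab: "{a, b} : z"
 shows "~ conn (u Un z) a c" "cls (u Un z) a = {a, b}"
proof -
 have "{a, b} : u" using s by (simp add: surg_def)
 hence k: "{a, b} : circ u z" using circ_common_arc[OF u z _ ab] by blast
 thus "cls (u Un z) a = {a, b}" using cc_eq_cls[OF k, of a] by simp
 hence "conn (u Un z) a p \<longleftrightarrow> p : {a, b}" for p using in_cls by metis
 thus "~ conn (u Un z) a c" using surg_distinct[OF s u] by simp
qed

lemma hmul_surg_merge: assumes s: "surg col u u' a b c d" and u: "pm u" and z: "pm z" and ab: "{a, b} : z"
 shows "bas u' u {} ** bas u z {} = bas u' z {}"
 using bas_merge[OF s u z common_arc_not_conn(1)[OF assms], of "{}"] by simp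

text \<open>Splitting off the circle \<open>{a, b}\<close>, capping it off, and merging a new circle
  in again is isotopic to the identity. Algebraically, differentiation selects from the
  comultiplication the terms with a dot on \<open>{a, b}\<close>.\<close>

lemma hmul_surg_section: assumes s: "surg col u u' a b c d" and u: "pm u" and z: "pm z" and ab: "{a, b} : z"
  and v: "v : Fs u' z"
 shows "bas u' u {} ** pdiff {a, b} (bas u u' {} ** v) = v"
proof (rule Fs_eqI[OF v, of "%v. bas u' u {} ** pdiff {a, b} (bas u u' {} ** v)" "%v. v"])
 fix D assume D: "D <= circ u' z"
 define k where "k = {a, b}"
 define q where "q = cls (u Un z) c"
 note n = common_arc_not_conn[OF s u z ab]
 note sc = surg_circles[OF s u z n(1), unfolded n(2), folded q_def k_def]
 note sp = bas_split[OF s u z n(1), unfolded n(2), folded q_def k_def]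
 note mg = bas_merge[OF s u z n(1), unfolded n(2), folded q_def k_def]
 have kD: "k ~: D" "q ~: D" using D sc by auto
 have Dm: "D - {k Un q} <= circ u z" using D sc(6) by auto
 show "bas u' u {} ** pdiff {a, b} (bas u u' {} ** bas u' z D) = bas u' z D"
 proof (cases "k Un q : D")
  case True
  have e1: "D - {k Un q} Un {k, q} - {k} = insert q (D - {k Un q})" using kD sc(3) by auto
  have e2: "insert (k Un q) (insert q (D - {k Un q}) - {k, q}) = D" using kD True by auto
  have "pdiff k (bas u u' {} ** bas u' z D) = bas u z (insert q (D - {k Un q}))"
   unfolding sp[OF D] using True e1 by simp
  moreover have "bas u' u {} ** bas u z (insert q (D - {k Un q})) = bas u' z D"
   using mg[of "insert q (D - {k Un q})"] Dm sc(2,3) kD e2 by simp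
  ultimately show ?thesis by (simp add: k_def)
 next
  case False
  have "D <= circ u z" using Dm False by auto
  moreover have "pdiff k (bas u u' {} ** bas u' z D) = bas u z D" unfolding sp[OF D] using False kD sc(3) by auto
  ultimately show ?thesis using mg[of D] kD by (simp add: k_def)
 qed
qed (simp_all add: hmul_simps)

lemma hmul_surg_section_right: assumes s: "surg col u u' a b c d" and u: "pm u" and z: "pm z" and ab: "{a, b} : z"
  and v: "v : Fs z u'"
 shows "pdiff {a, b} (v ** bas u' u {}) ** bas u u' {} = v"
proof -
 have "hrev (pdiff {a, b} (v ** bas u' u {}) ** bas u u' {}) = hrev v"
  using hmul_surg_section[OF s u z ab hrev_Fs[OF v]] by (simp add: hrev_hmul pdiff_hrev[symmetric])
 thus ?thesis using hrev_hrev by metis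
qed

text \<open>This is \<open>d X + X d = 1\<close> for \<open>d = d/dX\<close> on the integral
  polynomials modulo the square of \<open>X\<close>, or equivalently neck-cutting of the cylinder
  over \<open>ka\<close>.\<close>

lemma pdiff_dot_same: assumes x: "pm x" and z: "pm z" and ka: "ka : x" "ka : z" and v: "v : Fs x z"
 shows "pdiff ka (bas x x {ka} ** v) = v - bas x x {ka} ** pdiff ka v"
proof (rule Fs_eqI[OF v, of "%v. pdiff ka (bas x x {ka} ** v)" "%v. v - bas x x {ka} ** pdiff ka v"])
 fix D assume D: "D <= circ x z"
 have kc: "ka : circ x z" by (rule circ_common_arc[OF x z ka])
 have D': "D - {ka} <= circ x z" using D by blast
 show "pdiff ka (bas x x {ka} ** bas x z D) = bas x z D - bas x x {ka} ** pdiff ka (bas x z D)"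
  using bas_dot[OF x z ka(1) D kc] bas_dot[OF x z ka(1) D' kc] by (auto simp: hmul_simps insert_absorb)
qed (simp_all add: hmul_simps)

lemma pdiff_dot_other:
 assumes x: "pm x" and z: "pm z" and ka: "ka : x" "ka : z" and v: "v : Fs x z" and o: "al : x" "al ~= ka"
 shows "pdiff ka (bas x x {al} ** v) = bas x x {al} ** pdiff ka v"
proof (rule Fs_eqI[OF v, of "%v. pdiff ka (bas x x {al} ** v)" "%v. bas x x {al} ** pdiff ka v"])
 fix D assume D: "D <= circ x z"
 have kc: "ka : circ x z" by (rule circ_common_arc[OF x z ka])
 obtain K where K: "K : circ x z" "al <= K"
  using member_subset_cc[of al "x Un z"] o pmatch_nonempty[OF x o(1)] by blast
 have "K ~= ka" using K o ka pmatch_unique[OF x o(1) ka(1)] pmatch_nonempty[OF x o(1)] by blast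
 have D': "D - {ka} <= circ x z" using D by blast
 have "insert K D - {ka} = insert K (D - {ka})" using `K ~= ka` by blast
 thus "pdiff ka (bas x x {al} ** bas x z D) = bas x x {al} ** pdiff ka (bas x z D)"
  using bas_dot[OF x z o(1) D K] bas_dot[OF x z o(1) D' K] `K ~= ka` by (auto simp: hmul_simps)
qed (simp_all add: hmul_simps)

text \<open>Merging and splitting again is a tube, which neck-cutting turns into the sum of the dots
  on the two circles; on the merged circle the two dots agree. The arc \<open>al\<close> of
  \<open>z\<close> at \<open>c\<close> represents the second circle, so that its dot becomes a left
  multiplication.\<close>

lemma hmul_surg_split: assumes s: "surg col u u' a b c d" and u: "pm u" and z: "pm z" and ab: "{a, b} : z"
 obtains al where "al : z" "al ~= {a, b}"
  "bas z u' {} ** bas u' u {} = (bas z z {{a, b}} + bas z z {al}) ** bas z u {}"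
  "bas z z {{a, b}} ** bas z u' {} = bas z z {al} ** bas z u' {}"
proof -
 define k where "k = {a, b}"
 define q where "q = cls (u Un z) c"
 have u': "pm u'" by (rule surg_pmatch[OF s u])
 note n = common_arc_not_conn[OF s u z ab]
 note sc = surg_circles[OF s u z n(1), unfolded n(2), folded q_def k_def]
 note sp = bas_split[OF s u z n(1), unfolded n(2), folded q_def k_def]
 obtain al where al: "al : z" "c : al" using pmatch_arc_at[OF z surg_in_V(3)[OF s u]] .
 have alq: "al <= q" using al conn_step[of al "u Un z" c] by (auto simp: q_def)
 have ne: "al ~= k" using al(2) surg_distinct[OF s u] by (auto simp: k_def)
 have kz: "k : z" using ab by (simp add: k_def)
 have c1: "k : circ z u" "q : circ z u" "k Un q : circ z u'" using sc(1,2,5) by (simp_all add: circ_commute)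
 have "bas u u' {} ** bas u' z {} = bas u z {k} + bas u z {q}" using sp[of "{}"] by simp
 hence "hrev (bas u u' {} ** bas u' z {}) = hrev (bas u z {k} + bas u z {q})" by simp
 hence "bas z u' {} ** bas u' u {} = bas z u {k} + bas z u {q}" by (simp add: hrev_hmul)
 also have "... = (bas z z {k} + bas z z {al}) ** bas z u {}"
  using bas_dot[OF z u kz _ c1(1) subset_refl, of "{}"] bas_dot[OF z u al(1) _ c1(2) alq, of "{}"]
  by (simp add: hmul_simps)
 finally have 1: "bas z u' {} ** bas u' u {} = (bas z z {k} + bas z z {al}) ** bas z u {}" .
 have "al <= k Un q" using alq by blast
 hence 2: "bas z z {k} ** bas z u' {} = bas z z {al} ** bas z u' {}"
  using bas_dot[OF z u' kz _ c1(3), of "{}"] bas_dot[OF z u' al(1) _ c1(3), of "{}"] by simp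
 show ?thesis using that[OF al(1)] ne 1 2 by (simp add: k_def)
qed

text \<open>Every circle of \<open>x z\<close> contains an arc of \<open>x\<close>, so
  \<open>Fs x z\<close> arises from its undotted element by dots on arcs of \<open>x\<close>. A map
  that commutes with these dots is determined by one value.\<close>

lemma hmul_by_dots: assumes x: "pm x" and z: "pm z" and v: "v : Fs x z" and f: "!!u v. f (u - v) = f u - f v"
  and dots: "!!al D. al : x ==> D <= circ x z ==> f (bas x x {al} ** bas x z D) = bas x x {al} ** f (bas x z D)"
  and one: "f (bas x z {}) = bas x z {} ** y"
 shows "f v = v ** y"
proof (rule Fs_eqI[OF v, of f "%v. v ** y"])
 fix D assume D: "D <= circ x z"
 have "finite D" using D finite_circ[OF x z] finite_subset by blast
 thus "f (bas x z D) = bas x z D ** y" using D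
 proof (induction D rule: finite_induct)
  case empty
  show ?case by (rule one)
 next
  case (insert K D)
  hence K: "K : circ x z" "D <= circ x z" by auto
  obtain p where p: "p : K" using cc_nonempty[OF K(1)] by blast
  hence "p : V" using cc_subset[OF K(1)] pmatch_Union2[OF x z] by blast
  then obtain al where al: "al : x" "p : al" by (rule pmatch_arc_at[OF x])
  have "al <= K" using cc_absorb[OF K(1), of al] al p by blast
  hence "bas x z (insert K D) = bas x x {al} ** bas x z D" using bas_dot[OF x z al(1) K(2,1)] insert.hyps by simp
  thus ?case using dots[OF al(1) K(2)] insert.IH[OF K(2)] by (simp add: hmul_assoc)
 qed
qed (simp_all add: f hmul_simps)

end

section \<open>Crossingless matchings of linearly ordered points\<close>

locale ordered_points = fixes W :: "'p set" and pos :: "'p => nat"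
 assumes finite_W: "finite W" and inj_pos: "inj_on pos W"
begin

text \<open>Being symmetric in \<open>p\<close> and \<open>q\<close>, it expresses planarity for
  unordered arcs: two arcs do not cross iff neither separates the ends of the other.\<close>

definition btw :: "'p => 'p => 'p => bool" where
 "btw p q r \<longleftrightarrow> pos p < pos r & pos r < pos q | pos q < pos r & pos r < pos p"

lemma btw_commute: "btw p q r = btw q p r" by (auto simp: btw_def)

lemma btw_pair: "{p, q} = {u, v} ==> btw p q r = btw u v r"
 using btw_commute[of p q r] by (auto simp: doubleton_eq_iff)

abbreviation cm :: "'p set set => bool" where
 "cm \<equiv> crossingless_on pos W"

lemma pos_eq: "p : W ==> q : W ==> pos p = pos q \<longleftrightarrow> p = q" using inj_pos by (auto dest: inj_onD)

lemma cm_partition: "cm M ==> partition_on W M" by (simp add: crossingless_on_def)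

lemma cm_in_W: "cm M ==> {p, q} : M ==> p : W & q : W" using cm_partition[of M] by (auto simp: partition_on_def)

lemma cm_ne: "cm M ==> {p, q} : M ==> p ~= q" by (auto simp: crossingless_on_def)

lemma cm_arcE: assumes "cm M" "al : M"
 obtains p q where "al = {p, q}" "pos p < pos q" "p : W" "q : W"
proof -
 obtain p q where pq: "al = {p, q}" "p ~= q" using assms by (auto simp: crossingless_on_def card_2_iff)
 hence "p : W" "q : W" using cm_in_W assms by metis+
 hence "pos p ~= pos q" using pq pos_eq by metis
 thus ?thesis using that[of p q] that[of q p] pq `p : W` `q : W` by (metis insert_commute linorder_neqE_nat)
qed

lemma cm_unique: "cm M ==> al : M ==> be : M ==> p : al ==> p : be ==> al = be"
 using partition_onD2[OF cm_partition, of M] by (auto dest: disjointD)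

lemma cm_partner_unique: "cm M ==> {p, q} : M ==> {p, r} : M ==> q = r"
 using cm_unique[of M "{p, q}" "{p, r}" p] cm_ne[of M p q] by (auto simp: doubleton_eq_iff)

lemma cm_partner: assumes "cm M" "p : W"
 obtains q where "{p, q} : M" "q : W" "q ~= p"
proof -
 obtain al where al: "al : M" "p : al" using cm_partition[OF assms(1)] assms(2) by (auto simp: partition_on_def)
 obtain r s where rs: "al = {r, s}" "pos r < pos s" "r : W" "s : W" using cm_arcE[OF assms(1) al(1)] .
 show ?thesis
 proof (cases "p = r")
  case True
  thus ?thesis using that[of s] rs al by auto
 next
  case False
  hence "p = s" using rs al by auto
  thus ?thesis using that[of r] rs al by (auto simp: insert_commute)
 qed
qed

lemma finite_cm: "cm M ==> finite M" using cm_partition finite_W finite_elements by metis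

lemma finite_cms: "finite {M. cm M}"
proof (rule finite_subset)
 show "{M. cm M} <= Pow (Pow W)" using cm_partition by (auto simp: partition_on_def)
qed (simp add: finite_W)

lemma cm_distinct4: assumes "cm M" "{p, q} : M" "{r, s} : M" "{p, q} ~= {r, s}"
 shows "pos p ~= pos q" "pos p ~= pos r" "pos p ~= pos s" "pos q ~= pos r" "pos q ~= pos s" "pos r ~= pos s"
proof -
 have W: "p : W" "q : W" "r : W" "s : W" using cm_in_W assms by metis+
 have "p ~= r" "p ~= s" "q ~= r" "q ~= s" using cm_unique[OF assms(1-3)] assms(4) by auto
 moreover have "p ~= q" "r ~= s" using cm_ne assms by metis+
 ultimately show "pos p ~= pos q" "pos p ~= pos r" "pos p ~= pos s" "pos q ~= pos r" "pos q ~= pos s" "pos r ~= pos s"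
  using W by (simp_all add: pos_eq)
qed

lemma cm_noncrossing: assumes "cm M" "{p, q} : M" "{r, s} : M" "{p, q} ~= {r, s}"
 shows "btw p q r \<longleftrightarrow> btw p q s"
proof -
 have W: "p : W" "q : W" "r : W" "s : W" using cm_in_W assms by metis+
 note d = cm_distinct4[OF assms]
 have nc: "~ ({a, c} : M & {b, d} : M)"
  if "a : W" "b : W" "c : W" "d : W" "pos a < pos b" "pos b < pos c" "pos c < pos d" for a b c d
  using assms(1) that unfolding crossingless_on_def by blast
 have sw: "{q, p} : M" "{s, r} : M" using assms by (simp_all add: insert_commute)
 show ?thesis
 proof (rule ccontr)
  assume "~ ?thesis"
  then consider "btw p q r" "~ btw p q s" | "btw p q s" "~ btw p q r" by blast
  thus False
  proof cases
   case 1
   thus False using d W assms sw nc[of p r q s] nc[of s p r q] nc[of q r p s] nc[of s q r p]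
    unfolding btw_def by (metis linorder_neqE_nat)
  next
   case 2
   thus False using d W assms sw nc[of p s q r] nc[of r p s q] nc[of q s p r] nc[of r q s p]
    unfolding btw_def by (metis linorder_neqE_nat)
  qed
 qed
qed

lemma cmI: assumes "partition_on W M" "!!al. al : M ==> card al = 2"
  and "!!p q r s. {p, q} : M ==> {r, s} : M ==> {p, q} ~= {r, s} ==> btw p q r \<longleftrightarrow> btw p q s"
 shows "cm M" unfolding crossingless_on_def
proof (intro conjI ballI impI notI)
 fix p q r s
 assume o: "pos p < pos q & pos q < pos r & pos r < pos s" and m: "{p, r} : M & {q, s} : M"
 have "{p, r} ~= {q, s}" using o by (auto simp: doubleton_eq_iff)
 thus False using assms(3)[of p r q s] o m by (auto simp: btw_def)
qed (use assms in auto)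

text \<open>Interleaving of two pairs on a line is a symmetric relation.\<close>

lemma btw_swap: assumes "pos p ~= pos r" "pos p ~= pos s" "pos q ~= pos r" "pos q ~= pos s"
 shows "(btw p q r \<longleftrightarrow> btw p q s) \<longleftrightarrow> (btw r s p \<longleftrightarrow> btw r s q)"
 using assms unfolding btw_def by linarith

text \<open>By \<open>old\<close> no other arc separates \<open>u\<close> from \<open>v\<close>.
  Such an arc has \<open>u\<close> and \<open>x\<close> on one side, and likewise \<open>v\<close>
  and \<open>y\<close>, so it does not separate \<open>x\<close> from \<open>y\<close>
  either.\<close>

lemma cm_surgery: assumes M: "cm M" and ux: "{u, x} : M" and vy: "{v, y} : M" and ne: "{u, x} ~= {v, y}"
  and new: "btw u v x \<longleftrightarrow> btw u v y"
  and old: "!!p q. {p, q} : M ==> {p, q} ~= {u, x} ==> {p, q} ~= {v, y} ==> btw u v p \<longleftrightarrow> btw u v q"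
 shows "cm (M - {{u, x}, {v, y}} Un {{u, v}, {x, y}})"
proof (rule cmI)
 let ?N = "M - {{u, x}, {v, y}}"
 note d = cm_distinct4[OF M ux vy ne]
 have W: "u : W" "x : W" "v : W" "y : W" using cm_in_W M ux vy by metis+
 have offs: "al Int {u, x, v, y} = {}" if "al : ?N" for al
  using that cm_unique[OF M, of al "{u, x}"] cm_unique[OF M, of al "{v, y}"] ux vy by auto
 note P = cm_partition[OF M]
 show "partition_on W (?N Un {{u, v}, {x, y}})"
 proof (rule partition_onI)
  have "\<Union>M = \<Union>?N Un {u, x, v, y}" using ux vy by auto
  thus "\<Union>(?N Un {{u, v}, {x, y}}) = W" using P by (auto simp: partition_on_def)
  show "{} ~: ?N Un {{u, v}, {x, y}}" using partition_onD3[OF P] by auto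
  show "disjnt al be" if ab: "al : ?N Un {{u, v}, {x, y}}" "be : ?N Un {{u, v}, {x, y}}" "al ~= be" for al be
  proof -
   consider "al : ?N" "be : ?N" | "al : ?N" "be : {{u, v}, {x, y}}" | "be : ?N" "al : {{u, v}, {x, y}}"
    | "al : {{u, v}, {x, y}}" "be : {{u, v}, {x, y}}" using ab(1,2) unfolding Un_iff by metis
   thus ?thesis
   proof cases
    case 1
    hence "al : M" "be : M" by auto
    thus ?thesis using disjointD[OF partition_onD2[OF P]] ab(3) unfolding disjnt_def by metis
   next
    case 2
    thus ?thesis using offs[OF 2(1)] unfolding disjnt_def by blast
   next
    case 3
    thus ?thesis using offs[OF 3(1)] unfolding disjnt_def by blast
   next
    case 4
    thus ?thesis using ab(3) d by (auto simp: disjnt_def)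
   qed
  qed
 qed
 show "card al = 2" if "al : ?N Un {{u, v}, {x, y}}" for al
 proof (cases "al : M")
  case True
  thus ?thesis using M by (auto simp: crossingless_on_def)
 next
  case False
  hence "al = {u, v} | al = {x, y}" using that by blast
  moreover have "u ~= v" "x ~= y" using d by auto
  ultimately show ?thesis by auto
 qed
 have dp: "pos p ~= pos u & pos p ~= pos x & pos p ~= pos v & pos p ~= pos y" if "al : ?N" "p : al" for al p
 proof -
  have "p : W" using that P by (auto simp: partition_on_def)
  moreover have "p ~= u" "p ~= x" "p ~= v" "p ~= y" using offs[OF that(1)] that(2) by auto
  ultimately show ?thesis using W by (simp add: pos_eq)
 qed
 have uv: "btw u v p \<longleftrightarrow> btw u v q" "btw p q u \<longleftrightarrow> btw p q v" if "{p, q} : ?N" for p q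
 proof -
  show "btw u v p \<longleftrightarrow> btw u v q" using old[of p q] that by blast
  thus "btw p q u \<longleftrightarrow> btw p q v"
   using btw_swap[of p u v q] dp[OF that, of p] dp[OF that, of q] by simp
 qed
 have xy: "btw x y p \<longleftrightarrow> btw x y q" "btw p q x \<longleftrightarrow> btw p q y" if pq: "{p, q} : ?N" for p q
 proof -
  have "btw p q u \<longleftrightarrow> btw p q x" using cm_noncrossing[OF M _ ux, of p q] pq by blast
  moreover have "btw p q v \<longleftrightarrow> btw p q y" using cm_noncrossing[OF M _ vy, of p q] pq by blast
  ultimately show "btw p q x \<longleftrightarrow> btw p q y" using uv(2)[OF pq] by simp
  thus "btw x y p \<longleftrightarrow> btw x y q"
   using btw_swap[of p x y q] dp[OF pq, of p] dp[OF pq, of q] by simp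
 qed
 have nn: "btw x y u \<longleftrightarrow> btw x y v" using btw_swap[of u x y v] d new by auto
 fix p q r s
 assume pq: "{p, q} : ?N Un {{u, v}, {x, y}}" and rs: "{r, s} : ?N Un {{u, v}, {x, y}}" and ne': "{p, q} ~= {r, s}"
 consider "{p, q} : ?N" "{r, s} : ?N" | "{p, q} : ?N" "{r, s} = {u, v} | {r, s} = {x, y}"
  | "{r, s} : ?N" "{p, q} = {u, v} | {p, q} = {x, y}"
  | "{p, q} = {u, v} | {p, q} = {x, y}" "{r, s} = {u, v} | {r, s} = {x, y}"
  using pq rs unfolding Un_iff insert_iff empty_iff by metis
 thus "btw p q r \<longleftrightarrow> btw p q s"
 proof cases
  case 1
  thus ?thesis using cm_noncrossing[OF M _ _ ne'] by blast
 next
  case 2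
  show ?thesis using uv(2)[OF 2(1)] xy(2)[OF 2(1)] 2(2) unfolding doubleton_eq_iff by metis
 next
  case 3
  show ?thesis using uv(1)[OF 3(1)] xy(1)[OF 3(1)] 3(2) btw_commute unfolding doubleton_eq_iff by metis
 next
  case 4
  then consider "{p, q} = {u, v}" "{r, s} = {x, y}" | "{p, q} = {x, y}" "{r, s} = {u, v}" using ne' by auto
  thus ?thesis
  proof cases
   case 1
   thus ?thesis using new btw_pair[OF 1(1)] unfolding doubleton_eq_iff by metis
  next
   case 2
   thus ?thesis using nn btw_pair[OF 2(1)] unfolding doubleton_eq_iff by metis
  qed
 qed
qed

section \<open>Functionals on dotted matchings\<close>

text \<open>
 \<open>E\<close> is the set of undotted arcs.  The subsets in \<open>choices M E\<close> are the monomials of the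
 product of \<open>X\<^sub>p + X\<^sub>q\<close> over the undotted arcs \<open>{p, q}\<close>.
\<close>

definition choices :: "'p set set => 'p set set => 'p set set" where
 "choices M E = {S. S <= W & (ALL al:M. card (S Int al) = (if al : E then 1 else 0))}"

text \<open>The leading monomial: among the sets in \<open>choices\<close> it takes the end of
  smaller position from each undotted arc.\<close>

definition lefts :: "'p set set => 'p set" where
 "lefts E = {p. EX q. {p, q} : E & pos p < pos q}"

text \<open>No dotted arc is nested inside another arc. These are the normal forms under the two
  relations, which allow an inner dot to be moved outwards and a dotted arc inside a dotted one to
  be un-nested.\<close>

definition standard :: "'p set set => 'p set set => bool" where
 "standard M E \<longleftrightarrow> cm M & E <= M &
  (ALL a b c d. pos a < pos b & pos b < pos c & pos c < pos d & {a, d} : M & {b, c} : M --> {b, c} : E)"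

lemma standard_nested: assumes "standard M E" "{a, d} : M" "{b, c} : M" "btw a d b" "btw a d c" shows "{b, c} : E"
proof -
 have M: "cm M" using assms(1) by (simp add: standard_def)
 have "b ~= c" using cm_ne M assms(3) by blast
 hence bc: "pos b ~= pos c" using cm_in_W[OF M assms(3)] pos_eq by blast
 have *: "{b, c} : E" if "pos a < pos b" "pos b < pos c" "pos c < pos d" "{a, d} : M" "{b, c} : M" for a b c d
  using assms(1) that unfolding standard_def by blast
 have sw: "{d, a} : M" "{c, b} : M" using assms by (simp_all add: insert_commute)
 show ?thesis
 proof (cases "pos b < pos c")
  case True
  thus ?thesis using *[of a b c d] *[of d b c a] assms sw by (auto simp: btw_def)
 next
  case False
  hence "pos c < pos b" using bc by simp
  hence "{c, b} : E" using *[of a c b d] *[of d c b a] assms sw by (auto simp: btw_def)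
  thus ?thesis by (simp add: insert_commute)
 qed
qed

text \<open>Suppose that the arcs at \<open>p\<close> end at different points. The end of the
  shorter one is nested in the longer one and so lies there on an undotted arc; not being a left
  end, it is joined to a left end \<open>r\<close> in between. In the other configuration
  \<open>r\<close> starts a shorter undotted arc with a different end, against the induction
  hypothesis.\<close>

lemma lefts_undotted: assumes s1: "standard M1 E1" and s2: "standard M2 E2" and L: "lefts E1 = lefts E2"
  and pq: "{p, q} : E1" "pos p < pos q"
 shows "{p, q} : E2" using assms
proof (induction "pos q - pos p" arbitrary: M1 E1 M2 E2 p q rule: less_induct)
 case less
 note s1 = less.prems(1) and s2 = less.prems(2) and L = less.prems(3) and pq = less.prems(4,5)
 have M1: "cm M1" "E1 <= M1" and M2: "cm M2" "E2 <= M2" using s1 s2 by (auto simp: standard_def)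
 have pqM: "{p, q} : M1" using pq M1 by blast
 have W: "p : W" "q : W" using cm_in_W[OF M1(1) pqM] by blast+
 have "p : lefts E2" using pq L unfolding lefts_def by blast
 then obtain q2 where q2: "{p, q2} : E2" "pos p < pos q2" unfolding lefts_def by blast
 have q2M: "{p, q2} : M2" using q2 M2 by blast
 have q2W: "q2 : W" using cm_in_W[OF M2(1) q2M] by blast
 consider "q = q2" | "pos q < pos q2" | "pos q2 < pos q" using W q2W pos_eq by (metis linorder_neqE_nat)
 thus ?case
 proof cases
  case 1
  thus ?thesis using q2 by simp
 next
  case 2
  have qL: "q ~: lefts E1"
  proof
   assume "q : lefts E1"
   then obtain r where r: "{q, r} : E1" "pos q < pos r" unfolding lefts_def by blast
   have "{q, p} : M1" "{q, r} : M1" using pqM r M1 by (auto simp: insert_commute)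
   hence "p = r" by (rule cm_partner_unique[OF M1(1)])
   thus False using r pq by simp
  qed
  obtain r where r: "{q, r} : M2" "r : W" "r ~= q" using cm_partner[OF M2(1) W(2)] .
  have ne: "{p, q2} ~= {q, r}" using 2 pq by (auto simp: doubleton_eq_iff)
  have bq: "btw p q2 q" using 2 pq by (simp add: btw_def)
  hence br: "btw p q2 r" using cm_noncrossing[OF M2(1) q2M r(1) ne] by simp
  have rE: "{q, r} : E2" by (rule standard_nested[OF s2 q2M r(1) bq br])
  have "pos r < pos q"
  proof (rule ccontr)
   assume "~ pos r < pos q"
   hence "pos q < pos r" using pos_eq[OF W(2) r(2)] r(3) by auto
   hence "q : lefts E2" using rE unfolding lefts_def by blast
   with qL L show False by simp
  qed
  hence "r : lefts E2" using rE unfolding lefts_def by (auto simp: insert_commute)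
  then obtain r1 where r1: "{r, r1} : E1" "pos r < pos r1" using L unfolding lefts_def by blast
  have r1M: "{r, r1} : M1" using r1 M1 by blast
  have pr: "pos p < pos r" using br q2(2) by (auto simp: btw_def)
  have "{p, q} ~= {r, r1}" using pr `pos r < pos q` by (auto simp: doubleton_eq_iff)
  hence "btw p q r1" using cm_noncrossing[OF M1(1) pqM r1M] pr `pos r < pos q` by (simp add: btw_def)
  hence r1q: "pos r1 < pos q" using pq(2) by (auto simp: btw_def)
  have "{r, r1} : E2" by (rule less.hyps[OF _ s1 s2 L r1]) (use pr r1q r1 in linarith)
  hence "{r, r1} : M2" "{r, q} : M2" using M2 r(1) by (auto simp: insert_commute)
  hence "r1 = q" by (rule cm_partner_unique[OF M2(1)])
  thus ?thesis using r1q by simp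
 next
  case 3
  have "{p, q2} : E1" by (rule less.hyps[OF _ s2 s1 L[symmetric] q2]) (use 3 q2 in linarith)
  hence "{p, q2} : M1" using M1 by blast
  hence "q = q2" using cm_partner_unique[OF M1(1) pqM] by blast
  thus ?thesis using 3 by simp
 qed
qed

text \<open>Dotted arcs are not nested in anything, so the points off the undotted arcs are paired
  consecutively from left to right. Hence an induction on the left end.\<close>

lemma standard_dotted: assumes s1: "standard M1 E" and s2: "standard M2 E"
  and pq: "{p, q} : M1" "{p, q} ~: E" "pos p < pos q"
 shows "{p, q} : M2" using assms
proof (induction "pos p" arbitrary: M1 M2 p q rule: less_induct)
 case less
 note s1 = less.prems(1) and s2 = less.prems(2) and pq = less.prems(3-5)
 have M1: "cm M1" "E <= M1" and M2: "cm M2" "E <= M2" using s1 s2 by (auto simp: standard_def)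
 have W: "p : W" "q : W" using cm_in_W[OF M1(1) pq(1)] by blast+
 have out: "{r, s} ~: E" if "r : {p, q}" for r s
 proof
  assume "{r, s} : E"
  hence "{r, s} : M1" using M1 by blast
  hence "{r, s} = {p, q}" using cm_unique[OF M1(1) _ pq(1), of "{r, s}" r] that by blast
  with `{r, s} : E` pq(2) show False by simp
 qed
 obtain q2 where q2: "{p, q2} : M2" "q2 : W" "q2 ~= p" using cm_partner[OF M2(1) W(1)] .
 have q2E: "{p, q2} ~: E" using out by blast
 have "pos p < pos q2"
 proof (rule ccontr)
  assume "~ pos p < pos q2"
  hence lt: "pos q2 < pos p" using pos_eq[OF W(1) q2(2)] q2(3) by auto
  have "{q2, p} : M1" by (rule less.hyps[OF lt s2 s1 _ _ lt]) (use q2 q2E in "simp_all add: insert_commute")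
  hence "{p, q2} : M1" by (simp add: insert_commute)
  hence "q2 = q" using cm_partner_unique[OF M1(1) pq(1)] by blast
  with lt pq show False by simp
 qed
 consider "q = q2" | "pos q < pos q2" | "pos q2 < pos q" using W q2 pos_eq by (metis linorder_neqE_nat)
 thus ?case
 proof cases
  case 1
  thus ?thesis using q2 by simp
 next
  case 2
  obtain r where r: "{q, r} : M2" "r : W" "r ~= q" using cm_partner[OF M2(1) W(2)] .
  have ne: "{p, q2} ~= {q, r}" using 2 pq by (auto simp: doubleton_eq_iff)
  have bq: "btw p q2 q" using 2 pq by (simp add: btw_def)
  hence br: "btw p q2 r" using cm_noncrossing[OF M2(1) q2(1) r(1) ne] by simp
  have "{q, r} : E" by (rule standard_nested[OF s2 q2(1) r(1) bq br])
  thus ?thesis using out[of q r] by simp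
 next
  case 3
  obtain r where r: "{q2, r} : M1" "r : W" "r ~= q2" using cm_partner[OF M1(1) q2(2)] .
  have ne: "{p, q} ~= {q2, r}" using 3 `pos p < pos q2` by (auto simp: doubleton_eq_iff)
  have bq: "btw p q q2" using 3 `pos p < pos q2` by (simp add: btw_def)
  hence br: "btw p q r" using cm_noncrossing[OF M1(1) pq(1) r(1) ne] by simp
  have "{q2, r} : E" by (rule standard_nested[OF s1 pq(1) r(1) bq br])
  hence "{q2, r} : M2" using M2 by blast
  moreover have "{q2, p} : M2" using q2 by (simp add: insert_commute)
  ultimately have "r = p" by (rule cm_partner_unique[OF M2(1)])
  thus ?thesis using br by (simp add: btw_def)
 qed
qed

lemma lefts_inj: assumes s1: "standard M1 E1" and s2: "standard M2 E2" and L: "lefts E1 = lefts E2"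
 shows "M1 = M2 & E1 = E2"
proof -
 have sub: "E <= E'" if s: "standard M E" "standard M' E'" "lefts E = lefts E'" for M E M' E'
 proof
  fix al assume al: "al : E"
  hence "cm M" "al : M" using s by (auto simp: standard_def)
  then obtain p q where "al = {p, q}" "pos p < pos q" by (rule cm_arcE)
  thus "al : E'" using lefts_undotted[OF s] al by blast
 qed
 have E: "E1 = E2" using sub[OF s1 s2 L] sub[OF s2 s1] L by blast
 have subM: "M <= M'" if s: "standard M E1" "standard M' E1" for M M'
 proof
  fix al assume al: "al : M"
  show "al : M'"
  proof (cases "al : E1")
   case True
   thus ?thesis using s by (auto simp: standard_def)
  next
   case False
   have "cm M" using s by (simp add: standard_def)
   then obtain p q where "al = {p, q}" "pos p < pos q" using al by (rule cm_arcE)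
   thus ?thesis using standard_dotted[OF s] al False by blast
  qed
 qed
 show ?thesis using E subM[of M1 M2] subM[of M2 M1] s1 s2 by blast
qed

lemma lefts_arc: assumes "cm M" "E <= M" "{p, q} : M" "pos p < pos q"
 shows "lefts E Int {p, q} = (if {p, q} : E then {p} else {})"
proof -
 have "q ~: lefts E"
 proof
  assume "q : lefts E"
  then obtain r where r: "{q, r} : E" "pos q < pos r" unfolding lefts_def by blast
  hence "{q, r} : M" "{q, p} : M" using assms by (auto simp: insert_commute)
  hence "r = p" by (rule cm_partner_unique[OF assms(1)])
  with r assms show False by simp
 qed
 moreover have "p : lefts E \<longleftrightarrow> {p, q} : E"
 proof
  assume "p : lefts E"
  then obtain r where r: "{p, r} : E" "pos p < pos r" unfolding lefts_def by blast
  hence "r = q" using cm_partner_unique[OF assms(1,3), of r] assms(2) by blast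
  with r show "{p, q} : E" by simp
 qed (use assms(4) in "auto simp: lefts_def")
 ultimately show ?thesis by auto
qed

lemma lefts_choices: assumes "cm M" "E <= M" shows "lefts E : choices M E" unfolding choices_def
proof (intro CollectI conjI ballI)
 show "lefts E <= W" unfolding lefts_def using cm_in_W[OF assms(1)] assms(2) by blast
 fix al assume al: "al : M"
 obtain p q where pq: "al = {p, q}" "pos p < pos q" using cm_arcE[OF assms(1) al] by metis
 thus "card (lefts E Int al) = (if al : E then 1 else 0)" using lefts_arc[OF assms, of p q] al by simp
qed

lemma weight_arcs: assumes "cm M" "S <= W" shows "sum pos S = (SUM al:M. sum pos (S Int al))"
proof -
 have "S = (UN al:M. S Int al)" using assms cm_partition[OF assms(1)] by (auto simp: partition_on_def)
 hence "sum pos S = sum pos (UN al:M. S Int al)" by (rule arg_cong)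
 also have "... = (SUM al:M. sum pos (S Int al))"
 proof (rule sum.UNION_disjoint[OF finite_cm[OF assms(1)]])
  show "ALL al:M. finite (S Int al)" using assms(2) finite_W finite_subset by blast
  show "ALL al:M. ALL be:M. al ~= be --> S Int al Int (S Int be) = {}"
   using partition_onD2[OF cm_partition[OF assms(1)]] by (auto simp: disjoint_def)
 qed
 finally show ?thesis .
qed

text \<open>An admissible set contains one end of each undotted arc and no end of a dotted one;
  replacing a left end by the right end increases the sum of positions.\<close>

lemma lefts_minimal: assumes "cm M" "E <= M" "S : choices M E" "S ~= lefts E" shows "sum pos (lefts E) < sum pos S"
proof -
 have L: "lefts E <= W" using lefts_choices[OF assms(1,2)] by (simp add: choices_def)
 have S: "S <= W" using assms(3) by (simp add: choices_def)
 have arc: "sum pos (lefts E Int al) <= sum pos (S Int al) &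
   (sum pos (lefts E Int al) = sum pos (S Int al) --> lefts E Int al = S Int al)" if al: "al : M" for al
 proof -
  obtain p q where pq: "al = {p, q}" "pos p < pos q" using cm_arcE[OF assms(1) al] by metis
  have l: "lefts E Int al = (if al : E then {p} else {})" using lefts_arc[OF assms(1,2), of p q] al pq by simp
  have c: "card (S Int al) = (if al : E then 1 else 0)" using assms(3) al by (simp add: choices_def)
  have fin: "finite (S Int al)" using pq by simp
  show ?thesis
  proof (cases "al : E")
   case True
   then obtain r where "S Int al = {r}" using c card_1_singletonE by (metis)
   moreover hence "r = p | r = q" using pq by auto
   ultimately show ?thesis using l True pq by auto
  next
   case False
   hence "S Int al = {}" using c fin by simp
   thus ?thesis using l False by simp
  qed
 qed
 have "EX al:M. lefts E Int al ~= S Int al"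
 proof (rule ccontr)
  assume "~ ?thesis"
  hence eq: "lefts E Int al = S Int al" if "al : M" for al using that by blast
  have "r : lefts E \<longleftrightarrow> r : S" if r: "r : W" for r
  proof -
   obtain q where "{r, q} : M" using cm_partner[OF assms(1) r] by metis
   thus ?thesis using eq[of "{r, q}"] by blast
  qed
  thus False using L S assms(4) by blast
 qed
 then obtain al where "al : M" "sum pos (lefts E Int al) < sum pos (S Int al)" using arc by fastforce
 thus ?thesis unfolding weight_arcs[OF assms(1) L] weight_arcs[OF assms(1) S]
  using arc by (intro sum_strict_mono_ex1[OF finite_cm[OF assms(1)]]) auto
qed

end

text \<open>Leading coefficients are 1, so the solution is integral. The equation whose leading term
  has least weight is solved last: by minimality its leading unknown occurs in no other
  equation.\<close>

lemma triangular_solve: fixes val :: "'i => int" and w :: "'s => nat" assumes "finite I" "inj_on \<sigma> I"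
  and "!!i. i : I ==> finite (C i)" "!!i. i : I ==> \<sigma> i : C i"
  and "!!i s. i : I ==> s : C i ==> s ~= \<sigma> i ==> w (\<sigma> i) < w s"
 shows "EX p. ALL i:I. sum p (C i) = val i" using assms
proof (induction "card I" arbitrary: I)
 case 0
 thus ?case by simp
next
 case (Suc n)
 hence "I ~= {}" by auto
 then obtain i where i: "i : I" "!!j. j : I ==> w (\<sigma> i) <= w (\<sigma> j)"
  using ex_has_least_nat[of "%i. i : I" _ "%i. w (\<sigma> i)"] by (metis ex_in_conv)
 have "EX p. ALL j:I - {i}. sum p (C j) = val j"
 proof (rule Suc.hyps(1))
  show "n = card (I - {i})" using Suc.hyps(2) i Suc.prems(1) by simp
  show "inj_on \<sigma> (I - {i})" using Suc.prems(2) by (rule inj_on_subset) blast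
 qed (use Suc.prems in auto)
 then obtain p where p: "ALL j:I - {i}. sum p (C j) = val j" by blast
 define p' where "p' = p(\<sigma> i := val i - sum p (C i - {\<sigma> i}))"
 have "sum p' (C i) = p' (\<sigma> i) + sum p' (C i - {\<sigma> i})"
  using Suc.prems(3,4) i by (intro sum.remove) auto
 also have "sum p' (C i - {\<sigma> i}) = sum p (C i - {\<sigma> i})" by (rule sum.cong) (auto simp: p'_def)
 finally have "sum p' (C i) = val i" by (simp add: p'_def)
 moreover have "sum p' (C j) = val j" if j: "j : I - {i}" for j
 proof -
  have "\<sigma> i ~: C j"
  proof
   assume "\<sigma> i : C j"
   moreover have "\<sigma> i ~= \<sigma> j" using Suc.prems(2) i j by (auto dest: inj_onD)
   ultimately have "w (\<sigma> j) < w (\<sigma> i)" using Suc.prems(5)[of j "\<sigma> i"] j by blast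
   thus False using i(2)[of j] j by simp
  qed
  hence "sum p' (C j) = sum p (C j)" by (intro sum.cong) (auto simp: p'_def)
  thus ?thesis using p j by simp
 qed
 ultimately show ?case by blast
qed

context ordered_points
begin

definition arc_len :: "'p set => nat" where
 "arc_len al = Max (pos ` al) - Min (pos ` al)"

lemma arc_len_pair: "pos p < pos q ==> arc_len {p, q} = pos q - pos p" by (simp add: arc_len_def)

text \<open>Sums over \<open>choices\<close> satisfy both relations as well. On standard pairs the
  system is triangular with distinct leading terms and can be solved; the relations then propagate
  the equality to all other pairs. Throughout, \<open>E\<close> is the set of undotted arcs, so
  \<open>both\<close> is type II and \<open>one\<close> is type I.\<close>

theorem dotted_functional: fixes val :: "'p set set => 'p set set => int"
 assumes both: "!!N a b c d E. pos a < pos b ==> pos b < pos c ==> pos c < pos d ==> E <= N ==>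
   {a, b} ~: N ==> {c, d} ~: N ==> {a, d} ~: N ==> {b, c} ~: N ==>
   cm (N Un {{a, b}, {c, d}}) ==> cm (N Un {{a, d}, {b, c}}) ==>
   val (N Un {{a, b}, {c, d}}) E = val (N Un {{a, d}, {b, c}}) E"
  and one: "!!N a b c d E. pos a < pos b ==> pos b < pos c ==> pos c < pos d ==> E <= N ==>
   {a, b} ~: N ==> {c, d} ~: N ==> {a, d} ~: N ==> {b, c} ~: N ==>
   cm (N Un {{a, b}, {c, d}}) ==> cm (N Un {{a, d}, {b, c}}) ==>
   val (N Un {{a, b}, {c, d}}) (insert {a, b} E) + val (N Un {{a, b}, {c, d}}) (insert {c, d} E) =
   val (N Un {{a, d}, {b, c}}) (insert {a, d} E) + val (N Un {{a, d}, {b, c}}) (insert {b, c} E)"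
 shows "EX p. ALL M E. cm M --> E <= M --> val M E = sum p (choices M E)"
proof -
 let ?I = "{(M, E). standard M E}"
 have fch: "finite (choices M E)" for M E by (rule finite_subset[of _ "Pow W"]) (auto simp: choices_def finite_W)
 have "EX p. ALL i:?I. sum p (case_prod choices i) = case_prod val i"
 proof (rule triangular_solve)
  have "?I <= {M. cm M} \<times> Pow (Pow W)" using cm_partition by (auto simp: standard_def partition_on_def)
  thus "finite ?I" using finite_cms finite_W by (meson finite_Pow_iff finite_SigmaI finite_subset)
  show "inj_on (%(M, E). lefts E) ?I" using lefts_inj by (auto simp: inj_on_def)
  show "finite (case_prod choices i)" for i by (cases i) (simp add: fch)
  show "(case i of (M, E) => lefts E) : case_prod choices i" if "i : ?I" for i
   using that lefts_choices by (auto simp: standard_def)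
  show "sum pos (case i of (M, E) => lefts E) < sum pos s"
   if "i : ?I" "s : case_prod choices i" "s ~= (case i of (M, E) => lefts E)" for i s
   using that lefts_minimal by (auto simp: standard_def)
 qed
 then obtain p where p0: "ALL i:?I. sum p (case_prod choices i) = case_prod val i" by blast
 have p: "val M E = sum p (choices M E)" if "standard M E" for M E using bspec[OF p0, of "(M, E)"] that by simp
 define ch where "ch M E = sum p (choices M E)" for M E
 have ch_both: "ch (N Un {{a, b}, {c, d}}) E = ch (N Un {{a, d}, {b, c}}) E"
  if "E <= N" "{a, b} ~: N" "{c, d} ~: N" "{a, d} ~: N" "{b, c} ~: N" for N a b c d E
 proof -
  have nE: "{a, b} ~: E" "{c, d} ~: E" "{a, d} ~: E" "{b, c} ~: E" using that by auto
  have "choices (N Un {{a, b}, {c, d}}) E = choices (N Un {{a, d}, {b, c}}) E" using choices_def nE by auto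
  thus ?thesis by (simp add: ch_def)
 qed
 have ch_one: "ch (N Un {{a, b}, {c, d}}) (insert {a, b} E) + ch (N Un {{a, b}, {c, d}}) (insert {c, d} E) =
   ch (N Un {{a, d}, {b, c}}) (insert {a, d} E) + ch (N Un {{a, d}, {b, c}}) (insert {b, c} E)"
  if "E <= N" "{a, b} ~: N" "{c, d} ~: N" "{a, d} ~: N" "{b, c} ~: N"
   and dist: "pos a < pos b" "pos b < pos c" "pos c < pos d" for N a b c d E
 proof -
  define B where "B = {S. S <= W & (ALL al:N. card (S Int al) = (if al : E then 1 else 0))}"
  have d4: "a ~= b" "a ~= c" "a ~= d" "b ~= c" "b ~= d" "c ~= d" using dist by auto
  have one: "card (S Int {u, v}) = (if u : S then 1 else 0) + (if v : S then 1 else 0)" if "u ~= v" for S :: "'p set" and u v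
   using that by auto
  have pair: "choices (N Un {{u, v}, {x, y}}) (insert {u, v} E) = {S : B. (u : S) ~= (v : S) & x ~: S & y ~: S}"
   if "u ~= v" "x ~= y" "{u, v} ~: N" "{x, y} ~: N" "{u, v} ~= {x, y}" for u v x y
  proof (rule Set.set_eqI)
   fix S
   have "S : choices (N Un {{u, v}, {x, y}}) (insert {u, v} E) \<longleftrightarrow>
    S <= W & (ALL al:N. card (S Int al) = (if al : insert {u, v} E then 1 else 0)) &
    card (S Int {u, v}) = 1 & card (S Int {x, y}) = 0"
    unfolding choices_def using that `E <= N` by auto
   also have "(ALL al:N. card (S Int al) = (if al : insert {u, v} E then 1 else 0)) \<longleftrightarrow>
    (ALL al:N. card (S Int al) = (if al : E then 1 else 0))"
    using that by (intro ball_cong) auto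
   finally show "S : choices (N Un {{u, v}, {x, y}}) (insert {u, v} E) \<longleftrightarrow> S : {S : B. (u : S) ~= (v : S) & x ~: S & y ~: S}"
    unfolding B_def one[OF that(1)] one[OF that(2)] by auto
  qed
  have fB: "finite B" by (rule finite_subset[of _ "Pow W"]) (auto simp: B_def finite_W)
  define T where "T = {S : B. (a : S & b ~: S & c ~: S & d ~: S) | (a ~: S & b : S & c ~: S & d ~: S) |
   (a ~: S & b ~: S & c : S & d ~: S) | (a ~: S & b ~: S & c ~: S & d : S)}"
  have disj: "sum p {S : B. P S} + sum p {S : B. Q S} = sum p T"
   if "!!S. P S ==> ~ Q S" "T = {S : B. P S | Q S}" for P Q
  proof -
   have "T = {S : B. P S} Un {S : B. Q S}" using that(2) by auto
   thus ?thesis using that(1) fB by (simp add: sum.union_disjoint disjoint_iff)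
  qed
  have ne4: "{a, b} ~= {c, d}" "{a, d} ~= {b, c}" using d4 by (auto simp: doubleton_eq_iff)
  have "ch (N Un {{a, b}, {c, d}}) (insert {a, b} E) + ch (N Un {{a, b}, {c, d}}) (insert {c, d} E) = sum p T"
   unfolding ch_def pair[OF d4(1) d4(6) that(2,3) ne4(1)]
    pair[OF d4(6) d4(1) that(3,2) ne4(1)[symmetric], folded insert_commute[of "{a, b}" "{c, d}"]]
   by (rule disj) (auto simp: T_def)
  moreover have "ch (N Un {{a, d}, {b, c}}) (insert {a, d} E) + ch (N Un {{a, d}, {b, c}}) (insert {b, c} E) = sum p T"
   unfolding ch_def pair[OF d4(3) d4(4) that(4,5) ne4(2)]
    pair[OF d4(4) d4(3) that(5,4) ne4(2)[symmetric], folded insert_commute[of "{a, d}" "{b, c}"]]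
   by (rule disj) (auto simp: T_def)
  ultimately show ?thesis by simp
 qed
 have "val M E = ch M E" if "cm M" "E <= M" for M E using that
 \<comment> \<open>Un-nesting two arcs shortens \<open>M\<close>. In the type I relation there is
   also a term with the same matching, in which the inner arc is undotted in place of the outer one;
   it is smaller by the length of \<open>E\<close>.\<close>
 proof (induction "(sum arc_len M, sum arc_len E)" arbitrary: M E rule: wf_induct[OF wf_lex_prod[OF wf_less_than wf_less_than]])
  case (1 M E)
  note M = 1(2) and E = 1(3)
  have IH: "val M' E' = ch M' E'"
   if "sum arc_len M' < sum arc_len M | sum arc_len M' = sum arc_len M & sum arc_len E' < sum arc_len E"
    "cm M'" "E' <= M'" for M' E'
   using 1(1) that by (auto simp: less_than_iff)
  have fM: "finite M" by (rule finite_cm[OF M])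
  show ?case
  proof (cases "standard M E")
   case True
   thus ?thesis using p by (simp add: ch_def)
  next
   case False
   \<comment> \<open>Of all arcs around a dotted arc a shortest one is taken. Then no arc passes
     between it and \<open>{b, c}\<close>, since it would also enclose \<open>{b, c}\<close> and be
     shorter; so the un-nesting surgery stays crossingless.\<close>
   let ?P = "%n. EX a b c d. pos a < pos b & pos b < pos c & pos c < pos d & {a, d} : M & {b, c} : M & {b, c} ~: E & pos d - pos a = n"
   have "EX n. ?P n" using False M E unfolding standard_def by blast
   hence "?P (LEAST n. ?P n)" by (rule LeastI_ex)
   then obtain a b c d where abcd: "pos a < pos b" "pos b < pos c" "pos c < pos d"
    and ad: "{a, d} : M" and bc: "{b, c} : M" "{b, c} ~: E" and least: "pos d - pos a = (LEAST n. ?P n)" by blast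
   have min: "pos d - pos a <= pos d' - pos a'" if "pos a' < pos b" "pos c < pos d'" "{a', d'} : M" for a' d'
   proof -
    have "?P (pos d' - pos a')" using that abcd bc by blast
    thus ?thesis unfolding least by (rule Least_le)
   qed
   define N where "N = M - {{a, d}, {b, c}}"
   have ne: "{a, d} ~= {b, c}" using abcd by (auto simp: doubleton_eq_iff)
   have MN: "M = N Un {{a, d}, {b, c}}" unfolding N_def using ad bc by blast
   have adne: "{a, d} ~: N" "{b, c} ~: N" unfolding N_def by auto
   have abne: "{a, b} ~: N" "{c, d} ~: N"
   proof -
    have "{a, b} ~= {a, d}" "{c, d} ~= {a, d}" using abcd by (auto simp: doubleton_eq_iff)
    hence "{a, b} ~: M" "{c, d} ~: M"
     using cm_unique[OF M _ ad, of "{a, b}" a] cm_unique[OF M _ ad, of "{c, d}" d] by auto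
    thus "{a, b} ~: N" "{c, d} ~: N" by (auto simp: N_def)
   qed
   have M': "cm (N Un {{a, b}, {c, d}})"
   proof -
    have "cm (M - {{a, d}, {b, c}} Un {{a, b}, {d, c}})"
    proof (rule cm_surgery[OF M ad bc(1) ne])
     show "btw a b d \<longleftrightarrow> btw a b c" using abcd by (auto simp: btw_def)
     have half: "btw a b s" if rs: "{r, s} : M" "{r, s} ~= {a, d}" "{r, s} ~= {b, c}" and r: "btw a b r" for r s
     proof (rule ccontr)
      assume s: "~ btw a b s"
      have rp: "pos a < pos r" "pos r < pos b" using r abcd by (auto simp: btw_def)
      have "btw a d r" using rp abcd by (simp add: btw_def)
      hence "btw a d s" using cm_noncrossing[OF M ad rs(1)] rs(2) by auto
      moreover have "~ btw b c r" using rp abcd by (simp add: btw_def)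
      hence "~ btw b c s" using cm_noncrossing[OF M bc(1) rs(1)] rs(3) by auto
      moreover have "pos s ~= pos b" "pos s ~= pos c" using cm_distinct4[OF M bc(1) rs(1)] rs(3) by auto
      ultimately have sp: "pos c < pos s" "pos s < pos d" using s abcd by (auto simp: btw_def)
      have "pos d - pos a <= pos s - pos r" by (rule min[OF rp(2) sp(1) rs(1)])
      thus False using sp rp abcd by linarith
     qed
     show "btw a b r \<longleftrightarrow> btw a b s" if "{r, s} : M" "{r, s} ~= {a, d}" "{r, s} ~= {b, c}" for r s
      using half[of r s] half[of s r] that by (auto simp: insert_commute)
    qed
    thus ?thesis by (simp add: N_def insert_commute)
   qed
   have len: "arc_len {a, d} = pos d - pos a" "arc_len {b, c} = pos c - pos b"
    "arc_len {a, b} = pos b - pos a" "arc_len {c, d} = pos d - pos c"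
    using abcd by (simp_all add: arc_len_pair)
   have fN: "finite N" using fM by (simp add: N_def)
   have nab: "{a, b} ~= {c, d}" using abcd by (auto simp: doubleton_eq_iff)
   have lM: "sum arc_len M = sum arc_len N + (pos d - pos a) + (pos c - pos b)"
    unfolding MN using fN adne ne len by simp
   have lM': "sum arc_len (N Un {{a, b}, {c, d}}) = sum arc_len N + (pos b - pos a) + (pos d - pos c)"
    using fN abne nab len by simp
   have lt: "sum arc_len (N Un {{a, b}, {c, d}}) < sum arc_len M" unfolding lM lM' using abcd by linarith
   show ?thesis
   proof (cases "{a, d} : E")
    case False
    hence EN: "E <= N" using E bc MN by blast
    have "val M E = val (N Un {{a, b}, {c, d}}) E" using both[OF abcd EN abne adne M'] M MN by simp
    also have "... = ch (N Un {{a, b}, {c, d}}) E" by (rule IH[OF _ M']) (use lt EN in auto)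
    also have "... = ch M E" using ch_both[OF EN abne adne] MN by simp
    finally show ?thesis .
   next
    case True
    define E0 where "E0 = E - {{a, d}}"
    have E0: "E0 <= N" "E = insert {a, d} E0" unfolding E0_def using E bc MN True by auto
    have fE: "finite E0" using E0 fN finite_subset by blast
    have nE0: "{a, d} ~: E0" "{b, c} ~: E0" using E0 adne by auto
    have lE: "sum arc_len (insert {b, c} E0) < sum arc_len E" unfolding E0(2) using fE nE0 len abcd by simp
    have v: "val M E = val (N Un {{a, b}, {c, d}}) (insert {a, b} E0) + val (N Un {{a, b}, {c, d}}) (insert {c, d} E0)
      - val M (insert {b, c} E0)"
     using one[OF abcd E0(1) abne adne M'] M MN E0(2) by simp
    have c: "ch M E = ch (N Un {{a, b}, {c, d}}) (insert {a, b} E0) + ch (N Un {{a, b}, {c, d}}) (insert {c, d} E0)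
      - ch M (insert {b, c} E0)"
     using ch_one[OF E0(1) abne adne abcd] MN E0(2) by simp
    have "val (N Un {{a, b}, {c, d}}) (insert {a, b} E0) = ch (N Un {{a, b}, {c, d}}) (insert {a, b} E0)"
     by (rule IH[OF _ M']) (use lt E0 in auto)
    moreover have "val (N Un {{a, b}, {c, d}}) (insert {c, d} E0) = ch (N Un {{a, b}, {c, d}}) (insert {c, d} E0)"
     by (rule IH[OF _ M']) (use lt E0 in auto)
    moreover have "val M (insert {b, c} E0) = ch M (insert {b, c} E0)"
     by (rule IH[OF _ M]) (use lE E0 bc MN in auto)
    ultimately show ?thesis unfolding v c by simp
   qed
  qed
 qed
 thus ?thesis by (auto simp: ch_def)
qed

end

section \<open>The double centralizer property\<close>

lemma even_card_pairs: assumes "finite B" "partition_on B M" "!!al. al : M ==> card al = 2" shows "even (card B)"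
proof -
 have "card B = (SUM al:M. card al)"
  using assms card_Union_disjoint[of M] partition_onD1[OF assms(2)] partition_onD2[OF assms(2)]
  by (metis disjoint_def finite_UnionD pairwise_def disjnt_def card.infinite zero_neq_numeral)
 also have "... = 2 * card M" using assms(3) by simp
 finally show ?thesis by simp
qed

text \<open>The top points come first along the boundary. Positions fill \<open>1..N\<close> without
  gaps, so that their parity can serve as the colouring.\<close>

locale planar_points = fixes V :: "'p set" and pos :: "'p => nat" and top :: "'p => bool" and N :: nat
 assumes finV: "finite V" and injpos: "inj_on pos V" and posV: "pos ` V = {1..N}"
  and sides: "!!p q. p : V ==> q : V ==> top p ==> ~ top q ==> pos p < pos q"
begin

sublocale ordered_points V pos by unfold_locales (fact finV injpos)+

sublocale marked_points V "%p. even (pos p)" by unfold_locales (fact finV)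

notation hmul (infixl "**" 70)

abbreviation sg :: "'p set set => 'p set set => 'p => 'p => 'p => 'p => bool" where
 "sg \<equiv> surg (%p. even (pos p))"

text \<open>The points enclosed by an arc are matched among themselves, so their number is
  even.\<close>

lemma cm_parity: assumes M: "cm M" and pq: "{p, q} : M" shows "even (pos p) ~= even (pos q)"
proof -
 have *: "odd (pos q - pos p)" if pq: "{p, q} : M" and lt: "pos p < pos q" for p q
 proof -
  let ?B = "{r : V. pos p < pos r & pos r < pos q}"
  have W: "p : V" "q : V" using cm_in_W[OF M pq] by blast+
  have Bb: "r : ?B \<longleftrightarrow> r : V & btw p q r" for r using lt by (auto simp: btw_def)
  have "partition_on ?B {al : M. al <= ?B}"
  proof (rule partition_onI)
   show "\<Union>{al : M. al <= ?B} = ?B"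
   proof
    show "?B <= \<Union>{al : M. al <= ?B}"
    proof
     fix r assume r: "r : ?B"
     then obtain s where s: "{r, s} : M" "s : V" using cm_partner[OF M, of r] by blast
     have "{p, q} ~= {r, s}" using r by (auto simp: doubleton_eq_iff)
     hence "btw p q s" using cm_noncrossing[OF M pq s(1)] r Bb by blast
     hence "s : ?B" using Bb s by blast
     with r s show "r : \<Union>{al : M. al <= ?B}" by blast
    qed
   qed blast
   show "disjnt al be" if "al : {al : M. al <= ?B}" "be : {al : M. al <= ?B}" "al ~= be" for al be
    using that disjointD[OF partition_onD2[OF cm_partition[OF M]], of al be] by (simp add: disjnt_def)
   show "{} ~: {al : M. al <= ?B}" using partition_onD3[OF cm_partition[OF M]] by simp
  qed
  moreover have "card al = 2" if "al : {al : M. al <= ?B}" for al using that M by (auto simp: crossingless_on_def)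
  ultimately have "even (card ?B)" using finV by (intro even_card_pairs) auto
  moreover have "card ?B = card (pos ` ?B)"
   using injpos by (intro card_image[symmetric] inj_on_subset[OF injpos]) auto
  moreover have "pos ` ?B = {pos p<..<pos q}"
  proof
   show "{pos p<..<pos q} <= pos ` ?B"
   proof
    fix k assume k: "k : {pos p<..<pos q}"
    have "pos q : {1..N}" using W posV by blast
    hence "k : pos ` V" using k posV by auto
    thus "k : pos ` ?B" using k by auto
   qed
  qed auto
  ultimately have "even (pos q - pos p - 1)" by simp
  thus ?thesis using lt by (cases "pos q - pos p") auto
 qed
 have W: "p : V" "q : V" using cm_in_W[OF M pq] by blast+
 have "pos p ~= pos q" using cm_ne[OF M pq] W pos_eq by blast
 then consider "pos p < pos q" | "pos q < pos p" by linarith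
 thus ?thesis
 proof cases
  case 1
  thus ?thesis using *[OF pq 1] by (metis even_add le_add_diff_inverse less_imp_le)
 next
  case 2
  have "{q, p} : M" using pq by (simp add: insert_commute)
  thus ?thesis using *[OF _ 2] 2 by (metis even_add le_add_diff_inverse less_imp_le)
 qed
qed

lemma cm_pm: "cm M ==> pm M" unfolding pmatch_def
by (metis cm_partition cm_arcE cm_parity insert_commute)

text \<open>
 The arc \<open>{u, v}\<close> can be created by a surgery in every crossingless matching that contains \<open>Q\<close>.
\<close>

definition gap :: "'p set set => 'p => 'p => bool" where
 "gap Q u v \<longleftrightarrow> u ~: \<Union>Q & v ~: \<Union>Q & (ALL p:V. btw u v p --> (EX q. {p, q} : Q & btw u v q))"

text \<open>The points between \<open>u\<close> and \<open>v\<close> are matched among themselves by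
  \<open>Q\<close>, so no arc of \<open>x\<close> separates \<open>u\<close> from \<open>v\<close>,
  and neither old partner lies between them.\<close>

lemma gap_surgery:
 assumes x: "cm x" "Q <= x" and g: "gap Q u v" and uv: "u : V" "v : V" "even (pos u)" "odd (pos v)" "{u, v} ~: x"
 obtains x' b w where "sg x x' u b w v" "sg x' x u v w b" "cm x'" "insert {u, v} Q <= x'"
  "{u, b} : x" "{w, v} : x" "x' = x - {{u, b}, {w, v}} Un {{u, v}, {w, b}}"
proof -
 obtain b where b: "{u, b} : x" "b : V" "b ~= u" using cm_partner[OF x(1) uv(1)] .
 obtain w where w0: "{v, w} : x" "w : V" "w ~= v" using cm_partner[OF x(1) uv(2)] .
 have w: "{w, v} : x" using w0 by (simp add: insert_commute)
 have par: "odd (pos b)" "even (pos w)" using cm_parity[OF x(1) b(1)] cm_parity[OF x(1) w] uv by auto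
 have uw: "u ~= w" using w assms by blast
 define x' where "x' = x - {{u, b}, {w, v}} Un {{u, v}, {w, b}}"
 have s: "sg x x' u b w v" unfolding surg_def x'_def using b w par uv uw by simp
 have outQ: "{u, b} ~: Q" "{w, v} ~: Q" using g by (auto simp: gap_def)
 have nb: "~ btw u v r" if rs: "{r, s} : x" "s : {u, v}" for r s
 proof
  assume "btw u v r"
  moreover have "r : V" using cm_in_W[OF x(1) rs(1)] by blast
  ultimately obtain q where q: "{r, q} : Q" "btw u v q" using g by (auto simp: gap_def)
  hence "{r, q} : x" using x by blast
  hence "q = s" using cm_partner_unique[OF x(1) _ rs(1)] by blast
  thus False using q rs by (auto simp: btw_def)
 qed
 have "cm (x - {{u, b}, {v, w}} Un {{u, v}, {b, w}})"
 proof (rule cm_surgery[OF x(1) b(1) w0(1)])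
  show "{u, b} ~= {v, w}" using uw uv par by (auto simp: doubleton_eq_iff)
  have "{b, u} : x" using b by (simp add: insert_commute)
  thus "btw u v b \<longleftrightarrow> btw u v w" using nb[of b u] nb[of w v] w by blast
  have half: "btw u v q" if pq: "{p, q} : x" "btw u v p" for p q
  proof -
   have "p : V" using cm_in_W[OF x(1) pq(1)] by blast
   then obtain q' where q: "{p, q'} : Q" "btw u v q'" using g pq by (auto simp: gap_def)
   hence "{p, q'} : x" using x by blast
   hence "q' = q" using cm_partner_unique[OF x(1) _ pq(1)] by blast
   thus ?thesis using q by simp
  qed
  show "btw u v p \<longleftrightarrow> btw u v q" if "{p, q} : x" for p q
   using half[of p q] half[of q p] that by (auto simp: insert_commute)
 qed
 hence x'cm: "cm x'" by (simp add: x'_def insert_commute)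
 show ?thesis
 proof (rule that[OF s surg_sym[OF s cm_pm[OF x(1)]] x'cm])
  show "insert {u, v} Q <= x'" using x(2) outQ unfolding x'_def by blast
 qed (use b w x'_def in auto)
qed

text \<open>An arc of least length in \<open>A\<close> encloses no other arc of \<open>A\<close>; by
  \<open>inner\<close> everything that it encloses belongs to \<open>R\<close>.\<close>

lemma gap_exists: assumes s: "cm s" and RA: "R <= s" "A <= s - R" "A ~= {}"
  and inner: "!!u v p q. {u, v} : A ==> {p, q} : s ==> btw u v p ==> btw u v q ==> {p, q} : R Un A"
 obtains u v where "{u, v} : A" "even (pos u)" "odd (pos v)" "u : V" "v : V" "gap R u v"
proof -
 obtain ka where ka: "ka : A" "!!be. be : A ==> arc_len ka <= arc_len be"
  using ex_has_least_nat[of "%al. al : A" _ arc_len] RA(3) by (metis ex_in_conv)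
 have kas: "ka : s" "ka ~: R" using ka RA by auto
 obtain u v where uv: "ka = {u, v}" "even (pos u)" "odd (pos v)" using pmatch_arcE[OF cm_pm[OF s] kas(1)] .
 have uvs: "{u, v} : s" using uv kas by simp
 have W: "u : V" "v : V" using cm_in_W[OF s uvs] by blast+
 have "gap R u v" unfolding gap_def
 proof (intro conjI ballI impI)
  have "r ~: \<Union>R" if "r : ka" for r
  proof
   assume "r : \<Union>R"
   then obtain be where "be : R" "r : be" by blast
   hence "be = ka" using cm_unique[OF s _ kas(1), of be r] RA that by blast
   thus False using `be : R` kas by simp
  qed
  thus "u ~: \<Union>R" "v ~: \<Union>R" using uv by auto
  fix p assume p: "p : V" "btw u v p"
  obtain q where q: "{p, q} : s" "q : V" "q ~= p" using cm_partner[OF s p(1)] .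
  have "{u, v} ~= {p, q}" using p(2) by (auto simp: btw_def doubleton_eq_iff)
  hence bq: "btw u v q" using cm_noncrossing[OF s uvs q(1)] p(2) by simp
  have "{p, q} ~: A"
  proof
   assume "{p, q} : A"
   hence le: "arc_len {u, v} <= arc_len {p, q}" using ka uv by simp
   have len: "arc_len {a, b} = (if pos a < pos b then pos b - pos a else pos a - pos b)" for a b
    by (auto simp: arc_len_def max_def min_def)
   show False using le p(2) bq unfolding len btw_def by (auto split: if_splits)
  qed
  hence "{p, q} : R" using inner[of u v p q] ka(1) uv(1) q(1) p(2) bq by auto
  thus "EX q. {p, q} : R & btw u v q" using bq by blast
 qed
 thus ?thesis using that[of u v] ka(1) uv W by simp
qed

text \<open>With \<open>cm\<close> this describes a crossingless matching of the top points beside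
  one of the bottom points, which is what closes up a planar tangle.\<close>

definition hor :: "'p set set => bool" where
 "hor x \<longleftrightarrow> (ALL p q. {p, q} : x --> top p = top q)"

abbreviation split_cm :: "'p set set => bool" where
 "split_cm x \<equiv> cm x & hor x"

lemma split_surgery:
 assumes "split_cm x" "cm x'" "{u, b} : x" "{w, v} : x" "x' = x - {{u, b}, {w, v}} Un {{u, v}, {w, b}}" "top u = top v"
 shows "split_cm x'" unfolding hor_def
proof (intro conjI allI impI)
 fix p q assume pq: "{p, q} : x'"
 have h: "top u = top b" "top w = top v" using assms by (auto simp: hor_def)
 consider "{p, q} : x" | "{p, q} = {u, v}" | "{p, q} = {w, b}" using pq assms(5) by blast
 thus "top p = top q" by (metis assms hor_def doubleton_eq_iff)
qed (rule assms(2))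

lemma btw_top: "u : V ==> v : V ==> p : V ==> top u = top v ==> btw u v p ==> top p = top u"
 using sides[of u p] sides[of v p] sides[of p u] sides[of p v] unfolding btw_def by (metis less_asym)

text \<open>What bimodule linearity says about dots on arcs and about single surgeries between
  closures. Closures are restricted to those containing the arcs \<open>Q\<close> that have been
  treated already; this is what the induction varies.\<close>

definition lin_on :: "'p set set => 'p set set => 'p set set => (('p hgen \<Rightarrow>\<^sub>0 int) => 'p hgen \<Rightarrow>\<^sub>0 int) => bool" where
 "lin_on Q t t' f \<longleftrightarrow>
  (ALL u v. f (u - v) = f u - f v) &
  (ALL x v. split_cm x --> Q <= x --> v : Fs x t --> f v : Fs x t') &
  (ALL x al v. split_cm x --> Q <= x --> al : x --> v : Fs x t --> f (bas x x {al} ** v) = bas x x {al} ** f v) &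
  (ALL x x' a b c d v. split_cm x --> Q <= x --> split_cm x' --> Q <= x' --> sg x x' a b c d --> v : Fs x t -->
    f (bas x' x {} ** v) = bas x' x {} ** f v)"

lemma lin_onD: assumes "lin_on Q t t' f" shows "f (u - v) = f u - f v"
  and "split_cm x ==> Q <= x ==> w : Fs x t ==> f w : Fs x t'"
  and "split_cm x ==> Q <= x ==> al : x ==> w : Fs x t ==> f (bas x x {al} ** w) = bas x x {al} ** f w"
  and "split_cm x ==> Q <= x ==> split_cm x' ==> Q <= x' ==> sg x x' a b c d ==> w : Fs x t ==>
    f (bas x' x {} ** w) = bas x' x {} ** f w"
 using assms unfolding lin_on_def by blast+

lemma lin_on_mono: "lin_on Q t t' f ==> Q <= Q' ==> lin_on Q' t t' f" unfolding lin_on_def by (meson subset_trans)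

lemma lin_on_right: assumes "lin_on Q t t' f" "r : Fs t' t2" shows "lin_on Q t t2 (%v. f v ** r)"
proof -
 note l = lin_onD[OF assms(1)]
 show ?thesis unfolding lin_on_def
 proof (intro conjI allI impI)
  show "f (u - v) ** r = f u ** r - f v ** r" for u v by (simp add: l(1) hmul_simps)
  show "f v ** r : Fs x t2" if "split_cm x" "Q <= x" "v : Fs x t" for x v
   by (rule Fs_hmul[OF l(2)[OF that] assms(2)])
  show "f (bas x x {al} ** v) ** r = bas x x {al} ** (f v ** r)"
   if "split_cm x" "Q <= x" "al : x" "v : Fs x t" for x al v unfolding l(3)[OF that] by (rule hmul_assoc)
  show "f (bas x' x {} ** v) ** r = bas x' x {} ** (f v ** r)"
   if "split_cm x" "Q <= x" "split_cm x'" "Q <= x'" "sg x x' a b c d" "v : Fs x t" for x x' a b c d v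
   unfolding l(4)[OF that] by (rule hmul_assoc)
 qed
qed

lemma lin_on_left: assumes "lin_on Q t t' f" "r : Fs t2 t" shows "lin_on Q t2 t' (%v. f (v ** r))"
proof -
 note l = lin_onD[OF assms(1)]
 have F: "v ** r : Fs x t" if "v : Fs x t2" for v x using Fs_hmul[OF that assms(2)] .
 show ?thesis unfolding lin_on_def
 using l hmul_simps F hmul_assoc by auto
qed

lemma lin_on_by_dots: assumes f: "lin_on Q t t' f" and x: "split_cm x" "Q <= x" and t: "cm t"
  and one: "f (bas x t {}) = bas x t {} ** y" and v: "v : Fs x t"
 shows "f v = v ** y"
proof (rule hmul_by_dots[OF _ _ v])
 show "pm x" "pm t" using x t cm_pm by auto
 show "f (bas x x {al} ** bas x t D) = bas x x {al} ** f (bas x t D)" if "al : x" "D <= circ x t" for al D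
  using lin_onD(3)[OF f x that(1) Fs_bas[OF that(2)]] .
qed (use lin_onD(1)[OF f] one in auto)

text \<open>If the created arc lies in the source, then every other case is reached by merging.\<close>

lemma centralizer_extend:
 assumes f: "lin_on Q t t' f" and t: "cm t" "{u, v} : t" and g: "gap Q u v" and uv: "even (pos u)" "odd (pos v)" "top u = top v"
  and y: "!!x w. split_cm x ==> insert {u, v} Q <= x ==> w : Fs x t ==> f w = w ** y"
  and x: "split_cm x" "Q <= x" and w: "w : Fs x t"
 shows "f w = w ** y"
proof (cases "{u, v} : x")
 case True
 thus ?thesis using y x w by simp
next
 case False
 have V: "u : V" "v : V" using cm_in_W[OF t] by blast+
 obtain x' b c where s: "sg x x' u b c v" "sg x' x u v c b" "cm x'" "insert {u, v} Q <= x'"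
  "{u, b} : x" "{c, v} : x" "x' = x - {{u, b}, {c, v}} Un {{u, v}, {c, b}}"
  using gap_surgery[OF conjunct1[OF x(1)] x(2) g V uv(1,2) False] .
 have x': "split_cm x'" by (rule split_surgery[OF x(1) s(3,5-7) uv(3)])
 have e: "bas x t {} = bas x x' {} ** bas x' t {}" using hmul_surg_merge[OF s(2) cm_pm cm_pm t(2)] x' t(1) by simp
 have "f (bas x t {}) = bas x x' {} ** f (bas x' t {})"
  unfolding e by (rule lin_onD(4)[OF f x' _ x s(2) Fs_bas]) (use s in auto)
 also have "... = bas x t {} ** y" unfolding e using y[OF x' s(4) Fs_bas[of "{}"]] by (simp add: hmul_assoc)
 finally show ?thesis by (rule lin_on_by_dots[OF f x t(1) _ w])
qed

definition centralized :: "'p set set => 'p set set => 'p set set => (('p hgen \<Rightarrow>\<^sub>0 int) => 'p hgen \<Rightarrow>\<^sub>0 int) => bool" where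
 "centralized Q t t' f \<longleftrightarrow>
  (EX y. y : Fs t t' & (ALL x w. split_cm x --> Q <= x --> w : Fs x t --> f w = w ** y))"

lemma centralizedI: assumes "y : Fs t t'" "!!x w. split_cm x ==> Q <= x ==> w : Fs x t ==> f w = w ** y"
 shows "centralized Q t t' f" unfolding centralized_def using assms by (intro exI[of _ y] conjI allI impI)

text \<open>If \<open>t'\<close> lacks the arc, \<open>f\<close> is followed by the surgery to
  \<open>t2\<close>, which contains it. The induction hypothesis describes this composite, and
  \<open>f\<close> is recovered by the one-sided inverse of the surgery; the differentiation in that
  inverse moves onto \<open>y\<close> because closure, source and \<open>t2\<close> all contain the
  arc.\<close>

lemma centralized_source_arc: assumes f: "lin_on Q t t' f" and t: "cm t" "Q <= t" and t': "cm t'" "Q <= t'"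
  and k: "{u, v} : t" and g: "gap Q u v" and uv: "even (pos u)" "odd (pos v)" "top u = top v"
  and IH: "!!t' f. cm t' ==> insert {u, v} Q <= t' ==> lin_on (insert {u, v} Q) t t' f ==> centralized (insert {u, v} Q) t t' f"
 shows "centralized Q t t' f"
proof -
 have f': "lin_on (insert {u, v} Q) t t' f" by (rule lin_on_mono[OF f]) blast
 have V: "u : V" "v : V" using cm_in_W[OF t(1) k] by blast+
 show ?thesis
 proof (cases "{u, v} : t'")
  case True
  hence "centralized (insert {u, v} Q) t t' f" using IH[OF t'(1) _ f'] t'(2) by blast
  then obtain y where y: "y : Fs t t'"
   "ALL x w. split_cm x --> insert {u, v} Q <= x --> w : Fs x t --> f w = w ** y"
   unfolding centralized_def by (elim exE conjE)
  show ?thesis by (rule centralizedI[OF y(1)], rule centralizer_extend[OF f t(1) k g uv]) (simp_all add: y(2))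
 next
  case False
  obtain t2 b c where s: "sg t' t2 u b c v" "sg t2 t' u v c b" "cm t2" "insert {u, v} Q <= t2"
   using gap_surgery[OF t' g V uv(1,2) False] by metis
  have tau: "bas t' t2 {} : Fs t' t2" by (rule Fs_bas) simp
  obtain y where y: "y : Fs t t2"
   "ALL x w. split_cm x --> insert {u, v} Q <= x --> w : Fs x t --> f w ** bas t' t2 {} = w ** y"
   using IH[OF s(3,4) lin_on_right[OF f' tau]] unfolding centralized_def by (elim exE conjE)
  define y' where "y' = pdiff {u, v} y ** bas t2 t' {}"
  have y': "y' : Fs t t'" unfolding y'_def by (rule Fs_hmul[OF pdiff_Fs[OF y(1)] Fs_bas]) simp
  have one: "f (bas x t {}) = bas x t {} ** y'" if x: "split_cm x" "insert {u, v} Q <= x" for x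
  proof -
   have pms: "pm x" "pm t" "pm t2" "pm t'" using x t t' s cm_pm by auto
   have kx: "{u, v} : x" "{u, v} : t2" using x s by auto
   have b0: "bas x t {} : Fs x t" by (rule Fs_bas) simp
   have z: "f (bas x t {}) : Fs x t'" by (rule lin_onD(2)[OF f' x b0])
   have "bas x t {} ** y' = pdiff {u, v} (bas x t {} ** y) ** bas t2 t' {}"
    unfolding y'_def hmul_assoc[symmetric] pdiff_hmul[OF pms(1,2,3) kx(1) k kx(2) y(1)] ..
   also have "... = pdiff {u, v} (f (bas x t {}) ** bas t' t2 {}) ** bas t2 t' {}" using y(2) x b0 by simp
   also have "... = f (bas x t {})" by (rule hmul_surg_section_right[OF s(2) pms(3,1) kx(1) z])
   finally show ?thesis by simp
  qed
  have all: "f w = w ** y'" if "split_cm x" "insert {u, v} Q <= x" "w : Fs x t" for x w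
   by (rule lin_on_by_dots[OF f' that(1,2) t(1) one[OF that(1,2)] that(3)])
  show ?thesis by (rule centralizedI[OF y'], rule centralizer_extend[OF f t(1) k g uv]) (simp_all add: all)
 qed
qed

text \<open>Since the source lacks the arc, \<open>f\<close> is preceded by the surgery from
  \<open>t2\<close>. For the value \<open>z\<close> at an undotted element the claim becomes
  \<open>(X1 + X2) d z = z\<close>, with the dots \<open>X1\<close> at \<open>{u, v}\<close>,
  \<open>X2\<close> at \<open>al\<close>, and the derivative \<open>d\<close> at
  \<open>{u, v}\<close>. It follows from \<open>d X1 + X1 d = 1\<close>, \<open>d X2 = X2 d\<close>
  and \<open>X1 z = X2 z\<close>, the last because both arcs lie on one circle of
  \<open>x t\<close>.\<close>

lemma centralized_target_arc: assumes f: "lin_on Q t t' f" and t: "cm t" "Q <= t" and t': "cm t'" "Q <= t'"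
  and k: "{u, v} : t'" "{u, v} ~: t" and g: "gap Q u v" and uv: "even (pos u)" "odd (pos v)" "top u = top v"
  and IH: "!!t f. cm t ==> insert {u, v} Q <= t ==> lin_on (insert {u, v} Q) t t' f ==> centralized (insert {u, v} Q) t t' f"
 shows "centralized Q t t' f"
proof -
 have f': "lin_on (insert {u, v} Q) t t' f" by (rule lin_on_mono[OF f]) blast
 have V: "u : V" "v : V" using cm_in_W[OF t'(1) k(1)] by blast+
 obtain t2 b c where s: "sg t t2 u b c v" "sg t2 t u v c b" "cm t2" "insert {u, v} Q <= t2"
  using gap_surgery[OF t g V uv(1,2) k(2)] by metis
 have sig: "bas t2 t {} : Fs t2 t" by (rule Fs_bas) simp
 obtain y where y: "y : Fs t2 t'"
  "ALL x w. split_cm x --> insert {u, v} Q <= x --> w : Fs x t2 --> f (w ** bas t2 t {}) = w ** y"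
  using IH[OF s(3,4) lin_on_left[OF f' sig]] unfolding centralized_def by (elim exE conjE)
 define y' where "y' = bas t t2 {} ** pdiff {u, v} y"
 have y': "y' : Fs t t'" unfolding y'_def by (rule Fs_hmul[OF Fs_bas pdiff_Fs[OF y(1)]]) simp
 have one: "f (bas x t {}) = bas x t {} ** y'" if x: "split_cm x" "insert {u, v} Q <= x" for x
 proof -
  have pms: "pm x" "pm t" "pm t2" "pm t'" using x t t' s cm_pm by auto
  have kx: "{u, v} : x" "{u, v} : t2" using x s by auto
  have b0: "bas x t {} : Fs x t" "bas x t2 {} : Fs x t2" by (rule Fs_bas, simp)+
  define z where "z = f (bas x t {})"
  have zF: "z : Fs x t'" unfolding z_def by (rule lin_onD(2)[OF f' x b0(1)])
  have "hrev (bas t t2 {} ** bas t2 x {}) = hrev (bas t x {})"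
   using hmul_surg_merge[OF s(2) pms(3,1) kx(1)] by simp
  hence m: "bas x t2 {} ** bas t2 t {} = bas x t {}" by (simp add: hrev_hmul)
  have z: "z = bas x t2 {} ** y" using y(2)[rule_format, OF x b0(2)] m by (simp add: z_def)
  obtain al where al: "al : x" "al ~= {u, v}"
   "bas x t {} ** bas t t2 {} = (bas x x {{u, v}} + bas x x {al}) ** bas x t2 {}"
   "bas x x {{u, v}} ** bas x t {} = bas x x {al} ** bas x t {}"
   using hmul_surg_split[OF s(2) pms(3,1) kx(1)] .
  have dz: "bas x x {{u, v}} ** z = bas x x {al} ** z"
   using lin_onD(3)[OF f' x kx(1) b0(1)] lin_onD(3)[OF f' x al(1) b0(1)] al(4) by (simp add: z_def)
  have "bas x t {} ** y' = (bas x x {{u, v}} + bas x x {al}) ** (bas x t2 {} ** pdiff {u, v} y)"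
   unfolding y'_def hmul_assoc[symmetric] al(3) ..
  also have "bas x t2 {} ** pdiff {u, v} y = pdiff {u, v} z"
   unfolding z by (rule pdiff_hmul[OF pms(1,3,4) kx(1,2) k(1) y(1)])
  also have "(bas x x {{u, v}} + bas x x {al}) ** pdiff {u, v} z = z"
   using pdiff_dot_same[OF pms(1,4) kx(1) k(1) zF] pdiff_dot_other[OF pms(1,4) kx(1) k(1) zF al(1,2)] dz
   by (simp add: hmul_simps)
  finally show ?thesis by (simp add: z_def)
 qed
 have main: "f w = w ** y'" if "split_cm x" "insert {u, v} Q <= x" "w : Fs x t" for x w
  by (rule lin_on_by_dots[OF f' that(1,2) t(1) one[OF that(1,2)] that(3)])
 \<comment> \<open>For closures without the arc, the error \<open>r\<close> vanishes after the
   surgery that creates the arc, and this surgery is injective on \<open>Fs x t'\<close>, having a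
   left inverse.\<close>
 have "f w = w ** y'" if x: "split_cm x" "Q <= x" and w: "w : Fs x t" for x w
 proof (cases "{u, v} : x")
  case True
  thus ?thesis using main x w by simp
 next
  case False
  obtain x' b c where s': "sg x x' u b c v" "sg x' x u v c b" "cm x'" "insert {u, v} Q <= x'"
   "{u, b} : x" "{c, v} : x" "x' = x - {{u, b}, {c, v}} Un {{u, v}, {c, b}}"
   using gap_surgery[OF conjunct1[OF x(1)] x(2) g V uv(1,2) False] .
  have x': "split_cm x'" by (rule split_surgery[OF x(1) s'(3,5-7) uv(3)])
  have Q': "Q <= x'" using s' by blast
  have b0: "bas x' x {} : Fs x' x" by (rule Fs_bas) simp
  define r where "r = f w - w ** y'"
  have rF: "r : Fs x t'" unfolding r_def by (rule Fs_diff[OF lin_onD(2)[OF f x w] Fs_hmul[OF w y']])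
  have "bas x' x {} ** r = f (bas x' x {} ** w) - (bas x' x {} ** w) ** y'"
   unfolding r_def using lin_onD(4)[OF f x x' Q' s'(1) w] by (simp add: hmul_simps hmul_assoc)
  also have "... = 0" using main[OF x' s'(4) Fs_hmul[OF b0 w]] by simp
  finally have "bas x x' {} ** pdiff {u, v} (bas x' x {} ** r) = 0" by (simp add: hmul_simps)
  moreover have "bas x x' {} ** pdiff {u, v} (bas x' x {} ** r) = r"
   by (rule hmul_surg_section[OF s'(2) _ _ k(1) rF]) (use x' t' cm_pm in auto)
  ultimately show ?thesis by (simp add: r_def)
 qed
 thus ?thesis by (rule centralizedI[OF y'])
qed

end

section \<open>The case of vertical tangles\<close>

lemma partition_on_disjoint_Un: assumes "partition_on A P" "partition_on B R" "A Int B = {}"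
 shows "partition_on (A Un B) (P Un R)"
proof (rule partition_onI)
 show "\<Union>(P Un R) = A Un B" using partition_onD1[OF assms(1)] partition_onD1[OF assms(2)] by simp
 show "{} ~: P Un R" using partition_onD3[OF assms(1)] partition_onD3[OF assms(2)] by simp
 show "disjnt al be" if ab: "al : P Un R" "be : P Un R" "al ~= be" for al be
 proof -
  have sub: "ga : P ==> ga <= A" "ga : R ==> ga <= B" for ga
   using partition_onD1[OF assms(1)] partition_onD1[OF assms(2)] by auto
  consider "al : P" "be : P" | "al : R" "be : R" | "al <= A" "be <= B" | "al <= B" "be <= A"
   using ab(1,2) sub unfolding Un_iff by metis
  thus ?thesis
  proof cases
   case 1
   thus ?thesis using disjointD[OF partition_onD2[OF assms(1)]] ab(3) by (simp add: disjnt_def)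
  next
   case 2
   thus ?thesis using disjointD[OF partition_onD2[OF assms(2)]] ab(3) by (simp add: disjnt_def)
  qed (use assms(3) in "unfold disjnt_def, blast+")
 qed
qed

context planar_points
begin

text \<open>The transpose of merging: a coefficient with a dot on the merged circle collects those
  with a dot on either of the two circles.\<close>

lemma surg_lookup_merge: assumes s: "sg u u' a b c d" and u: "pm u" and z: "pm z" and n: "~ conn (u Un z) a c"
  and v: "v : Fs u z" and G: "G <= circ u' z"
 defines "A \<equiv> cls (u Un z) a" and "C \<equiv> cls (u Un z) c"
 shows "lookup (bas u' u {} ** v) (u', z, G) =
  (if A Un C : G then lookup v (u, z, insert A (G - {A Un C})) + lookup v (u, z, insert C (G - {A Un C}))
  else lookup v (u, z, G))"
proof (rule Fs_eqI[OF v, of "%v. lookup (bas u' u {} ** v) (u', z, G)"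
  "%v. if A Un C : G then lookup v (u, z, insert A (G - {A Un C})) + lookup v (u, z, insert C (G - {A Un C}))
  else lookup v (u, z, G)"])
 fix D assume D: "D <= circ u z"
 note sc = surg_circles[OF s u z n, folded A_def C_def]
 note mg = bas_merge[OF s u z n D, folded A_def C_def]
 have DAC: "A Un C ~: D" using D sc(4) by blast
 have GAC: "A ~: G" "C ~: G" using G sc(1-6) by auto
 show "lookup (bas u' u {} ** bas u z D) (u', z, G) =
  (if A Un C : G then lookup (bas u z D) (u, z, insert A (G - {A Un C})) + lookup (bas u z D) (u, z, insert C (G - {A Un C}))
  else lookup (bas u z D) (u, z, G))"
 proof -
  consider "A : D" "C : D" | "A : D" "C ~: D" | "A ~: D" "C : D" | "A ~: D" "C ~: D" by blast
  thus ?thesis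
  proof cases
   case 1
   have "insert A (G - {A Un C}) ~= D" "insert C (G - {A Un C}) ~= D" "G ~= D" using 1 GAC sc(3) by auto
   thus ?thesis unfolding mg using 1 by simp
  next
   case 2
   have "G = insert (A Un C) (D - {A, C}) \<longleftrightarrow> A Un C : G & insert A (G - {A Un C}) = D"
    using 2 GAC DAC sc(3) by (auto simp: insert_eq_iff)
   moreover have "insert C (G - {A Un C}) ~= D" "G ~= D" using 2 GAC sc(3) by auto
   ultimately show ?thesis unfolding mg using 2 by auto
  next
   case 3
   have "G = insert (A Un C) (D - {A, C}) \<longleftrightarrow> A Un C : G & insert C (G - {A Un C}) = D"
    using 3 GAC DAC sc(3) by (auto simp: insert_eq_iff)
   moreover have "insert A (G - {A Un C}) ~= D" "G ~= D" using 3 GAC sc(3) by auto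
   ultimately show ?thesis unfolding mg using 3 by auto
  next
   case 4
   thus ?thesis unfolding mg using DAC by auto
  qed
 qed
qed (simp_all add: hmul_simps lookup_minus)

lemma Fs_lookup_eqI:
 assumes "u : Fs x y" "v : Fs x y" "!!D. D <= circ x y ==> lookup u (x, y, D) = lookup v (x, y, D)"
 shows "u = v"
proof (rule poly_mapping_eqI)
 fix k
 show "lookup u k = lookup v k"
 proof (cases "k : {(x, y, D) | D. D <= circ x y}")
  case True
  thus ?thesis using assms(3) by auto
 next
  case False
  hence "k ~: keys u" "k ~: keys v" using assms(1,2) by (auto simp: Fs_def)
  thus ?thesis by (simp add: in_keys_iff)
 qed
qed

end

text \<open>
 The situation at the end of the induction: the arcs outside of \<open>Q\<close> connect the two sides.
\<close>

locale vertical_tangle = planar_points V pos top N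
 for V :: "'p set" and pos :: "'p => nat" and top :: "'p => bool" and N :: nat +
 fixes t Q :: "'p set set"
 assumes t: "cm t" and Qt: "Q <= t" and Qhor: "hor Q"
  and vert: "!!p q. {p, q} : t ==> {p, q} ~: Q ==> top p ~= top q"
begin

definition U :: "'p set" where "U = {p : V. top p & p ~: \<Union>Q}"

text \<open>On the points off \<open>Q\<close> this reflects top to bottom along the vertical
  strands. It reverses positions, since the boundary runs through the two lines in opposite
  directions.\<close>

definition mir :: "'p => 'p" where "mir p = (THE q. {p, q} : t)"

lemma mir: "p : V ==> {p, mir p} : t" unfolding mir_def by (rule theI2[of _ "SOME q. {p, q} : t"])
  (metis cm_partner[OF t] someI, (metis cm_partner_unique[OF t] cm_partner[OF t] someI)+)

lemma mir_eq: "{p, q} : t ==> mir p = q" using cm_partner_unique[OF t] cm_in_W[OF t] mir by blast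

lemma mir_mir: "p : V ==> mir (mir p) = p" using mir[of p] by (intro mir_eq) (simp add: insert_commute)

lemma mir_V: "p : V ==> mir p : V" using mir cm_in_W[OF t] by blast

lemma U_V: "p : U ==> p : V" by (simp add: U_def)

lemma mir_arc_notin_Q: "p : V ==> p ~: \<Union>Q ==> {p, mir p} ~: Q" by blast

lemma mir_bottom: "p : U ==> ~ top (mir p)" using vert[OF mir, of p] by (auto simp: U_def)

lemma mir_notin_Q: "p : V ==> p ~: \<Union>Q ==> mir p ~: \<Union>Q" using cm_unique t mir Qt by fastforce

lemma bottom_is_mir: assumes "q : V" "~ top q" "q ~: \<Union>Q" shows "mir q : U" "mir (mir q) = q"
proof -
 show "mir (mir q) = q" by (rule mir_mir[OF assms(1)])
 have "top (mir q)" using vert[OF mir[OF assms(1)]] mir_arc_notin_Q[OF assms(1,3)] assms(2) by auto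
 thus "mir q : U" using mir_V mir_notin_Q assms by (simp add: U_def)
qed

lemma mir_inj: "inj_on mir U" by (rule inj_on_inverseI[of _ mir]) (simp add: mir_mir U_V)

lemma mir_order: assumes "p : U" "q : U" "pos p < pos q" shows "pos (mir q) < pos (mir p)"
proof -
 have V: "p : V" "q : V" "mir p : V" "mir q : V" using assms U_V mir_V by auto
 have ne: "{p, mir p} ~= {q, mir q}"
  using assms mir_bottom[OF assms(1)] mir_bottom[OF assms(2)] by (auto simp: doubleton_eq_iff U_def)
 have "pos q < pos (mir p)" using sides[OF V(2,3)] mir_bottom[OF assms(1)] assms(2) by (simp add: U_def)
 hence "btw p (mir p) q" using assms(3) by (simp add: btw_def)
 hence "btw p (mir p) (mir q)" using cm_noncrossing[OF t mir[OF V(1)] mir[OF V(2)] ne] by simp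
 moreover have "pos p < pos (mir q)" using sides[OF V(1,4)] mir_bottom[OF assms(2)] assms(1) by (simp add: U_def)
 ultimately show ?thesis by (auto simp: btw_def)
qed

sublocale top_points: ordered_points U pos
 by unfold_locales (auto simp: U_def finV intro: inj_on_subset[OF injpos])

lemma mir_btw: "p : U ==> q : U ==> r : U ==> btw (mir p) (mir q) (mir r) = btw p q r"
proof -
 assume U: "p : U" "q : U" "r : U"
 have iff: "pos x < pos y \<longleftrightarrow> pos (mir y) < pos (mir x)" if "x : U" "y : U" for x y
  by (metis that U_V pos_eq mir_order less_asym linorder_neqE_nat)
 show ?thesis unfolding btw_def using iff U by blast
qed

lemma Q_not_btw: assumes "{p, q} : Q" "r : V" "r ~: \<Union>Q" shows "~ btw p q r"
proof
 assume b: "btw p q r"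
 have pqt: "{p, q} : t" using assms(1) Qt by blast
 have V: "p : V" "q : V" using cm_in_W[OF t pqt] by blast+
 have h: "top p = top q" using Qhor assms(1) by (auto simp: hor_def)
 have "{p, q} ~= {r, mir r}" using mir_arc_notin_Q assms by metis
 hence "btw p q (mir r)" using cm_noncrossing[OF t pqt mir[OF assms(2)]] b by simp
 hence "top (mir r) = top p" "top r = top p"
  using btw_top[OF V mir_V[OF assms(2)] h] btw_top[OF V assms(2) h b] by simp_all
 thus False using vert[OF mir[OF assms(2)]] mir_arc_notin_Q[OF assms(2,3)] by simp
qed

text \<open>For \<open>M' = M\<close> each arc, its reflection and the two strands between them form
  one circle with \<open>t\<close>. The circles are then indexed by \<open>Q\<close> and
  \<open>M\<close>, which turns coefficients into functionals on dotted matchings of the free top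
  points.\<close>

definition sym_cm :: "'p set set => 'p set set => 'p set set" where
 "sym_cm M M' = Q Un M Un (`) mir ` M'"

lemma image_pair_in: "{p, q} : (`) mir ` M' ==> top_points.cm M' ==>
  EX p' q'. {p', q'} : M' & p = mir p' & q = mir q'"
proof -
 assume a: "{p, q} : (`) mir ` M'" "top_points.cm M'"
 then obtain be where be: "be : M'" "{p, q} = mir ` be" by blast
 obtain r s where rs: "be = {r, s}" using top_points.cm_arcE[OF a(2) be(1)] by metis
 hence "{p, q} = {mir r, mir s}" using be by simp
 thus ?thesis using be(1) rs by (metis doubleton_eq_iff insert_commute)
qed

lemma sym_cm: assumes M: "top_points.cm M" and M': "top_points.cm M'" shows "split_cm (sym_cm M M')"
proof -
 have MU: "p : U" "q : U" if "{p, q} : M" for p q using top_points.cm_in_W[OF M that] by blast+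
 have M'U: "p : U" "q : U" if "{p, q} : M'" for p q using top_points.cm_in_W[OF M' that] by blast+
 have UM: "\<Union>M = U" "\<Union>M' = U"
  using top_points.cm_partition[OF M] top_points.cm_partition[OF M'] by (auto simp: partition_on_def)
 have UmM: "\<Union>((`) mir ` M') = mir ` U" unfolding UM(2)[symmetric] by blast
 have V: "V = \<Union>Q Un U Un mir ` U"
 proof
  show "V <= \<Union>Q Un U Un mir ` U"
  proof
   fix p assume p: "p : V"
   show "p : \<Union>Q Un U Un mir ` U"
   proof (cases "p : \<Union>Q")
    case False
    thus ?thesis using p bottom_is_mir[of p] by (cases "top p") (auto simp: U_def intro: rev_image_eqI)
   qed simp
  qed
  show "\<Union>Q Un U Un mir ` U <= V" using Qt cm_partition[OF t] mir_V by (auto simp: U_def partition_on_def)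
 qed
 have d: "\<Union>Q Int U = {}" "\<Union>Q Int mir ` U = {}" "U Int mir ` U = {}"
  using mir_notin_Q mir_bottom by (auto simp: U_def)
 have "partition_on (\<Union>Q Un U Un mir ` U) (Q Un M Un (`) mir ` M')"
 proof (intro partition_on_disjoint_Un)
  show "partition_on (\<Union>Q) Q"
  proof (rule partition_onI)
   show "disjnt al be" if "al : Q" "be : Q" "al ~= be" for al be
    using that Qt disjointD[OF partition_onD2[OF cm_partition[OF t]], of al be] by (auto simp: disjnt_def)
   show "{} ~: Q" using partition_onD3[OF cm_partition[OF t]] Qt by blast
  qed simp
  show "partition_on U M" by (rule top_points.cm_partition[OF M])
  show "partition_on (mir ` U) ((`) mir ` M')"
  proof -
   have "{} ~: (`) mir ` M'" using partition_onD3[OF top_points.cm_partition[OF M']] by auto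
   thus ?thesis using partition_on_inj_image[OF top_points.cm_partition[OF M'] mir_inj] by simp
  qed
 qed (use d in auto)
 hence "partition_on V (sym_cm M M')" unfolding sym_cm_def V[symmetric] .
 moreover have "card al = 2" if "al : sym_cm M M'" for al
 proof -
  consider "al : Q" | "al : M" | be where "be : M'" "al = mir ` be" using `al : sym_cm M M'` unfolding sym_cm_def by blast
  thus ?thesis
  proof cases
   case 1
   thus ?thesis using Qt t by (auto simp: crossingless_on_def)
  next
   case 2
   thus ?thesis using M by (auto simp: crossingless_on_def)
  next
   case 3
   have "be <= U" using 3 UM by blast
   hence "card (mir ` be) = card be" by (intro card_image inj_on_subset[OF mir_inj])
   thus ?thesis using 3 M' by (auto simp: crossingless_on_def)
  qed
 qed
 moreover have "btw p q r \<longleftrightarrow> btw p q s"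
  if pq: "{p, q} : sym_cm M M'" and rs: "{r, s} : sym_cm M M'" and ne: "{p, q} ~= {r, s}" for p q r s
 proof -
  have topD: "e : V & top e" if "e : U" for e using that by (simp add: U_def)
  have botD: "e : V & ~ top e" if e: "e : mir ` U" for e using mir_V U_V mir_bottom that by blast
  have top_no: "~ btw a b e" if ab: "{a, b} : M" and e: "e : mir ` U" for a b e
   by (metis btw_top topD MU botD that)
  have bot_no: "~ btw a b e" if abM: "{a, b} : (`) mir ` M'" and eU: "e : U" for a b e
  proof
   assume b: "btw a b e"
   obtain a' b' where ab: "{a', b'} : M'" "a = mir a'" "b = mir b'" using image_pair_in[OF abM M'] by blast
   have "a' : U" "b' : U" using M'U[OF ab(1)] by blast+
   hence "a : V" "b : V" "~ top a" "~ top b" using ab botD[of a] botD[of b] by simp_all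
   hence "~ top e" using btw_top[of a b e] b eU U_V by simp
   thus False using eU by (simp add: U_def)
  qed
  have offQ: "e : V & e ~: \<Union>Q" if "e : U | e : mir ` U" for e using that d V by blast
  have ends: "e : U" "f : U" if "{e, f} : M" for e f using MU[OF that] by blast+
  have ends': "e : mir ` U" "f : mir ` U" if "{e, f} : (`) mir ` M'" for e f using that UmM by blast+
  have endsQ: "e : V" "f : V" "e : \<Union>Q" "f : \<Union>Q" if "{e, f} : Q" for e f using that V by blast+
  have swap: "(btw p q r \<longleftrightarrow> btw p q s) \<longleftrightarrow> (btw r s p \<longleftrightarrow> btw r s q)"
   if "p ~= r" "p ~= s" "q ~= r" "q ~= s" "p : V" "q : V" "r : V" "s : V"
   by (rule btw_swap) (use that pos_eq in auto)
  consider "{p, q} : Q" "{r, s} : Q" | "{p, q} : Q" "{r, s} : M | {r, s} : (`) mir ` M'"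
   | "{p, q} : M | {p, q} : (`) mir ` M'" "{r, s} : Q"
   | "{p, q} : M" "{r, s} : M" | "{p, q} : M" "{r, s} : (`) mir ` M'"
   | "{p, q} : (`) mir ` M'" "{r, s} : M" | "{p, q} : (`) mir ` M'" "{r, s} : (`) mir ` M'"
   using pq rs unfolding sym_cm_def Un_iff by metis
  thus ?thesis
  proof cases
   case 1
   thus ?thesis using cm_noncrossing[OF t _ _ ne] Qt by blast
  next
   case 2
   hence "r : U | r : mir ` U" "s : U | s : mir ` U" using ends[of r s] ends'[of r s] by blast+
   thus ?thesis using Q_not_btw[OF 2(1)] offQ by blast
  next
   case 3
   hence pq': "p : U | p : mir ` U" "q : U | q : mir ` U" using ends[of p q] ends'[of p q] by blast+
   have n: "~ btw r s p" "~ btw r s q" using Q_not_btw[OF 3(2)] offQ pq' by blast+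
   have "p ~: {r, s}" "q ~: {r, s}" using offQ[OF pq'(1)] offQ[OF pq'(2)] endsQ[OF 3(2)] by auto
   thus ?thesis using swap n offQ[OF pq'(1)] offQ[OF pq'(2)] endsQ[OF 3(2)] by simp
  next
   case 4
   thus ?thesis using top_points.cm_noncrossing[OF M 4 ne] by simp
  next
   case 5
   thus ?thesis using top_no[OF 5(1)] ends'[OF 5(2)] by blast
  next
   case 6
   thus ?thesis using bot_no[OF 6(1)] ends[OF 6(2)] by blast
  next
   case 7
   obtain p' q' where p': "{p', q'} : M'" "p = mir p'" "q = mir q'" using image_pair_in[OF 7(1) M'] by blast
   obtain r' s' where r': "{r', s'} : M'" "r = mir r'" "s = mir s'" using image_pair_in[OF 7(2) M'] by blast
   have "{p', q'} ~= {r', s'}" using ne p' r' by (auto simp: doubleton_eq_iff)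
   hence "btw p' q' r' \<longleftrightarrow> btw p' q' s'" using top_points.cm_noncrossing[OF M' p'(1) r'(1)] by simp
   thus ?thesis using mir_btw M'U[OF p'(1)] M'U[OF r'(1)] p' r' by simp
  qed
 qed
 ultimately have "cm (sym_cm M M')" by (rule cmI)
 moreover have "hor (sym_cm M M')" unfolding hor_def
 proof (intro allI impI)
  fix p q assume "{p, q} : sym_cm M M'"
  then consider "{p, q} : Q" | "{p, q} : M" | "{p, q} : (`) mir ` M'" unfolding sym_cm_def by blast
  thus "top p = top q"
  proof cases
   case 1
   thus ?thesis using Qhor by (auto simp: hor_def)
  next
   case 2
   thus ?thesis using MU by (simp add: U_def)
  next
   case 3
   then obtain p' q' where "{p', q'} : M'" "p = mir p'" "q = mir q'" using image_pair_in[OF 3 M'] by blast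
   thus ?thesis using M'U mir_bottom by blast
  qed
 qed
 ultimately show ?thesis ..
qed

lemma sym_cm_Q: "Q <= sym_cm M M'" unfolding sym_cm_def by blast

end

lemma cc_blockI: assumes "B ~= {}" "B <= \<Union>VV" "!!W. W : VV ==> W Int B ~= {} ==> W <= B"
  and "!!x y. x : B ==> y : B ==> conn VV x y"
 shows "B : ccs VV"
proof -
 obtain x where x: "x : B" using assms(1) by blast
 have "cls VV x = B" by (auto simp: conn_closed x assms)
 moreover have "cls VV x : ccs VV" by (rule cls_in_cc) (use x assms(2) in blast)
 ultimately show ?thesis by simp
qed

context marked_points
begin

lemma bas_dots_right: assumes x: "pm x" and z: "pm z" and S: "S <= x" shows "bas z x {} ** bas x x S =
  (if ALL K:circ z x. dots S K <= 1 then bas z x {K : circ z x. dots S K = 1} else 0)"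
proof -
 have d0: "dots {} K = 0" for K :: "'p set" by (simp add: dots_def)
 have "hrev (bas z x {} ** bas x x S) = bas x x S ** bas x z {}" by (simp add: hrev_hmul)
 also have "... = (if ALL K:circ z x. dots S K <= 1 then bas x z {K : circ z x. dots S K = 1} else 0)"
  using bas_dots[OF x z S, of "{}"] by (simp only: d0 empty_subsetI circ_commute[of x z] add_0_right)
 also have "... = hrev (if ALL K:circ z x. dots S K <= 1 then bas z x {K : circ z x. dots S K = 1} else 0)" by simp
 finally show ?thesis by (drule_tac arg_cong[where f = hrev]) (simp only: hrev_hrev)
qed

end

context vertical_tangle
begin

definition phi :: "'p set => 'p set" where
 "phi al = al Un mir ` al"

lemma phi_Int_U: "al <= U ==> phi al Int U = al" using mir_bottom by (auto simp: phi_def U_def)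

lemma cm_sub_U: "top_points.cm M ==> al : M ==> al <= U" using partition_onD1[OF top_points.cm_partition] by blast

lemma phi_block: assumes x: "cm x" and al: "al <= U" "al : x" "mir ` al : x" shows "phi al : circ x t"
proof (rule cc_blockI)
 obtain p q where pq: "al = {p, q}" "p : V" "q : V" using cm_arcE[OF x al(2)] by metis
 have phi: "phi al = {p, q, mir p, mir q}" by (auto simp: phi_def pq)
 show "phi al ~= {}" by (simp add: phi)
 show "phi al <= \<Union>(x Un t)" using al(2,3) by (auto simp: phi_def)
 show "W <= phi al" if W: "W : x Un t" "W Int phi al ~= {}" for W
 proof (cases "W : x")
  case True
  obtain e where e: "e : W" "e : al | e : mir ` al" using W(2) by (auto simp: phi_def)
  hence "W = al | W = mir ` al" using cm_unique[OF x True al(2), of e] cm_unique[OF x True al(3), of e] by blast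
  thus ?thesis by (auto simp: phi_def)
 next
  case False
  hence Wt: "W : t" using W by blast
  obtain e where e: "e : W" "e : {p, q, mir p, mir q}" using W(2) phi by blast
  hence "e : {p, mir p} | e : {q, mir q}" by blast
  hence "W = {p, mir p} | W = {q, mir q}"
   using cm_unique[OF t Wt mir[OF pq(2)], of e] cm_unique[OF t Wt mir[OF pq(3)], of e] e(1) by blast
  thus ?thesis by (auto simp: phi)
 qed
 have pc: "conn (x Un t) p e" if "e : phi al" for e
 proof -
  have 1: "conn (x Un t) p q" by (rule conn_step[of al]) (use al pq in auto)
  have 2: "conn (x Un t) p (mir p)" by (rule conn_step[of "{p, mir p}"]) (use mir pq in auto)
  have "conn (x Un t) q (mir q)" by (rule conn_step[of "{q, mir q}"]) (use mir pq in auto)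
  hence 3: "conn (x Un t) p (mir q)" using 1 conn_trans by metis
  show ?thesis using that 1 2 3 unfolding phi by auto
 qed
 show "conn (x Un t) e f" if "e : phi al" "f : phi al" for e f
  using pc[OF that(1)] pc[OF that(2)] conn_trans conn_sym by metis
qed

lemma circ_sym_cm: assumes M: "top_points.cm M" shows "circ (sym_cm M M) t = Q Un phi ` M"
proof -
 let ?x = "sym_cm M M"
 have x: "cm ?x" using sym_cm[OF M M] by simp
 have sub: "Q Un phi ` M <= circ ?x t"
 proof
  fix K assume "K : Q Un phi ` M"
  then consider "K : Q" | al where "al : M" "K = phi al" by blast
  thus "K : circ ?x t"
  proof cases
   case 1
   thus ?thesis using circ_common_arc[OF cm_pm[OF x] cm_pm[OF t]] Qt sym_cm_Q by blast
  next
   case 2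
   have "phi al : circ ?x t" by (rule phi_block[OF x cm_sub_U[OF M 2(1)]]) (use 2 in "auto simp: sym_cm_def")
   thus ?thesis using 2 by simp
  qed
 qed
 have "K : Q Un phi ` M" if K: "K : circ ?x t" for K
 proof -
  obtain p where p: "p : K" using cc_nonempty[OF K] by blast
  have pV: "p : V" using p cc_subset[OF K] pmatch_Union2[OF cm_pm[OF x] cm_pm[OF t]] by blast
  obtain L where L: "L : Q Un phi ` M" "p : L"
  proof -
   obtain q where q: "{p, q} : ?x" using cm_partner[OF x pV] by metis
   then consider "{p, q} : Q" | "{p, q} : M" | al where "al : M" "{p, q} = mir ` al" unfolding sym_cm_def by blast
   thus ?thesis using that phi_def by auto
  qed
  have "K = L" by (rule cc_disjoint[OF K _ p L(2)]) (use L sub in blast)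
  thus ?thesis using L by simp
 qed
 thus ?thesis using sub by blast
qed

lemma phi_notin_Q: "al <= U ==> al ~= {} ==> phi al ~: Q" unfolding phi_def U_def by blast

lemma phi_inj: "al <= U ==> be <= U ==> phi al = phi be ==> al = be" using phi_Int_U by metis

text \<open>As \<open>f\<close> commutes with the merging surgery, the coefficients on both sides of
  the surgery can be compared: they persist if the merged circle is undotted and add up over the two
  circles if it is dotted.\<close>

lemma half_surgery_lookup: assumes f: "lin_on Q t t f" and x: "split_cm x" "Q <= x" and x': "split_cm x'" "Q <= x'"
  and s: "sg x x' p q r s" and K: "K : circ x t" "L : circ x t" "K ~= L" "p : K" "r : L"
  and G: "G <= circ x t" "K ~: G" "L ~: G"
 shows "lookup (f (bas x' t {})) (x', t, G) = lookup (f (bas x t {})) (x, t, G)"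
  and "lookup (f (bas x' t {})) (x', t, insert (K Un L) G) =
   lookup (f (bas x t {})) (x, t, insert K G) + lookup (f (bas x t {})) (x, t, insert L G)"
proof -
 have pmx: "pm x" and pmt: "pm t" using x t cm_pm by auto
 have n: "~ conn (x Un t) p r" using cc_closed[OF K(1,4)] cc_disjoint[OF K(1,2) _ K(5)] K(3) by blast
 have cl: "cls (x Un t) p = K" "cls (x Un t) r = L" using cc_eq_cls[OF K(1,4)] cc_eq_cls[OF K(2,5)] by simp_all
 note sc = surg_circles[OF s pmx pmt n, unfolded cl]
 have b0: "bas x t {} : Fs x t" by (rule Fs_bas) simp
 have "bas x' x {} ** bas x t {} = bas x' t {}" using bas_merge[OF s pmx pmt n, of "{}"] by simp
 hence e: "f (bas x' t {}) = bas x' x {} ** f (bas x t {})" using lin_onD(4)[OF f x x' s b0] by simp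
 have z: "f (bas x t {}) : Fs x t" by (rule lin_onD(2)[OF f x b0])
 have KL: "K Un L ~: G" using G(1) sc(4) by blast
 have G': "G <= circ x' t" "insert (K Un L) G <= circ x' t" using G sc(6) by auto
 have d: "insert (K Un L) G - {K Un L} = G" using KL by blast
 show "lookup (f (bas x' t {})) (x', t, G) = lookup (f (bas x t {})) (x, t, G)"
  unfolding e surg_lookup_merge[OF s pmx pmt n z G'(1), unfolded cl] using KL by simp
 show "lookup (f (bas x' t {})) (x', t, insert (K Un L) G) =
   lookup (f (bas x t {})) (x, t, insert K G) + lookup (f (bas x t {})) (x, t, insert L G)"
  unfolding e surg_lookup_merge[OF s pmx pmt n z G'(2), unfolded cl] d by simp
qed

lemma mir_parity: "p : V ==> even (pos (mir p)) ~= even (pos p)" using cm_parity[OF t mir] by blast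

text \<open>The surgery on the top half of the first symmetric closure and the reflected surgery on
  the bottom half of the second lead to the same mixed closure, and both merge two circles. Equating
  coefficients there gives the two hypotheses of \<open>dotted_functional\<close>.\<close>

lemma sym_value_relations: assumes f: "lin_on Q t t f" and R: "R <= Q"
  and lt: "pos a < pos b" "pos b < pos c" "pos c < pos d" and E: "E <= B"
  and new: "{a, b} ~: B" "{c, d} ~: B" "{a, d} ~: B" "{b, c} ~: B"
  and M: "top_points.cm (B Un {{a, b}, {c, d}})" and M': "top_points.cm (B Un {{a, d}, {b, c}})"
 defines "val \<equiv> %M E. lookup (f (bas (sym_cm M M) t {})) (sym_cm M M, t, R Un phi ` E)"
 shows "val (B Un {{a, b}, {c, d}}) E = val (B Un {{a, d}, {b, c}}) E"
  and "val (B Un {{a, b}, {c, d}}) (insert {a, b} E) + val (B Un {{a, b}, {c, d}}) (insert {c, d} E) =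
   val (B Un {{a, d}, {b, c}}) (insert {a, d} E) + val (B Un {{a, d}, {b, c}}) (insert {b, c} E)"
proof -
 let ?M = "B Un {{a, b}, {c, d}}" and ?M' = "B Un {{a, d}, {b, c}}"
 let ?x0 = "sym_cm ?M ?M" and ?x1 = "sym_cm ?M' ?M" and ?x2 = "sym_cm ?M' ?M'"
 have U: "a : U" "b : U" "c : U" "d : U" using top_points.cm_in_W[OF M, of a b] top_points.cm_in_W[OF M, of c d] by auto
 have UV: "e : V" if "e : U" for e using that U_V by blast
 have x: "split_cm ?x0" "split_cm ?x1" "split_cm ?x2" by (rule sym_cm[OF M M] sym_cm[OF M' M] sym_cm[OF M' M'])+
 have Qs: "Q <= ?x0" "Q <= ?x1" "Q <= ?x2" by (rule sym_cm_Q)+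
 have arcs: "{a, b} : ?x0" "{c, d} : ?x0" "{a, d} : ?x2" unfolding sym_cm_def by auto
 have par: "even (pos a) ~= even (pos b)" "even (pos c) ~= even (pos d)" "even (pos a) ~= even (pos d)"
  using cm_parity[OF conjunct1[OF x(1)] arcs(1)] cm_parity[OF conjunct1[OF x(1)] arcs(2)]
   cm_parity[OF conjunct1[OF x(3)] arcs(3)] by blast+
 have dist: "a ~= b" "a ~= c" "a ~= d" "b ~= c" "b ~= d" "c ~= d" using lt by auto
 have UQ: "al ~: Q" if "e : al" "e : U" for al e using that unfolding U_def by blast
 have Um: "al ~: (`) mir ` MM" if "e : al" "e : U" "top_points.cm MM" for al e MM
 proof
  assume "al : (`) mir ` MM"
  then obtain be where be: "be : MM" "al = mir ` be" by blast
  hence "be <= U" using cm_sub_U that(3) by blast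
  thus False using be that(1,2) mir_bottom by (auto simp: U_def)
 qed
 have x1a: "?x1 = ?x0 - {{a, b}, {c, d}} Un {{a, d}, {b, c}}"
 proof -
  have "{a, b} ~: Q" "{c, d} ~: Q" "{a, b} ~: (`) mir ` ?M" "{c, d} ~: (`) mir ` ?M"
   using UQ[of a] UQ[of c] Um[of a _ ?M] Um[of c _ ?M] U M by auto
  thus ?thesis using new unfolding sym_cm_def by blast
 qed
 \<comment> \<open>Either \<open>a\<close> and \<open>c\<close> or \<open>b\<close> and
   \<open>d\<close> are the coloured points; in the second case both arcs are read
   backwards.\<close>
 obtain p q r s where s0: "sg ?x0 ?x1 p q r s" "p : {a, b}" "r : {c, d}"
 proof (cases "even (pos a)")
  case True
  hence "sg ?x0 ?x1 a b c d" unfolding surg_def using arcs par dist x1a by (auto simp: insert_commute)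
  thus ?thesis using that by blast
 next
  case False
  hence "sg ?x0 ?x1 b a d c" unfolding surg_def using arcs par dist x1a by (auto simp: insert_commute)
  thus ?thesis using that by blast
 qed
 have m4: "mir a ~= mir b" "mir a ~= mir c" "mir a ~= mir d" "mir b ~= mir c" "mir b ~= mir d" "mir c ~= mir d"
  using dist inj_onD[OF mir_inj] U by metis+
 have mV: "mir e ~: U" "mir e ~: \<Union>Q" if "e : U" for e
 proof -
  show "mir e ~: U" using mir_bottom[OF that] unfolding U_def by simp
  have "e : V & e ~: \<Union>Q" using that unfolding U_def by simp
  thus "mir e ~: \<Union>Q" using mir_notin_Q[of e] by simp
 qed
 have x1b: "?x1 = ?x2 - {{mir a, mir d}, {mir b, mir c}} Un {{mir a, mir b}, {mir c, mir d}}"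
 proof -
  have ad: "{mir a, mir d} ~: Q" "{mir b, mir c} ~: Q" "{mir a, mir d} ~: ?M'" "{mir b, mir c} ~: ?M'"
  proof -
   have nQ: "{e, g} ~: Q" if "e ~: \<Union>Q" for e g using that by (meson UnionI insertI1)
   have nM: "{e, g} ~: ?M'" if "e ~: U" for e g using that cm_sub_U[OF M', of "{e, g}"] by (meson insert_subset)
   show "{mir a, mir d} ~: Q" "{mir b, mir c} ~: Q" "{mir a, mir d} ~: ?M'" "{mir b, mir c} ~: ?M'"
    using nQ[OF mV(2)[OF U(1)]] nQ[OF mV(2)[OF U(2)]] nM[OF mV(1)[OF U(1)]] nM[OF mV(1)[OF U(2)]] by simp_all
  qed
  have cmN: "mir ` {a, d} ~: (`) mir ` B" "mir ` {b, c} ~: (`) mir ` B"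
  proof -
   have NU: "be <= U" if "be : B" for be using that cm_sub_U[OF M, of be] by blast
   have nn: "mir ` {e, g} ~: (`) mir ` B" if h: "{e, g} ~: B" "e : U" "g : U" for e g
   proof
    assume "mir ` {e, g} : (`) mir ` B"
    thus False
    proof (rule imageE)
     fix be assume be: "mir ` {e, g} = mir ` be" "be : B"
     hence "{e, g} = be" using inj_on_image_eq_iff[OF mir_inj, of "{e, g}" be] NU h(2,3) by simp
     thus False using be(2) h(1) by simp
    qed
   qed
   show "mir ` {a, d} ~: (`) mir ` B" by (rule nn[OF new(3) U(1,4)])
   show "mir ` {b, c} ~: (`) mir ` B" by (rule nn[OF new(4) U(2,3)])
  qed
  have "(`) mir ` ?M' = (`) mir ` B Un {{mir a, mir d}, {mir b, mir c}}"
   "(`) mir ` ?M = (`) mir ` B Un {{mir a, mir b}, {mir c, mir d}}" by auto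
  thus ?thesis using ad cmN unfolding sym_cm_def by auto
 qed
 have marcs: "{mir a, mir d} : ?x2" "{mir b, mir c} : ?x2" unfolding sym_cm_def by auto
 have mpar: "even (pos (mir e)) ~= even (pos e)" if "e : U" for e using mir_parity[OF UV[OF that]] .
 obtain p' q' r' s' where s2: "sg ?x2 ?x1 p' q' r' s'" "p' : {mir a, mir d}" "r' : {mir b, mir c}"
 proof (cases "even (pos a)")
  case True
  hence "sg ?x2 ?x1 (mir d) (mir a) (mir b) (mir c)"
   unfolding surg_def using marcs par mpar[OF U(1)] mpar[OF U(2)] mpar[OF U(3)] mpar[OF U(4)] m4 x1b
   by (auto simp: insert_commute)
  thus ?thesis using that by blast
 next
  case False
  hence "sg ?x2 ?x1 (mir a) (mir d) (mir c) (mir b)"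
   unfolding surg_def using marcs par mpar[OF U(1)] mpar[OF U(2)] mpar[OF U(3)] mpar[OF U(4)] m4 x1b
   by (auto simp: insert_commute)
  thus ?thesis using that by blast
 qed
 have c0: "circ ?x0 t = Q Un phi ` ?M" and c2: "circ ?x2 t = Q Un phi ` ?M'"
  by (rule circ_sym_cm[OF M] circ_sym_cm[OF M'])+
 have NU: "be <= U" if "be : B" for be using that cm_sub_U[OF M, of be] by blast
 let ?G = "R Un phi ` E"
 have notG: "phi {e, g} ~: ?G" if "{e, g} ~: B" "e : U" "g : U" for e g
 proof
  assume "phi {e, g} : ?G"
  then consider "phi {e, g} : Q" | be where "be : B" "phi {e, g} = phi be" using R E by blast
  thus False
  proof cases
   case 1
   thus ?thesis using phi_notin_Q[of "{e, g}"] that by simp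
  next
   case 2
   hence "{e, g} = be" using phi_inj[of "{e, g}" be] NU that by simp
   thus ?thesis using 2 that by simp
  qed
 qed
 have pne: "phi {a, b} ~= phi {c, d}" "phi {a, d} ~= phi {b, c}"
  using phi_inj[of "{a, b}" "{c, d}"] phi_inj[of "{a, d}" "{b, c}"] U dist by (auto simp: doubleton_eq_iff)
 have G0: "?G <= circ ?x0 t" "?G <= circ ?x2 t" unfolding c0 c2 using R E by auto
 note h0 = half_surgery_lookup[OF f x(1) Qs(1) x(2) Qs(2) s0(1), of "phi {a, b}" "phi {c, d}" ?G]
 note h2 = half_surgery_lookup[OF f x(3) Qs(3) x(2) Qs(2) s2(1), of "phi {a, d}" "phi {b, c}" ?G]
 have mem0: "phi {a, b} : circ ?x0 t" "phi {c, d} : circ ?x0 t" "p : phi {a, b}" "r : phi {c, d}"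
  using s0(2,3) unfolding c0 by (auto simp: phi_def)
 have mem2: "phi {a, d} : circ ?x2 t" "phi {b, c} : circ ?x2 t" "p' : phi {a, d}" "r' : phi {b, c}"
  using s2(2,3) unfolding c2 by (auto simp: phi_def)
 have un: "phi {a, b} Un phi {c, d} = phi {a, d} Un phi {b, c}" by (auto simp: phi_def)
 show "val ?M E = val ?M' E" unfolding val_def
  using h0(1)[OF mem0(1,2) pne(1) mem0(3,4) G0(1) notG notG] h2(1)[OF mem2(1,2) pne(2) mem2(3,4) G0(2) notG notG]
   new U by simp
 have ins: "R Un phi ` insert al E = insert (phi al) ?G" for al by auto
 show "val ?M (insert {a, b} E) + val ?M (insert {c, d} E) = val ?M' (insert {a, d} E) + val ?M' (insert {b, c} E)"
  unfolding val_def ins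
  using h0(2)[OF mem0(1,2) pne(1) mem0(3,4) G0(1) notG notG] h2(2)[OF mem2(1,2) pne(2) mem2(3,4) G0(2) notG notG]
   new U un by simp
qed

lemma dots_strands: assumes M: "top_points.cm M" and R: "R <= Q" and S: "S <= U"
 defines "T \<equiv> R Un (%w. {w, mir w}) ` S"
 shows "ka : Q ==> dots T ka = (if ka : R then 1 else 0)" and "al : M ==> dots T (phi al) = card (S Int al)"
proof -
 have tne: "be ~= {}" if "be : t" for be using that partition_onD3[OF cm_partition[OF t]] by blast
 show "dots T ka = (if ka : R then 1 else 0)" if ka: "ka : Q"
 proof -
  have "be = ka" if be: "be : T" "be <= ka" for be
  proof (cases "be : R")
   case True
   then obtain e where "e : be" using tne[of be] R Qt by blast
   thus ?thesis using cm_unique[OF t, of be ka e] True be R Qt ka by blast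
  next
   case False
   then obtain w where "w : S" "be = {w, mir w}" using be T_def by blast
   thus ?thesis using be(2) ka S by (auto simp: U_def)
  qed
  hence "{c : T. c <= ka} = (if ka : T then {ka} else {})" by auto
  moreover have "ka : T \<longleftrightarrow> ka : R" using ka S unfolding T_def U_def by blast
  ultimately show ?thesis by (simp add: dots_def)
 qed
 show "dots T (phi al) = card (S Int al)" if al: "al : M"
 proof -
  have alU: "al <= U" by (rule cm_sub_U[OF M al])
  have disj: "\<Union>Q Int phi al = {}" using alU mir_notin_Q by (auto simp: phi_def U_def)
  have "{c : T. c <= phi al} = (%w. {w, mir w}) ` (S Int al)"
  proof
   show "{c : T. c <= phi al} <= (%w. {w, mir w}) ` (S Int al)"
   proof clarify
    fix be assume be: "be : T" "be <= phi al"
    have "be ~: R" using tne be Qt disj assms by blast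
    then obtain w where w: "w : S" "be = {w, mir w}" using be T_def by blast
    hence "w : phi al Int U" using be(2) S by blast
    hence "w : al" using phi_Int_U[OF alU] by blast
    thus "be : (%w. {w, mir w}) ` (S Int al)" using w by blast
   qed
   show "(%w. {w, mir w}) ` (S Int al) <= {c : T. c <= phi al}" unfolding T_def phi_def by blast
  qed
  moreover have "inj_on (%w. {w, mir w}) (S Int al)"
  proof (rule inj_onI)
   fix v w assume "v : S Int al" "w : S Int al" "{v, mir v} = {w, mir w}"
   thus "v = w" using mir_bottom[of v] mir_bottom[of w] S by (auto simp: doubleton_eq_iff U_def)
  qed
  ultimately show ?thesis by (simp add: dots_def card_image)
 qed
qed

text \<open>A dot on the strand at \<open>w\<close> slides to the circle of the arc through
  \<open>w\<close>. One dot on the circles in \<open>E\<close> and none on the others is exactly the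
  condition that defines \<open>choices\<close>.\<close>

lemma sym_hmul_strands:
 assumes M: "top_points.cm M" and R: "R <= Q" and S: "S <= U" and R': "R' <= Q" and E: "E <= M"
 shows "lookup (bas (sym_cm M M) t {} ** bas t t (R Un (%w. {w, mir w}) ` S)) (sym_cm M M, t, R' Un phi ` E) =
  (if R = R' & S : top_points.choices M E then 1 else 0)"
proof -
 let ?x = "sym_cm M M" and ?T = "R Un (%w. {w, mir w}) ` S"
 have x: "pm ?x" "pm t" using sym_cm[OF M M] t cm_pm by auto
 have T: "?T <= t" using R Qt S mir U_V by blast
 note ds = dots_strands[OF M R S]
 have c: "circ ?x t = Q Un phi ` M" by (rule circ_sym_cm[OF M])
 have Mne: "al ~= {}" "al <= U" if "al : M" for al
  using that partition_onD3[OF top_points.cm_partition[OF M]] cm_sub_U[OF M] by blast+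
 have inP: "phi al : R' Un phi ` E \<longleftrightarrow> al : E" if "al : M" for al
 proof -
  have "phi al ~: R'" using phi_notin_Q[OF Mne(2)[OF that] Mne(1)[OF that]] R' by blast
  moreover have "phi al : phi ` E ==> al : E" using phi_inj[OF Mne(2)[OF that]] Mne(2) E by blast
  ultimately show ?thesis by blast
 qed
 have inQ: "ka : R' Un phi ` E \<longleftrightarrow> ka : R'" if "ka : Q" for ka
  using that E phi_notin_Q Mne by blast
 have eq: "R' Un phi ` E = {K : circ ?x t. dots ?T K = 1} \<longleftrightarrow>
  (ALL K:circ ?x t. K : R' Un phi ` E \<longleftrightarrow> dots ?T K = 1)"
 proof -
  have "R' Un phi ` E <= circ ?x t" unfolding c using R' E by blast
  thus ?thesis by blast
 qed
 have "(ALL K:circ ?x t. dots ?T K <= 1) & R' Un phi ` E = {K : circ ?x t. dots ?T K = 1} \<longleftrightarrow>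
  (ALL K:circ ?x t. dots ?T K = (if K : R' Un phi ` E then 1 else 0))"
  unfolding eq by (auto simp: le_Suc_eq split: if_splits)
 also have "... \<longleftrightarrow> (ALL ka:Q. dots ?T ka = (if ka : R' then 1 else 0)) &
   (ALL al:M. dots ?T (phi al) = (if al : E then 1 else 0))"
  unfolding c by (simp only: ball_Un ball_simps inP inQ cong: ball_cong)
 also have "... \<longleftrightarrow> R = R' & S : top_points.choices M E"
  using ds top_points.choices_def assms by auto
 finally have iff: "(ALL K:circ ?x t. dots ?T K <= 1) & R' Un phi ` E = {K : circ ?x t. dots ?T K = 1} \<longleftrightarrow>
  R = R' & S : top_points.choices M E" .
 show ?thesis unfolding bas_dots_right[OF x(2,1) T] iff[symmetric] by simp
qed

end

context ordered_points
begin

lemma cm_subset_eq: "cm x ==> cm y ==> x <= y ==> x = y"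
proof
 assume x: "cm x" and y: "cm y" and xy: "x <= y"
 show "y <= x"
 proof
  fix al assume al: "al : y"
  obtain p q where pq: "al = {p, q}" "p : W" using cm_arcE[OF y al] by metis
  obtain r where r: "{p, r} : x" using cm_partner[OF x pq(2)] by metis
  hence "al = {p, r}" using cm_unique[OF y al, of "{p, r}" p] pq xy by blast
  thus "al : x" using r by simp
 qed
qed

end

context vertical_tangle
begin

text \<open>For each set \<open>R\<close> of dotted arcs of \<open>Q\<close>, the coefficients of
  the values of \<open>f\<close> form a functional as in \<open>dotted_functional\<close>. Its
  solution prescribes the coefficients of the dots on strands of \<open>t\<close> that make up
  \<open>y\<close>.\<close>

lemma lin_on_symmetric: assumes f: "lin_on Q t t f"
 obtains y where "y : Fs t t"
  "ALL M. top_points.cm M --> f (bas (sym_cm M M) t {}) = bas (sym_cm M M) t {} ** y"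
proof -
 have "EX p. ALL M E. top_points.cm M --> E <= M -->
   lookup (f (bas (sym_cm M M) t {})) (sym_cm M M, t, R Un phi ` E) = sum p (top_points.choices M E)"
  if "R : Pow Q" for R by (rule top_points.dotted_functional; rule sym_value_relations[OF f]) (use that in auto)
 hence "ALL R:Pow Q. EX p. ALL M E. top_points.cm M --> E <= M -->
   lookup (f (bas (sym_cm M M) t {})) (sym_cm M M, t, R Un phi ` E) = sum p (top_points.choices M E)"
  by (rule ballI)
 then obtain P where P: "ALL R:Pow Q. ALL M E. top_points.cm M --> E <= M -->
   lookup (f (bas (sym_cm M M) t {})) (sym_cm M M, t, R Un phi ` E) = sum (P R) (top_points.choices M E)"
  by (rule bchoice[THEN exE])
 have fin: "finite (Pow Q)" "finite (Pow U)"
  using finite_subset[OF Qt finite_elements[OF finV cm_partition[OF t]]] top_points.finite_W by simp_all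
 define T where "T R S = R Un (%w. {w, mir w}) ` S" for R S
 define y where "y = (SUM R:Pow Q. SUM S:Pow U. frag_cmul (P R S) (bas t t (T R S)))"
 have Tt: "T R S <= circ t t" if "R : Pow Q" "S : Pow U" for R S
  using that Qt mir U_V circ_self[OF cm_pm[OF t]] unfolding T_def by auto
 have y: "y : Fs t t" unfolding y_def by (intro Fs_sum Fs_cmul Fs_bas Tt)
 have "f (bas (sym_cm M M) t {}) = bas (sym_cm M M) t {} ** y" if M: "top_points.cm M" for M
 proof (rule Fs_lookup_eqI)
  let ?x = "sym_cm M M"
  have x: "split_cm ?x" "Q <= ?x" using sym_cm[OF M M] sym_cm_Q by auto
  have b: "bas ?x t {} : Fs ?x t" by (rule Fs_bas) simp
  show "f (bas ?x t {}) : Fs ?x t" by (rule lin_onD(2)[OF f x b])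
  show "bas ?x t {} ** y : Fs ?x t" by (rule Fs_hmul[OF b y])
  fix D assume D: "D <= circ ?x t"
  define R' where "R' = D Int Q"
  define E where "E = {al : M. phi al : D}"
  have "D = R' Un phi ` E" using D unfolding circ_sym_cm[OF M] R'_def E_def by blast
  have R': "R' <= Q" and E: "E <= M" by (auto simp: R'_def E_def)
  have "lookup (bas ?x t {} ** y) (?x, t, R' Un phi ` E) =
   (SUM R:Pow Q. SUM S:Pow U. P R S * (if R = R' & S : top_points.choices M E then 1 else 0))"
   unfolding y_def hmul_simps lookup_sum lookup_frag_cmul
   by (intro sum.cong refl arg_cong2[where f = "(*)"]) (use sym_hmul_strands[OF M _ _ R' E] in "simp add: T_def")
  also have "... = (SUM R:Pow Q. if R = R' then (SUM S:Pow U. if S : top_points.choices M E then P R S else 0) else 0)"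
   by (intro sum.cong refl) (simp add: if_distrib cong: if_cong)
  also have "... = (SUM S:Pow U. if S : top_points.choices M E then P R' S else 0)"
   using R' fin by (simp add: sum.delta)
  also have "... = sum (P R') (Pow U Int top_points.choices M E)" using fin by (simp add: sum.inter_restrict)
  also have "Pow U Int top_points.choices M E = top_points.choices M E" by (auto simp: top_points.choices_def)
  also have "sum (P R') (top_points.choices M E) = lookup (f (bas ?x t {})) (?x, t, R' Un phi ` E)"
   using P R' M E by simp
  finally show "lookup (f (bas ?x t {})) (?x, t, D) = lookup (bas ?x t {} ** y) (?x, t, D)"
   unfolding \<open>D = R' Un phi ` E\<close> by simp
 qed
 thus ?thesis using that[OF y] by blast
qed

lemma top_arcs: assumes x: "split_cm x" "Q <= x" shows "top_points.cm {al : x. al <= U}"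
 unfolding crossingless_on_def
proof (intro conjI ballI impI)
 have xc: "cm x" using x(1) by simp
 have arc: "EX q. {p, q} : x & {p, q} <= U" if p: "p : U" for p
 proof -
  obtain q where q: "{p, q} : x" "q : V" using cm_partner[OF xc U_V[OF p]] by metis
  have "top q" using x(1) q(1) p by (auto simp: hor_def U_def)
  moreover have "q ~: \<Union>Q"
  proof
   assume "q : \<Union>Q"
   then obtain be where be: "be : Q" "q : be" by (rule UnionE)
   hence "be = {p, q}" using cm_unique[OF xc, of be "{p, q}" q] q x(2) by blast
   thus False using be(1) p by (simp add: U_def) (metis insertI1)
  qed
  ultimately show ?thesis using q p by (auto simp: U_def)
 qed
 show "partition_on U {al : x. al <= U}"
 proof (rule partition_onI)
  show "\<Union>{al : x. al <= U} = U" using arc by fastforce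
  show "{} ~: {al : x. al <= U}" using partition_onD3[OF cm_partition[OF xc]] by simp
  show "disjnt al be" if "al : {al : x. al <= U}" "be : {al : x. al <= U}" "al ~= be" for al be
   using disjointD[OF partition_onD2[OF cm_partition[OF xc]], of al be] that by (simp add: disjnt_def)
 qed
 show "card al = 2" if "al : {al : x. al <= U}" for al using that xc by (simp add: crossingless_on_def)
 show "~ ({p, r} : {al : x. al <= U} & {q, s} : {al : x. al <= U})"
  if "p : U" "q : U" "r : U" "s : U" "pos p < pos q & pos q < pos r & pos r < pos s" for p q r s
 proof -
  have "p : V" "q : V" "r : V" "s : V" using that U_V by auto
  hence "~ ({p, r} : x & {q, s} : x)" using xc that(5) unfolding crossingless_on_def by blast
  thus ?thesis by blast
 qed
qed

text \<open>Surgeries on the bottom half create the reflections of the arcs of \<open>M\<close> one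
  after the other. Each of them completes a circle \<open>phi al\<close>, so undoing it merges two
  circles and carries the undotted element, and with it the formula, back to
  \<open>x\<close>.\<close>

lemma lin_on_from_symmetric: assumes f: "lin_on Q t t f" and M: "top_points.cm M"
  and base: "f (bas (sym_cm M M) t {}) = bas (sym_cm M M) t {} ** y" and x: "split_cm x" "Q <= x" "M <= x"
 shows "f (bas x t {}) = bas x t {} ** y" using x
proof (induction "card (sym_cm M M - x)" arbitrary: x rule: less_induct)
 case less
 let ?s = "sym_cm M M"
 have s: "cm ?s" "hor ?s" using sym_cm[OF M M] by auto
 have xc: "cm x" using less.prems(1) by simp
 show ?case
 proof (cases "?s <= x")
  case True
  thus ?thesis using cm_subset_eq[OF s(1) xc] base by simp
 next
  case False
  have A: "?s Int x <= ?s" "?s - x <= ?s - ?s Int x" "?s - x ~= {}" using False by blast+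
  have inner: "{p, q} : ?s Int x Un (?s - x)" if "{p, q} : ?s" for p q using that by blast
  obtain u v where uv: "{u, v} : ?s - x" "even (pos u)" "odd (pos v)" "u : V" "v : V" "gap (?s Int x) u v"
   using gap_exists[OF s(1) A inner] .
  have uvs: "{u, v} : ?s" "{u, v} ~: x" using uv(1) by auto
  obtain al where al: "al : M" "{u, v} = mir ` al" using uvs less.prems(2,3) unfolding sym_cm_def by blast
  have alU: "al <= U" by (rule cm_sub_U[OF M al(1)])
  have bot: "~ top u" "~ top v" using mir_bottom al(2) alU by (metis imageE insertCI subsetD)+
  obtain x' b w where x': "sg x x' u b w v" "sg x' x u v w b" "cm x'" "insert {u, v} (?s Int x) <= x'"
   "{u, b} : x" "{w, v} : x" "x' = x - {{u, b}, {w, v}} Un {{u, v}, {w, b}}"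
   using gap_surgery[OF xc _ uv(6,4,5,2,3) uvs(2)] by (metis inf_le2)
  have sx': "split_cm x'" by (rule split_surgery[OF less.prems(1) x'(3,5-7)]) (simp add: bot)
  have Qx': "Q <= x'" "M <= x'" using less.prems(2,3) x'(4) unfolding sym_cm_def by blast+
  have fs: "finite ?s" by (rule finite_elements[OF finV cm_partition[OF s(1)]])
  have "card (?s - x') < card (?s - x)"
  proof (rule psubset_card_mono)
   show "finite (?s - x)" using fs by simp
   show "?s - x' \<subset> ?s - x" using uvs x'(4) by blast
  qed
  hence IH: "f (bas x' t {}) = bas x' t {} ** y" using less.hyps sx' Qx' by simp
  have ph: "phi al : circ x' t" by (rule phi_block[OF x'(3) alU]) (use al x'(4) Qx' in auto)
  have uph: "u : phi al" unfolding phi_def using al(2) by blast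
  have wtop: "~ top w" using less.prems(1) x'(6) bot by (auto simp: hor_def)
  have wn: "w ~= u" "w ~= v" using x'(2) by (auto simp: surg_def)
  have "w ~: phi al" unfolding phi_def al(2)[symmetric] using wtop wn alU by (auto simp: U_def)
  hence n: "~ conn (x' Un t) u w" using cc_closed[OF ph uph] by metis
  have e: "bas x t {} = bas x x' {} ** bas x' t {}"
   using bas_merge[OF x'(2) cm_pm[OF x'(3)] cm_pm[OF t] n, of "{}"] by simp
  have "f (bas x t {}) = bas x x' {} ** f (bas x' t {})"
   unfolding e by (rule lin_onD(4)[OF f sx' Qx'(1) less.prems(1,2) x'(2) Fs_bas]) simp
  also have "... = bas x t {} ** y" unfolding e IH by (simp add: hmul_assoc)
  finally show ?thesis .
 qed
qed

theorem centralized_vertical: assumes f: "lin_on Q t t f" shows "centralized Q t t f"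
proof -
 obtain y where y: "y : Fs t t"
  "ALL M. top_points.cm M --> f (bas (sym_cm M M) t {}) = bas (sym_cm M M) t {} ** y"
  using lin_on_symmetric[OF f] .
 show ?thesis
 proof (rule centralizedI[OF y(1)])
  fix x w assume x: "split_cm x" "Q <= x" "w : Fs x t"
  have "f (bas x t {}) = bas x t {} ** y"
   by (rule lin_on_from_symmetric[OF f top_arcs[OF x(1,2)] _ x(1,2)]) (use y(2) top_arcs[OF x(1,2)] in auto)
  thus "f w = w ** y" by (rule lin_on_by_dots[OF f x(1,2) t _ x(3)])
 qed
qed

end

section \<open>Uniqueness of the vertical tangle and the induction over arcs\<close>

context planar_points
begin

text \<open>Both maps are order-reversing bijections between the same finite sets; at the first
  point where they differ, the larger value would already be taken by an earlier point.\<close>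

lemma vertical_mir_eq: assumes t: "vertical_tangle V pos top N t Q" and t': "vertical_tangle V pos top N t' Q"
  and p: "p : vertical_tangle.U V top Q"
 shows "vertical_tangle.mir t p = vertical_tangle.mir t' p"
proof -
 interpret A: vertical_tangle V pos top N t Q by (rule t)
 interpret B: vertical_tangle V pos top N t' Q by (rule t')
 show ?thesis using p
 proof (induction "pos p" arbitrary: p rule: less_induct)
  case less
  have no: "~ pos (vertical_tangle.mir S p) < pos (vertical_tangle.mir S' p)"
   if "vertical_tangle V pos top N S Q" "vertical_tangle V pos top N S' Q"
    and agree: "!!r. pos r < pos p ==> r : A.U ==> vertical_tangle.mir S r = vertical_tangle.mir S' r" for S S'
  proof
   interpret S: vertical_tangle V pos top N S Q by (rule that)
   interpret S': vertical_tangle V pos top N S' Q by (rule that)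
   assume lt: "pos (S.mir p) < pos (S'.mir p)"
   have pV: "p : V" "p ~: \<Union>Q" using less.prems by (simp_all add: A.U_def)
   have m: "S'.mir p : V" "~ top (S'.mir p)" "S'.mir p ~: \<Union>Q"
    using S'.mir_V[OF pV(1)] S'.mir_bottom[OF less.prems] S'.mir_notin_Q[OF pV] by auto
   define r where "r = S.mir (S'.mir p)"
   have r: "r : A.U" "S.mir r = S'.mir p" using S.bottom_is_mir[OF m] by (auto simp: r_def)
   have "pos r < pos p"
   proof (rule ccontr)
    assume "~ pos r < pos p"
    hence "pos p < pos r | p = r" using pos_eq[OF pV(1) A.U_V[OF r(1)]] by linarith
    thus False using S.mir_order[OF less.prems r(1)] r(2) lt by auto
   qed
   hence "S'.mir r = S'.mir p" using agree[OF _ r(1)] r(2) by simp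
   hence "r = p" using inj_onD[OF S'.mir_inj] r(1) less.prems by metis
   thus False using r(2) lt by simp
  qed
  have V: "A.mir p : V" "B.mir p : V" using A.mir_V B.mir_V A.U_V[OF less.prems] by auto
  have "pos (A.mir p) = pos (B.mir p)" using no[OF t t' less.hyps] no[OF t' t less.hyps[symmetric]] by linarith
  thus ?case using pos_eq[OF V] by simp
 qed
qed

lemma vertical_subset: assumes t: "vertical_tangle V pos top N t Q" and t': "vertical_tangle V pos top N t' Q"
 shows "t <= t'"
proof
 interpret A: vertical_tangle V pos top N t Q by (rule t)
 interpret B: vertical_tangle V pos top N t' Q by (rule t')
 fix al assume al: "al : t"
 show "al : t'"
 proof (cases "al : Q")
  case True
  thus ?thesis using B.Qt by blast
 next
  case False
  obtain p q where pq: "al = {p, q}" using cm_arcE[OF A.t al] by metis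
  have pqt: "{p, q} : t" "{q, p} : t" "{p, q} ~: Q" "{q, p} ~: Q" using al False pq by (auto simp: insert_commute)
  have ends: "r : A.U" if "{r, s} : t" "{r, s} ~: Q" "top r" for r s
  proof -
   have "r ~: \<Union>Q"
   proof
    assume "r : \<Union>Q"
    then obtain be where "be : Q" "r : be" by (rule UnionE)
    moreover from this have "be = {r, s}" using cm_unique[OF A.t _ that(1), of be r] A.Qt by blast
    ultimately show False using that(2) by simp
   qed
   thus ?thesis using cm_in_W[OF A.t that(1)] that(3) by (simp add: A.U_def)
  qed
  have main: "{r, s} : t'" if "{r, s} : t" "{r, s} ~: Q" "top r" for r s
   by (metis ends that A.mir_eq vertical_mir_eq B.mir A.U_V assms)
  show ?thesis
  proof (cases "top p")
   case True
   thus ?thesis using main[OF pqt(1,3)] pq by simp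
  next
   case False
   hence "top q" using A.vert[OF pqt(1,3)] by simp
   thus ?thesis using main[OF pqt(2,4)] pq by (simp add: insert_commute)
  qed
 qed
qed

lemma horizontal_gap: assumes t: "cm t" and Q: "Q <= t" and pq: "{p, q} : t" "{p, q} ~: Q" "top p = top q"
 obtains u v where "{u, v} : t" "{u, v} ~: Q" "top u = top v" "even (pos u)" "odd (pos v)" "gap Q u v"
proof -
 define A where "A = {al : t - Q. ALL p:al. ALL q:al. top p = top q}"
 have A: "A <= t - Q" "A ~= {}" using pq by (auto simp: A_def)
 have AD: "{u, v} : t & {u, v} ~: Q & top u = top v" if "{u, v} : A" for u v
  using that unfolding A_def mem_Collect_eq by (intro conjI) (blast, blast, metis insertI1 insertI2)
 have "{r, s} : Q Un A" if "{u, v} : A" "{r, s} : t" "btw u v r" "btw u v s" for u v r s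
 proof -
  have uvt: "{u, v} : t" "top u = top v" using AD[OF that(1)] by blast+
  have V: "u : V" "v : V" "r : V" "s : V" using cm_in_W[OF t uvt(1)] cm_in_W[OF t that(2)] by auto
  have "top r = top u" "top s = top u"
   using btw_top[OF V(1,2,3) uvt(2) that(3)] btw_top[OF V(1,2,4) uvt(2) that(4)] by auto
  hence "ALL p:{r, s}. ALL q:{r, s}. top p = top q" by simp
  thus ?thesis using that(2) unfolding A_def Un_iff Diff_iff mem_Collect_eq by (meson excluded_middle)
 qed
 note inner = this
 obtain u v where uv: "{u, v} : A" "even (pos u)" "odd (pos v)" "u : V" "v : V" "gap Q u v"
  using gap_exists[OF t Q A inner] .
 thus ?thesis using that AD[OF uv(1)] by blast
qed

text \<open>Horizontal arcs of the source are added to \<open>Q\<close> first, then those of the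
  target. When none is left, both tangles are vertical with the same \<open>Q\<close> and therefore
  equal. The measure counts the subsets of \<open>V\<close> outside of \<open>Q\<close>.\<close>

theorem double_centralizer: assumes "cm t" "cm t'" "Q <= t" "Q <= t'" "hor Q" "lin_on Q t t' f"
 shows "centralized Q t t' f" using assms
proof (induction "card (Pow V - Q)" arbitrary: Q t t' f rule: less_induct)
 case less
 note t = less.prems(1,3) and t' = less.prems(2,4)
 have smaller: "card (Pow V - insert {u, v} Q) < card (Pow V - Q)" if "{u, v} ~: Q" "{u, v} <= V" for u v
  by (rule psubset_card_mono) (use that finV in auto)
 have hins: "hor (insert {u, v} Q)" if "top u = top v" for u v
  using less.prems(5) that unfolding hor_def by (auto simp: doubleton_eq_iff)
 show ?case
 proof (cases "EX p q. {p, q} : t & {p, q} ~: Q & top p = top q")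
  case True
  then obtain u v where uv: "{u, v} : t" "{u, v} ~: Q" "top u = top v" "even (pos u)" "odd (pos v)" "gap Q u v"
   using horizontal_gap[OF t] by metis
  have V: "{u, v} <= V" using cm_in_W[OF t(1) uv(1)] by simp
  show ?thesis
  proof (rule centralized_source_arc[OF less.prems(6) t t' uv(1,6,4,5,3)])
   fix t' f assume a: "cm t'" "insert {u, v} Q <= t'" "lin_on (insert {u, v} Q) t t' f"
   show "centralized (insert {u, v} Q) t t' f"
    by (rule less.hyps[OF smaller[OF uv(2) V] t(1) a(1) _ a(2) hins[OF uv(3)] a(3)]) (use uv t in auto)
  qed
 next
  case noh: False
  show ?thesis
  proof (cases "EX p q. {p, q} : t' & {p, q} ~: Q & top p = top q")
   case True
   then obtain u v where uv: "{u, v} : t'" "{u, v} ~: Q" "top u = top v" "even (pos u)" "odd (pos v)" "gap Q u v"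
    using horizontal_gap[OF t'] by metis
   have V: "{u, v} <= V" using cm_in_W[OF t'(1) uv(1)] by simp
   have nt: "{u, v} ~: t" using noh uv by metis
   show ?thesis
   proof (rule centralized_target_arc[OF less.prems(6) t t' uv(1) nt uv(6,4,5,3)])
    fix t f assume a: "cm t" "insert {u, v} Q <= t" "lin_on (insert {u, v} Q) t t' f"
    show "centralized (insert {u, v} Q) t t' f"
     by (rule less.hyps[OF smaller[OF uv(2) V] a(1) t'(1) a(2) _ hins[OF uv(3)] a(3)]) (use uv t' in auto)
   qed
  next
   case False
   have v: "vertical_tangle V pos top N t Q" by unfold_locales (use t less.prems(5) noh in auto)
   have v': "vertical_tangle V pos top N t' Q" by unfold_locales (use t' less.prems(5) False in auto)
   have "t = t'" using vertical_subset[OF v v'] vertical_subset[OF v' v] by simp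
   thus ?thesis using vertical_tangle.centralized_vertical[OF v] less.prems(6) by simp
  qed
 qed
qed

end

section \<open>Values of glued surfaces\<close>

lemma sum_filter_image_mset_set: assumes "finite A"
 shows "(\<Sum>q\<in>#filter_mset P (image_mset f (mset_set A)). g q) = (SUM al:{al : A. P (f al)}. g (f al))"
 using assms by (simp add: filter_mset_image_mset sum_unfold_sum_mset image_mset.compositionality comp_def)

text \<open>The first hypothesis is the Euler characteristic formula free of \<open>div\<close> and
  \<open>nat\<close>. An outgoing circle labelled 1 counts as a dot, as it is closed up by the dual,
  dotted disc.\<close>

lemma component_coeff_ev:
 assumes "2 - ((\<Sum>q\<in>#filter_mset (%q. piece_verts q ~= {} & piece_verts q <= K) Q. piece_euler q) - int (card K))
   - int (card {c : In. c <= K} + card {c : Out. c <= K}) = 2 * int g"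
  and "(\<Sum>q\<in>#filter_mset (%q. piece_verts q ~= {} & piece_verts q <= K) Q. piece_dots q) = k"
 shows "component_coeff Q In Out D E K = ev g (k + card {c : D. c <= K} + card {c : Out - E. c <= K})"
 unfolding component_coeff_def Let_def assms by (simp add: surface_coeff_ev)

lemma cc_eq_family: assumes "F <= ccs VV" "\<Union>VV <= \<Union>F" shows "ccs VV = F"
proof
 show "ccs VV <= F"
 proof
  fix K assume K: "K : ccs VV"
  obtain p where p: "p : K" using cc_nonempty[OF K] by blast
  then obtain L where L: "L : F" "p : L" using cc_subset[OF K] assms(2) by blast
  have "K = L" by (rule cc_disjoint[OF K _ p L(2)]) (use L assms(1) in blast)
  thus "K : F" using L by simp
 qed
qed (rule assms(1))

lemma card_pair_blocks: assumes "finite V" "partition_on V P" "!!al. al : P ==> card al = 2" "K <= V"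
  and "!!al. al : P ==> al Int K ~= {} ==> al <= K"
 shows "card K = 2 * card {al : P. al <= K}"
 using card_blocks[OF finite_elements[OF assms(1,2)] assms(2,5,4,1)] assms(3) by simp

lemma pmatch_card2: "pmatch col V x ==> al : x ==> card al = 2" by (erule pmatch_arcE) (auto simp: card_insert_if)

lemma sum_image_simps [simp]:
 "Inl i : Inl ` A \<longleftrightarrow> i : A" "Inr p : Inr ` B \<longleftrightarrow> p : B" "Inl i ~: Inr ` B" "Inr p ~: Inl ` A"
 by auto

text \<open>
 The surface of the left action (\<open>io = Top\<close>) and, up to renaming, of the right action (\<open>io = Bot\<close>).
\<close>

locale saddle_gluing = marked_points V col for V :: "'p set" and col :: "'p => bool" +
 fixes io :: "'i => 'p" and io' :: "'j => 'p" and d b :: "'i set set" and a :: "'j set set" and T :: "'p set set"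
 assumes inj: "inj io" "inj io'" and disj: "range io Int range io' = {}"
  and px: "pm ((`) io ` d Un (`) io' ` a)" and py: "pm ((`) io ` b Un (`) io' ` a)" and pT: "pm T"
begin

abbreviation (input) "xs \<equiv> (`) io ` d Un (`) io' ` a"
abbreviation (input) "ys \<equiv> (`) io ` b Un (`) io' ` a"

text \<open>The glued surface has a second copy, tagged by \<open>Inl\<close>, of the points on the
  side of the saddles. Its components are those of the three matchings with these copies
  added.\<close>

definition hat :: "'p set => ('i + 'p) set" where
 "hat K = Inl ` {i : \<Union>d. io i : K} Un Inr ` K"

definition fam :: "('i + 'p) set set" where
 "fam = (`) Inl ` d Un (%al. Inl ` al Un Inr ` io ` al) ` b Un (`) Inr ` T Un (%al. Inr ` io' ` al) ` a"

lemma Union_bd: "\<Union>b = \<Union>d"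
proof -
 have "io ` \<Union>d Un io' ` \<Union>a = V" "io ` \<Union>b Un io' ` \<Union>a = V"
  using pmatchD(2)[OF px] pmatchD(2)[OF py] by (simp_all add: image_Union)
 hence "io ` \<Union>b = io ` \<Union>d" using disj by blast
 thus ?thesis using inj(1) by (simp add: inj_image_eq_iff)
qed

lemma V_eq: "V = io ` \<Union>d Un io' ` \<Union>a" using pmatchD(2)[OF px] by (simp add: image_Union)

lemma UT: "\<Union>T = V" by (rule pmatchD(2)[OF pT])

lemma fin: "finite (\<Union>d)" "finite (\<Union>a)" "finite d" "finite b" "finite a" "finite T"
proof -
 show d: "finite (\<Union>d)" "finite (\<Union>a)"
  using finite_V V_eq finite_imageD[of io "\<Union>d"] finite_imageD[of io' "\<Union>a"] inj
  by (metis finite_Un inj_on_subset subset_UNIV)+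
 show "finite d" "finite b" "finite a" using d Union_bd finite_UnionD by metis+
 show "finite T" by (rule pmatch_finite[OF pT finite_V])
qed

lemma Union_fam: "\<Union>fam = Inl ` \<Union>d Un Inr ` V"
proof -
 have "\<Union>fam = Inl ` \<Union>d Un (Inl ` \<Union>b Un Inr ` io ` \<Union>b) Un Inr ` \<Union>T Un Inr ` io' ` \<Union>a"
  unfolding fam_def Union_Un_distrib image_Union by auto
 thus ?thesis unfolding Union_bd UT V_eq image_Un by (simp only: Un_ac Un_absorb Un_left_absorb)
qed

lemma hat_mem: "Inl i : hat K \<longleftrightarrow> i : \<Union>d & io i : K" "Inr p : hat K \<longleftrightarrow> p : K"
 unfolding hat_def Un_iff by simp_all

lemma sub_hat:
 "al <= \<Union>d ==> Inl ` al <= hat K \<longleftrightarrow> io ` al <= K"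
 "Inr ` be <= hat K \<longleftrightarrow> be <= K"
 unfolding image_subset_iff hat_mem by blast+

lemma hat_cc: assumes K: "K : ccs (xs Un ys Un T)" shows "hat K : ccs fam"
proof (rule cc_blockI)
 have KV: "K <= V" using cc_subset[OF K] pmatchD(2)[OF px] pmatchD(2)[OF py] UT by auto
 show "hat K ~= {}" using cc_nonempty[OF K] by (auto simp: hat_def)
 show "hat K <= \<Union>fam" unfolding Union_fam hat_def using KV by blast
 have ab: "A <= K" if "A : xs Un ys Un T" "A Int K ~= {}" for A by (rule cc_absorb[OF K that])
 show "W <= hat K" if W: "W : fam" "W Int hat K ~= {}" for W
 proof -
  obtain w where w: "w : W" "w : hat K" using W(2) by blast
  consider al where "al : d" "W = Inl ` al" | al where "al : b" "W = Inl ` al Un Inr ` io ` al"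
   | al where "al : T" "W = Inr ` al" | al where "al : a" "W = Inr ` io' ` al"
   using W(1) unfolding fam_def Un_iff image_iff by metis
  thus ?thesis
  proof cases
   case 1
   then obtain i where "i : al" "io i : K" using w hat_mem by blast
   hence "io ` al <= K" by (intro ab) (use 1(1) in blast)+
   moreover have "al <= \<Union>d" using 1(1) by (rule Union_upper)
   ultimately show ?thesis unfolding 1(2) by (simp only: sub_hat)
  next
   case 2
   then obtain i where "i : al" "io i : K" using w hat_mem by blast
   hence "io ` al <= K" by (intro ab) (use 2(1) in blast)+
   moreover have "al <= \<Union>d" using 2(1) unfolding Union_bd[symmetric] by (rule Union_upper)
   ultimately show ?thesis unfolding 2(2) by (simp only: sub_hat Un_least)
  next
   case 3
   then obtain p where "p : al" "p : K" using w hat_mem by blast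
   hence "al <= K" by (intro ab) (use 3(1) in blast)+
   thus ?thesis unfolding 3(2) by (simp only: sub_hat)
  next
   case 4
   then obtain i where "i : al" "io' i : K" using w hat_mem by blast
   hence "io' ` al <= K" by (intro ab) (use 4(1) in blast)+
   thus ?thesis unfolding 4(2) by (simp only: sub_hat)
  qed
 qed
 have lr: "conn fam (Inl i) (Inr (io i))" if i: "i : \<Union>d" for i
 proof -
  obtain al where "al : b" "i : al" using i Union_bd by blast
  thus ?thesis by (intro conn_step[of "Inl ` al Un Inr ` io ` al"]) (auto simp: fam_def)
 qed
 have arcstep: "conn fam (Inr p) (Inr q)" if A: "A : xs Un ys Un T" "p : A" "q : A" for A p q
 proof -
  consider al where "al : d" "A = io ` al" | al where "al : b" "A = io ` al" | al where "al : a" "A = io' ` al" | "A : T"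
   using A(1) unfolding Un_iff image_iff by metis
  thus ?thesis
  proof cases
   case 1
   then obtain i j where ij: "i : al" "j : al" "p = io i" "q = io j" using A by blast
   have "conn fam (Inl i) (Inl j)" by (rule conn_step[of "Inl ` al"]) (use 1 ij in "auto simp: fam_def")
   moreover have "conn fam (Inl i) (Inr p)" "conn fam (Inl j) (Inr q)" using lr[of i] lr[of j] ij 1(1) by auto
   ultimately show ?thesis using conn_sym conn_trans by metis
  next
   case 2
   thus ?thesis using A by (intro conn_step[of "Inl ` al Un Inr ` io ` al"]) (auto simp: fam_def)
  next
   case 3
   thus ?thesis using A by (intro conn_step[of "Inr ` io' ` al"]) (auto simp: fam_def)
  next
   case 4
   thus ?thesis using A by (intro conn_step[of "Inr ` A"]) (auto simp: fam_def)
  qed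
 qed
 have lift: "conn fam (Inr p) (Inr q)" if "conn (xs Un ys Un T) p q" for p q using that
 proof (induction rule: conn_induct)
  case (step q r A)
  show ?case by (rule conn_trans[OF step.IH arcstep[OF step.hyps(2-4)]])
 qed simp
 have rep: "EX p:K. conn fam v (Inr p)" if "v : hat K" for v
 proof (cases v)
  case (Inl i)
  thus ?thesis using that lr[of i] hat_mem(1)[of i K] by metis
 next
  case (Inr p)
  thus ?thesis using that hat_mem(2)[of p K] conn_refl[of fam "Inr p"] by metis
 qed
 show "conn fam v w" if vw: "v : hat K" "w : hat K" for v w
 proof -
  obtain p q where pq: "p : K" "q : K" "conn fam v (Inr p)" "conn fam w (Inr q)"
   using rep[OF vw(1)] rep[OF vw(2)] by blast
  show ?thesis using lift[OF cc_conn[OF K pq(1,2)]] pq(3,4) conn_trans conn_sym by metis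
 qed
qed

lemma cc_fam: "ccs fam = hat ` ccs (xs Un ys Un T)"
proof (rule cc_eq_family)
 have UK: "\<Union>(ccs (xs Un ys Un T)) = V" using pmatchD(2)[OF px] pmatchD(2)[OF py] UT by simp
 show "\<Union>fam <= \<Union>(hat ` ccs (xs Un ys Un T))"
 proof
  fix v assume v: "v : \<Union>fam"
  define p where "p = case_sum io id v"
  have "p : V" using v unfolding Union_fam p_def by (auto simp: V_eq)
  then obtain K where K: "K : ccs (xs Un ys Un T)" "p : K" using UK by blast
  have "v : hat K" using v K(2) unfolding Union_fam p_def hat_def by auto
  thus "v : \<Union>(hat ` ccs (xs Un ys Un T))" using K(1) by blast
 qed
qed (use hat_cc in blast)

lemma hat_inj: "inj_on hat A" by (rule inj_on_inverseI[of _ "%H. {p. Inr p : H}"]) (auto simp: hat_def)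

text \<open>The arcs of \<open>a\<close> are shared by both matchings and form circles of their own.
  They are undotted discs in \<open>theta\<close> which do not occur as incoming circles of the
  action.\<close>

lemma circ_xy: "circ xs ys = (`) io ` circ d b Un (`) io' ` a"
proof -
 have i: "inj_on io A" "inj_on io' B" for A B using inj inj_on_subset by blast+
 have pa: "partition_on (io' ` \<Union>a) ((`) io' ` a)"
 proof (rule partition_onI)
  show "\<Union>((`) io' ` a) = io' ` \<Union>a" by (simp add: image_Union)
  show "{} ~: (`) io' ` a" using partition_onD3[OF pmatchD(1)[OF px]] by blast
  show "disjnt al be" if "al : (`) io' ` a" "be : (`) io' ` a" "al ~= be" for al be
   by (rule pmatch_disjoint[OF px]) (use that in auto)
 qed
 have "xs Un ys = (`) io ` (d Un b) Un (`) io' ` a" by auto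
 moreover have "ccs ((`) io ` (d Un b) Un (`) io' ` a)
   = ccs ((`) io ` (d Un b)) Un ccs ((`) io' ` a)"
  by (rule cc_disjoint_Un) (use disj in auto)
 ultimately show ?thesis using cc_image_inj[OF i(1), of "d Un b"] cc_partition_id[OF pa] by simp
qed

lemma card_image_inj: "inj f ==> card {c : (`) f ` A. P c} = card {c : A. P (f ` c)}"
proof -
 assume f: "inj f"
 have "{c : (`) f ` A. P c} = (`) f ` {c : A. P (f ` c)}" by auto
 moreover have "inj_on ((`) f) {c : A. P (f ` c)}" using f by (auto intro!: inj_onI simp: inj_image_eq_iff)
 ultimately show ?thesis by (simp add: card_image)
qed

abbreviation (input) "surface \<equiv> strips Inl d + saddles Inl (Inr \<circ> io) b + strips Inr T + strips (Inr \<circ> io') a"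

text \<open>The two descriptions are compared by Euler characteristics:
  \<open>nd + nb + nT + na\<close> discs with one gluing for each vertex of \<open>hat K\<close> on
  the one side, \<open>genus3\<close> on the other. The \<open>na\<close> additional circles of the
  shared arcs appear only in \<open>faces xs ys\<close>.\<close>

lemma hat_coeff: assumes D: "D <= circ d b" and E: "E <= circ ys T" and G: "G <= circ xs T"
  and K: "K : ccs (xs Un ys Un T)"
 shows "component_coeff surface ((`) Inl ` circ d b Un (`) Inr ` circ ys T) ((`) Inr ` circ xs T)
   ((`) Inl ` D Un (`) Inr ` E) ((`) Inr ` G) (hat K) =
  ev (genus3 xs ys T K) (dots ((`) io ` D) K + dots E K + dots (circ xs T - G) K)"
proof -
 have KV: "K <= V" using cc_subset[OF K] pmatchD(2)[OF px] pmatchD(2)[OF py] UT by auto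
 have fK: "finite K" by (rule finite_subset[OF KV finite_V])
 have ab: "A <= K" if "A : xs Un ys Un T" "A Int K ~= {}" for A by (rule cc_absorb[OF K that])
 have ne: "{} ~: d" "{} ~: b" "{} ~: a" "{} ~: T"
  using partition_onD3[OF pmatchD(1)[OF px]] partition_onD3[OF pmatchD(1)[OF py]]
   partition_onD3[OF pmatchD(1)[OF pT]] by blast+
 let ?P = "%q :: ('i + 'p) piece. piece_verts q ~= {} & piece_verts q <= hat K"
 define nd nb na nT where "nd = card {al : d. io ` al <= K}" and "nb = card {al : b. io ` al <= K}"
  and "na = card {al : a. io' ` al <= K}" and "nT = card {al : T. al <= K}"
 have sets: "{al : d. ?P (Inl ` al, 1, 0)} = {al : d. io ` al <= K}"
  "{al : b. ?P (Inl ` al Un (Inr \<circ> io) ` al, 1, 0)} = {al : b. io ` al <= K}"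
  "{al : T. ?P (Inr ` al, 1, 0)} = {al : T. al <= K}"
  "{al : a. ?P ((Inr \<circ> io') ` al, 1, 0)} = {al : a. io' ` al <= K}"
 proof -
  have db: "al : d ==> al <= \<Union>d" "al : b ==> al <= \<Union>d" for al using Union_bd by auto
  have e1: "?P (Inl ` al, 1, 0) \<longleftrightarrow> io ` al <= K" if "al : d" for al
   by (metis that ne piece_verts.simps sub_hat db image_is_empty)
  show "{al : d. ?P (Inl ` al, 1, 0)} = {al : d. io ` al <= K}" by (intro Collect_cong conj_cong refl e1)
  have e2: "?P (Inl ` al Un (Inr \<circ> io) ` al, 1, 0) \<longleftrightarrow> io ` al <= K" if "al : b" for al
  proof -
   have "al ~= {}" using that ne by metis
   thus ?thesis
    by (simp only: piece_verts.simps sub_hat(1)[OF db(2)[OF that]] sub_hat(2) image_comp[symmetric] Un_subset_iff Un_empty image_is_empty simp_thms not_False_eq_True)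
  qed
  show "{al : b. ?P (Inl ` al Un (Inr \<circ> io) ` al, 1, 0)} = {al : b. io ` al <= K}" by (intro Collect_cong conj_cong refl e2)
  have e3: "?P (Inr ` al, 1, 0) \<longleftrightarrow> al <= K" if "al : T" for al
   by (metis that ne piece_verts.simps sub_hat image_is_empty)
  show "{al : T. ?P (Inr ` al, 1, 0)} = {al : T. al <= K}" by (intro Collect_cong conj_cong refl e3)
  have e4: "?P ((Inr \<circ> io') ` al, 1, 0) \<longleftrightarrow> io' ` al <= K" if "al : a" for al
   by (metis that ne piece_verts.simps sub_hat image_comp image_is_empty)
  show "{al : a. ?P ((Inr \<circ> io') ` al, 1, 0)} = {al : a. io' ` al <= K}" by (intro Collect_cong conj_cong refl e4)
 qed
 have sum_P: "(\<Sum>q\<in>#filter_mset ?P surface. h q) =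
   (SUM al:{al : d. io ` al <= K}. h (Inl ` al, 1, 0)) + (SUM al:{al : b. io ` al <= K}. h (Inl ` al Un (Inr \<circ> io) ` al, 1, 0))
   + (SUM al:{al : T. al <= K}. h (Inr ` al, 1, 0)) + (SUM al:{al : a. io' ` al <= K}. h ((Inr \<circ> io') ` al, 1, 0))"
  for h :: "('i + 'p) piece => 'c :: comm_monoid_add"
  unfolding strips_def saddles_def filter_union_mset image_mset_union sum_mset.union
  by (simp only: sum_filter_image_mset_set fin sets)
 have euler: "(\<Sum>q\<in>#filter_mset ?P surface. piece_euler q) = int (nd + nb + nT + na)"
  unfolding sum_P nd_def nb_def nT_def na_def by simp
 have dot0: "(\<Sum>q\<in>#filter_mset ?P surface. piece_dots q) = 0" unfolding sum_P by simp
 have half: "card K = 2 * card {al : w. al <= K}" if "pm w" "w <= xs Un ys Un T" for w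
  by (rule card_pair_blocks[OF finite_V pmatchD(1)[OF that(1)] pmatch_card2[OF that(1)] KV])
   (assumption, rule ab, use that(2) in blast, assumption)
 have splt: "card {al : (`) io ` A Un (`) io' ` B. al <= K} = card {al : A. io ` al <= K} + card {al : B. io' ` al <= K}"
  if "finite A" "finite B" "{} ~: A" for A B
 proof -
  have "{al : (`) io ` A Un (`) io' ` B. al <= K} = {al : (`) io ` A. al <= K} Un {al : (`) io' ` B. al <= K}" by blast
  moreover have "{al : (`) io ` A. al <= K} Int {al : (`) io' ` B. al <= K} = {}"
  proof (rule ccontr)
   assume "~ ?thesis"
   hence "EX ga. ga : (`) io ` A & ga : (`) io' ` B" by blast
   then obtain ga where "ga : (`) io ` A" "ga : (`) io' ` B" by (elim exE conjE)
   then obtain al be where ab: "al : A" "io ` al = io' ` be" by (elim imageE) metis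
   have "al ~= {}" using ab(1) that(3) by metis
   then obtain i where "i : al" by (metis equals0I)
   hence "io i : io' ` be" using ab(2) by (metis imageI)
   thus False using disj by blast
  qed
  ultimately show ?thesis using that card_image_inj[OF inj(1)] card_image_inj[OF inj(2)]
   by (simp add: card_Un_disjoint)
 qed
 have cK: "card K = 2 * (nd + na)" "card K = 2 * (nb + na)" "card K = 2 * nT"
 proof -
  have w: "xs <= xs Un ys Un T" "ys <= xs Un ys Un T" "T <= xs Un ys Un T" by blast+
  show "card K = 2 * (nd + na)" "card K = 2 * (nb + na)" "card K = 2 * nT" unfolding nd_def nb_def na_def nT_def
   by (rule half[OF px w(1), unfolded splt[OF fin(3,5) ne(1)]] half[OF py w(2), unfolded splt[OF fin(4,5) ne(2)]]
    half[OF pT w(3)])+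
 qed
 have "card {i : \<Union>d. io i : K} = 2 * card {al : d. al <= {i : \<Union>d. io i : K}}"
 proof (rule card_pair_blocks[OF fin(1)])
  show "partition_on (\<Union>d) d"
  proof (rule partition_onI)
   show "disjnt al be" if "al : d" "be : d" "al ~= be" for al be
   proof -
    have "disjnt (io ` al) (io ` be)"
     by (rule pmatch_disjoint[OF px]) (use that inj_image_eq_iff[OF inj(1)] in auto)
    thus ?thesis by (auto simp: disjnt_iff)
   qed
  qed (use ne in auto)
  show "card al = 2" if "al : d" for al
  proof -
   have "card (io ` al) = 2" by (rule pmatch_card2[OF px]) (use that in blast)
   thus ?thesis using card_image[OF inj_on_subset[OF inj(1)], of al] by simp
  qed
  show "al <= {i : \<Union>d. io i : K}" if "al : d" "al Int {i : \<Union>d. io i : K} ~= {}" for al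
   using ab that by blast
 qed blast
 moreover have "{al : d. al <= {i : \<Union>d. io i : K}} = {al : d. io ` al <= K}" by blast
 ultimately have "card {i : \<Union>d. io i : K} = 2 * nd" by (simp add: nd_def)
 moreover have "card (hat K) = card {i : \<Union>d. io i : K} + card K"
  unfolding hat_def Plus_def[symmetric] by (rule card_Plus[OF finite_subset[OF _ fin(1)] fK]) blast
 ultimately have chat: "card (hat K) = 2 * nd + card K" by simp
 have circ_d: "c <= \<Union>d" if "c : circ d b" for c using cc_subset[OF that] Union_bd by simp
 have fc: "finite (circ d b)" "finite (circ ys T)" "finite (circ xs T)"
  using finite_cc[of "d Un b"] fin(1) Union_bd finite_circ[OF py pT] finite_circ[OF px pT] by auto
 have both: "card {c : (`) Inl ` D Un (`) Inr ` E. c <= hat K} = card {c : D. io ` c <= K} + card {c : E. c <= K}"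
  if "D <= circ d b" "E <= circ ys T" for D E
 proof -
  have eq: "{c : (`) Inl ` D Un (`) Inr ` E. c <= hat K} = (`) Inl ` {c : D. io ` c <= K} Un (`) Inr ` {c : E. c <= K}"
  proof -
   have "{c : (`) Inl ` D. c <= hat K} = (`) Inl ` {c : D. io ` c <= K}"
    using sub_hat(1)[OF circ_d] that(1) by blast
   moreover have "{c : (`) Inr ` E. c <= hat K} = (`) Inr ` {c : E. c <= K}" using sub_hat(2) by blast
   moreover have "{c : A Un B. c <= hat K} = {c : A. c <= hat K} Un {c : B. c <= hat K}" for A B by blast
   ultimately show ?thesis by (simp only:)
  qed
  have fDE: "finite D" "finite E" using that fc finite_subset by blast+
  have "c ~= {}" if "c : D" for c using that `D <= circ d b` cc_nonempty by blast
  hence "Inl ` c ~= Inr ` c'" if "c : D" for c and c' :: "'p set" using that by (metis disjoint_iff equals0I imageI sum_image_simps(3))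
  hence "(`) Inl ` {c : D. io ` c <= K} Int (`) Inr ` {c : E. c <= K} = {}"
   unfolding disjoint_iff by (metis (no_types, lifting) imageE mem_Collect_eq)
  moreover have "card ((`) (Inl :: 'i => 'i + 'p) ` A) = card A" "card ((`) (Inr :: 'p => 'i + 'p) ` B) = card B" for A :: "'i set set" and B :: "'p set set"
   by (intro card_image inj_onI; simp add: inj_image_eq_iff)+
  ultimately show ?thesis unfolding eq using fDE by (simp add: card_Un_disjoint)
 qed
 have In: "card {c : (`) Inl ` circ d b Un (`) Inr ` circ ys T. c <= hat K} = card {c : circ d b. io ` c <= K} + faces ys T K"
  using both[OF subset_refl subset_refl] by (simp add: faces_def)
 have Inr_card: "card {c : (`) Inr ` A. c <= hat K} = card {c : A. c <= K}" for A :: "'p set set"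
  using card_image_inj[of "Inr :: 'p => 'i + 'p" A "%c. c <= hat K"] sub_hat(2) by simp
 have fxy: "faces xs ys K = card {c : circ d b. io ` c <= K} + na"
  unfolding faces_def circ_xy na_def by (rule splt[OF fc(1) fin(5)]) (use cc_nonempty in blast)
 have g3: "faces xs ys K + faces ys T K + faces xs T K + 2 * genus3 xs ys T K = card K div 2 + 2"
  by (rule genus3_eq[OF finite_V px py pT K])
 have Dd: "card {c : D. io ` c <= K} = dots ((`) io ` D) K"
  unfolding dots_def using card_image_inj[OF inj(1), of D "%c. c <= K"] by simp
 have diff: "(`) Inr ` circ xs T - (`) Inr ` G = (`) Inr ` (circ xs T - G)"
  by (rule image_set_diff[symmetric]) (intro injI; simp add: inj_image_eq_iff)
 show ?thesis
  using component_coeff_ev[where g = "genus3 xs ys T K" and k = 0, OF _ dot0, of "(`) Inl ` circ d b Un (`) Inr ` circ ys T" "(`) Inr ` circ xs T"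
    "(`) Inl ` D Un (`) Inr ` E" "(`) Inr ` G"]
  unfolding both[OF D E] diff Inr_card In euler chat Dd using g3 fxy cK by (simp add: dots_def faces_def)
qed

theorem surface_theta: assumes D: "D <= circ d b" and E: "E <= circ ys T" and G: "G <= circ xs T"
 shows "cob_coeff surface ((`) Inl ` circ d b Un (`) Inr ` circ ys T) ((`) Inr ` circ xs T)
   ((`) Inl ` D Un (`) Inr ` E) ((`) Inr ` G) = theta xs ys T ((`) io ` D) E (circ xs T - G)"
proof -
 have ne: "{} ~: d" "{} ~: b" "{} ~: a" "{} ~: T"
  using partition_onD3[OF pmatchD(1)[OF px]] partition_onD3[OF pmatchD(1)[OF py]]
   partition_onD3[OF pmatchD(1)[OF pT]] by blast+
 have verts: "piece_verts ` set_mset surface = fam" unfolding fam_def strips_def saddles_def using fin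
  by (simp add: image_Un image_image image_comp[symmetric])
 have nil: "filter_mset (%q. piece_verts q = {}) surface = {#}"
 proof (intro filter_mset_eq_mempty_iff[THEN iffD2] allI impI notI)
  fix q assume "q \<in># surface" "piece_verts q = {}"
  hence "{} : fam" unfolding verts[symmetric] by (metis imageI)
  thus False using ne by (auto simp: fam_def)
 qed
 show ?thesis unfolding cob_coeff_def theta_def verts cc_fam nil
  by (simp only: prod.reindex[OF hat_inj, unfolded comp_def] image_mset_empty prod_mset_empty mult_1_right)
   (rule prod.cong[OF refl hat_coeff[OF D E G]])
qed

end

text \<open>The coefficient of the discs with dots on \<open>A\<close> after neck-cutting near every
  boundary circle: each component is closed up by discs that are dotted at the circles outside of
  \<open>A\<close>.\<close>

definition cob_weight :: "cobordism => endpoint set set => int" where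
 "cob_weight S A = (\<Prod>s\<in>#S. ev (fst (snd s)) (snd (snd s) + card (fst s - A)))"

locale cobordism_gluing = marked_points V col for V :: "endpoint set" and col :: "endpoint => bool" +
 fixes c T1 T2 :: "endpoint set set" and S :: cobordism
 assumes pc: "pm c" and p1: "pm T1" and p2: "pm T2" and S: "S : cobordisms T1 T2"
begin

text \<open>The components with boundary. Every boundary circle lies in just one of them, so they
  have multiplicity one and a set suffices; closed components may repeat and contribute a scalar
  factor.\<close>

definition Z where "Z = {s : set_mset S. fst s ~= {}}"
definition base :: "endpoint set set \<times> nat \<times> nat => endpoint set" where "base s = \<Union>(fst s)"

abbreviation (input) "F \<equiv> circ T1 T2"
abbreviation (input) "P1 \<equiv> base ` Z"
abbreviation (input) "P2 \<equiv> ccs (c Un T1 Un T2)"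

lemma S_sub: "s \<in># S ==> fst s <= F" using S unfolding cobordisms_def by (auto simp: split_beta)

lemma piece_at: "e : F ==> EX s. filter_mset (%s. e : fst s) S = {#s#}"
proof -
 assume "e : F"
 hence "size (filter_mset (%(B, g, k). e : B) S) = 1" using S by (simp add: cobordisms_def)
 moreover have "(%(B, g, k). e : B) = (%s :: endpoint set set \<times> nat \<times> nat. e : fst s)"
  by (simp add: fun_eq_iff split_beta)
 ultimately show ?thesis by (simp only: size_1_singleton_mset)
qed

lemma Z_unique: "s : Z ==> s' : Z ==> e : fst s ==> e : fst s' ==> s = s'"
proof -
 assume s: "s : Z" "s' : Z" "e : fst s" "e : fst s'"
 have S: "s \<in># S" "s' \<in># S" using s(1,2) by (simp_all add: Z_def)
 obtain t where t: "filter_mset (%s. e : fst s) S = {#t#}" using piece_at S_sub[OF S(1)] s(3) by blast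
 have "s \<in># filter_mset (%s. e : fst s) S" "s' \<in># filter_mset (%s. e : fst s) S" using S s(3,4) by simp_all
 thus "s = s'" unfolding t by simp
qed

lemma Z_cover: "e : F ==> EX s:Z. e : fst s"
proof -
 assume "e : F"
 then obtain t where "filter_mset (%s. e : fst s) S = {#t#}" using piece_at by blast
 hence "t \<in># filter_mset (%s. e : fst s) S" by simp
 thus ?thesis by (intro bexI[of _ t]) (auto simp: Z_def)
qed

lemma fin_Z: "finite Z" by (simp add: Z_def)

lemma filter_Z: "filter_mset (%s. fst s ~= {}) S = mset_set Z"
proof (rule multiset_eqI)
 fix s
 show "count (filter_mset (%s. fst s ~= {}) S) s = count (mset_set Z) s"
 proof (cases "s : Z")
  case True
  then obtain e where e: "e : fst s" "s \<in># S" "fst s ~= {}" by (auto simp: Z_def)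
  then obtain t where t: "filter_mset (%s. e : fst s) S = {#t#}" using piece_at S_sub by blast
  have "count S s = count (filter_mset (%s. e : fst s) S) s" using e by simp
  moreover have "s \<in># filter_mset (%s. e : fst s) S" using e by simp
  ultimately have "count S s = 1" unfolding t by simp
  thus ?thesis using True e fin_Z by simp
 next
  case False
  thus ?thesis using fin_Z by (auto simp: Z_def not_in_iff)
 qed
qed

lemma UF: "\<Union>F = V" using pmatch_Union2[OF p1 p2] by simp

lemma F_ne: "e : F ==> e ~= {}" by (rule cc_nonempty)

lemma F_disj: "e : F ==> e' : F ==> p : e ==> p : e' ==> e = e'" by (rule cc_disjoint)

lemma base_unique: assumes "s : Z" "s' : Z" "p : base s" "p : base s'" shows "s = s'"
proof -
 obtain e where e: "e : fst s" "p : e" using assms(3) unfolding base_def by (elim UnionE)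
 obtain e' where e': "e' : fst s'" "p : e'" using assms(4) unfolding base_def by (elim UnionE)
 have "s \<in># S" "s' \<in># S" using assms by (simp_all add: Z_def)
 hence "e : F" "e' : F" using S_sub e(1) e'(1) by blast+
 hence "e = e'" using F_disj e(2) e'(2) by metis
 thus ?thesis using Z_unique[OF assms(1,2) e(1)] e'(1) by simp
qed

lemma base_ne: "s : Z ==> base s ~= {}" using Z_def S_sub F_ne base_def by blast

lemma base_inj: "inj_on base Z"
proof (rule inj_onI)
 fix s s' assume s: "s : Z" "s' : Z" "base s = base s'"
 obtain p where "p : base s" using base_ne[OF s(1)] by blast
 thus "s = s'" using base_unique[OF s(1,2)] s(3) by simp
qed

lemma sub_base: "e : F ==> s : Z ==> e <= base s \<longleftrightarrow> e : fst s"
proof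
 assume e: "e : F" "s : Z" "e <= base s"
 obtain p where p: "p : e" using F_ne[OF e(1)] by blast
 then obtain e' where e': "e' : fst s" "p : e'" using e(3) unfolding base_def by blast
 have "e' : F" using S_sub[of s] e'(1) e(2) by (auto simp: Z_def)
 hence "e = e'" using F_disj[OF e(1) _ p e'(2)] by simp
 thus "e : fst s" using e'(1) by simp
qed (auto simp: base_def)

lemma partition_P1: "partition_on V P1"
proof (rule partition_onI)
 show "\<Union>P1 = V"
 proof
  show "\<Union>P1 <= V" using S_sub UF base_def Z_def by blast
  show "V <= \<Union>P1" using UF Z_cover base_def by blast
 qed
 show "{} ~: P1" using base_ne by auto
 show "disjnt N N'" if "N : P1" "N' : P1" "N ~= N'" for N N'
  using that base_unique unfolding disjnt_iff by (elim imageE) metis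
qed

lemma UP2: "\<Union>(c Un T1 Un T2) = V" by (simp add: pmatchD(2)[OF pc] pmatchD(2)[OF p1] pmatchD(2)[OF p2])

lemma partition_P2: "partition_on V P2" using partition_cc[of "c Un T1 Un T2"] unfolding UP2 .

lemma F_P1: "e : F ==> EX N:P1. e <= N" using Z_cover sub_base by (meson imageI)

lemma F_P2: "e : F ==> EX N:P2. e <= N" by (erule sub_cc) blast

abbreviation (input) "surface \<equiv> strips id c + cob_pieces S"

lemma pieces_image: "cob_pieces S =
  image_mset (%s. (base s, 2 - 2 * int (fst (snd s)) - int (card (fst s)), snd (snd s))) S"
 unfolding cob_pieces_def base_def by (intro image_mset_cong) auto

lemma cc_surface: "ccs (piece_verts ` set_mset surface) = ccs (P1 Un P2)"
proof (rule cc_eqI2)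
 have sb: "base s : P1 | base s = {}" if "s \<in># S" for s
  using that by (cases "fst s = {}") (auto simp: Z_def base_def)
 have fc: "finite c" by (rule pmatch_finite[OF pc finite_V])
 have verts: "piece_verts ` set_mset surface = c Un base ` set_mset S"
  unfolding pieces_image strips_def using fc by (simp add: image_Un image_image)
 have P1S: "P1 <= base ` set_mset S" unfolding Z_def by blast
 have "\<Union>(base ` set_mset S) = \<Union>P1" using sb P1S by fastforce
 thus "\<Union>(piece_verts ` set_mset surface) = \<Union>(P1 Un P2)"
  unfolding verts Union_Un_distrib partition_onD1[OF partition_P1, symmetric] partition_onD1[OF partition_P2, symmetric]
   pmatchD(2)[OF pc] by simp
 show "conn (P1 Un P2) x y" if B: "B : piece_verts ` set_mset surface" "x : B" "y : B" for B x y
 proof (cases "B : c")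
  case True
  have "conn (c Un T1 Un T2) x y" by (rule conn_step[OF _ B(2,3)]) (use True in blast)
  hence "conn P2 x y" by simp
  thus ?thesis by (rule conn_mono) blast
 next
  case False
  hence "B : P1" using B sb unfolding verts by blast
  thus ?thesis by (intro conn_step[OF _ B(2,3)]) blast
 qed
 show "conn (piece_verts ` set_mset surface) x y" if B: "B : P1 Un P2" "x : B" "y : B" for B x y
 proof (cases "B : P1")
  case True
  thus ?thesis by (intro conn_step[OF _ B(2,3)]) (use P1S verts in blast)
 next
  case False
  hence "conn (c Un T1 Un T2) x y" using cc_conn[OF _ B(2,3)] B(1) by blast
  thus ?thesis
  proof (rule conn_le)
   fix W x y assume W: "W : c Un T1 Un T2" "x : W" "y : W"
   show "conn (piece_verts ` set_mset surface) x y"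
   proof (cases "W : c")
    case True
    thus ?thesis by (intro conn_step[OF _ W(2,3)]) (use True in "unfold verts, blast")
   next
    case False
    hence "W : T1 Un T2" "W ~= {}" using W by blast+
    then obtain e where e: "e : F" "W <= e" using member_subset_cc[of W "T1 Un T2"] by metis
    obtain N where "N : P1" "e <= N" using F_P1[OF e(1)] by blast
    thus ?thesis by (intro conn_step[of N]) (use P1S verts e(2) W in auto)
   qed
  qed
 qed
qed

definition g1 where "g1 N = fst (snd (inv_into Z base N))"
definition k1 where "k1 N = snd (snd (inv_into Z base N))"

lemma g1_base [simp]: "s : Z ==> g1 (base s) = fst (snd s)"
 and k1_base [simp]: "s : Z ==> k1 (base s) = snd (snd s)" by (simp_all add: g1_def k1_def base_inj)

lemma component_theta: assumes D: "D <= circ c T1" and E: "E <= circ c T2" and K: "K : ccs (P1 Un P2)"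
 shows "component_coeff surface (circ c T1) (circ c T2) D E K =
  ev (sum g1 {N : P1. N <= K} + sum (genus3 c T1 T2) {N : P2. N <= K} + card {e : F. e <= K} + 1
       - (card {N : P1. N <= K} + card {N : P2. N <= K}))
   (sum k1 {N : P1. N <= K} + sum (%N. dots D N + dots (circ c T2 - E) N) {N : P2. N <= K})"
proof -
 have KV: "K <= V" using cc_subset[OF K] partition_onD1[OF partition_P1] partition_onD1[OF partition_P2] by auto
 have cl1: "N <= K" if "N : P1" "N Int K ~= {}" for N using cc_absorb[OF K, of N] that by blast
 have cl2: "N <= K" if "N : P2" "N Int K ~= {}" for N using cc_absorb[OF K, of N] that by blast
 have fP1: "finite P1" using fin_Z by simp
 note b2 = three_matchings_blocks[OF finite_V pc p1 p2 KV K Un_upper2]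
 have d2: "sum (%N. dots D N + dots (circ c T2 - E) N) {N : P2. N <= K} = dots D K + dots (circ c T2 - E) K"
  using b2(1)[of D] b2(1)[of "circ c T2 - E"] D by (auto simp: sum.distrib)
 have le: "card {N : P1. N <= K} + card {N : P2. N <= K} <= card {e : F. e <= K} + 1"
  by (rule glue_partitions(1)[OF finite_V partition_P1 partition_P2 _ F_P1 F_P2 K])
   (use partition_cc[of "T1 Un T2"] UF in simp)
 let ?ZK = "{s : Z. base s <= K}"
 have P1K: "{N : P1. N <= K} = base ` ?ZK" by blast
 have iK: "inj_on base ?ZK" by (rule inj_on_subset[OF base_inj]) blast
 have s1: "(SUM N:{N : P1. N <= K}. w N) = (SUM s:?ZK. w (base s))" for w :: "endpoint set => nat"
  unfolding P1K by (simp add: sum.reindex[OF iK])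
 have cP1: "card {N : P1. N <= K} = card ?ZK" unfolding P1K by (rule card_image[OF iK])
 have cF: "card {e : F. e <= K} = (SUM s:?ZK. card (fst s))"
 proof -
  have "card {e : F. e <= K} = (SUM N:{N : P1. N <= K}. card {e : F. e <= N})"
   by (rule count_blocks[OF fP1 partition_P1 cl1 finite_circ[OF p1 p2] F_ne F_P1])
  also have "... = (SUM s:?ZK. card {e : F. e <= base s})" by (rule s1)
  also have "... = (SUM s:?ZK. card (fst s))"
  proof (rule sum.cong[OF refl])
   fix s assume "s : ?ZK"
   hence s: "s : Z" by simp
   have "fst s <= F" using S_sub[of s] s by (simp add: Z_def)
   hence "{e : F. e <= base s} = fst s" using sub_base s by blast
   thus "card {e : F. e <= base s} = card (fst s)" by simp
  qed
  finally show ?thesis .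
 qed
 let ?P = "%q :: endpoint piece. piece_verts q ~= {} & piece_verts q <= K"
 have fc: "finite c" by (rule pmatch_finite[OF pc finite_V])
 have neC: "{} ~: c" by (rule partition_onD3[OF pmatchD(1)[OF pc]])
 have arcs: "filter_mset ?P (strips id c) = image_mset (%al. (al, 1, 0)) (mset_set {al : c. al <= K})"
 proof -
  have "{al : c. al ~= {} & al <= K} = {al : c. al <= K}" using neC by metis
  thus ?thesis unfolding strips_def filter_mset_image_mset using fc by (simp add: filter_mset_mset_set)
 qed
 have cobs: "filter_mset ?P (cob_pieces S) =
   image_mset (%s. (base s, 2 - 2 * int (fst (snd s)) - int (card (fst s)), snd (snd s))) (mset_set ?ZK)"
 proof -
  have "filter_mset (%s. base s ~= {} & base s <= K) S = filter_mset (%s. base s <= K) (filter_mset (%s. fst s ~= {}) S)"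
  proof -
   have "base s ~= {} \<longleftrightarrow> fst s ~= {}" if "s \<in># S" for s
    using base_ne[of s] that by (auto simp: Z_def base_def)
   thus ?thesis unfolding filter_filter_mset by (intro filter_mset_cong refl) auto
  qed
  thus ?thesis unfolding pieces_image filter_mset_image_mset filter_Z using fin_Z
   by (simp add: filter_mset_mset_set)
 qed
 have euler: "(\<Sum>q\<in>#filter_mset ?P surface. piece_euler q) =
   int (card {al : c. al <= K}) + (2 * int (card ?ZK) - 2 * int (SUM s:?ZK. fst (snd s)) - int (SUM s:?ZK. card (fst s)))"
  unfolding filter_union_mset arcs cobs using fin_Z fc
  by (simp add: sum_unfold_sum_mset[symmetric] image_mset.compositionality comp_def sum_subtractf sum_distrib_left)
 have kdots: "(\<Sum>q\<in>#filter_mset ?P surface. piece_dots q) = sum k1 {N : P1. N <= K}"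
  unfolding filter_union_mset arcs cobs s1 using fin_Z fc
  by (simp add: sum_unfold_sum_mset[symmetric] image_mset.compositionality comp_def)
 have cc: "card K = 2 * card {al : c. al <= K}"
 proof (rule card_pair_blocks[OF finite_V pmatchD(1)[OF pc] pmatch_card2[OF pc] KV])
  show "al <= K" if a: "al : c" "al Int K ~= {}" for al
  proof -
   have "al : c Un T1 Un T2" "al ~= {}" using a by blast+
   then obtain N where N: "N : P2" "al <= N" using member_subset_cc[of al "c Un T1 Un T2"] by metis
   have "N <= K" by (rule cl2[OF N(1)]) (use N(2) a(2) in blast)
   thus ?thesis using N(2) by blast
  qed
 qed
 have half: "card K div 2 = card {al : c. al <= K}" unfolding cc by simp
 have sg: "sum g1 {N : P1. N <= K} = (SUM s:?ZK. fst (snd s))" unfolding s1 by simp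
 have "component_coeff surface (circ c T1) (circ c T2) D E K =
  ev (sum g1 {N : P1. N <= K} + sum (genus3 c T1 T2) {N : P2. N <= K} + card {e : F. e <= K} + 1
       - (card {N : P1. N <= K} + card {N : P2. N <= K}))
   (sum k1 {N : P1. N <= K} + card {e : D. e <= K} + card {e : circ c T2 - E. e <= K})"
  by (rule component_coeff_ev[OF _ kdots])
   (unfold euler sg cP1 cF[symmetric], use le[unfolded cP1] b2(2)[THEN conjunct2, unfolded half] cc cF in "unfold faces_def, linarith")
 thus ?thesis unfolding d2 by (simp add: dots_def add.assoc)
qed

text \<open>Cutting along the circles of \<open>T1\<close> and \<open>T2\<close> separates
  \<open>S\<close> from a surface of three matchings. The closed components of \<open>S\<close>
  split off as the factor \<open>w0\<close>.\<close>

theorem surface_theta: assumes D: "D <= circ c T1" and E: "E <= circ c T2"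
 shows "cob_coeff surface (circ c T1) (circ c T2) D E =
  (SUM A:Pow F. cob_weight S A * theta c T1 T2 D A (circ c T2 - E))"
proof -
 define w0 where "w0 = (\<Prod>s\<in>#filter_mset (%s. fst s = {}) S. ev (fst (snd s)) (snd (snd s)))"
 have split: "S = filter_mset (%s. fst s ~= {}) S + filter_mset (%s. fst s = {}) S"
  using multiset_partition[of S "%s. fst s ~= {}"] by simp
 have weight: "cob_weight S A = (PROD N:P1. ev (g1 N) (k1 N + card {e : F - A. e <= N})) * w0" for A
 proof -
  have "cob_weight S A = (\<Prod>s\<in>#filter_mset (%s. fst s ~= {}) S. ev (fst (snd s)) (snd (snd s) + card (fst s - A))) *
    (\<Prod>s\<in>#filter_mset (%s. fst s = {}) S. ev (fst (snd s)) (snd (snd s) + card (fst s - A)))"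
   unfolding cob_weight_def by (subst (1) split) (simp only: image_mset_union prod_mset.union)
  also have "(\<Prod>s\<in>#filter_mset (%s. fst s = {}) S. ev (fst (snd s)) (snd (snd s) + card (fst s - A))) = w0"
   unfolding w0_def by (intro arg_cong[where f = prod_mset] image_mset_cong) simp
  also have "(\<Prod>s\<in>#filter_mset (%s. fst s ~= {}) S. ev (fst (snd s)) (snd (snd s) + card (fst s - A))) =
    (PROD s:Z. ev (fst (snd s)) (snd (snd s) + card (fst s - A)))"
   unfolding filter_Z by (simp add: prod_unfold_prod_mset)
  also have "... = (PROD s:Z. ev (g1 (base s)) (k1 (base s) + card {e : F - A. e <= base s}))"
  proof (rule prod.cong[OF refl])
   fix s assume s: "s : Z"
   have "fst s <= F" using S_sub[of s] s by (simp add: Z_def)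
   hence "{e : F - A. e <= base s} = fst s - A" using sub_base s by blast
   thus "ev (fst (snd s)) (snd (snd s) + card (fst s - A)) =
     ev (g1 (base s)) (k1 (base s) + card {e : F - A. e <= base s})" using s by simp
  qed
  also have "... = (PROD N:P1. ev (g1 N) (k1 N + card {e : F - A. e <= N}))"
   by (simp add: prod.reindex[OF base_inj])
  finally show ?thesis .
 qed
 have closed: "(\<Prod>q\<in>#filter_mset (%q. piece_verts q = {}) surface.
    surface_coeff (nat ((2 - piece_euler q) div 2)) (piece_dots q) 0 0) = w0"
 proof -
  have neC: "{} ~: c" by (rule partition_onD3[OF pmatchD(1)[OF pc]])
  have fc: "finite c" by (rule pmatch_finite[OF pc finite_V])
  have e: "filter_mset (%q. piece_verts q = {}) (strips id c) = {#}" unfolding strips_def using fc neC by auto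
  have f: "filter_mset (%s. base s = {}) S = filter_mset (%s. fst s = {}) S"
  proof (intro filter_mset_cong refl)
   fix s assume "s \<in># S"
   hence "base s ~= {} \<longleftrightarrow> fst s ~= {}" using base_ne[of s] by (auto simp: Z_def base_def)
   thus "base s = {} \<longleftrightarrow> fst s = {}" by blast
  qed
  show ?thesis unfolding filter_union_mset e pieces_image filter_mset_image_mset w0_def
   by (simp add: f image_mset.compositionality comp_def)
    (intro arg_cong[where f = prod_mset] image_mset_cong, simp add: surface_coeff_ev)
 qed
 let ?p2 = "%N. dots D N + dots (circ c T2 - E) N"
 have "(SUM A:Pow F. cob_weight S A * theta c T1 T2 D A (circ c T2 - E)) =
  (SUM A:Pow F. (PROD N:P1. ev (g1 N) (k1 N + card {e : F - A. e <= N})) *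
   (PROD N:P2. ev (genus3 c T1 T2 N) (?p2 N + card {e : A. e <= N}))) * w0"
  unfolding weight theta_def sum_distrib_right by (intro sum.cong refl) (simp add: dots_def add_ac mult_ac)
 also have "... = (PROD K:ccs (P1 Un P2).
   ev (sum g1 {N : P1. N <= K} + sum (genus3 c T1 T2) {N : P2. N <= K} + card {e : F. e <= K} + 1
       - (card {N : P1. N <= K} + card {N : P2. N <= K}))
    (sum k1 {N : P1. N <= K} + sum ?p2 {N : P2. N <= K})) * w0"
  by (subst glue_partitions(2)[OF finite_V partition_P1 partition_P2 _ F_P1 F_P2])
   (use partition_cc[of "T1 Un T2"] UF in simp_all)
 also have "... = cob_coeff surface (circ c T1) (circ c T2) D E" unfolding cob_coeff_def cc_surface closed
  by (intro arg_cong2[where f = "(*)"] prod.cong refl component_theta[OF D E, symmetric])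
 finally show ?thesis by simp
qed

end

section \<open>Planar tangles as crossingless matchings\<close>

lemma crossingless_onD: assumes "crossingless_on pos V M"
 shows "partition_on V M" "al : M ==> card al = 2" "al : M ==> al <= V" "{} ~: M"
  and "p : V ==> q : V ==> r : V ==> s : V ==> pos p < pos q ==> pos q < pos r ==> pos r < pos s ==>
   {p, r} : M ==> {q, s} ~: M"
proof -
 show p: "partition_on V M" using assms by (simp add: crossingless_on_def)
 show "al : M ==> card al = 2" using assms by (simp add: crossingless_on_def)
 show "al : M ==> al <= V" using partition_onD1[OF p] by blast
 show "{} ~: M" by (rule partition_onD3[OF p])
 show "p : V ==> q : V ==> r : V ==> s : V ==> pos p < pos q ==> pos q < pos r ==> pos r < pos s ==>
   {p, r} : M ==> {q, s} ~: M" using assms by (simp add: crossingless_on_def)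
qed

lemma crossingless_on_image: assumes M: "crossingless_on pos V M" and f: "inj_on f V"
  and ord: "(ALL p:V. ALL q:V. pos' (f p) < pos' (f q) --> pos p < pos q) |
   (ALL p:V. ALL q:V. pos' (f p) < pos' (f q) --> pos q < pos p)"
 shows "crossingless_on pos' (f ` V) ((`) f ` M)" unfolding crossingless_on_def
proof (intro conjI ballI impI)
 note MD = crossingless_onD[OF M]
 have "(`) f ` M - {{}} = (`) f ` M" using MD(4) by auto
 thus "partition_on (f ` V) ((`) f ` M)" using partition_on_inj_image[OF MD(1) f] by simp
 show "card al = 2" if al: "al : (`) f ` M" for al
 proof -
  obtain be where be: "be : M" "al = f ` be" using al by (rule imageE)
  show ?thesis unfolding be(2) using card_image[OF inj_on_subset[OF f MD(3)[OF be(1)]]] MD(2)[OF be(1)] by simp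
 qed
 fix p' q' r' s' assume V: "p' : f ` V" "q' : f ` V" "r' : f ` V" "s' : f ` V"
  and lt: "pos' p' < pos' q' & pos' q' < pos' r' & pos' r' < pos' s'"
 obtain p q r s where pq: "p : V" "q : V" "r : V" "s : V" "p' = f p" "q' = f q" "r' = f r" "s' = f s"
  using V by (elim imageE)
 have pull: "{u, v} : M" if h: "{f u, f v} : (`) f ` M" "u : V" "v : V" for u v
 proof -
  obtain be where be: "be : M" "{f u, f v} = f ` be" using h(1) by (rule imageE)
  have "f ` {u, v} = f ` be" using be(2) by simp
  hence "{u, v} = be" using inj_on_image_eq_iff[OF f, of "{u, v}" be] MD(3)[OF be(1)] h(2,3) by simp
  thus ?thesis using be(1) by simp
 qed
 show "~ ({p', r'} : (`) f ` M & {q', s'} : (`) f ` M)"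
 proof
  assume "{p', r'} : (`) f ` M & {q', s'} : (`) f ` M"
  hence a: "{p, r} : M" "{q, s} : M" using pull pq by auto
  from ord show False
  proof
   assume "ALL p:V. ALL q:V. pos' (f p) < pos' (f q) --> pos p < pos q"
   hence "pos p < pos q" "pos q < pos r" "pos r < pos s" using lt pq by auto
   thus False using MD(5)[OF pq(1-4)] a by simp
  next
   assume "ALL p:V. ALL q:V. pos' (f p) < pos' (f q) --> pos q < pos p"
   hence "pos s < pos r" "pos r < pos q" "pos q < pos p" using lt pq by auto
   thus False using MD(5)[OF pq(4,3,2,1)] a by (simp add: insert_commute)
  qed
 qed
qed

lemma crossingless_on_Un: assumes M: "crossingless_on pos A M" and M': "crossingless_on pos B M'"
  and lt: "!!p q. p : A ==> q : B ==> pos p < pos q"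
 shows "crossingless_on pos (A Un B) (M Un M')" unfolding crossingless_on_def
proof (intro conjI ballI impI)
 note D = crossingless_onD[OF M] and D' = crossingless_onD[OF M']
 have disj: "A Int B = {}" using lt by (metis disjoint_iff less_irrefl)
 show "partition_on (A Un B) (M Un M')" by (rule partition_on_disjoint_Un[OF D(1) D'(1) disj])
 show "card al = 2" if "al : M Un M'" for al using that D(2) D'(2) by (elim UnE)
 fix p q r s assume l: "pos p < pos q & pos q < pos r & pos r < pos s"
 have MA: "u : A & v : A" if "{u, v} : M" for u v using D(3)[OF that] by simp
 have MB: "u : B & v : B" if "{u, v} : M'" for u v using D'(3)[OF that] by simp
 show "~ ({p, r} : M Un M' & {q, s} : M Un M')"
 proof
  assume a: "{p, r} : M Un M' & {q, s} : M Un M'"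
  consider "{p, r} : M" "{q, s} : M" | "{p, r} : M" "{q, s} : M'" | "{p, r} : M'" "{q, s} : M"
   | "{p, r} : M'" "{q, s} : M'" using a unfolding Un_iff by argo
  thus False
  proof cases
   case 1
   thus ?thesis using D(5)[of p q r s] MA[OF 1(1)] MA[OF 1(2)] l by blast
  next
   case 2
   thus ?thesis using lt[of r q] MA[OF 2(1)] MB[OF 2(2)] l by simp
  next
   case 3
   thus ?thesis using lt[of q p] MB[OF 3(1)] MA[OF 3(2)] l by simp
  next
   case 4
   thus ?thesis using D'(5)[of p q r s] MB[OF 4(1)] MB[OF 4(2)] l by blast
  qed
 qed
qed

lemma crossingless_on_restrict:
 assumes M: "crossingless_on pos V M" and A: "A <= V" and closed: "!!al. al : M ==> al Int A ~= {} ==> al <= A"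
 shows "crossingless_on pos A {al : M. al <= A}" unfolding crossingless_on_def
proof (intro conjI ballI impI)
 note D = crossingless_onD[OF M]
 show "partition_on A {al : M. al <= A}"
 proof (rule partition_onI)
  show "\<Union>{al : M. al <= A} = A"
  proof
   show "A <= \<Union>{al : M. al <= A}"
   proof
    fix p assume p: "p : A"
    then obtain al where al: "al : M" "p : al" using partition_onD1[OF D(1)] A by blast
    hence "al <= A" using closed[OF al(1)] p by blast
    thus "p : \<Union>{al : M. al <= A}" using al by blast
   qed
  qed blast
  show "{} ~: {al : M. al <= A}" using D(4) by simp
  show "disjnt al be" if "al : {al : M. al <= A}" "be : {al : M. al <= A}" "al ~= be" for al be
   using disjointD[OF partition_onD2[OF D(1)], of al be] that by (simp add: disjnt_def)
 qed
 show "card al = 2" if "al : {al : M. al <= A}" for al using that D(2) by simp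
 show "~ ({p, r} : {al : M. al <= A} & {q, s} : {al : M. al <= A})"
  if "p : A" "q : A" "r : A" "s : A" "pos p < pos q & pos q < pos r & pos r < pos s" for p q r s
  using D(5)[of p q r s] that A by blast
qed

definition is_top :: "endpoint => bool" where
 "is_top e = (EX i. e = Top i)"

lemma is_top_simps [simp]: "is_top (Top i)" "~ is_top (Bot i)" by (simp_all add: is_top_def)

text \<open>Taking both closing matchings as one matching of all endpoints turns
  \<open>W(b) T a\<close> into a pair of matchings of the same points.\<close>

definition cl :: "nat set set => nat set set => tangle" where
 "cl b a = (`) Top ` b Un (`) Bot ` a"

lemma closed_up_cl: "closed_up b T a = cl b a Un T" by (auto simp: closed_up_def cl_def)

locale tangle_setting = fixes m n :: nat
begin

abbreviation (input) "V \<equiv> endpoints m n"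
abbreviation (input) "pos \<equiv> boundary_pos m"

lemma endpoints_iff: "Top i : V \<longleftrightarrow> 1 <= i & i <= 2 * m" "Bot j : V \<longleftrightarrow> 1 <= j & j <= 2 * n"
 by (auto simp: endpoints_def)

lemma bend_pos: "e : V ==> bend_point m (pos e) = e" by (cases e) (auto simp: endpoints_iff bend_point_def)

lemma pos_bend: "i : {1..2 * (m + n)} ==> pos (bend_point m i) = i" by (auto simp: bend_point_def)

lemma bend_in: "i : {1..2 * (m + n)} ==> bend_point m i : V" by (auto simp: bend_point_def endpoints_iff)

lemma pos_in: "e : V ==> pos e : {1..2 * (m + n)}" by (cases e) (auto simp: endpoints_iff)

lemma pos_image: "pos ` V = {1..2 * (m + n)}"
proof
 show "{1..2 * (m + n)} <= pos ` V"
 proof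
  fix i assume "i : {1..2 * (m + n)}"
  thus "i : pos ` V" using pos_bend[of i] bend_in[of i] by (metis imageI)
 qed
qed (use pos_in in blast)

lemma bend_image: "bend_point m ` {1..2 * (m + n)} = V"
proof
 show "V <= bend_point m ` {1..2 * (m + n)}"
 proof
  fix e assume "e : V"
  thus "e : bend_point m ` {1..2 * (m + n)}" using bend_pos[of e] pos_in[of e] by (metis imageI)
 qed
qed (use bend_in in blast)

lemma inj_pos_V: "inj_on pos V" by (rule inj_on_inverseI[of _ "bend_point m"]) (rule bend_pos)

lemma inj_bend: "inj_on (bend_point m) {1..2 * (m + n)}" by (rule inj_on_inverseI[of _ pos]) (rule pos_bend)

sublocale planar_points V pos is_top "2 * (m + n)"
proof
 show "finite V" by (simp add: endpoints_def)
 show "inj_on pos V" by (rule inj_pos_V)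
 show "pos ` V = {1..2 * (m + n)}" by (rule pos_image)
 show "pos p < pos q" if "p : V" "q : V" "is_top p" "~ is_top q" for p q
  using that by (cases p; cases q) (auto simp: endpoints_iff)
qed

notation hmul (infixl "**" 70)

lemma tangles_cm: "T : tangles m n \<longleftrightarrow> cm T" by (simp add: tangles_def)

definition unbend :: "tangle => nat set set" where
 "unbend T = (`) pos ` T"

lemma bend_cm: "M : matchings (m + n) ==> cm (bend m M)"
 using crossingless_on_image[of "%i. i" "{1..2 * (m + n)}" M "bend_point m" pos, OF _ inj_bend]
 unfolding matchings_def bend_def bend_image by (simp add: pos_bend)

lemma unbend_matching: "cm T ==> unbend T : matchings (m + n)"
 using crossingless_on_image[of pos V T pos "%i. i", OF _ inj_pos_V]
 unfolding matchings_def unbend_def pos_image by simp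

lemma image_bend_pos: "A <= V ==> bend_point m ` pos ` A = A" using bend_pos by (force simp: image_image)

lemma image_pos_bend: "A <= {1..2 * (m + n)} ==> pos ` bend_point m ` A = A"
 using pos_bend by (force simp: image_image)

lemma bend_unbend: "\<Union>T <= V ==> bend m (unbend T) = T"
proof -
 assume "\<Union>T <= V"
 hence "bend_point m ` pos ` A = A" if "A : T" for A by (intro image_bend_pos) (use that in blast)
 thus ?thesis unfolding bend_def unbend_def image_image[of "(`) (bend_point m)"] by simp
qed

lemma unbend_bend: "\<Union>M <= {1..2 * (m + n)} ==> unbend (bend m M) = M"
proof -
 assume "\<Union>M <= {1..2 * (m + n)}"
 hence "pos ` bend_point m ` A = A" if "A : M" for A by (intro image_pos_bend) (use that in blast)
 thus ?thesis unfolding bend_def unbend_def image_image[of "(`) pos"] by simp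
qed

lemma cm_Union: "cm x ==> \<Union>x = V" using partition_onD1[OF cm_partition] by blast

lemma matchings_Union: "M : matchings k ==> \<Union>M = {1..2 * k}"
 using partition_onD1[OF crossingless_onD(1), of "%i. i" "{1..2 * k}" M] unfolding matchings_def mem_Collect_eq by metis

lemma circ_bend: assumes "\<Union>(b Un a) <= {1..2 * (m + n)}"
 shows "circ (bend m b) (bend m a) = (`) (bend_point m) ` circ b a"
 using cc_image_inj[OF inj_on_subset[OF inj_bend assms]] by (simp add: bend_def image_Un)

lemma split_cl: assumes b: "b : matchings m" and a: "a : matchings n" shows "split_cm (cl b a)"
proof
 have B: "crossingless_on pos (Top ` {1..2 * m}) ((`) Top ` b)"
  by (rule crossingless_on_image[of "%i. i"]) (use b in "auto simp: matchings_def inj_on_def")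
 have A: "crossingless_on pos (Bot ` {1..2 * n}) ((`) Bot ` a)"
  by (rule crossingless_on_image[of "%i. i"]) (use a in "auto simp: matchings_def inj_on_def")
 show "cm (cl b a)" unfolding cl_def endpoints_def by (rule crossingless_on_Un[OF B A]) auto
 show "hor (cl b a)" unfolding hor_def
 proof (intro allI impI)
  fix p q assume "{p, q} : cl b a"
  then consider al where "{p, q} = Top ` al" | al where "{p, q} = Bot ` al" unfolding cl_def by blast
  thus "is_top p = is_top q"
  proof cases
   case 1
   hence "p : Top ` al" "q : Top ` al" by auto
   thus ?thesis by auto
  next
   case 2
   hence "p : Bot ` al" "q : Bot ` al" by auto
   thus ?thesis by auto
  qed
 qed
qed

lemma image_image_inj: "inj f ==> (`) f ` A = (`) f ` B \<longleftrightarrow> A = B"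
 using inj_image_eq_iff[of "(`) f" A B] inj_image_eq_iff[of f] by (metis injI)

lemma cl_parts: assumes "{} ~: b" "{} ~: a"
 shows "{al : cl b a. al <= range Top} = (`) Top ` b" "{al : cl b a. al <= range Bot} = (`) Bot ` a"
proof -
 have pick: "{al : A Un B. P al} = A" "{al : B Un A. P al} = A" if "ALL al:A. P al" "ALL al:B. ~ P al" for A B :: "tangle" and P
  using that by blast+
 have no: "~ Bot ` al <= range Top" "~ Top ` al <= range Bot" if "al ~= {}" for al using that by auto
 have f: "ALL al:(`) Bot ` a. ~ al <= range Top" "ALL al:(`) Top ` b. ~ al <= range Bot"
  using no assms by (metis imageE)+
 have g: "ALL al:(`) Top ` b. al <= range Top" "ALL al:(`) Bot ` a. al <= range Bot" by auto
 show "{al : cl b a. al <= range Top} = (`) Top ` b" "{al : cl b a. al <= range Bot} = (`) Bot ` a"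
  unfolding cl_def by (rule pick(1)[OF g(1) f(1)], rule pick(2)[OF g(2) f(2)])
qed

lemma matching_ne: "b : matchings k ==> {} ~: b"
 unfolding matchings_def mem_Collect_eq by (rule crossingless_onD(4))

lemma cl_inj: assumes "b : matchings m" "a : matchings n" "b' : matchings m" "a' : matchings n" "cl b a = cl b' a'"
 shows "b = b'" "a = a'"
proof -
 have ne: "{} ~: b" "{} ~: a" "{} ~: b'" "{} ~: a'" using matching_ne assms(1-4) by metis+
 have "(`) Top ` b = (`) Top ` b'" "(`) Bot ` a = (`) Bot ` a'"
  using cl_parts[OF ne(1,2)] cl_parts[OF ne(3,4)] unfolding assms(5) by simp_all
 thus "b = b'" "a = a'" using image_image_inj[of Top] image_image_inj[of Bot] by (simp_all add: inj_on_def)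
qed

lemma split_cmE: assumes x: "split_cm x"
 obtains b a where "b : matchings m" "a : matchings n" "x = cl b a"
proof -
 have xc: "cm x" and hx: "hor x" using x by auto
 have arc: "al <= Top ` {1..2 * m} | al <= Bot ` {1..2 * n}" if al: "al : x" for al
 proof -
  obtain p q where pq: "al = {p, q}" "p : V" "q : V" using cm_arcE[OF xc al] by metis
  hence "is_top p = is_top q" using hx al by (simp add: hor_def)
  thus ?thesis using pq by (cases p; cases q) (auto simp: endpoints_iff)
 qed
 have disj: "Top ` {1..2 * m} Int Bot ` {1..2 * n} = {}" by auto
 have cb: "crossingless_on pos (Top ` {1..2 * m}) {al : x. al <= Top ` {1..2 * m}}"
  by (rule crossingless_on_restrict[OF xc]) (use arc disj in "auto simp: endpoints_def")
 have ca: "crossingless_on pos (Bot ` {1..2 * n}) {al : x. al <= Bot ` {1..2 * n}}"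
  by (rule crossingless_on_restrict[OF xc]) (use arc disj in "auto simp: endpoints_def")
 define unt where "unt = (%e. case e of Top i => i | Bot i => i)"
 have unt: "unt (Top i) = i" "unt (Bot i) = i" for i by (simp_all add: unt_def)
 have ib: "unt ` Top ` A = A" "unt ` Bot ` A = A" for A by (simp_all add: image_image unt)
 have uT: "Top ` unt ` A = A" if "A <= Top ` B" for A B
  using that by (elim subset_imageE) (simp add: image_image unt)
 have uB: "Bot ` unt ` A = A" if "A <= Bot ` B" for A B
  using that by (elim subset_imageE) (simp add: image_image unt)
 define b where "b = (`) unt ` {al : x. al <= Top ` {1..2 * m}}"
 define a where "a = (`) unt ` {al : x. al <= Bot ` {1..2 * n}}"
 have "crossingless_on (%i. i) (unt ` Top ` {1..2 * m}) b" unfolding b_def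
  by (rule crossingless_on_image[OF cb]) (auto simp: unt inj_on_def)
 hence bm: "b : matchings m" unfolding ib matchings_def by simp
 have "crossingless_on (%i. i) (unt ` Bot ` {1..2 * n}) a" unfolding a_def
  by (rule crossingless_on_image[OF ca]) (auto simp: unt inj_on_def)
 hence am: "a : matchings n" unfolding ib matchings_def by simp
 have "(`) Top ` b = {al : x. al <= Top ` {1..2 * m}}"
 proof -
  have "(`) Top ` b = (%al. Top ` unt ` al) ` {al : x. al <= Top ` {1..2 * m}}" unfolding b_def by (simp only: image_image)
  also have "... = (%al. al) ` {al : x. al <= Top ` {1..2 * m}}" by (rule image_cong[OF refl]) (elim CollectE conjE, rule uT)
  finally show ?thesis by simp
 qed
 moreover have "(`) Bot ` a = {al : x. al <= Bot ` {1..2 * n}}"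
 proof -
  have "(`) Bot ` a = (%al. Bot ` unt ` al) ` {al : x. al <= Bot ` {1..2 * n}}" unfolding a_def by (simp only: image_image)
  also have "... = (%al. al) ` {al : x. al <= Bot ` {1..2 * n}}" by (rule image_cong[OF refl]) (elim CollectE conjE, rule uB)
  finally show ?thesis by simp
 qed
 moreover have "{al : x. P al} Un {al : x. P' al} = x" if "!!al. al : x ==> P al | P' al" for P P' using that by auto
 note this[OF arc]
 ultimately have "cl b a = x" unfolding cl_def by (simp only:)
 thus ?thesis using that bm am by simp
qed

text \<open>All arcs before and after the surgery are horizontal, so its four points lie on one
  line. Hence the surgery is realized by one of the two arc rings.\<close>

lemma split_surg: assumes b: "b : matchings m" "a : matchings n" and b': "b' : matchings m" "a' : matchings n"
  and s: "sg (cl b a) (cl b' a') p q r s"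
 shows "b = b' | a = a'"
proof -
 have x: "{p, q} : cl b a" "{r, s} : cl b a" "cl b' a' = cl b a - {{p, q}, {r, s}} Un {{p, s}, {r, q}}"
  using s by (simp_all add: surg_def)
 have h: "hor (cl b a)" "hor (cl b' a')" using split_cl b b' by auto
 have t: "is_top p = is_top q" "is_top r = is_top s" "is_top p = is_top s" using h x unfolding hor_def by blast+
 have ne: "{} ~: b" "{} ~: a" "{} ~: b'" "{} ~: a'" using matching_ne b b' by metis+
 show ?thesis
 proof (cases "is_top p")
  case True
  hence "~ {p, q} <= range Bot" "~ {r, s} <= range Bot" "~ {p, s} <= range Bot" "~ {r, q} <= range Bot"
   using t by (auto simp: is_top_def)
  hence "{al : cl b' a'. al <= range Bot} = {al : cl b a. al <= range Bot}" unfolding x(3) by blast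
  hence "(`) Bot ` a' = (`) Bot ` a" unfolding cl_parts(2)[OF ne(1,2)] cl_parts(2)[OF ne(3,4)] .
  thus ?thesis using image_image_inj[of Bot a' a] by (simp add: inj_on_def)
 next
  case False
  hence "~ {p, q} <= range Top" "~ {r, s} <= range Top" "~ {p, s} <= range Top" "~ {r, q} <= range Top"
   using t by (auto simp: is_top_def)
  hence "{al : cl b' a'. al <= range Top} = {al : cl b a. al <= range Top}" unfolding x(3) by blast
  hence "(`) Top ` b' = (`) Top ` b" unfolding cl_parts(1)[OF ne(1,2)] cl_parts(1)[OF ne(3,4)] .
  thus ?thesis using image_image_inj[of Top b' b] by (simp add: inj_on_def)
 qed
qed

end

section \<open>Bimodule homomorphisms as right multiplications\<close>

lemma saddles_commute: "saddles f g b = saddles g f b" by (simp add: saddles_def Un_commute)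

context marked_points
begin

lemma keys_hmul_gen: "keys (hmul_gen (x, y, D) (y', z, E)) <= (if y = y' then {(x, z, G) | G. G <= circ x z} else {})"
proof (cases "y = y'")
 case True
 thus ?thesis using hmul_gen_Fs[of x y D y' z E] unfolding Fs_def mem_Collect_eq by (simp only: if_True simp_thms)
qed simp

lemma keys_hmul: assumes "k : keys (u ** v)"
 shows "EX x y z D E G. (x, y, D) : keys u & (y, z, E) : keys v & k = (x, z, G) & G <= circ x z"
proof -
 obtain p where p: "p : keys u" "k : keys (frag_extend (hmul_gen p) v)"
  using assms keys_frag_extend[of "%p. frag_extend (hmul_gen p) v" u] unfolding hmul_def bilinear_extend_def by blast
 obtain q where q: "q : keys v" "k : keys (hmul_gen p q)" using p(2) keys_frag_extend[of "hmul_gen p" v] by blast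
 obtain x y D where pe: "p = (x, y, D)" by (cases p) auto
 obtain y' z E where qe: "q = (y', z, E)" by (cases q) auto
 have "y = y'" "k : {(x, z, G) | G. G <= circ x z}"
  using q(2) keys_hmul_gen[of x y D y' z E] unfolding pe qe by (auto split: if_splits)
 thus ?thesis using p(1) q(1) unfolding pe qe by blast
qed

end

context tangle_setting
begin

definition gens :: "tangle => tangle_gen set" where
 "gens T = tangle_gens m n T"

lemma gens_iff: "(b, a, D) : gens T \<longleftrightarrow> b : matchings m & a : matchings n & D <= circ (cl b a) T"
 by (simp add: gens_def tangle_gens_def closed_up_cl)

lemma carrier_tangle_module: "u : carrier (tangle_module m n T) \<longleftrightarrow> keys u <= gens T"
 by (simp add: tangle_module_def gens_def)

fun Jg :: "tangle => tangle_gen => endpoint hgen" where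
 "Jg T (b, a, D) = (cl b a, T, D)"

text \<open>A generator \<open>W(b) T a\<close> is read as the morphism from \<open>cl b a\<close>
  to \<open>T\<close> with the same dots. The map \<open>U\<close> inverts this and kills all basis
  elements of other forms, so it also selects the target \<open>T\<close>.\<close>

definition J :: "tangle => (tangle_gen \<Rightarrow>\<^sub>0 int) => endpoint hgen \<Rightarrow>\<^sub>0 int" where
 "J T u = frag_extend (%g. frag_of (Jg T g)) u"

definition U :: "tangle => (endpoint hgen \<Rightarrow>\<^sub>0 int) => tangle_gen \<Rightarrow>\<^sub>0 int" where
 "U T v = frag_extend (%h. if h : Jg T ` gens T then frag_of (inv_into (gens T) (Jg T) h) else 0) v"

lemma Jg_inj: "inj_on (Jg T) (gens T)"
proof (rule inj_onI)
 fix g g' assume g: "g : gens T" "g' : gens T" "Jg T g = Jg T g'"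
 obtain b a D where ge: "g = (b, a, D)" by (cases g) auto
 obtain b' a' D' where ge': "g' = (b', a', D')" by (cases g') auto
 have "cl b a = cl b' a'" "D = D'" using g(3) unfolding ge ge' by simp_all
 thus "g = g'" using cl_inj[of b a b' a'] g(1,2) unfolding ge ge' gens_iff by simp
qed

lemma J_of [simp]: "J T (frag_of (b, a, D)) = bas (cl b a) T D" by (simp add: J_def)

lemma J_diff: "J T (u - v) = J T u - J T v" and J_0 [simp]: "J T 0 = 0" and J_add: "J T (u + v) = J T u + J T v"
 by (simp_all add: J_def frag_extend_diff frag_extend_add)

lemma U_diff: "U T (u - v) = U T u - U T v" and U_0 [simp]: "U T 0 = 0" and U_add: "U T (u + v) = U T u + U T v"
 by (simp_all add: U_def frag_extend_diff frag_extend_add)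

lemma U_of: "(b, a, D) : gens T ==> U T (bas (cl b a) T D) = frag_of (b, a, D)"
 using inv_into_f_f[OF Jg_inj, of "(b, a, D)" T] image_eqI[of "(cl b a, T, D)" "Jg T" "(b, a, D)" "gens T"]
 by (simp add: U_def)

lemma U_J: "keys u <= gens T ==> U T (J T u) = u"
 by (rule frag_additive_eqI[of u "gens T" "%u. U T (J T u)" "%u. u"])
  (auto simp: J_diff U_diff U_of)

lemma U_other: "t ~= T ==> U T (bas x t D) = 0" by (auto simp: U_def)

lemma keys_U: "keys (U T v) <= gens T"
proof -
 have "keys (if h : Jg T ` gens T then frag_of (inv_into (gens T) (Jg T) h) else 0) <= gens T" for h
  using inv_into_into[of h "Jg T" "gens T"] by auto
 thus ?thesis using keys_frag_extend[of "%h. if h : Jg T ` gens T then frag_of (inv_into (gens T) (Jg T) h) else 0" v]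
  unfolding U_def by blast
qed

lemma J_U: "b : matchings m ==> a : matchings n ==> v : Fs (cl b a) T ==> J T (U T v) = v"
 by (rule Fs_eqI[of v "cl b a" T "%v. J T (U T v)" "%v. v"]) (simp_all add: J_diff U_diff U_of gens_iff)

lemma U_Fs_keys: assumes b: "b : matchings m" "a : matchings n" and v: "v : Fs (cl b a) T"
 shows "keys (U T v) <= {(b, a, D) | D. D <= circ (cl b a) T}" using v
proof (induction rule: Fs_induct)
 case (bas D)
 thus ?case using b by (simp add: U_of gens_iff)
next
 case (diff u v)
 thus ?case using keys_diff[of "U T u" "U T v"] unfolding U_diff by (meson Un_least subset_trans)
qed simp

lemma J_Fs: "keys u <= {(b, a, D) | D. D <= circ (cl b a) T} ==> J T u : Fs (cl b a) T"
 using keys_frag_extend[of "%g. frag_of (Jg T g)" u] unfolding J_def Fs_def by fastforce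

lemma pm_cl: "b : matchings m ==> a : matchings n ==> pm (cl b a)" using split_cl cm_pm by blast

lemma matching_circ: "b : matchings k ==> circ b b = b"
 unfolding matchings_def mem_Collect_eq Un_absorb by (rule cc_partition_id[OF crossingless_onD(1)])

text \<open>The element of the arc ring is completed by the unchanged matching \<open>a\<close> on
  the other side. In \<open>J_right_gen\<close> the right action becomes a left multiplication too:
  the tangle stays at the right end of the product while the closure changes on either line.\<close>

lemma J_left_gen: assumes T: "cm T" and b: "d : matchings m" "b : matchings m" "a : matchings n"
  and D: "D <= circ d b" and E: "E <= circ (cl b a) T"
 shows "J T (left_action_gen T (d, b, D) (b, a, E)) = bas (cl d a) (cl b a) ((`) Top ` D) ** bas (cl b a) T E"
proof -
 interpret saddle_gluing V "%p. even (pos p)" Top Bot d b a T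
  by unfold_locales (use pm_cl b cm_pm[OF T] in "auto simp: inj_on_def cl_def")
 have Dx: "(`) Top ` D <= circ (cl d a) (cl b a)" unfolding cl_def circ_xy using D by blast
 have "left_action_gen T (d, b, D) (b, a, E) =
   (SUM G:Pow (circ (cl d a) T). frag_cmul (theta (cl d a) (cl b a) T ((`) Top ` D) E (circ (cl d a) T - G)) (frag_of (d, a, G)))"
  unfolding left_action_gen.simps tqft_def closed_up_cl
  using surface_theta[OF D E[unfolded cl_def], folded cl_def] by (simp add: cl_def[symmetric])
 thus ?thesis unfolding hmul_bas[OF pm_cl[OF b(1,3)] pm_cl[OF b(2,3)] cm_pm[OF T] Dx E]
  by (simp add: J_def frag_extend_sum finite_circ[OF pm_cl[OF b(1,3)] cm_pm[OF T]] frag_extend_cmul)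
qed

lemma J_right_gen: assumes T: "cm T" and b: "b : matchings m" "a : matchings n" "c : matchings n"
  and D: "D <= circ a c" and E: "E <= circ (cl b a) T"
 shows "J T (right_action_gen T (b, a, E) (a, c, D)) = bas (cl b c) (cl b a) ((`) Bot ` D) ** bas (cl b a) T E"
proof -
 have cl_swap: "(`) Bot ` a Un (`) Top ` b = cl b a" for a b by (auto simp: cl_def)
 interpret saddle_gluing V "%p. even (pos p)" Bot Top c a b T
  by unfold_locales (use pm_cl b cm_pm[OF T] in "auto simp: inj_on_def cl_swap")
 have D': "D <= circ c a" using D by (simp add: Un_commute)
 have Dx: "(`) Bot ` D <= circ (cl b c) (cl b a)" unfolding cl_swap[symmetric] circ_xy using D' by blast
 have pieces: "strips (Inr \<circ> Top) b + strips Inr T + saddles (Inr \<circ> Bot) Inl a + strips Inl c =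
   strips Inl c + saddles Inl (Inr \<circ> Bot) a + strips Inr T + strips (Inr \<circ> Top) b"
  by (simp add: saddles_commute[of Inl] add_ac)
 have "right_action_gen T (b, a, E) (a, c, D) =
   (SUM G:Pow (circ (cl b c) T). frag_cmul (theta (cl b c) (cl b a) T ((`) Bot ` D) E (circ (cl b c) T - G)) (frag_of (b, c, G)))"
  unfolding right_action_gen.simps tqft_def closed_up_cl pieces
  using surface_theta[OF D' E[folded cl_swap], unfolded cl_swap] by (simp add: Un_commute[of "(`) Inr ` _" "(`) Inl ` _"] Un_commute[of a c])
 thus ?thesis unfolding hmul_bas[OF pm_cl[OF b(1,3)] pm_cl[OF b(1,2)] cm_pm[OF T] Dx E]
  by (simp add: J_def frag_extend_sum finite_circ[OF pm_cl[OF b(1,3)] cm_pm[OF T]] frag_extend_cmul)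
qed

lemma keys_tqft: "keys (tqft Q In D io Out lab) <= lab ` Pow Out"
proof
 let ?c = "%E. cob_coeff Q In ((`) io ` Out) D ((`) io ` E)"
 fix k assume "k : keys (tqft Q In D io Out lab)"
 then obtain E where E: "E : Pow Out" "k : keys (frag_cmul (?c E) (frag_of (lab E)))"
  using keys_sum[of "%E. frag_cmul (?c E) (frag_of (lab E))" "Pow Out"] unfolding tqft_def by blast
 hence "k = lab E" using keys_cmul[of "?c E" "frag_of (lab E)"] by auto
 thus "k : lab ` Pow Out" using E(1) by blast
qed

lemma keys_left_gen:
 "keys (left_action_gen T (d, c, D) (b, a, E)) <= (if c = b then {(d, a, G) | G. G <= circ (cl d a) T} else {})"
 unfolding left_action_gen.simps closed_up_cl by (auto dest!: subsetD[OF keys_tqft])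

lemma keys_right_gen:
 "keys (right_action_gen T (b, a, E) (d, c, D)) <= (if a = d then {(b, c, G) | G. G <= circ (cl b c) T} else {})"
 unfolding right_action_gen.simps closed_up_cl by (auto dest!: subsetD[OF keys_tqft])

lemma left_action_of: "left_action T (frag_of h) u = frag_extend (left_action_gen T h) u"
 by (simp add: left_action_def bilinear_extend_def)

lemma right_action_of: "right_action T u (frag_of h) = frag_extend (%g. right_action_gen T g h) u"
 by (simp add: right_action_def bilinear_extend_def)

lemma J_left: assumes T: "cm T" and b: "d : matchings m" "b : matchings m" "a : matchings n"
  and D: "D <= circ d b" and v: "v : Fs (cl b a) T"
 shows "J T (left_action T (frag_of (d, b, D)) (U T v)) = bas (cl d a) (cl b a) ((`) Top ` D) ** v"
 by (rule Fs_eqI[OF v, of "%v. J T (left_action T (frag_of (d, b, D)) (U T v))" "%v. bas (cl d a) (cl b a) ((`) Top ` D) ** v"])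
  (simp_all add: U_diff left_action_of frag_extend_diff J_diff hmul_simps U_of gens_iff b J_left_gen[OF T b D] del: left_action_gen.simps)

lemma J_right: assumes T: "cm T" and b: "b : matchings m" "a : matchings n" "c : matchings n"
  and D: "D <= circ a c" and v: "v : Fs (cl b a) T"
 shows "J T (right_action T (U T v) (frag_of (a, c, D))) = bas (cl b c) (cl b a) ((`) Bot ` D) ** v"
 by (rule Fs_eqI[OF v, of "%v. J T (right_action T (U T v) (frag_of (a, c, D)))" "%v. bas (cl b c) (cl b a) ((`) Bot ` D) ** v"])
  (simp_all add: U_diff right_action_of frag_extend_diff J_diff hmul_simps U_of gens_iff b J_right_gen[OF T b D] del: right_action_gen.simps)

lemma keys_left: assumes T: "cm T" and d: "d : matchings m" and u: "keys u <= gens T"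
 shows "keys (left_action T (frag_of (d, c, D)) u) <= {g : gens T. fst g = d}"
proof
 fix g assume "g : keys (left_action T (frag_of (d, c, D)) u)"
 then obtain g' where g': "g' : keys u" "g : keys (left_action_gen T (d, c, D) g')"
  using keys_frag_extend[of "left_action_gen T (d, c, D)" u] unfolding left_action_of by blast
 obtain b a E where e: "g' = (b, a, E)" by (cases g') auto
 have "a : matchings n" using g'(1) u e gens_iff[of b a E T] by blast
 thus "g : {g : gens T. fst g = d}"
  using g'(2) keys_left_gen[of T d c D b a E] d unfolding e by (auto simp: gens_iff split: if_splits simp del: left_action_gen.simps)
qed

lemma keys_right: assumes T: "cm T" and c: "c : matchings n" and u: "keys u <= gens T"
 shows "keys (right_action T u (frag_of (d, c, D))) <= {g : gens T. fst (snd g) = c}"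
proof
 fix g assume "g : keys (right_action T u (frag_of (d, c, D)))"
 then obtain g' where g': "g' : keys u" "g : keys (right_action_gen T g' (d, c, D))"
  using keys_frag_extend[of "%g. right_action_gen T g (d, c, D)" u] unfolding right_action_of by blast
 obtain b a E where e: "g' = (b, a, E)" by (cases g') auto
 have "b : matchings m" using g'(1) u e gens_iff[of b a E T] by blast
 thus "g : {g : gens T. fst (snd g) = c}"
  using g'(2) keys_right_gen[of T b a E d c D] c unfolding e by (auto simp: gens_iff split: if_splits simp del: right_action_gen.simps)
qed

lemma bimodule_homD: assumes f: "f : bimodule_homs m n T1 T2" shows "keys u <= gens T1 ==> keys (f u) <= gens T2"
  and "keys u <= gens T1 ==> keys v <= gens T1 ==> f (u + v) = f u + f v"
  and "h : arc_gens m ==> keys u <= gens T1 ==> f (left_action T1 (frag_of h) u) = left_action T2 (frag_of h) (f u)"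
  and "h : arc_gens n ==> keys u <= gens T1 ==> f (right_action T1 u (frag_of h)) = right_action T2 (f u) (frag_of h)"
  and "~ keys u <= gens T1 ==> f u = 0"
proof -
 have h: "f : hom (tangle_module m n T1) (tangle_module m n T2)" using f by (simp add: bimodule_homs_def)
 have L: "ALL h:carrier (arc_ring m). ALL x:carrier (tangle_module m n T1). f (left_action T1 h x) = left_action T2 h (f x)"
  and R: "ALL h:carrier (arc_ring n). ALL x:carrier (tangle_module m n T1). f (right_action T1 x h) = right_action T2 (f x) h"
  using f unfolding bimodule_homs_def by blast+
 show "keys u <= gens T1 ==> keys (f u) <= gens T2"
  using hom_in_carrier[OF h, of u] by (simp add: carrier_tangle_module)
 show "keys u <= gens T1 ==> keys v <= gens T1 ==> f (u + v) = f u + f v"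
  using hom_mult[OF h, of u v] unfolding carrier_tangle_module by (simp add: tangle_module_def)
 show "h : arc_gens m ==> keys u <= gens T1 ==> f (left_action T1 (frag_of h) u) = left_action T2 (frag_of h) (f u)"
  by (rule L[rule_format]) (simp_all add: arc_ring_def carrier_tangle_module)
 show "h : arc_gens n ==> keys u <= gens T1 ==> f (right_action T1 u (frag_of h)) = right_action T2 (f u) (frag_of h)"
  by (rule R[rule_format]) (simp_all add: arc_ring_def carrier_tangle_module)
 show "~ keys u <= gens T1 ==> f u = 0" using f unfolding bimodule_homs_def carrier_tangle_module by simp
qed

lemma bimodule_hom_diff: assumes f: "f : bimodule_homs m n T1 T2" and u: "keys u <= gens T1" "keys v <= gens T1"
 shows "f (u - v) = f u - f v"
proof -
 have "keys (u - v) <= gens T1" using keys_diff[of u v] u by blast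
 hence "f ((u - v) + v) = f (u - v) + f v" by (rule bimodule_homD(2)[OF f _ u(2)])
 thus ?thesis by simp
qed

lemma arc_gens_iff: "(d, b, D) : arc_gens k \<longleftrightarrow> d : matchings k & b : matchings k & D <= circ d b"
 by (simp add: arc_gens_def)

text \<open>Compatibility with the idempotents \<open>(b, b, {})\<close> and
  \<open>(a, a, {})\<close> forces the value into the summand with the same indices.\<close>

lemma bimodule_hom_Fs: assumes f: "f : bimodule_homs m n T1 T2" and T: "cm T1" "cm T2"
  and b: "b : matchings m" "a : matchings n" and v: "v : Fs (cl b a) T1"
 shows "J T2 (f (U T1 v)) : Fs (cl b a) T2"
proof (rule J_Fs)
 let ?w = "U T1 v"
 have w: "keys ?w <= gens T1" by (rule keys_U)
 have fw: "keys (f ?w) <= gens T2" by (rule bimodule_homD(1)[OF f w])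
 have u: "bas (cl b a) (cl b a) {} ** v = v" by (rule unit_left[OF pm_cl[OF b] cm_pm[OF T(1)] v])
 have "left_action T1 (frag_of (b, b, {})) ?w = U T1 (J T1 (left_action T1 (frag_of (b, b, {})) ?w))"
  by (rule U_J[symmetric]) (use keys_left[OF T(1) b(1) w] in blast)
 also have "... = ?w" using J_left[OF T(1) b(1) b(1,2) _ v, of "{}"] u by simp
 finally have l: "f ?w = left_action T2 (frag_of (b, b, {})) (f ?w)"
  using bimodule_homD(3)[OF f _ w, of "(b, b, {})"] b by (simp add: arc_gens_iff)
 have "right_action T1 ?w (frag_of (a, a, {})) = U T1 (J T1 (right_action T1 ?w (frag_of (a, a, {}))))"
  by (rule U_J[symmetric]) (use keys_right[OF T(1) b(2) w] in blast)
 also have "... = ?w" using J_right[OF T(1) b b(2) _ v, of "{}"] u by simp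
 finally have r: "f ?w = right_action T2 (f ?w) (frag_of (a, a, {}))"
  using bimodule_homD(4)[OF f _ w, of "(a, a, {})"] b by (simp add: arc_gens_iff)
 have "keys (f ?w) <= {g : gens T2. fst g = b}" using keys_left[OF T(2) b(1) fw, of b "{}"] l by simp
 hence kl: "g : gens T2 & fst g = b" if "g : keys (f ?w)" for g using that by blast
 have "keys (f ?w) <= {g : gens T2. fst (snd g) = a}" using keys_right[OF T(2) b(2) fw, of a "{}"] r by simp
 hence kr: "fst (snd g) = a" if "g : keys (f ?w)" for g using that by blast
 show "keys (f ?w) <= {(b, a, D) | D. D <= circ (cl b a) T2}" using kl kr gens_iff by auto
qed

lemma bimodule_hom_left: assumes f: "f : bimodule_homs m n T1 T2" and T: "cm T1" "cm T2"
  and b: "d : matchings m" "b : matchings m" "a : matchings n" and D: "D <= circ d b" and v: "v : Fs (cl b a) T1"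
 shows "J T2 (f (U T1 (bas (cl d a) (cl b a) ((`) Top ` D) ** v))) = bas (cl d a) (cl b a) ((`) Top ` D) ** J T2 (f (U T1 v))"
proof -
 let ?h = "frag_of (d, b, D)"
 have w: "keys (U T1 v) <= gens T1" by (rule keys_U)
 have "U T1 (bas (cl d a) (cl b a) ((`) Top ` D) ** v) = left_action T1 ?h (U T1 v)"
  unfolding J_left[OF T(1) b D v, symmetric] by (rule U_J) (use keys_left[OF T(1) b(1) w] in blast)
 hence "f (U T1 (bas (cl d a) (cl b a) ((`) Top ` D) ** v)) = left_action T2 ?h (f (U T1 v))"
  using bimodule_homD(3)[OF f _ w, of "(d, b, D)"] b D by (simp add: arc_gens_iff)
 also have "... = left_action T2 ?h (U T2 (J T2 (f (U T1 v))))" using U_J[OF bimodule_homD(1)[OF f w]] by simp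
 finally show ?thesis using J_left[OF T(2) b D bimodule_hom_Fs[OF f T b(2,3) v]] by simp
qed

lemma bimodule_hom_right: assumes f: "f : bimodule_homs m n T1 T2" and T: "cm T1" "cm T2"
  and b: "b : matchings m" "a : matchings n" "c : matchings n" and D: "D <= circ a c" and v: "v : Fs (cl b a) T1"
 shows "J T2 (f (U T1 (bas (cl b c) (cl b a) ((`) Bot ` D) ** v))) = bas (cl b c) (cl b a) ((`) Bot ` D) ** J T2 (f (U T1 v))"
proof -
 let ?h = "frag_of (a, c, D)"
 have w: "keys (U T1 v) <= gens T1" by (rule keys_U)
 have "U T1 (bas (cl b c) (cl b a) ((`) Bot ` D) ** v) = right_action T1 (U T1 v) ?h"
  unfolding J_right[OF T(1) b D v, symmetric] by (rule U_J) (use keys_right[OF T(1) b(3) w] in blast)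
 hence "f (U T1 (bas (cl b c) (cl b a) ((`) Bot ` D) ** v)) = right_action T2 (f (U T1 v)) ?h"
  using bimodule_homD(4)[OF f _ w, of "(a, c, D)"] b D by (simp add: arc_gens_iff)
 also have "... = right_action T2 (U T2 (J T2 (f (U T1 v)))) ?h" using U_J[OF bimodule_homD(1)[OF f w]] by simp
 finally show ?thesis using J_right[OF T(2) b D bimodule_hom_Fs[OF f T b(1,2) v]] by simp
qed

text \<open>Every arc of a closure, and every surgery between closures, belongs to one of the two
  lines. Multiplication by the corresponding element is therefore the action of a single generator
  of one arc ring.\<close>

lemma bimodule_hom_lin_on: assumes f: "f : bimodule_homs m n T1 T2" and T: "cm T1" "cm T2"
 shows "lin_on {} T1 T2 (%v. J T2 (f (U T1 v)))" unfolding lin_on_def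
proof (intro conjI allI impI)
 show "J T2 (f (U T1 (u - v))) = J T2 (f (U T1 u)) - J T2 (f (U T1 v))" for u v
  by (simp add: U_diff bimodule_hom_diff[OF f keys_U keys_U] J_diff)
 show "J T2 (f (U T1 v)) : Fs x T2" if x: "split_cm x" "v : Fs x T1" for x v
  by (metis split_cmE bimodule_hom_Fs that assms)
 show "J T2 (f (U T1 (bas x x {al} ** v))) = bas x x {al} ** J T2 (f (U T1 v))"
  if x: "split_cm x" "al : x" "v : Fs x T1" for x al v
 proof -
  obtain b a where ba: "b : matchings m" "a : matchings n" "x = cl b a" using split_cmE[OF x(1)] by metis
  consider be where "be : b" "al = Top ` be" | be where "be : a" "al = Bot ` be"
   using x(2) unfolding ba(3) cl_def by blast
  thus ?thesis
  proof cases
   case 1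
   show ?thesis
    using bimodule_hom_left[OF f T ba(1,1,2), of "{be}" v] x(3) 1 matching_circ[OF ba(1)] unfolding ba(3) by simp
  next
   case 2
   show ?thesis
    using bimodule_hom_right[OF f T ba(1,2,2), of "{be}" v] x(3) 2 matching_circ[OF ba(2)] unfolding ba(3) by simp
  qed
 qed
 show "J T2 (f (U T1 (bas x' x {} ** v))) = bas x' x {} ** J T2 (f (U T1 v))"
  if x: "split_cm x" "split_cm x'" "sg x x' p q r s" "v : Fs x T1" for x x' p q r s v
 proof -
  obtain b a where ba: "b : matchings m" "a : matchings n" "x = cl b a" using split_cmE[OF x(1)] by metis
  obtain b' a' where ba': "b' : matchings m" "a' : matchings n" "x' = cl b' a'" using split_cmE[OF x(2)] by metis
  have "b = b' | a = a'" using split_surg[OF ba(1,2) ba'(1,2)] x(3) unfolding ba(3) ba'(3) by metis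
  thus ?thesis
  proof
   assume "a = a'"
   thus ?thesis using bimodule_hom_left[OF f T ba'(1) ba(1,2), of "{}" v] x(4) unfolding ba(3) ba'(3) by simp
  next
   assume "b = b'"
   thus ?thesis using bimodule_hom_right[OF f T ba(1,2) ba'(2), of "{}" v] x(4) unfolding ba(3) ba'(3) by simp
  qed
 qed
qed

theorem bimodule_hom_right_mult: assumes f: "f : bimodule_homs m n T1 T2" and T: "cm T1" "cm T2"
 obtains y where "y : Fs T1 T2" "!!u. keys u <= gens T1 ==> f u = U T2 (J T1 u ** y)"
proof -
 have "centralized {} T1 T2 (%v. J T2 (f (U T1 v)))"
  by (rule double_centralizer[OF T _ _ _ bimodule_hom_lin_on[OF f T]]) (simp_all add: hor_def)
 then obtain y where y: "y : Fs T1 T2" "ALL x w. split_cm x --> {} <= x --> w : Fs x T1 --> J T2 (f (U T1 w)) = w ** y"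
  unfolding centralized_def by (elim exE conjE)
 have "f u = U T2 (J T1 u ** y)" if "keys u <= gens T1" for u
 proof (rule free_Abelian_group_induct[OF that])
  have "f 0 = 0" using bimodule_homD(2)[OF f, of 0 0] by simp
  thus "f 0 = U T2 (J T1 0 ** y)" by (simp add: hmul_simps)
  show "f (v - w) = U T2 (J T1 (v - w) ** y)"
   if "keys v <= gens T1" "keys w <= gens T1" "f v = U T2 (J T1 v ** y)" "f w = U T2 (J T1 w ** y)" for v w
   using bimodule_hom_diff[OF f that(1,2)] that(3,4) by (simp add: J_diff hmul_simps U_diff)
  fix g assume g: "g : gens T1"
  obtain b a D where e: "g = (b, a, D)" by (cases g) auto
  have ba: "b : matchings m" "a : matchings n" "D <= circ (cl b a) T1" using g unfolding e gens_iff by auto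
  have "U T2 (J T2 (f (frag_of g))) = f (frag_of g)" by (rule U_J[OF bimodule_homD(1)[OF f]]) (use g in simp)
  hence "f (frag_of g) = U T2 (J T2 (f (U T1 (bas (cl b a) T1 D))))" using U_of[of b a D T1] g unfolding e by simp
  also have "... = U T2 (bas (cl b a) T1 D ** y)" using y(2) split_cl[OF ba(1,2)] Fs_bas[OF ba(3)] by simp
  finally show "f (frag_of g) = U T2 (J T1 (frag_of g) ** y)" unfolding e by simp
 qed
 thus ?thesis using that y(1) by blast
qed

end

section \<open>The homomorphism ring as a quotient of the algebra\<close>

lemma frag_keys_induct [consumes 1, case_names zero diff of]: assumes "keys x <= S" "P 0"
  and "!!x y. keys x <= S ==> keys y <= S ==> P x ==> P y ==> P (x - y)" and "!!a. a : S ==> P (frag_of a)"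
 shows "P x" by (rule free_Abelian_group_induct[where P = P and x = x and S = S]) (use assms in blast)+

context tangle_setting
begin

definition Hs :: "(endpoint hgen \<Rightarrow>\<^sub>0 int) set" where
 "Hs = {z. keys z <= {(x, y, D). cm x & cm y & D <= circ x y}}"

definition hom_part :: "tangle => tangle => (endpoint hgen \<Rightarrow>\<^sub>0 int) => endpoint hgen \<Rightarrow>\<^sub>0 int" where
 "hom_part T1 T2 = frag_extend (%(x, y, D). if x = T1 & y = T2 then frag_of (x, y, D) else 0)"

text \<open>Right multiplication by \<open>z\<close>, with the value 0 outside of the carriers as in
  the convention of \<open>Hom_ring\<close>.\<close>

definition Theta :: "(endpoint hgen \<Rightarrow>\<^sub>0 int) => hom_family" where
 "Theta z = (%T1 T2 u. if cm T1 & cm T2 & keys u <= gens T1 then U T2 (J T1 u ** z) else 0)"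

lemma Hs_diff: "u : Hs ==> v : Hs ==> u - v : Hs" using keys_diff[of u v] unfolding Hs_def by blast

lemma Hs_add: "u : Hs ==> v : Hs ==> u + v : Hs" using keys_add[of u v] unfolding Hs_def by blast

lemma Hs_0 [simp]: "0 : Hs" by (simp add: Hs_def)

lemma Hs_sum: "(!!i. i : I ==> u i : Hs) ==> sum u I : Hs"
 by (induction I rule: infinite_finite_induct) (simp_all add: Hs_add)

lemma Hs_bas: "cm x ==> cm y ==> D <= circ x y ==> bas x y D : Hs" by (simp add: Hs_def)

lemma Fs_Hs: "cm x ==> cm y ==> v : Fs x y ==> v : Hs" unfolding Fs_def Hs_def by blast

lemma Hs_hmul: assumes u: "u : Hs" and v: "v : Hs" shows "u ** v : Hs" unfolding Hs_def mem_Collect_eq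
using keys_hmul Hs_def assms by blast

lemma Hs_induct [consumes 1, case_names zero bas diff]:
 assumes "z : Hs" "P 0" "!!x y D. cm x ==> cm y ==> D <= circ x y ==> P (bas x y D)"
  "!!u v. u : Hs ==> v : Hs ==> P u ==> P v ==> P (u - v)"
 shows "P z"
proof (rule free_Abelian_group_induct[of z "{(x, y, D). cm x & cm y & D <= circ x y}"])
 show "keys z <= {(x, y, D). cm x & cm y & D <= circ x y}" using assms(1) by (simp add: Hs_def)
 show "P (frag_of k)" if k: "k : {(x, y, D). cm x & cm y & D <= circ x y}" for k using k assms(3) by (cases k) auto
qed (use assms(2,4) in "auto simp: Hs_def")

lemma hom_part_diff: "hom_part T1 T2 (u - v) = hom_part T1 T2 u - hom_part T1 T2 v"
 and hom_part_0 [simp]: "hom_part T1 T2 0 = 0"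
 and hom_part_add: "hom_part T1 T2 (u + v) = hom_part T1 T2 u + hom_part T1 T2 v"
 by (simp_all add: hom_part_def frag_extend_diff frag_extend_add)

lemma hom_part_sum: "hom_part T1 T2 (sum u I) = (SUM i:I. hom_part T1 T2 (u i))"
 by (induction I rule: infinite_finite_induct) (simp_all add: hom_part_add)

lemma hom_part_bas: "hom_part T1 T2 (bas x y D) = (if x = T1 & y = T2 then bas x y D else 0)"
 by (simp add: hom_part_def)

lemma hom_part_of_Fs: "v : Fs x y ==> hom_part T1 T2 v = (if x = T1 & y = T2 then v else 0)"
 by (rule Fs_eqI[of v x y "hom_part T1 T2" "%v. if x = T1 & y = T2 then v else 0"]) (simp_all add: hom_part_diff hom_part_bas)

lemma hom_part_Fs: "z : Hs ==> hom_part T1 T2 z : Fs T1 T2"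
 by (induction rule: Hs_induct) (auto simp: hom_part_bas hom_part_diff Fs_diff Fs_bas)

lemma U_Fs_other: "v : Fs x t ==> t ~= T ==> U T v = 0"
 by (rule Fs_eqI[of v x t "U T" "%v. 0"]) (simp_all add: U_diff U_other)

text \<open>Parts of \<open>z\<close> with another source do not compose with \<open>J T1 u\<close>,
  and those with another target are killed by \<open>U T2\<close>.\<close>

lemma U_comp: "U T2 (J T1 u ** z) = U T2 (J T1 u ** hom_part T1 T2 z)"
proof (rule frag_additive_eqI[of z UNIV "%z. U T2 (J T1 u ** z)" "%z. U T2 (J T1 u ** hom_part T1 T2 z)"])
 fix h :: "endpoint hgen"
 obtain x y D where h: "h = (x, y, D)" by (cases h) auto
 show "U T2 (J T1 u ** frag_of h) = U T2 (J T1 u ** hom_part T1 T2 (frag_of h))"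
 proof (cases "x = T1 & y = T2")
  case False
  have "U T2 (J T1 u ** frag_of h) = 0"
  proof (rule frag_additive_eqI[of u UNIV "%u. U T2 (J T1 u ** frag_of h)" "%u. 0"])
   fix g :: tangle_gen
   obtain b a E where g: "g = (b, a, E)" by (cases g) auto
   show "U T2 (J T1 (frag_of g) ** frag_of h) = 0"
   proof (cases "x = T1")
    case True
    hence "y ~= T2" using False by simp
    thus ?thesis unfolding g h J_of hmul_of by (rule U_Fs_other[OF hmul_gen_Fs])
   qed (simp add: g h hmul_of)
  qed (simp_all add: J_diff hmul_simps U_diff)
  thus ?thesis using False by (auto simp: h hom_part_bas hmul_simps)
 qed (simp add: h hom_part_bas)
qed (simp_all add: hmul_simps U_diff hom_part_diff)

lemma J_hmul_Fs:
 "y : Fs T1 T2 ==> bas (cl b a) T1 E ** y : Fs (cl b a) T2" if "E <= circ (cl b a) T1"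
 using Fs_hmul[OF Fs_bas[OF that]] by simp

text \<open>This is associativity. The two cases distinguish whether the middle matchings of the
  generators agree; if they do not, both sides are 0.\<close>

lemma left_mult: assumes T: "cm T1" "cm T2" and y: "y : Fs T1 T2"
  and h: "keys h <= arc_gens m" and u: "keys u <= gens T1"
 shows "keys (left_action T1 h u) <= gens T1 &
  U T2 (J T1 (left_action T1 h u) ** y) = left_action T2 h (U T2 (J T1 u ** y))"
 using h
proof (induction h rule: frag_keys_induct)
 case zero
 show ?case by (simp add: left_action_def hmul_simps)
next
 case (diff h h')
 thus ?case using keys_diff[of "left_action T1 h u" "left_action T1 h' u"]
  unfolding left_action_def bilinear_diff_left by (auto simp: J_diff hmul_simps U_diff)
next
 case (of k)
 obtain d c D where k: "k = (d, c, D)" by (cases k) auto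
 have dc: "d : matchings m" "c : matchings m" "D <= circ d c" using of by (simp_all add: k arc_gens_iff)
 show ?case using u
 proof (induction u rule: frag_keys_induct)
  case zero
  show ?case by (simp add: left_action_def hmul_simps)
 next
  case (diff u u')
  thus ?case using keys_diff[of "left_action T1 (frag_of k) u" "left_action T1 (frag_of k) u'"]
   unfolding left_action_of frag_extend_diff by (auto simp: J_diff hmul_simps U_diff frag_extend_diff)
 next
  case (of g)
  obtain b a E where g: "g = (b, a, E)" by (cases g) auto
  have ba: "b : matchings m" "a : matchings n" "E <= circ (cl b a) T1" using of unfolding g gens_iff by auto
  let ?w = "bas (cl b a) T1 E ** y"
  have w: "?w : Fs (cl b a) T2" by (rule J_hmul_Fs[OF ba(3) y])
  have keys: "keys (left_action T1 (frag_of k) (frag_of g)) <= gens T1"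
   using keys_left[OF T(1) dc(1), of "frag_of g" c D] of unfolding k by auto
  show ?case
  proof (cases "c = b")
   case True
   have "left_action T2 (frag_of k) (U T2 ?w) = U T2 (J T2 (left_action T2 (frag_of k) (U T2 ?w)))"
    by (rule U_J[symmetric]) (use keys_left[OF T(2) dc(1) keys_U, of c D ?w] k in blast)
   also have "... = U T2 (bas (cl d a) (cl b a) ((`) Top ` D) ** ?w)"
    using J_left[OF T(2) dc(1) ba(1,2) _ w, of D] dc(3) True by (simp add: k)
   also have "... = U T2 (J T1 (left_action T1 (frag_of k) (frag_of g)) ** y)"
    using J_left_gen[OF T(1) dc(1) ba(1,2) _ ba(3), of D] dc(3) True
    by (simp add: k g left_action_of hmul_assoc del: left_action_gen.simps)
   finally show ?thesis using keys by (simp add: g)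
  next
   case False
   have "left_action T2 (frag_of k) (U T2 ?w) = 0" unfolding left_action_of
   proof (rule frag_extend_eq_0)
    fix g' assume "g' : keys (U T2 ?w)"
    then obtain E' where "g' = (b, a, E')" using U_Fs_keys[OF ba(1,2) w] by blast
    thus "left_action_gen T2 k g' = 0" using False by (simp add: k)
   qed
   thus ?thesis using keys False by (simp add: g k left_action_of hmul_simps)
  qed
 qed
qed

lemma right_mult: assumes T: "cm T1" "cm T2" and y: "y : Fs T1 T2"
  and h: "keys h <= arc_gens n" and u: "keys u <= gens T1"
 shows "keys (right_action T1 u h) <= gens T1 &
  U T2 (J T1 (right_action T1 u h) ** y) = right_action T2 (U T2 (J T1 u ** y)) h"
 using h
proof (induction h rule: frag_keys_induct)
 case zero
 show ?case by (simp add: right_action_def hmul_simps)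
next
 case (diff h h')
 thus ?case using keys_diff[of "right_action T1 u h" "right_action T1 u h'"]
  unfolding right_action_def bilinear_diff_right by (auto simp: J_diff hmul_simps U_diff)
next
 case (of k)
 obtain d c D where k: "k = (d, c, D)" by (cases k) auto
 have dc: "d : matchings n" "c : matchings n" "D <= circ d c" using of by (simp_all add: k arc_gens_iff)
 show ?case using u
 proof (induction u rule: frag_keys_induct)
  case zero
  show ?case by (simp add: right_action_def hmul_simps)
 next
  case (diff u u')
  thus ?case using keys_diff[of "right_action T1 u (frag_of k)" "right_action T1 u' (frag_of k)"]
   unfolding right_action_of frag_extend_diff by (auto simp: J_diff hmul_simps U_diff frag_extend_diff)
 next
  case (of g)
  obtain b a E where g: "g = (b, a, E)" by (cases g) auto
  have ba: "b : matchings m" "a : matchings n" "E <= circ (cl b a) T1" using of unfolding g gens_iff by auto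
  let ?w = "bas (cl b a) T1 E ** y"
  have w: "?w : Fs (cl b a) T2" by (rule J_hmul_Fs[OF ba(3) y])
  have keys: "keys (right_action T1 (frag_of g) (frag_of k)) <= gens T1"
   using keys_right[OF T(1) dc(2), of "frag_of g" d D] of unfolding k by auto
  show ?case
  proof (cases "a = d")
   case True
   have "right_action T2 (U T2 ?w) (frag_of k) = U T2 (J T2 (right_action T2 (U T2 ?w) (frag_of k)))"
    by (rule U_J[symmetric]) (use keys_right[OF T(2) dc(2) keys_U, of ?w d D] k in blast)
   also have "... = U T2 (bas (cl b c) (cl b a) ((`) Bot ` D) ** ?w)"
    using J_right[OF T(2) ba(1,2) dc(2) _ w, of D] dc(3) True by (simp add: k)
   also have "... = U T2 (J T1 (right_action T1 (frag_of g) (frag_of k)) ** y)"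
    using J_right_gen[OF T(1) ba(1,2) dc(2) _ ba(3), of D] dc(3) True
    by (simp add: k g right_action_of hmul_assoc del: right_action_gen.simps)
   finally show ?thesis using keys by (simp add: g)
  next
   case False
   have "right_action T2 (U T2 ?w) (frag_of k) = 0" unfolding right_action_of
   proof (rule frag_extend_eq_0)
    fix g' assume "g' : keys (U T2 ?w)"
    then obtain E' where "g' = (b, a, E')" using U_Fs_keys[OF ba(1,2) w] by blast
    thus "right_action_gen T2 g' k = 0" using False by (simp add: k)
   qed
   thus ?thesis using keys False by (simp add: g k right_action_of hmul_simps)
  qed
 qed
qed

lemma carrier_arc_ring: "h : carrier (arc_ring k) \<longleftrightarrow> keys h <= arc_gens k"
 by (simp add: arc_ring_def)

lemma Theta_bimodule_hom: assumes T: "cm T1" "cm T2" and z: "z : Hs"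
 shows "Theta z T1 T2 : bimodule_homs m n T1 T2"
proof -
 let ?y = "hom_part T1 T2 z"
 have y: "?y : Fs T1 T2" by (rule hom_part_Fs[OF z])
 have th: "Theta z T1 T2 u = (if keys u <= gens T1 then U T2 (J T1 u ** ?y) else 0)" for u
  using T by (simp add: Theta_def U_comp[of T2 T1 u z])
 have car: "u : carrier (tangle_module m n T) \<longleftrightarrow> keys u <= gens T" for u T
  by (rule carrier_tangle_module)
 show ?thesis unfolding bimodule_homs_def mem_Collect_eq
 proof (intro conjI ballI allI impI)
  show "Theta z T1 T2 : hom (tangle_module m n T1) (tangle_module m n T2)"
  proof (rule homI)
   fix u assume "u : carrier (tangle_module m n T1)"
   thus "Theta z T1 T2 u : carrier (tangle_module m n T2)" unfolding car th by (simp add: keys_U)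
  next
   fix u v assume "u : carrier (tangle_module m n T1)" "v : carrier (tangle_module m n T1)"
   hence uv: "keys u <= gens T1" "keys v <= gens T1" by (simp_all add: car)
   hence "keys (u + v) <= gens T1" using keys_add[of u v] by blast
   thus "Theta z T1 T2 (u \<otimes>\<^bsub>tangle_module m n T1\<^esub> v) = Theta z T1 T2 u \<otimes>\<^bsub>tangle_module m n T2\<^esub> Theta z T1 T2 v"
    using uv by (simp add: tangle_module_def th J_add hmul_simps U_add)
  qed
  show "Theta z T1 T2 (left_action T1 h u) = left_action T2 h (Theta z T1 T2 u)"
   if "h : carrier (arc_ring m)" "u : carrier (tangle_module m n T1)" for h u
   using left_mult[OF T y, of h u] that unfolding car carrier_arc_ring th by simp
  show "Theta z T1 T2 (right_action T1 u h) = right_action T2 (Theta z T1 T2 u) h"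
   if "h : carrier (arc_ring n)" "u : carrier (tangle_module m n T1)" for h u
   using right_mult[OF T y, of h u] that unfolding car carrier_arc_ring th by simp
  show "Theta z T1 T2 u = 0" if "u ~: carrier (tangle_module m n T1)" for u using that unfolding car th by simp
 qed
qed

lemma Theta_carrier: "z : Hs ==> Theta z : carrier (Hom_ring m n)"
 using Theta_bimodule_hom by (auto simp: Hom_ring_def tangles_cm Theta_def)

lemma Theta_diff: "Theta (z - w) T1 T2 u = Theta z T1 T2 u - Theta w T1 T2 u"
 and Theta_add: "Theta (z + w) T1 T2 u = Theta z T1 T2 u + Theta w T1 T2 u" and Theta_0: "Theta 0 T1 T2 u = 0"
 by (simp_all add: Theta_def hmul_simps U_diff U_add)

lemma finite_tangles: "finite (tangles m n)"
proof -
 have "tangles m n <= Pow (Pow V)" using cm_partition unfolding tangles_def partition_on_def by blast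
 thus ?thesis using finite_subset finV by blast
qed

lemma sum_J_U:
 assumes "!!x y D. (x, y, D) : keys v ==> cm y & D <= circ x y & (EX b:matchings m. EX a:matchings n. x = cl b a)"
 shows "(SUM T:tangles m n. J T (U T v)) = v"
proof (rule frag_additive_eqI[of v "{(cl b a, y, D) | b a y D. b : matchings m & a : matchings n & cm y & D <= circ (cl b a) y}"
   "%v. SUM T:tangles m n. J T (U T v)" "%v. v"])
 show "keys v <= {(cl b a, y, D) | b a y D. b : matchings m & a : matchings n & cm y & D <= circ (cl b a) y}"
  using assms by fastforce
 fix k assume "k : {(cl b a, y, D) | b a y D. b : matchings m & a : matchings n & cm y & D <= circ (cl b a) y}"
 then obtain b a y D where k: "k = (cl b a, y, D)" "b : matchings m" "a : matchings n" "cm y" "D <= circ (cl b a) y" by blast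
 have "J T (U T (frag_of k)) = (if T = y then frag_of k else 0)" for T
  using J_U[OF k(2,3) Fs_bas[OF k(5)]] U_other[of y T "cl b a" D] by (simp add: k(1))
 thus "(SUM T:tangles m n. J T (U T (frag_of k))) = frag_of k" using finite_tangles k(4) by (simp add: tangles_cm)
qed (simp_all add: U_diff J_diff sum_subtractf)

lemma hmul_sum_J: "U T3 ((SUM T:I. f T) ** w) = (SUM T:I. U T3 (f T ** w))"
 by (induction I rule: infinite_finite_induct) (simp_all add: hmul_simps U_add)

lemma keys_J: "(x, y, D) : keys (J T u) ==> keys u <= gens T ==>
  y = T & (EX b:matchings m. EX a:matchings n. x = cl b a)"
proof -
 assume k: "(x, y, D) : keys (J T u)" and u: "keys u <= gens T"
 then obtain g where g: "g : keys u" "(x, y, D) = Jg T g"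
  using keys_frag_extend[of "%g. frag_of (Jg T g)" u] unfolding J_def by auto
 obtain b a E where e: "g = (b, a, E)" by (cases g) auto
 have "(b, a, E) : gens T" using u g(1) unfolding e by blast
 thus ?thesis using g(2) unfolding e gens_iff by auto
qed

text \<open>Right multiplications compose in the opposite order. The sum over the intermediate
  tangles reassembles the product \<open>J T1 u ** z\<close>, all of whose targets are crossingless
  because \<open>z\<close> lies in \<open>Hs\<close>.\<close>

lemma Theta_mult: assumes z: "z : Hs" and w: "w : Hs"
 shows "Theta w \<otimes>\<^bsub>Hom_ring m n\<^esub> Theta z = Theta (z ** w)"
proof (intro ext)
 fix T1 T3 u
 have mult: "(Theta w \<otimes>\<^bsub>Hom_ring m n\<^esub> Theta z) T1 T3 u = (SUM T2:tangles m n. Theta w T2 T3 (Theta z T1 T2 u))"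
  by (simp add: Hom_ring_def)
 show "(Theta w \<otimes>\<^bsub>Hom_ring m n\<^esub> Theta z) T1 T3 u = Theta (z ** w) T1 T3 u"
 proof (cases "cm T1 & cm T3 & keys u <= gens T1")
  case True
  have "(SUM T2:tangles m n. Theta w T2 T3 (Theta z T1 T2 u)) =
    (SUM T2:tangles m n. U T3 (J T2 (U T2 (J T1 u ** z)) ** w))"
   by (rule sum.cong[OF refl]) (use True in "simp add: Theta_def tangles_cm keys_U")
  also have "... = U T3 ((SUM T2:tangles m n. J T2 (U T2 (J T1 u ** z))) ** w)" by (rule hmul_sum_J[symmetric])
  also have "(SUM T2:tangles m n. J T2 (U T2 (J T1 u ** z))) = J T1 u ** z"
  proof (rule sum_J_U)
   fix x y D assume k0: "(x, y, D) : keys (J T1 u ** z)"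
   then obtain x' y' z' D' E G where k: "(x', y', D') : keys (J T1 u)" "(y', z', E) : keys z"
    "(x, y, D) = (x', z', G)" "G <= circ x' z'"
    using keys_hmul[OF k0] by blast
   have "cm z'" using z k(2) unfolding Hs_def by blast
   thus "cm y & D <= circ x y & (EX b:matchings m. EX a:matchings n. x = cl b a)"
    using keys_J[OF k(1)] True k(3,4) by simp
  qed
  finally show ?thesis unfolding mult using True by (simp add: Theta_def hmul_assoc)
 next
  case False
  have "Theta w T2 T3 (Theta z T1 T2 u) = 0" for T2
  proof (cases "cm T3")
   case True
   hence "Theta z T1 T2 u = 0" using False by (auto simp: Theta_def)
   thus ?thesis by (simp add: Theta_def hmul_simps)
  qed (simp add: Theta_def)
  thus ?thesis unfolding mult using False by (auto simp: Theta_def)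
 qed
qed

text \<open>For each pair of tangles the double centralizer property yields an element of
  \<open>Fs T1 T2\<close>. The sum of these elements represents the whole family, as
  \<open>hom_part\<close> separates the pairs again.\<close>

lemma Theta_surj: assumes f: "f : carrier (Hom_ring m n)"
 obtains z where "z : Hs" "Theta z = f"
proof -
 have hom: "f T1 T2 : bimodule_homs m n T1 T2" if "cm T1" "cm T2" for T1 T2
  using f that by (auto simp: Hom_ring_def tangles_cm)
 have "EX y. y : Fs T1 T2 & (ALL u. keys u <= gens T1 --> f T1 T2 u = U T2 (J T1 u ** y))"
  if "cm T1" "cm T2" for T1 T2 using bimodule_hom_right_mult[OF hom[OF that] that] by metis
 then obtain y where y: "!!T1 T2. cm T1 ==> cm T2 ==> y T1 T2 : Fs T1 T2"
  "!!T1 T2 u. cm T1 ==> cm T2 ==> keys u <= gens T1 ==> f T1 T2 u = U T2 (J T1 u ** y T1 T2)"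
  by metis
 define z where "z = (SUM T1:tangles m n. SUM T2:tangles m n. y T1 T2)"
 have z: "z : Hs" unfolding z_def by (intro Hs_sum, rule Fs_Hs[OF _ _ y(1)]) (simp_all add: tangles_cm)
 have cz: "hom_part T1 T2 z = y T1 T2" if T: "cm T1" "cm T2" for T1 T2
 proof -
  have cy: "hom_part T1 T2 (y S1 S2) = (if S1 = T1 & S2 = T2 then y S1 S2 else 0)" if "cm S1" "cm S2" for S1 S2
   by (rule hom_part_of_Fs[OF y(1)[OF that]])
  have "hom_part T1 T2 z = (SUM S1:tangles m n. SUM S2:tangles m n. if S1 = T1 & S2 = T2 then y S1 S2 else 0)"
   unfolding z_def hom_part_sum by (intro sum.cong refl cy) (simp_all add: tangles_cm)
  also have "... = (SUM S1:tangles m n. if S1 = T1 then y S1 T2 else 0)"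
   by (intro sum.cong refl) (use finite_tangles T in "simp add: tangles_cm")
  also have "... = y T1 T2" using finite_tangles T by (simp add: tangles_cm)
  finally show ?thesis .
 qed
 have "Theta z T1 T2 u = f T1 T2 u" for T1 T2 u
 proof (cases "cm T1 & cm T2")
  case True
  thus ?thesis using y(2)[of T1 T2 u] bimodule_homD(5)[OF hom, of T1 T2 u] cz[of T1 T2] U_comp[of T2 T1 u z]
   by (simp add: Theta_def)
 next
  case False
  hence "f T1 T2 = (%_. 0)" using f by (auto simp: Hom_ring_def tangles_cm split: if_splits)
  thus ?thesis using False by (auto simp: Theta_def)
 qed
 hence "Theta z = f" by (intro ext)
 thus ?thesis using that z by blast
qed

end

section \<open>Cobordisms as elements of the algebra\<close>

definition covers :: "cobordism => endpoint set => nat" where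
 "covers S e = size (filter_mset (%s. e : fst s) S)"

lemma covers_add: "covers (add_mset (B, g, k) S) e = (if e : B then 1 else 0) + covers S e"
 by (simp add: covers_def)

lemma cobordisms_iff: "S : cobordisms T1 T2 \<longleftrightarrow>
  (\<forall>s\<in>#S. fst s <= circ T1 T2) & (ALL e:circ T1 T2. covers S e = 1)"
proof -
 have "(%(B, g, k). e : B) = (%s :: endpoint set set \<times> nat \<times> nat. e : fst s)" for e
  by (simp add: fun_eq_iff split_beta)
 thus ?thesis unfolding cobordisms_def covers_def by (simp add: split_beta)
qed

lemma strips_id: "inj f ==> strips f M = strips id ((`) f ` M)"
proof -
 assume "inj f"
 hence "inj_on ((`) f) M" by (auto intro!: inj_onI simp: inj_image_eq_iff)
 thus ?thesis by (simp add: strips_def image_mset_mset_set[symmetric] image_mset.compositionality comp_def)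
qed

lemma strips_cl: "finite b ==> finite a ==> {} ~: b ==> strips Top b + strips Bot a = strips id (cl b a)"
proof -
 assume f: "finite b" "finite a" "{} ~: b"
 have "(`) Top ` b Int (`) Bot ` a = {}"
 proof (rule ccontr)
  assume "~ ?thesis"
  then obtain al be where ab: "al : b" "Top ` al = Bot ` be" by blast
  have "al ~= {}" using ab(1) f(3) by metis
  then obtain i where "i : al" by blast
  hence "Top i : Bot ` be" using ab(2) by (metis imageI)
  thus False by auto
 qed
 hence "strips id (cl b a) = strips id ((`) Top ` b) + strips id ((`) Bot ` a)"
  using f by (simp add: strips_def cl_def mset_set_Union)
 thus ?thesis using strips_id[of Top b] strips_id[of Bot a] by (simp add: inj_on_def)
qed

lemma cob_weight_add: "cob_weight (add_mset (B, g, k) S) A = ev g (k + card (B - A)) * cob_weight S A"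
 by (simp add: cob_weight_def)

context tangle_setting
begin

text \<open>The expansion of a cobordism in dotted discs, obtained by neck-cutting near each
  boundary circle.\<close>

fun Wg :: "bn_gen => endpoint hgen \<Rightarrow>\<^sub>0 int" where
 "Wg (T1, T2, S) = (SUM A:Pow (circ T1 T2). frag_cmul (cob_weight S A) (bas T1 T2 A))"

declare Wg.simps [simp del]

definition W :: "(bn_gen \<Rightarrow>\<^sub>0 int) => endpoint hgen \<Rightarrow>\<^sub>0 int" where
 "W = frag_extend Wg"

lemma BN_gens_iff: "(T1, T2, S) : BN_gens m n \<longleftrightarrow> cm T1 & cm T2 & S : cobordisms T1 T2"
 by (simp add: BN_gens_def tangles_cm)

lemma Wg_Fs: "Wg (T1, T2, S) : Fs T1 T2" unfolding Wg.simps by (intro Fs_sum Fs_cmul Fs_bas) blast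

text \<open>Both sides evaluate the cobordism glued to the closing strips, the right-hand one after
  cutting along the boundary circles of \<open>S\<close>.\<close>

lemma cob_map_gen_W: assumes T: "cm T1" "cm T2" and S: "S : cobordisms T1 T2" and g: "(b, a, D) : gens T1"
 shows "cob_map_gen T1 T2 S (b, a, D) = U T2 (bas (cl b a) T1 D ** Wg (T1, T2, S))"
proof -
 have ba: "b : matchings m" "a : matchings n" "D <= circ (cl b a) T1" using g unfolding gens_iff by auto
 let ?c = "cl b a"
 have pms: "pm ?c" "pm T1" "pm T2" using pm_cl[OF ba(1,2)] cm_pm T by auto
 interpret cobordism_gluing V "%p. even (pos p)" ?c T1 T2 S by unfold_locales (use pms S in auto)
 have fin: "finite b" "finite a"
  using matchings_Union[OF ba(1)] matchings_Union[OF ba(2)] finite_UnionD by (metis finite_atLeastAtMost)+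
 have pieces: "strips Top b + cob_pieces S + strips Bot a = strips id ?c + cob_pieces S"
  using strips_cl[OF fin matching_ne[OF ba(1)]] by (simp add: add_ac)
 have fC: "finite (circ ?c T2)" "finite (circ T1 T2)" using finite_circ pms by auto
 have "bas ?c T1 D ** Wg (T1, T2, S) = (SUM A:Pow (circ T1 T2). frag_cmul (cob_weight S A) (bas ?c T1 D ** bas T1 T2 A))"
  unfolding Wg.simps by (simp add: hmul_simps)
 also have "... = (SUM A:Pow (circ T1 T2). SUM E:Pow (circ ?c T2).
   frag_cmul (cob_weight S A * theta ?c T1 T2 D A (circ ?c T2 - E)) (bas ?c T2 E))"
  by (rule sum.cong[OF refl]) (simp add: hmul_bas[OF pms ba(3)] frag_cmul_sum)
 also have "... = (SUM E:Pow (circ ?c T2). SUM A:Pow (circ T1 T2).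
   frag_cmul (cob_weight S A * theta ?c T1 T2 D A (circ ?c T2 - E)) (bas ?c T2 E))"
  by (rule sum.swap)
 also have "... = (SUM E:Pow (circ ?c T2). frag_cmul (cob_coeff (strips id ?c + cob_pieces S) (circ ?c T1) (circ ?c T2) D E) (bas ?c T2 E))"
  unfolding frag_cmul_sum_left by (rule sum.cong[OF refl]) (simp add: surface_theta[OF ba(3)])
 finally have "U T2 (bas ?c T1 D ** Wg (T1, T2, S)) =
   U T2 (SUM E:Pow (circ ?c T2). frag_cmul (cob_coeff (strips id ?c + cob_pieces S) (circ ?c T1) (circ ?c T2) D E) (bas ?c T2 E))"
  by simp
 also have "... = (SUM E:Pow (circ ?c T2). frag_cmul (cob_coeff (strips id ?c + cob_pieces S) (circ ?c T1) (circ ?c T2) D E) (U T2 (bas ?c T2 E)))"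
  unfolding U_def using fC by (simp only: frag_extend_sum finite_Pow_iff comp_def frag_extend_cmul)
 also have "... = (SUM E:Pow (circ ?c T2). frag_cmul (cob_coeff (strips id ?c + cob_pieces S) (circ ?c T1) (circ ?c T2) D E) (frag_of (b, a, E)))"
  by (rule sum.cong[OF refl]) (use ba(1,2) in "simp add: U_of gens_iff")
 also have "... = cob_map_gen T1 T2 S (b, a, D)" unfolding cob_map_gen.simps tqft_def closed_up_cl pieces by simp
 finally show ?thesis ..
qed

lemma cob_map_W: assumes T: "cm T1" "cm T2" and S: "S : cobordisms T1 T2"
 shows "cob_map m n T1 T2 S u = (if keys u <= gens T1 then U T2 (J T1 u ** Wg (T1, T2, S)) else 0)"
proof (cases "keys u <= gens T1")
 case True
 have "frag_extend (cob_map_gen T1 T2 S) u = U T2 (J T1 u ** Wg (T1, T2, S))" using True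
 proof (induction u rule: frag_keys_induct)
  case (of g)
  obtain b a D where g: "g = (b, a, D)" by (cases g) auto
  show ?case using cob_map_gen_W[OF T S, of b a D] of unfolding g by (simp del: cob_map_gen.simps)
 qed (simp_all add: frag_extend_diff J_diff hmul_simps U_diff)
 thus ?thesis using True by (simp add: cob_map_def carrier_tangle_module)
qed (simp add: cob_map_def carrier_tangle_module)

lemma phi_lift_Theta: assumes "keys z <= BN_gens m n" shows "phi_lift m n z = Theta (W z)"
proof (intro ext)
 fix T1 T2 u
 show "phi_lift m n z T1 T2 u = Theta (W z) T1 T2 u" using assms
 proof (induction z rule: frag_keys_induct)
  case (of k)
  obtain U1 U2 S where k: "k = (U1, U2, S)" by (cases k) auto
  have v: "cm U1" "cm U2" "S : cobordisms U1 U2" using of unfolding k BN_gens_iff by auto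
  have "U T2 (J T1 u ** Wg k) = 0" if "~ (U1 = T1 & U2 = T2)"
   using U_comp[of T2 T1 u "Wg k"] hom_part_of_Fs[OF Wg_Fs, of T1 T2 U1 U2 S] that unfolding k by (auto simp: hmul_simps)
  thus ?case
  proof (cases "U1 = T1 & U2 = T2")
   case True
   thus ?thesis using cob_map_W[OF v, of u] v by (simp add: phi_lift_def Theta_def W_def k)
  next
   case False
   hence "U T2 (J T1 u ** Wg k) = 0" using `~ (U1 = T1 & U2 = T2) ==> U T2 (J T1 u ** Wg k) = 0` by blast
   thus ?thesis using False by (auto simp: phi_lift_def Theta_def W_def k)
  qed
 next
  case (diff x y)
  thus ?case by (simp add: phi_lift_def W_def frag_extend_diff Theta_diff)
 qed (simp add: phi_lift_def W_def Theta_0)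
qed

lemma finite_Un_circ: "B <= circ T1 T2 ==> cm T1 ==> cm T2 ==> finite B"
 using finite_circ[OF cm_pm cm_pm] finite_subset by blast

lemma Wg_add: "Wg (T1, T2, add_mset (B, g, k) S) =
  (SUM A:Pow (circ T1 T2). frag_cmul (ev g (k + card (B - A)) * cob_weight S A) (bas T1 T2 A))"
 by (simp add: Wg.simps cob_weight_add)

text \<open>Each relation is an identity for \<open>ev\<close>: the first three by direct
  evaluation, the neck relations by \<open>ev_handle\<close> and \<open>ev_neck\<close>. Validity of
  the generators is proved along with it, since a relation presupposes it for only some of its
  terms.\<close>

lemma BN_relation_W: assumes "r : BN_relations m n" shows "keys r <= BN_gens m n & W r = 0" using assms
proof (induction rule: BN_relations.induct)
 case (sphere T1 T2 S)
 have "(T1, T2, add_mset ({}, 0, 0) S) : BN_gens m n"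
  using sphere by (simp add: BN_gens_iff cobordisms_iff covers_add)
 moreover have "Wg (T1, T2, add_mset ({}, 0, 0) S) = 0" unfolding Wg_add by (simp add: ev_def)
 ultimately show ?case by (simp add: W_def)
next
 case (dotted_sphere T1 T2 S)
 have "(T1, T2, add_mset ({}, 0, 1) S) : BN_gens m n"
  using dotted_sphere by (simp add: BN_gens_iff cobordisms_iff covers_add)
 hence "keys (frag_of (T1, T2, add_mset ({}, 0, 1) S) - frag_of (T1, T2, S)) <= BN_gens m n"
  using dotted_sphere keys_diff[of "frag_of (T1, T2, add_mset ({}, 0, 1) S)" "frag_of (T1, T2, S)"] by auto
 moreover have "Wg (T1, T2, add_mset ({}, 0, 1) S) = Wg (T1, T2, S)"
  unfolding Wg_add by (simp add: ev_def Wg.simps)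
 ultimately show ?case by (simp add: W_def frag_extend_diff)
next
 case (two_dots T1 T2 B g k S)
 have "Wg (T1, T2, add_mset (B, g, k + 2) S) = 0" unfolding Wg_add by (simp add: ev_def)
 thus ?case using two_dots by (simp add: W_def)
next
 case (neck_nonseparating T1 T2 B g k S)
 have v: "(T1, T2, add_mset (B, g, k + 1) S) : BN_gens m n"
  using neck_nonseparating by (simp add: BN_gens_iff cobordisms_iff covers_add)
 let ?x = "frag_of (T1, T2, add_mset (B, g + 1, k) S)" and ?y = "frag_of (T1, T2, add_mset (B, g, k + 1) S)"
 have "keys (?x - (?y + ?y)) <= BN_gens m n"
  using v neck_nonseparating keys_diff[of ?x "?y + ?y"] keys_add[of ?y ?y] by auto
 moreover have "Wg (T1, T2, add_mset (B, g + 1, k) S) = Wg (T1, T2, add_mset (B, g, k + 1) S) + Wg (T1, T2, add_mset (B, g, k + 1) S)"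
  unfolding Wg_add sum.distrib[symmetric] frag_cmul_distrib[symmetric]
  by (rule sum.cong[OF refl]) (simp add: ev_handle mult_ac)
 ultimately show ?case by (simp add: W_def frag_extend_diff frag_extend_add)
next
 case (neck_separating T1 T2 B B' g g' k k' S)
 have v: "cm T1" "cm T2" "add_mset (B Un B', g + g', k + k') S : cobordisms T1 T2"
  using neck_separating(1) by (simp_all add: BN_gens_iff)
 have sub: "B <= circ T1 T2" "B' <= circ T1 T2" using v(3) by (simp_all add: cobordisms_iff)
 have fB: "finite B" "finite B'" using finite_Un_circ sub v(1,2) by blast+
 have g1: "(T1, T2, add_mset (B, g, k + 1) (add_mset (B', g', k') S)) : BN_gens m n"
  and g2: "(T1, T2, add_mset (B, g, k) (add_mset (B', g', k' + 1) S)) : BN_gens m n"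
  using v neck_separating(2) by (auto simp: BN_gens_iff cobordisms_iff covers_add)
 let ?x = "frag_of (T1, T2, add_mset (B Un B', g + g', k + k') S)"
  and ?y = "frag_of (T1, T2, add_mset (B, g, k + 1) (add_mset (B', g', k') S))"
  and ?z = "frag_of (T1, T2, add_mset (B, g, k) (add_mset (B', g', k' + 1) S))"
 have "keys (?x - (?y + ?z)) <= BN_gens m n"
  using g1 g2 neck_separating(1) keys_diff[of ?x "?y + ?z"] keys_add[of ?y ?z] by auto
 moreover have "Wg (T1, T2, add_mset (B Un B', g + g', k + k') S) =
   Wg (T1, T2, add_mset (B, g, k + 1) (add_mset (B', g', k') S)) + Wg (T1, T2, add_mset (B, g, k) (add_mset (B', g', k' + 1) S))"
  unfolding Wg_add cob_weight_add sum.distrib[symmetric] frag_cmul_distrib[symmetric]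
 proof (rule sum.cong[OF refl])
  fix A
  have "card (B Un B' - A) = card (B - A) + card (B' - A)"
   unfolding Un_Diff by (rule card_Un_disjoint) (use fB neck_separating(2) in auto)
  hence "ev (g + g') (k + k' + card (B Un B' - A)) =
    ev g (k + 1 + card (B - A)) * ev g' (k' + card (B' - A)) + ev g (k + card (B - A)) * ev g' (k' + 1 + card (B' - A))"
   using ev_neck[of g g' "k + card (B - A)" "k' + card (B' - A)"] by (simp add: add_ac)
  thus "frag_cmul (ev (g + g') (k + k' + card (B Un B' - A)) * cob_weight S A) (bas T1 T2 A) =
    frag_cmul (ev g (k + 1 + card (B - A)) * (ev g' (k' + card (B' - A)) * cob_weight S A) +
     ev g (k + card (B - A)) * (ev g' (k' + 1 + card (B' - A)) * cob_weight S A)) (bas T1 T2 A)"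
   by (simp only: distrib_right mult.assoc)
 qed
 ultimately show ?case by (simp add: W_def frag_extend_diff frag_extend_add)
qed

lemma BN_subgroup_W: assumes "h : BN_subgroup m n" shows "keys h <= BN_gens m n & W h = 0"
 using assms unfolding BN_subgroup_def
proof (induction rule: generate.induct)
 case one
 show ?case by (simp add: W_def)
next
 case (incl h)
 thus ?case by (rule BN_relation_W)
next
 case (inv h)
 thus ?case using BN_relation_W[OF inv] by (simp add: W_def frag_extend_minus)
next
 case (eng h h')
 thus ?case using keys_add[of h h'] by (auto simp: W_def frag_extend_add)
qed

text \<open>The effect of \<open>gamma\<close> followed by the expansion in discs, given directly on
  generators. The matchings change places because \<open>a\<close> is bent to the bottom and becomes
  the source.\<close>

definition beta :: "(arc_gen \<Rightarrow>\<^sub>0 int) => endpoint hgen \<Rightarrow>\<^sub>0 int" where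
 "beta = frag_extend (%(b, a, D). bas (bend m a) (bend m b) ((`) (bend_point m) ` D))"

lemma gamma_gen_W: assumes g: "(b, a, D) : arc_gens (m + n)" shows "gamma_gen m (b, a, D) : BN_gens m n"
  and "Wg (gamma_gen m (b, a, D)) = bas (bend m a) (bend m b) ((`) (bend_point m) ` D)"
proof -
 have ba: "b : matchings (m + n)" "a : matchings (m + n)" "D <= circ b a" using g by (auto simp: arc_gens_iff)
 have U: "\<Union>(a Un b) = {1..2 * (m + n)}" using matchings_Union[OF ba(1)] matchings_Union[OF ba(2)] by simp
 let ?f = "(`) (bend_point m)" and ?C = "circ b a"
 have F: "circ (bend m a) (bend m b) = ?f ` ?C" using circ_bend[OF eq_refl[OF U]] by (simp add: Un_commute)
 have sub: "e <= {1..2 * (m + n)}" if "e : ?C" for e using cc_subset[OF that] unfolding Un_commute[of b a] U .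
 have inj: "inj_on ?f ?C"
 proof (rule inj_onI)
  fix e e' assume e: "e : ?C" "e' : ?C" "?f e = ?f e'"
  show "e = e'" using inj_on_image_eq_iff[OF inj_bend sub[OF e(1)] sub[OF e(2)]] e(3) by simp
 qed
 have fC: "finite ?C" unfolding Un_commute[of b a] by (rule finite_cc) (unfold U, simp)
 have DF: "?f ` D <= circ (bend m a) (bend m b)" unfolding F using ba(3) by blast
 let ?s = "%e. ({?f e}, 0 :: nat, if e : D then 1 else 0 :: nat)"
 let ?S = "image_mset ?s (mset_set ?C)"
 have cmT: "cm (bend m a)" "cm (bend m b)" using bend_cm ba by auto
 show "gamma_gen m (b, a, D) : BN_gens m n" unfolding gamma_gen.simps BN_gens_iff
 proof (intro conjI cmT)
  show "?S : cobordisms (bend m a) (bend m b)" unfolding cobordisms_iff F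
  proof (intro conjI ballI)
   show "fst s <= ?f ` ?C" if "s \<in># ?S" for s using that fC by auto
   fix e assume "e : ?f ` ?C"
   then obtain e' where e': "e' : ?C" "e = ?f e'" by blast
   have "{x : ?C. e : fst (?s x)} = {e'}" using e' inj_onD[OF inj] by auto
   thus "covers ?S e = 1" unfolding covers_def using fC by (simp add: filter_mset_image_mset filter_mset_mset_set)
  qed
 qed
 have weight: "cob_weight ?S A = (if A = ?f ` D then 1 else 0)" if A: "A <= ?f ` ?C" for A
 proof -
  have "cob_weight ?S A = (PROD e:?C. if ?f e : A \<longleftrightarrow> e : D then 1 else 0)"
   unfolding cob_weight_def image_mset.compositionality comp_def prod_unfold_prod_mset[symmetric]
   by (rule prod.cong[OF refl]) (auto simp: ev_def insert_Diff_if)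
  also have "... = (if ALL e:?C. ?f e : A \<longleftrightarrow> e : D then 1 else 0)"
   using fC by (auto intro: prod_zero)
  also have "(ALL e:?C. ?f e : A \<longleftrightarrow> e : D) \<longleftrightarrow> A = ?f ` D"
  proof
   assume h: "ALL e:?C. ?f e : A \<longleftrightarrow> e : D"
   show "A = ?f ` D" using h ba that by blast
  next
   assume h: "A = ?f ` D"
   show "ALL e:?C. ?f e : A \<longleftrightarrow> e : D"
    unfolding h using inj_on_image_mem_iff[OF inj _ ba(3)] by simp
  qed
  finally show ?thesis .
 qed
 have "Wg (gamma_gen m (b, a, D)) =
   (SUM A:Pow (?f ` ?C). frag_cmul (if A = ?f ` D then 1 else 0) (bas (bend m a) (bend m b) A))"
  unfolding gamma_gen.simps Wg.simps F by (rule sum.cong[OF refl]) (simp add: weight)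
 also have "... = (SUM A:Pow (?f ` ?C). if A = ?f ` D then bas (bend m a) (bend m b) A else 0)"
  by (rule sum.cong[OF refl]) simp
 also have "... = bas (bend m a) (bend m b) (?f ` D)" using DF fC unfolding F by (simp add: sum.delta)
 finally show "Wg (gamma_gen m (b, a, D)) = bas (bend m a) (bend m b) (?f ` D)" .
qed

lemma beta_Hs: "keys x <= arc_gens (m + n) ==> beta x : Hs"
proof (induction x rule: frag_keys_induct)
 case (of k)
 obtain b a D where k: "k = (b, a, D)" by (cases k) auto
 have ba: "b : matchings (m + n)" "a : matchings (m + n)" "D <= circ b a" using of by (auto simp: arc_gens_iff k)
 have "circ (bend m b) (bend m a) = (`) (bend_point m) ` circ b a"
  by (rule circ_bend) (use matchings_Union[OF ba(1)] matchings_Union[OF ba(2)] in simp)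
 hence "(`) (bend_point m) ` D <= circ (bend m a) (bend m b)" using ba(3) by (simp add: Un_commute image_mono)
 thus ?case using Hs_bas[OF bend_cm[OF ba(2)] bend_cm[OF ba(1)]] by (simp add: beta_def k)
qed (simp_all add: beta_def frag_extend_diff Hs_diff)

text \<open>The lift of \<open>phi\<close> is constant on the coset \<open>gamma m n x\<close>,
  because \<open>W\<close> vanishes on the relations; its value there is right multiplication by
  \<open>beta x\<close>.\<close>

theorem gamma_kernel: assumes x: "keys x <= arc_gens (m + n)"
 shows "gamma m n x : kernel (Hom_BN m n) (add_monoid (Hom_ring m n)) (phi m n) \<longleftrightarrow> Theta (beta x) = (%_ _ _. 0)"
proof -
 let ?F = "free_Abelian_group (BN_gens m n)"
 define g where "g = frag_extend (%p. frag_of (gamma_gen m p)) x"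
 have "keys g <= BN_gens m n & W g = beta x" using x unfolding g_def
 proof (induction x rule: frag_keys_induct)
  case (of k)
  obtain b a D where k: "k = (b, a, D)" by (cases k) auto
  show ?case using gamma_gen_W[of b a D] of unfolding k by (simp add: W_def beta_def del: gamma_gen.simps)
 next
  case (diff u v)
  thus ?case
   using keys_diff[of "frag_extend (%p. frag_of (gamma_gen m p)) u" "frag_extend (%p. frag_of (gamma_gen m p)) v"]
   by (auto simp: frag_extend_diff W_def beta_def)
 qed (simp add: W_def beta_def)
 hence g: "keys g <= BN_gens m n" "W g = beta x" by blast+
 have coset: "gamma m n x = {h + g | h. h : BN_subgroup m n}"
  unfolding gamma_def g_def[symmetric] r_coset_def by auto
 have lift: "phi_lift m n (h + g) = Theta (beta x)" if "h : BN_subgroup m n" for h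
 proof -
  note h = BN_subgroup_W[OF that]
  have "keys (h + g) <= BN_gens m n" using h g(1) keys_add[of h g] by blast
  hence "phi_lift m n (h + g) = Theta (W (h + g))" by (rule phi_lift_Theta)
  also have "W (h + g) = beta x" using h g(2) by (simp add: W_def frag_extend_add)
  finally show ?thesis .
 qed
 have "0 : BN_subgroup m n" unfolding BN_subgroup_def using generate.one[of ?F] by simp
 hence "phi_lift m n ` gamma m n x = {Theta (beta x)}" unfolding coset using lift by (auto simp: image_iff) (metis add.left_neutral)
 hence "phi m n (gamma m n x) = Theta (beta x)" unfolding phi_def by simp
 moreover have "gamma m n x : carrier (Hom_BN m n)"
  unfolding Hom_BN_def FactGroup_def gamma_def g_def[symmetric] using g(1) by (auto simp: RCOSETS_def)
 ultimately show ?thesis unfolding kernel_def by (simp add: Hom_ring_def)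
qed

end

section \<open>Commutators and the relations of types I and II\<close>

context tangle_setting
begin

abbreviation (input) "G \<equiv> free_Abelian_group (dotted_matchings (m + n))"

definition K12 :: "(dotted_matching \<Rightarrow>\<^sub>0 int) set" where
 "K12 = generate G (type_I_relations (m + n) Un type_II_relations (m + n))"

lemma dotted_iff: "(M, E) : dotted_matchings k \<longleftrightarrow> M : matchings k & E <= M"
 by (simp add: dotted_matchings_def)

lemma keys_type_I: "r : type_I_relations k ==> keys r <= dotted_matchings k"
proof -
 assume "r : type_I_relations k"
 then obtain M E a b c d where r: "E <= M" "M Un {{a, b}, {c, d}} : matchings k" "M Un {{a, d}, {b, c}} : matchings k"
  "r = frag_of (M Un {{a, b}, {c, d}}, insert {a, b} E) + frag_of (M Un {{a, b}, {c, d}}, insert {c, d} E)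
    - (frag_of (M Un {{a, d}, {b, c}}, insert {a, d} E) + frag_of (M Un {{a, d}, {b, c}}, insert {b, c} E))"
  unfolding type_I_relations_def by blast
 have "frag_of (M Un {{a, b}, {c, d}}, insert {a, b} E) : carrier (free_Abelian_group (dotted_matchings k))"
  "frag_of (M Un {{a, b}, {c, d}}, insert {c, d} E) : carrier (free_Abelian_group (dotted_matchings k))"
  "frag_of (M Un {{a, d}, {b, c}}, insert {a, d} E) : carrier (free_Abelian_group (dotted_matchings k))"
  "frag_of (M Un {{a, d}, {b, c}}, insert {b, c} E) : carrier (free_Abelian_group (dotted_matchings k))"
  unfolding frag_of_in_free_Abelian_group dotted_iff using r(1-3) by blast+
 thus ?thesis unfolding r(4) carrier_free_Abelian_group_iff by (meson keys_add keys_diff subset_trans Un_least)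
qed

lemma keys_type_II: "r : type_II_relations k ==> keys r <= dotted_matchings k"
proof -
 assume "r : type_II_relations k"
 then obtain M E a b c d where r: "E <= M" "M Un {{a, b}, {c, d}} : matchings k" "M Un {{a, d}, {b, c}} : matchings k"
  "r = frag_of (M Un {{a, b}, {c, d}}, E Un {{a, b}, {c, d}}) - frag_of (M Un {{a, d}, {b, c}}, E Un {{a, d}, {b, c}})"
  unfolding type_II_relations_def by blast
 have "frag_of (M Un {{a, b}, {c, d}}, E Un {{a, b}, {c, d}}) : carrier (free_Abelian_group (dotted_matchings k))"
  "frag_of (M Un {{a, d}, {b, c}}, E Un {{a, d}, {b, c}}) : carrier (free_Abelian_group (dotted_matchings k))"
  unfolding frag_of_in_free_Abelian_group dotted_iff using r(1-3) by blast+
 thus ?thesis unfolding r(4) carrier_free_Abelian_group_iff by (meson keys_diff subset_trans Un_least)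
qed

lemma generate_closed: assumes "Rel <= carrier G"
 shows "0 : generate G Rel" "u : generate G Rel ==> v : generate G Rel ==> u + v : generate G Rel"
  "u : generate G Rel ==> - u : generate G Rel"
  "u : generate G Rel ==> v : generate G Rel ==> u - v : generate G Rel"
proof -
 interpret sg: subgroup "generate G Rel" G by (rule group.generate_is_subgroup[OF group_free_Abelian_group assms])
 show "0 : generate G Rel" using sg.one_closed by simp
 show add: "u : generate G Rel ==> v : generate G Rel ==> u + v : generate G Rel" for u v
  using sg.m_closed[of u v] by simp
 show neg: "u : generate G Rel ==> - u : generate G Rel" for u using sg.mem_carrier sg.m_inv_closed by auto
 show "u : generate G Rel ==> v : generate G Rel ==> u - v : generate G Rel"
  using add[of u "- v"] neg[of v] by simp
qed

lemma rel12_carrier: "type_I_relations (m + n) Un type_II_relations (m + n) <= carrier G"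
 using keys_type_I keys_type_II by auto

lemmas K12_closed = generate_closed[OF rel12_carrier, folded K12_def]

lemma ordered_relations: assumes lt: "i < j" "j < k" "k < l" and E: "E <= M"
  and M: "M Un {{i, j}, {k, l}} : matchings (m + n)" "M Un {{i, l}, {k, j}} : matchings (m + n)"
 shows "frag_of (M Un {{i, j}, {k, l}}, insert {i, j} E) + frag_of (M Un {{i, j}, {k, l}}, insert {k, l} E)
   - (frag_of (M Un {{i, l}, {k, j}}, insert {i, l} E) + frag_of (M Un {{i, l}, {k, j}}, insert {k, j} E)) : K12"
  and "frag_of (M Un {{i, j}, {k, l}}, E Un {{i, j}, {k, l}}) - frag_of (M Un {{i, l}, {k, j}}, E Un {{i, l}, {k, j}}) : K12"
proof -
 have kj: "{k, j} = {j, k}" by (rule insert_commute)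
 have "frag_of (M Un {{i, j}, {k, l}}, insert {i, j} E) + frag_of (M Un {{i, j}, {k, l}}, insert {k, l} E)
   - (frag_of (M Un {{i, l}, {k, j}}, insert {i, l} E) + frag_of (M Un {{i, l}, {k, j}}, insert {k, j} E)) : type_I_relations (m + n)"
  unfolding type_I_relations_def kj using lt E M[unfolded kj] by blast
 thus "frag_of (M Un {{i, j}, {k, l}}, insert {i, j} E) + frag_of (M Un {{i, j}, {k, l}}, insert {k, l} E)
   - (frag_of (M Un {{i, l}, {k, j}}, insert {i, l} E) + frag_of (M Un {{i, l}, {k, j}}, insert {k, j} E)) : K12"
  unfolding K12_def by (intro generate.incl UnI1)
 have "frag_of (M Un {{i, j}, {k, l}}, E Un {{i, j}, {k, l}}) - frag_of (M Un {{i, l}, {k, j}}, E Un {{i, l}, {k, j}}) : type_II_relations (m + n)"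
  unfolding type_II_relations_def kj using lt E M[unfolded kj] by blast
 thus "frag_of (M Un {{i, j}, {k, l}}, E Un {{i, j}, {k, l}}) - frag_of (M Un {{i, l}, {k, j}}, E Un {{i, l}, {k, j}}) : K12"
  unfolding K12_def by (intro generate.incl UnI2)
qed

text \<open>Both relations for a quadruple in any order, with partners exchanged as in
  \<open>surg\<close>. This form is invariant under the symmetries of the quadrilateral, whereas the
  relations themselves are imposed for increasing points.\<close>

definition rel_ok :: "nat set set => nat set set => nat => nat => nat => nat => bool" where
 "rel_ok M E i j k l \<longleftrightarrow>
  frag_of (M Un {{i, j}, {k, l}}, insert {i, j} E) + frag_of (M Un {{i, j}, {k, l}}, insert {k, l} E)
   - (frag_of (M Un {{i, l}, {k, j}}, insert {i, l} E) + frag_of (M Un {{i, l}, {k, j}}, insert {k, j} E)) : K12 &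
  frag_of (M Un {{i, j}, {k, l}}, E Un {{i, j}, {k, l}}) - frag_of (M Un {{i, l}, {k, j}}, E Un {{i, l}, {k, j}}) : K12"

lemma rel_ok_flip: "rel_ok M E i j k l ==> rel_ok M E i l k j"
 unfolding rel_ok_def using K12_closed(3) by (metis minus_diff_eq)

lemma rel_ok_turn: "rel_ok M E i j k l ==> rel_ok M E k l i j"
 unfolding rel_ok_def by (simp add: insert_commute add.commute)

lemma rel_ok_reverse: "rel_ok M E i j k l ==> rel_ok M E j i l k"
 unfolding rel_ok_def by (simp add: insert_commute add.commute)

text \<open>
 The pairs \<open>ij, kl\<close> and \<open>il, kj\<close> are both crossingless only if \<open>i, j, k, l\<close> occur in this cyclic
 order, up to reversal.
\<close>

lemma relations_min: assumes lt: "i < j" "j < l" "i < k" and dist: "k ~= j" "k ~= l" and E: "E <= M"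
  and M: "M Un {{i, j}, {k, l}} : matchings (m + n)" "M Un {{i, l}, {k, j}} : matchings (m + n)"
 shows "rel_ok M E i j k l"
proof -
 have cr: "{q, s} ~: Y" if Y: "Y : matchings (m + n)" "{p, r} : Y" "p < q" "q < r" "r < s" "q : \<Union>Y" "s : \<Union>Y" for Y p q r s
 proof -
  have "{p, q, r, s} <= {1..2 * (m + n)}" using that(6,7) Y(2) matchings_Union[OF Y(1)] by blast
  thus ?thesis using crossingless_onD(5)[of "%i. i" "{1..2 * (m + n)}" Y p q r s] Y unfolding matchings_def by simp
 qed
 consider "k < j" | "j < k" "k < l" | "l < k" using dist by linarith
 thus ?thesis
 proof cases
  case 1
  have "{k, l} ~: M Un {{i, j}, {k, l}}" by (rule cr[OF M(1), of i j]) (use 1 lt in auto)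
  thus ?thesis by simp
 next
  case 2
  thus ?thesis unfolding rel_ok_def using ordered_relations[OF lt(1) 2 E M] by simp
 next
  case 3
  have "{j, k} ~: M Un {{i, l}, {k, j}}" by (rule cr[OF M(2), of i l]) (use 3 lt in auto)
  thus ?thesis by (simp add: insert_commute)
 qed
qed

text \<open>By the symmetries of the quadrilateral the least of the four points may be moved to the
  first place.\<close>

lemma relations: assumes dist: "distinct [i, j, k, l]" and E: "E <= M"
  and M: "M Un {{i, j}, {k, l}} : matchings (m + n)" "M Un {{i, l}, {k, j}} : matchings (m + n)"
 shows "rel_ok M E i j k l"
proof -
 have first: "rel_ok M E i j k l" if lt: "i < j" "i < k" "i < l" and d: "distinct [i, j, k, l]"
   and M: "M Un {{i, j}, {k, l}} : matchings (m + n)" "M Un {{i, l}, {k, j}} : matchings (m + n)" for i j k l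
 proof (cases "j < l")
  case True
  thus ?thesis using relations_min[OF lt(1) True lt(2) _ _ E M] d by simp
 next
  case False
  hence "l < j" using d by simp
  hence "rel_ok M E i l k j" using relations_min[OF lt(3) _ lt(2) _ _ E M(2,1)] d by simp
  thus ?thesis by (rule rel_ok_flip)
 qed
 have c1: "{{k, l}, {i, j}} = {{i, j}, {k, l}}" "{{k, j}, {i, l}} = {{i, l}, {k, j}}"
  "{{j, i}, {l, k}} = {{i, j}, {k, l}}" "{{j, k}, {l, i}} = {{i, l}, {k, j}}"
  "{{l, k}, {j, i}} = {{i, j}, {k, l}}" "{{l, i}, {j, k}} = {{i, l}, {k, j}}" by (auto simp: insert_commute)
 consider "i < j" "i < k" "i < l" | "k < i" "k < j" "k < l" | "j < i" "j < k" "j < l" | "l < i" "l < j" "l < k"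
  using dist by fastforce
 thus ?thesis
 proof cases
  case 1
  thus ?thesis using first[OF 1 dist M] by simp
 next
  case 2
  have "rel_ok M E k l i j" by (rule first) (use 2 dist M c1 in auto)
  thus ?thesis by (rule rel_ok_turn)
 next
  case 3
  have "rel_ok M E j i l k" by (rule first) (use 3 dist M c1 in auto)
  thus ?thesis by (rule rel_ok_reverse)
 next
  case 4
  have "rel_ok M E l k j i" by (rule first) (use 4 dist M c1 in auto)
  thus ?thesis by (rule rel_ok_reverse[OF rel_ok_turn])
 qed
qed

text \<open>Cutting, carried over to the algebra; elements between different matchings go to 0. It
  is a trace modulo \<open>K12\<close>.\<close>

definition cutH :: "(endpoint hgen \<Rightarrow>\<^sub>0 int) => dotted_matching \<Rightarrow>\<^sub>0 int" where
 "cutH = frag_extend (%(x, y, D). if x = y then frag_of (unbend x, unbend D) else 0)"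

lemma cutH_diff: "cutH (u - v) = cutH u - cutH v" and cutH_0 [simp]: "cutH 0 = 0"
 and cutH_add: "cutH (u + v) = cutH u + cutH v" and cutH_minus: "cutH (- u) = - cutH u"
 by (simp_all add: cutH_def frag_extend_diff frag_extend_add frag_extend_minus)

lemma cutH_bas: "cutH (bas x y D) = (if x = y then frag_of (unbend x, unbend D) else 0)" by (simp add: cutH_def)

lemma cutH_off: "v : Fs x y ==> x ~= y ==> cutH v = 0"
 by (rule Fs_eqI[of v x y cutH "%v. 0"]) (simp_all add: cutH_diff cutH_bas)

lemma hmul_mismatch: "y ~= y' ==> bas x y D ** bas y' z E = 0" by (simp add: hmul_of)

text \<open>Closed under differences and products, so it only has to be verified for generators of
  the algebra, namely dots and single surgeries.\<close>

definition tracial :: "(endpoint hgen \<Rightarrow>\<^sub>0 int) => bool" where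
 "tracial y \<longleftrightarrow> (ALL x:Hs. cutH (x ** y - y ** x) : K12)"

lemma tracial_0: "tracial 0" by (simp add: tracial_def hmul_simps K12_closed(1))

lemma tracial_diff: "tracial y ==> tracial z ==> tracial (y - z)"
proof -
 assume a: "tracial y" "tracial z"
 have "x ** (y - z) - (y - z) ** x = (x ** y - y ** x) - (x ** z - z ** x)" for x by (simp add: hmul_simps)
 hence "cutH (x ** (y - z) - (y - z) ** x) = cutH (x ** y - y ** x) - cutH (x ** z - z ** x)" for x by (simp only: cutH_diff)
 thus ?thesis using a K12_closed(4) unfolding tracial_def by (simp only: Ball_def) blast
qed

text \<open>The commutator of \<open>x\<close> with \<open>y z\<close> is the sum of the commutators
  of \<open>x y\<close> with \<open>z\<close> and of \<open>z x\<close> with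
  \<open>y\<close>.\<close>

lemma tracial_mult: assumes "tracial y" "tracial z" "y : Hs" "z : Hs" shows "tracial (y ** z)"
 unfolding tracial_def
proof
 fix x assume x: "x : Hs"
 have "x ** (y ** z) - (y ** z) ** x = ((x ** y) ** z - z ** (x ** y)) + ((z ** x) ** y - y ** (z ** x))"
  by (simp add: hmul_assoc)
 moreover have "cutH ((x ** y) ** z - z ** (x ** y)) : K12" "cutH ((z ** x) ** y - y ** (z ** x)) : K12"
  using assms Hs_hmul x unfolding tracial_def by blast+
 ultimately show "cutH (x ** (y ** z) - (y ** z) ** x) : K12" using K12_closed(2) by (simp only: cutH_add)
qed

lemma tracialI: assumes y: "y : Fs p q" and p: "cm p" "cm q"
  and D: "!!D. D <= circ q p ==> cutH (bas q p D ** y - y ** bas q p D) : K12"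
 shows "tracial y" unfolding tracial_def
proof
 fix z assume "z : Hs"
 thus "cutH (z ** y - y ** z) : K12"
 proof (induction rule: Hs_induct)
  case zero
  show ?case by (simp add: hmul_simps K12_closed(1))
 next
  case (diff u v)
  have "(u - v) ** y - y ** (u - v) = (u ** y - y ** u) - (v ** y - y ** v)" by (simp add: hmul_simps)
  thus ?case using diff.IH K12_closed(4) by (simp only: cutH_diff)
 next
  case (bas x x' D)
  show ?case
  proof (cases "x = q & x' = p")
   case True
   thus ?thesis using D bas by simp
  next
   case False
   have F: "bas x x' D ** y : Fs x q" "y ** bas x x' D : Fs p x'"
    using Fs_hmul[OF Fs_bas[OF bas(3)] y] Fs_hmul[OF y Fs_bas[OF bas(3)]] .
   have "cutH (bas x x' D ** y) = 0"
   proof (cases "x = q")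
    case True
    hence ne: "x' ~= p" using False by simp
    have "bas x x' D ** y = 0"
     by (rule Fs_eqI[OF y, of "%y. bas x x' D ** y" "%y. 0"]) (simp_all add: hmul_simps hmul_mismatch[OF ne])
    thus ?thesis by simp
   qed (rule cutH_off[OF F(1)])
   moreover have "cutH (y ** bas x x' D) = 0"
   proof (cases "x' = p")
    case True
    hence ne: "q ~= x" using False by simp
    have "y ** bas x x' D = 0"
     by (rule Fs_eqI[OF y, of "%y. y ** bas x x' D" "%y. 0"]) (simp_all add: hmul_simps hmul_mismatch[OF ne])
    thus ?thesis by simp
   qed (rule cutH_off[OF F(2)], simp)
   ultimately show ?thesis by (simp add: cutH_diff K12_closed(1))
  qed
 qed
qed

lemma cm_circ: "cm x ==> circ x x = x" by (rule circ_self[OF cm_pm])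

lemma tracial_dots: assumes x: "cm x" and S: "S <= x" shows "tracial (bas x x S)"
proof (rule tracialI[OF _ x x])
 show "bas x x S : Fs x x" by (rule Fs_bas) (simp only: cm_circ[OF x] S)
 fix D assume D: "D <= circ x x"
 have Dx: "D <= x" "S <= circ x x" using D S by (simp_all only: cm_circ[OF x])
 have "bas x x D ** bas x x S = bas x x S ** bas x x D"
  unfolding bas_dots[OF cm_pm[OF x] cm_pm[OF x] Dx] bas_dots[OF cm_pm[OF x] cm_pm[OF x] S D]
  by (simp only: add.commute[of "dots D _"])
 thus "cutH (bas x x D ** bas x x S - bas x x S ** bas x x D) : K12" by (simp add: K12_closed(1))
qed

lemma surg_diagonal: assumes s: "sg x x' a b c d" and x: "cm x" and E: "E <= x - {{a, b}, {c, d}}"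
 shows "bas x x' {} ** bas x' x E = bas x x (insert {a, b} E) + bas x x (insert {c, d} E)"
  and "bas x x' {} ** bas x' x (insert {a, b, c, d} E) = bas x x (E Un {{a, b}, {c, d}})"
  and "circ x' x = insert {a, b, c, d} (x - {{a, b}, {c, d}})" and "{a, b, c, d} ~: x"
proof -
 have pmx: "pm x" by (rule cm_pm[OF x])
 have arcs: "{a, b} : x" "{c, d} : x" using s by (simp_all add: surg_def)
 have circx: "circ x x = x" by (rule cm_circ[OF x])
 have cl: "cls (x Un x) a = {a, b}" "cls (x Un x) c = {c, d}"
  using cc_eq_cls[of "{a, b}" "x Un x" a] cc_eq_cls[of "{c, d}" "x Un x" c] arcs circx by simp_all
 have ne: "{a, b} ~= {c, d}" using surg_distinct(7)[OF s pmx] .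
 have n: "~ conn (x Un x) a c" using cl ne cls_eq_iff[of "x Un x" a c] by simp
 note sc = surg_circles[OF s pmx pmx n, unfolded cl circx]
 have K4: "{a, b} Un {c, d} = {a, b, c, d}" by blast
 show c: "circ x' x = insert {a, b, c, d} (x - {{a, b}, {c, d}})" using sc(6) unfolding K4 by simp
 show nx: "{a, b, c, d} ~: x" using sc(4) unfolding K4 .
 have nE: "{a, b, c, d} ~: E" using nx E by blast
 have sub: "E <= circ x' x" "insert {a, b, c, d} E <= circ x' x" unfolding c using E by blast+
 have d: "insert {a, b, c, d} E - {{a, b, c, d}} = E" using nE by simp
 show "bas x x' {} ** bas x' x E = bas x x (insert {a, b} E) + bas x x (insert {c, d} E)"
  using bas_split[OF s pmx pmx n sub(1)] nE unfolding cl K4 by simp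
 show "bas x x' {} ** bas x' x (insert {a, b, c, d} E) = bas x x (E Un {{a, b}, {c, d}})"
  using bas_split[OF s pmx pmx n sub(2)] unfolding cl K4 d by simp
qed

lemma surg_diagonal': assumes s: "sg x x' a b c d" and x: "cm x" "cm x'" and E: "E <= x - {{a, b}, {c, d}}"
 shows "bas x' x E ** bas x x' {} = bas x' x' (insert {a, d} E) + bas x' x' (insert {c, b} E)"
  and "bas x' x (insert {a, b, c, d} E) ** bas x x' {} = bas x' x' (E Un {{a, d}, {c, b}})"
proof -
 have s': "sg x' x a d c b" by (rule surg_sym[OF s cm_pm[OF x(1)]])
 have "x' = x - {{a, b}, {c, d}} Un {{a, d}, {c, b}}" using s by (simp add: surg_def)
 moreover have "{a, d} ~: x" "{c, b} ~: x" using surg_not_in[OF s cm_pm[OF x(1)]] .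
 ultimately have E': "E <= x' - {{a, d}, {c, b}}" using E by blast
 have rev: "bas x' x D ** bas x x' {} = hrev (bas x' x {} ** bas x x' D)" for D by (simp add: hrev_hmul)
 have K4: "{a, d, c, b} = {a, b, c, d}" by blast
 show "bas x' x E ** bas x x' {} = bas x' x' (insert {a, d} E) + bas x' x' (insert {c, b} E)"
  unfolding rev surg_diagonal(1)[OF s' x(2) E'] by simp
 show "bas x' x (insert {a, b, c, d} E) ** bas x x' {} = bas x' x' (E Un {{a, d}, {c, b}})"
  unfolding rev using surg_diagonal(2)[OF s' x(2) E'] unfolding K4 by simp
qed

lemma unbend_Un: "unbend (A Un B) = unbend A Un unbend B" and unbend_insert: "unbend (insert al A) = insert (pos ` al) (unbend A)"
 and unbend_empty: "unbend {} = {}" by (auto simp: unbend_def)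

text \<open>The circle \<open>{a, b, c, d}\<close> of the two matchings is split into arcs of
  \<open>x\<close> by one order of the factors and into arcs of \<open>x'\<close> by the other. The
  difference is a relation of type I if this circle is undotted and of type II if it is
  dotted.\<close>

lemma tracial_surg: assumes s: "sg x x' a b c d" and x: "cm x" "cm x'" shows "tracial (bas x x' {})"
proof (rule tracialI[OF _ x])
 show "bas x x' {} : Fs x x'" by (rule Fs_bas) simp
 fix D assume D: "D <= circ x' x"
 let ?B = "x - {{a, b}, {c, d}}"
 have xe: "x = ?B Un {{a, b}, {c, d}}" "x' = ?B Un {{a, d}, {c, b}}" using s by (auto simp: surg_def)
 define E where "E = D - {{a, b, c, d}}"
 have c: "circ x' x = insert {a, b, c, d} ?B" by (rule surg_diagonal(3)[OF s x(1) empty_subsetI])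
 have E: "E <= ?B" using D unfolding c E_def by blast
 let ?M = "unbend ?B" and ?E = "unbend E"
 have ux: "unbend x = ?M Un {{pos a, pos b}, {pos c, pos d}}" "unbend x' = ?M Un {{pos a, pos d}, {pos c, pos b}}"
  by (subst xe(1), simp add: unbend_Un unbend_insert unbend_empty, subst xe(2), simp add: unbend_Un unbend_insert unbend_empty)
 have V: "a : V" "b : V" "c : V" "d : V" using surg_in_V[OF s cm_pm[OF x(1)]] by auto
 have "distinct [pos a, pos b, pos c, pos d]"
  using surg_distinct[OF s cm_pm[OF x(1)]] inj_onD[OF injpos] V by (simp; metis)
 hence rel: "rel_ok ?M ?E (pos a) (pos b) (pos c) (pos d)"
  by (rule relations) (use E unbend_matching[OF x(1)] unbend_matching[OF x(2)] ux in "auto simp: unbend_def")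
 show "cutH (bas x' x D ** bas x x' {} - bas x x' {} ** bas x' x D) : K12"
 proof (cases "{a, b, c, d} : D")
  case True
  hence De: "D = insert {a, b, c, d} E" by (auto simp: E_def)
  have "cutH (bas x x' {} ** bas x' x D) - cutH (bas x' x D ** bas x x' {}) : K12"
   using rel unfolding De surg_diagonal(2)[OF s x(1) E] surg_diagonal'(2)[OF s x E] rel_ok_def
   by (simp add: cutH_bas ux unbend_Un unbend_insert unbend_empty)
  hence "- (cutH (bas x x' {} ** bas x' x D) - cutH (bas x' x D ** bas x x' {})) : K12" by (rule K12_closed(3))
  thus ?thesis by (simp add: cutH_diff)
 next
  case False
  hence De: "D = E" by (auto simp: E_def)
  have "cutH (bas x x' {} ** bas x' x D) - cutH (bas x' x D ** bas x x' {}) : K12"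
   using rel unfolding De surg_diagonal(1)[OF s x(1) E] surg_diagonal'(1)[OF s x E] rel_ok_def
   by (simp add: cutH_bas cutH_add ux unbend_Un unbend_insert unbend_empty)
  hence "- (cutH (bas x x' {} ** bas x' x D) - cutH (bas x' x D ** bas x x' {})) : K12" by (rule K12_closed(3))
  thus ?thesis by (simp add: cutH_diff)
 qed
qed

text \<open>An undotted element is a product of surgery elements: each surgery creates one more arc
  of \<open>y\<close>, and going back merges two undotted circles.\<close>

lemma tracial_pair: assumes "cm x" "cm y" shows "tracial (bas x y {})" using assms
proof (induction "card (y - x)" arbitrary: x rule: less_induct)
 case less
 note x = less.prems(1) and y = less.prems(2)
 show ?case
 proof (cases "y <= x")
  case True
  hence "y = x" by (rule cm_subset_eq[OF y x])
  thus ?thesis using tracial_dots[OF x, of "{}"] by simp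
 next
  case False
  have A: "x Int y <= y" "y - x <= y - x Int y" "y - x ~= {}" using False by blast+
  have inner: "{p, q} : x Int y Un (y - x)" if "{p, q} : y" for p q using that by blast
  obtain u v where uv: "{u, v} : y - x" "even (pos u)" "odd (pos v)" "u : V" "v : V" "gap (x Int y) u v"
   using gap_exists[OF y A inner] .
  have uvx: "{u, v} ~: x" and uvy: "{u, v} : y" using uv(1) by auto
  obtain x' b w where s: "sg x x' u b w v" "sg x' x u v w b" "cm x'" "insert {u, v} (x Int y) <= x'"
   "{u, b} : x" "{w, v} : x" "x' = x - {{u, b}, {w, v}} Un {{u, v}, {w, b}}"
   using gap_surgery[OF x Int_lower1 uv(6,4,5,2,3) uvx] .
  have "card (y - x') < card (y - x)"
  proof (rule psubset_card_mono)
   show "finite (y - x)" using finite_elements[OF finV cm_partition[OF y]] by simp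
   show "y - x' \<subset> y - x" using uv(1) s(4) by blast
  qed
  hence IH: "tracial (bas x' y {})" using less.hyps s(3) y by simp
  have "bas x x' {} ** bas x' y {} = bas x y {}" by (rule hmul_surg_merge[OF s(2) cm_pm[OF s(3)] cm_pm[OF y] uvy])
  moreover have "tracial (bas x x' {} ** bas x' y {})"
   by (rule tracial_mult[OF tracial_surg[OF s(1) x s(3)] IH]) (use Hs_bas x y s(3) in auto)
  ultimately show ?thesis by simp
 qed
qed

text \<open>Choosing one arc of \<open>x\<close> on every dotted circle writes the element as a
  product of dots on arcs and an undotted element.\<close>

lemma tracial_bas: assumes x: "cm x" and y: "cm y" and D: "D <= circ x y" shows "tracial (bas x y D)"
proof -
 have ex: "EX al. al : x & al <= K" if K: "K : circ x y" for K
 proof -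
  obtain p where p: "p : K" using cc_nonempty[OF K] by blast
  have "p : V" using p cc_subset[OF K] cm_Union[OF x] cm_Union[OF y] by auto
  then obtain al where al: "al : x" "p : al" using cm_Union[OF x] by blast
  have "al <= K" by (rule cc_absorb[OF K]) (use al p in auto)
  thus ?thesis using al by blast
 qed
 define r where "r K = (SOME al. al : x & al <= K)" for K
 have r: "r K : x" "r K <= K" if "K : circ x y" for K using someI_ex[OF ex[OF that]] unfolding r_def by blast+
 have Sx: "r ` D <= x" using r D by blast
 have rne: "r K ~= {}" if "K : circ x y" for K using r(1)[OF that] partition_onD3[OF cm_partition[OF x]] by metis
 have dots: "dots (r ` D) K = (if K : D then 1 else 0)" if K: "K : circ x y" for K
 proof -
  have "{al : r ` D. al <= K} = (if K : D then {r K} else {})"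
  proof -
   have "L = K" if L: "L : D" "r L <= K" for L
   proof -
    have Lc: "L : circ x y" using L(1) D by blast
    obtain p where "p : r L" using rne[OF Lc] by blast
    thus ?thesis using cc_disjoint[OF Lc K, of p] r(2)[OF Lc] L(2) by blast
   qed
   thus ?thesis using r(2)[OF K] by auto
  qed
  thus ?thesis by (simp add: dots_def)
 qed
 have d0: "dots {} K = 0" for K :: "endpoint set" by (simp add: dots_def)
 have "{K : circ x y. dots (r ` D) K + dots {} K = 1} = D" using dots D by (auto simp: d0 split: if_splits)
 moreover have "ALL K:circ x y. dots (r ` D) K + dots {} K <= 1" using dots by (simp add: d0)
 ultimately have "bas x x (r ` D) ** bas x y {} = bas x y D"
  using bas_dots[OF cm_pm[OF x] cm_pm[OF y] Sx, of "{}"] by simp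
 moreover have "tracial (bas x x (r ` D) ** bas x y {})"
  by (rule tracial_mult[OF tracial_dots[OF x Sx] tracial_pair[OF x y]])
   (use Hs_bas[OF x x, of "r ` D"] Sx Hs_bas[OF x y, of "{}"] cm_circ[OF x] in auto)
 ultimately show ?thesis by simp
qed

theorem cut_commutator: assumes "x : Hs" "y : Hs" shows "cutH (x ** y - y ** x) : K12"
proof -
 have "tracial y" using assms(2) by (induction rule: Hs_induct) (simp_all add: tracial_0 tracial_bas tracial_diff)
 thus ?thesis using assms(1) by (simp add: tracial_def)
qed

end

section \<open>The isomorphism\<close>

context tangle_setting
begin

text \<open>The matching is doubled to \<open>W(M)M\<close> with the same dots; this is a right
  inverse of cutting.\<close>

definition sec :: "(dotted_matching \<Rightarrow>\<^sub>0 int) => endpoint hgen \<Rightarrow>\<^sub>0 int" where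
 "sec = frag_extend (%(M, E). bas (bend m M) (bend m M) (bend m E))"

lemma sec_simps: "sec (u - v) = sec u - sec v" "sec (u + v) = sec u + sec v" "sec 0 = 0"
 "sec (frag_of (M, E)) = bas (bend m M) (bend m M) (bend m E)"
 by (simp_all add: sec_def frag_extend_diff frag_extend_add)

lemma sec_Hs: "keys w <= dotted_matchings (m + n) ==> sec w : Hs"
proof (induction w rule: frag_keys_induct)
 case (of k)
 obtain M E where k: "k = (M, E)" by (cases k) auto
 have ME: "M : matchings (m + n)" "E <= M" using of by (simp_all add: k dotted_iff)
 have "bend m E <= circ (bend m M) (bend m M)"
  unfolding cm_circ[OF bend_cm[OF ME(1)]] using ME(2) by (simp add: bend_def image_mono)
 thus ?case unfolding k sec_simps by (rule Hs_bas[OF bend_cm[OF ME(1)] bend_cm[OF ME(1)]])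
qed (simp_all add: sec_simps Hs_diff)

lemma unbend_bend_matching: "M : matchings (m + n) ==> E <= M ==> unbend (bend m E) = E"
 using matchings_Union[of M "m + n"] by (intro unbend_bend) blast

lemma cut_sec: "keys w <= dotted_matchings (m + n) ==> cutH (sec w) = w"
proof (induction w rule: frag_keys_induct)
 case (of k)
 obtain M E where k: "k = (M, E)" by (cases k) auto
 have ME: "M : matchings (m + n)" "E <= M" using of by (simp_all add: k dotted_iff)
 show ?case unfolding k sec_simps cutH_bas
  using unbend_bend_matching[OF ME] unbend_bend_matching[OF ME(1) subset_refl] by simp
qed (simp_all add: sec_simps cutH_diff)

lemma keys_cut: "z : Hs ==> keys (cutH z) <= dotted_matchings (m + n)"
proof (induction z rule: Hs_induct)
 case (bas x y D)
 show ?case using bas cm_circ unbend_matching dotted_iff unbend_def cutH_bas by auto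
next
 case (diff u v)
 thus ?case using keys_diff[of "cutH u" "cutH v"] unfolding cutH_diff by (meson Un_least subset_trans)
qed simp

text \<open>On the diagonal the circles are the arcs of \<open>a\<close> themselves, so sliding dots
  in \<open>cut_gen\<close> returns the set \<open>D\<close> unchanged.\<close>

lemma cut_beta: "keys x <= arc_gens (m + n) ==> frag_extend cut_gen x = cutH (beta x)"
proof (induction x rule: frag_keys_induct)
 case (of k)
 obtain b a D where k: "k = (b, a, D)" by (cases k) auto
 have ba: "b : matchings (m + n)" "a : matchings (m + n)" "D <= circ b a" using of by (auto simp: arc_gens_iff k)
 have inv: "unbend (bend m b) = b" "unbend (bend m a) = a" using unbend_bend_matching ba by blast+
 have be: "beta (frag_of k) = bas (bend m a) (bend m b) (bend m D)" by (simp add: beta_def k bend_def)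
 show ?case
 proof (cases "b = a")
  case True
  have Da: "D <= a" using ba(3) matching_circ[OF ba(2)] True by simp
  have pa: "partition_on {1..2 * (m + n)} a" using ba(2) crossingless_onD(1) unfolding matchings_def by blast
  have "al : D" if al: "al : a" "c : D" "al <= c" for al c
  proof -
   have "al ~= {}" using al(1) partition_onD3[OF pa] by metis
   hence "al Int c ~= {}" using al(3) by blast
   hence "al = c" using disjointD[OF partition_onD2[OF pa] al(1), of c] al(2) Da by blast
   thus ?thesis using al(2) by simp
  qed
  hence "{al : a. EX c:D. al <= c} = D" using Da by blast
  thus ?thesis unfolding be cutH_bas using True inv unbend_bend_matching[OF ba(2) Da] by (simp add: k)
 next
  case False
  hence "bend m a ~= bend m b" using inv by metis
  thus ?thesis unfolding be cutH_bas using False by (simp add: k)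
 qed
qed (simp_all add: frag_extend_diff cutH_diff beta_def)

section \<open>The commutator subgroup of the homomorphism ring\<close>

abbreviation (input) "R \<equiv> Hom_ring m n"

lemma Theta_plus: "Theta z \<oplus>\<^bsub>R\<^esub> Theta w = Theta (z + w)"
 by (intro ext) (simp add: Hom_ring_def Theta_add)

lemma Theta_zero: "Theta 0 = \<zero>\<^bsub>R\<^esub>" by (intro ext) (simp add: Hom_ring_def Theta_0)

lemma abelian_group_Hom: "abelian_group R"
proof (rule abelian_groupI)
 show "f \<oplus>\<^bsub>R\<^esub> g : carrier R" if f: "f : carrier R" and g: "g : carrier R" for f g
  by (metis Theta_surj Theta_carrier Hs_add Theta_plus that)
 show "\<zero>\<^bsub>R\<^esub> : carrier R" using Theta_carrier[OF Hs_0] unfolding Theta_zero .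
 show "EX g:carrier R. g \<oplus>\<^bsub>R\<^esub> f = \<zero>\<^bsub>R\<^esub>" if f: "f : carrier R" for f
 proof -
  obtain z where z: "z : Hs" "Theta z = f" using Theta_surj[OF f] .
  have "Theta (0 - z) \<oplus>\<^bsub>R\<^esub> f = \<zero>\<^bsub>R\<^esub>" unfolding z(2)[symmetric] Theta_plus Theta_zero[symmetric] by simp
  thus ?thesis using Theta_carrier[OF Hs_diff[OF Hs_0 z(1)]] by blast
 qed
qed (simp_all add: Hom_ring_def add_ac)

lemma Theta_minus: assumes z: "z : Hs" and w: "w : Hs"
 shows "\<ominus>\<^bsub>R\<^esub> Theta z = Theta (- z)" "Theta z \<ominus>\<^bsub>R\<^esub> Theta w = Theta (z - w)"
proof -
 interpret abelian_group R by (rule abelian_group_Hom)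
 have neg: "\<ominus>\<^bsub>R\<^esub> Theta z = Theta (- z)" if "z : Hs" for z
 proof (rule minus_equality)
  have "- z : Hs" using Hs_diff[OF Hs_0 that] by simp
  thus "Theta (- z) : carrier R" "Theta z : carrier R" using Theta_carrier that by auto
  show "Theta (- z) \<oplus>\<^bsub>R\<^esub> Theta z = \<zero>\<^bsub>R\<^esub>" unfolding Theta_plus Theta_zero[symmetric] by simp
 qed
 show "\<ominus>\<^bsub>R\<^esub> Theta z = Theta (- z)" by (rule neg[OF z])
 show "Theta z \<ominus>\<^bsub>R\<^esub> Theta w = Theta (z - w)" unfolding a_minus_def neg[OF w] Theta_plus by simp
qed

definition comms :: "hom_family set" where
 "comms = {x \<otimes>\<^bsub>R\<^esub> y \<ominus>\<^bsub>R\<^esub> y \<otimes>\<^bsub>R\<^esub> x | x y. x : carrier R & y : carrier R}"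

lemma comms_eq: "comms = {Theta (w ** z - z ** w) | z w. z : Hs & w : Hs}"
proof -
 have c: "Theta z \<otimes>\<^bsub>R\<^esub> Theta w \<ominus>\<^bsub>R\<^esub> Theta w \<otimes>\<^bsub>R\<^esub> Theta z = Theta (w ** z - z ** w)" if "z : Hs" "w : Hs" for z w
  unfolding Theta_mult[OF that] Theta_mult[OF that(2,1)] by (rule Theta_minus(2)[OF Hs_hmul[OF that(2,1)] Hs_hmul[OF that]])
 show ?thesis
 proof
  show "comms <= {Theta (w ** z - z ** w) | z w. z : Hs & w : Hs}"
  proof
   fix h assume "h : comms"
   then obtain x y where xy: "x : carrier R" "y : carrier R" "h = x \<otimes>\<^bsub>R\<^esub> y \<ominus>\<^bsub>R\<^esub> y \<otimes>\<^bsub>R\<^esub> x"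
    unfolding comms_def by blast
   obtain z where z: "z : Hs" "Theta z = x" using Theta_surj[OF xy(1)] .
   obtain w where w: "w : Hs" "Theta w = y" using Theta_surj[OF xy(2)] .
   have "h = Theta (w ** z - z ** w)" unfolding xy(3) c[OF z(1) w(1), symmetric] z(2) w(2) ..
   thus "h : {Theta (w ** z - z ** w) | z w. z : Hs & w : Hs}" using z(1) w(1) by blast
  qed
  show "{Theta (w ** z - z ** w) | z w. z : Hs & w : Hs} <= comms"
  proof
   fix h assume "h : {Theta (w ** z - z ** w) | z w. z : Hs & w : Hs}"
   then obtain z w where zw: "z : Hs" "w : Hs" "h = Theta (w ** z - z ** w)" by blast
   show "h : comms" unfolding comms_def mem_Collect_eq
    by (intro exI[of _ "Theta z"] exI[of _ "Theta w"] conjI Theta_carrier zw(1,2)) (simp add: zw(3) c[OF zw(1,2)])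
  qed
 qed
qed

definition C :: "hom_family set" where
 "C = generate (add_monoid R) comms"

lemma comms_carrier: "comms <= carrier R" unfolding comms_eq using Theta_carrier Hs_diff Hs_hmul by blast

lemma subgroup_C: "subgroup C (add_monoid R)" unfolding C_def
 by (rule group.generate_is_subgroup[OF abelian_group.a_group[OF abelian_group_Hom]]) (simp add: comms_carrier)

lemma C_closed:
 "z : Hs ==> w : Hs ==> Theta z : C ==> Theta w : C ==> Theta (z + w) : C"
 "z : Hs ==> Theta z : C ==> Theta (- z) : C"
 "z : Hs ==> w : Hs ==> Theta z : C ==> Theta w : C ==> Theta (z - w) : C"
 "Theta 0 : C"
proof -
 interpret sg: subgroup C "add_monoid R" by (rule subgroup_C)
 show add: "Theta (z + w) : C" if "Theta z : C" "Theta w : C" for z w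
  using sg.m_closed[OF that] by (simp add: Theta_plus)
 show neg: "Theta (- z) : C" if "z : Hs" "Theta z : C" for z
  using sg.m_inv_closed[OF that(2)] Theta_minus(1)[OF that(1) that(1)] by (simp add: a_inv_def)
 show "z : Hs ==> w : Hs ==> Theta z : C ==> Theta w : C ==> Theta (z - w) : C" for z w
  using add[of z "- w"] neg[of w] by simp
 show "Theta 0 : C" using sg.one_closed by (simp add: Theta_zero)
qed

lemma comm_in_C: "z : Hs ==> w : Hs ==> Theta (z ** w - w ** z) : C"
 unfolding C_def by (rule generate.incl) (unfold comms_eq, blast)

text \<open>Cutting and doubling reproduces a diagonal basis element. An off-diagonal one is its own
  commutator with the unit of its source, as it does not compose with that unit on the other
  side.\<close>

lemma sec_cut_C: "z : Hs ==> Theta (z - sec (cutH z)) : C"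
proof (induction z rule: Hs_induct)
 case zero
 show ?case by (simp add: sec_simps C_closed(4))
next
 case (bas x y D)
 show ?case
 proof (cases "x = y")
  case True
  hence "D <= x" using bas(3) cm_circ[OF bas(1)] by simp
  hence "\<Union>D <= V" "\<Union>x <= V" using cm_Union[OF bas(1)] by blast+
  hence "sec (cutH (bas x y D)) = bas x y D" using bend_unbend True by (simp add: cutH_bas sec_simps)
  thus ?thesis by (simp add: C_closed(4))
 next
  case False
  have u: "bas x x {} ** bas x y D = bas x y D"
   by (rule unit_left[OF cm_pm[OF bas(1)] cm_pm[OF bas(2)] Fs_bas[OF bas(3)]])
  have "Theta (bas x x {} ** bas x y D - bas x y D ** bas x x {}) : C"
   by (rule comm_in_C[OF Hs_bas[OF bas(1,1)] Hs_bas[OF bas]]) simp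
  thus ?thesis using False hmul_mismatch[of y x x D x "{}"] unfolding u by (simp add: cutH_bas sec_simps)
 qed
next
 case (diff u v)
 have eq: "u - v - sec (cutH (u - v)) = (u - sec (cutH u)) - (v - sec (cutH v))" by (simp add: cutH_diff sec_simps)
 show ?case unfolding eq by (intro C_closed(3) diff.IH Hs_diff sec_Hs keys_cut diff.hyps)
qed

text \<open>
 The relations are commutators of the two elementary elements between the matchings involved.
\<close>

lemma relations_in_C: assumes lt: "a < b" "b < c" "c < d" and E: "E <= M"
  and M: "M Un {{a, b}, {c, d}} : matchings (m + n)" "M Un {{a, d}, {b, c}} : matchings (m + n)"
 shows "Theta (sec (frag_of (M Un {{a, b}, {c, d}}, insert {a, b} E) + frag_of (M Un {{a, b}, {c, d}}, insert {c, d} E)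
    - (frag_of (M Un {{a, d}, {b, c}}, insert {a, d} E) + frag_of (M Un {{a, d}, {b, c}}, insert {b, c} E)))) : C"
  and "Theta (sec (frag_of (M Un {{a, b}, {c, d}}, E Un {{a, b}, {c, d}})
    - frag_of (M Un {{a, d}, {b, c}}, E Un {{a, d}, {b, c}}))) : C"
proof -
 let ?X = "M Un {{a, b}, {c, d}}" and ?X' = "M Un {{a, d}, {b, c}}"
 let ?f = "bend_point m"
 let ?x = "bend m ?X" and ?x' = "bend m ?X'"
 have x: "cm ?x" "cm ?x'" using bend_cm M by auto
 have rng: "a : {1..2 * (m + n)}" "b : {1..2 * (m + n)}" "c : {1..2 * (m + n)}" "d : {1..2 * (m + n)}"
  using matchings_Union[OF M(1)] by blast+
 have fp: "pos (?f a) = a" "pos (?f b) = b" "pos (?f c) = c" "pos (?f d) = d" using pos_bend rng by auto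
 have xe: "?x = bend m M Un {{?f a, ?f b}, {?f c, ?f d}}" "?x' = bend m M Un {{?f a, ?f d}, {?f b, ?f c}}"
  by (auto simp: bend_def)
 have arcs: "{?f a, ?f b} : ?x" "{?f c, ?f d} : ?x" "{?f a, ?f d} : ?x'" unfolding xe by auto
 have par: "even a ~= even b" "even c ~= even d" "even a ~= even d"
  using cm_parity[OF x(1) arcs(1)] cm_parity[OF x(1) arcs(2)] cm_parity[OF x(2) arcs(3)] by (simp_all add: fp)
 have fne: "?f a ~= ?f b" "?f a ~= ?f c" "?f a ~= ?f d" "?f b ~= ?f c" "?f b ~= ?f d" "?f c ~= ?f d"
  using fp lt by auto
 have new: "al ~: bend m M" if "al : {{?f a, ?f b}, {?f c, ?f d}}" for al
 proof
  assume al: "al : bend m M"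
  hence "al : ?x'" unfolding xe by blast
  moreover have "{?f a, ?f d} : ?x'" "{?f b, ?f c} : ?x'" unfolding xe by auto
  ultimately have "al = {?f a, ?f d} | al = {?f b, ?f c}"
   using that cm_unique[OF x(2), of al "{?f a, ?f d}" "?f a"] cm_unique[OF x(2), of al "{?f b, ?f c}" "?f c"] by blast
  thus False using that fne by (auto simp: doubleton_eq_iff)
 qed
 have xB: "?x - {{?f a, ?f b}, {?f c, ?f d}} = bend m M" unfolding xe using new by blast
 have x'e: "?x' = ?x - {{?f a, ?f b}, {?f c, ?f d}} Un {{?f a, ?f d}, {?f c, ?f b}}"
  unfolding xB xe(2) by (simp add: insert_commute)
 let ?E = "bend m E"
 have EB: "?E <= ?x - {{?f a, ?f b}, {?f c, ?f d}}" unfolding xB unfolding bend_def using E by (rule image_mono)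
 have bi: "bend m (insert {p, q} E) = insert {?f p, ?f q} ?E" for p q by (simp add: bend_def)
 have bu: "bend m (E Un {{p, q}, {r, s}}) = ?E Un {{?f p, ?f q}, {?f r, ?f s}}" for p q r s by (auto simp: bend_def)
 have H: "bas ?x ?x' {} : Hs" "D <= circ ?x' ?x ==> bas ?x' ?x D : Hs" for D using Hs_bas x by auto
 have comm: "Theta (bas ?x ?x' {} ** bas ?x' ?x D - bas ?x' ?x D ** bas ?x ?x' {}) : C" if "D <= circ ?x' ?x" for D
  by (rule comm_in_C[OF H(1) H(2)[OF that]])
 have main: "Theta (bas ?x ?x (insert {?f a, ?f b} ?E) + bas ?x ?x (insert {?f c, ?f d} ?E)
   - (bas ?x' ?x' (insert {?f a, ?f d} ?E) + bas ?x' ?x' (insert {?f c, ?f b} ?E))) : C &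
  Theta (bas ?x ?x (?E Un {{?f a, ?f b}, {?f c, ?f d}}) - bas ?x' ?x' (?E Un {{?f a, ?f d}, {?f c, ?f b}})) : C"
 proof (cases "even a")
  case True
  hence s: "sg ?x ?x' (?f a) (?f b) (?f c) (?f d)" unfolding surg_def using arcs fp par fne x'e by simp
  have sub: "?E <= circ ?x' ?x" "insert {?f a, ?f b, ?f c, ?f d} ?E <= circ ?x' ?x"
   unfolding surg_diagonal(3)[OF s x(1) EB] using EB by blast+
  show ?thesis using comm[OF sub(1)] comm[OF sub(2)]
   unfolding surg_diagonal(1,2)[OF s x(1) EB] surg_diagonal'[OF s x EB] by simp
 next
  case False
  hence s: "sg ?x ?x' (?f b) (?f a) (?f d) (?f c)"
   unfolding surg_def using arcs fp par fne x'e by (simp add: insert_commute)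
  have EB': "?E <= ?x - {{?f b, ?f a}, {?f d, ?f c}}" using EB by (simp add: insert_commute)
  have sub: "?E <= circ ?x' ?x" "insert {?f b, ?f a, ?f d, ?f c} ?E <= circ ?x' ?x"
   unfolding surg_diagonal(3)[OF s x(1) EB'] using EB' by blast+
  show ?thesis using comm[OF sub(1)] comm[OF sub(2)]
   unfolding surg_diagonal(1,2)[OF s x(1) EB'] surg_diagonal'[OF s x EB'] by (simp add: insert_commute add.commute)
 qed
 show "Theta (sec (frag_of (?X, insert {a, b} E) + frag_of (?X, insert {c, d} E)
    - (frag_of (?X', insert {a, d} E) + frag_of (?X', insert {b, c} E)))) : C"
  using conjunct1[OF main] unfolding sec_simps bi by (simp add: insert_commute)
 show "Theta (sec (frag_of (?X, E Un {{a, b}, {c, d}}) - frag_of (?X', E Un {{a, d}, {b, c}}))) : C"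
  using conjunct2[OF main] unfolding sec_simps bu by (simp add: insert_commute)
qed

section \<open>The subgroup of relations and its identification with the commutators\<close>

definition Rel :: "(dotted_matching \<Rightarrow>\<^sub>0 int) set" where
 "Rel = type_I_relations (m + n) Un type_II_relations (m + n) Un kernel_relations m n"

definition RelG :: "(dotted_matching \<Rightarrow>\<^sub>0 int) set" where
 "RelG = generate G Rel"

lemma kernel_relations_eq:
 "kernel_relations m n = {cutH (beta x) | x. keys x <= arc_gens (m + n) & Theta (beta x) = Theta 0}"
proof -
 have z: "Theta 0 = (%_ _ _. 0)" unfolding Theta_zero by (simp add: Hom_ring_def)
 show ?thesis unfolding kernel_relations_def carrier_arc_ring z using gamma_kernel cut_beta by (auto; metis)
qed

lemma Rel_carrier: "Rel <= carrier G" using kernel_relations_eq keys_cut beta_Hs Rel_def rel12_carrier by auto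

lemmas RelG_closed = generate_closed[OF Rel_carrier, folded RelG_def]

lemma RelG_carrier: "RelG <= carrier G"
 unfolding RelG_def by (rule group.generate_incl[OF group_free_Abelian_group Rel_carrier])

lemma K12_RelG: "K12 <= RelG"
 unfolding K12_def RelG_def Rel_def by (rule group.mono_generate[OF group_free_Abelian_group]) blast

lemma Rel_in_C: assumes "r : Rel" shows "Theta (sec r) : C"
proof -
 consider "r : type_I_relations (m + n)" | "r : type_II_relations (m + n)" | "r : kernel_relations m n"
  using assms unfolding Rel_def by blast
 thus ?thesis
 proof cases
  case 1
  thus ?thesis unfolding type_I_relations_def using relations_in_C(1) by blast
 next
  case 2
  thus ?thesis unfolding type_II_relations_def using relations_in_C(2) by blast
 next
  case 3
  then obtain x where x: "keys x <= arc_gens (m + n)" "Theta (beta x) = Theta 0" "r = cutH (beta x)"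
   unfolding kernel_relations_eq by blast
  have b: "beta x : Hs" by (rule beta_Hs[OF x(1)])
  have s: "sec r : Hs" unfolding x(3) by (rule sec_Hs[OF keys_cut[OF b]])
  \<comment> \<open>\<open>beta x\<close> and \<open>sec r\<close> differ by commutators, and
    \<open>Theta (beta x)\<close> vanishes by the choice of \<open>x\<close>.\<close>
  have "Theta (beta x - sec r) : C" using sec_cut_C[OF b] unfolding x(3) .
  hence "Theta (beta x - (beta x - sec r)) : C"
   using C_closed(3)[OF b Hs_diff[OF b s]] C_closed(4) unfolding x(2) by blast
  thus ?thesis by simp
 qed
qed

lemma RelG_in_C: "r : RelG ==> Theta (sec r) : C" unfolding RelG_def
proof (induction r rule: generate.induct)
 case one
 show ?case by (simp add: sec_simps C_closed(4))
next
 case (incl r)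
 thus ?case by (rule Rel_in_C)
next
 case (inv r)
 have k: "keys r <= dotted_matchings (m + n)" using subsetD[OF Rel_carrier inv] by simp
 have "sec (- r) = - sec r" using sec_simps(1)[of 0 r] by (simp add: sec_simps)
 thus ?case using C_closed(2)[OF sec_Hs[OF k] Rel_in_C[OF inv]] k by simp
next
 case (eng r s)
 have rs: "r : RelG" "s : RelG" using eng.hyps by (simp_all add: RelG_def)
 hence "keys r <= dotted_matchings (m + n)" "keys s <= dotted_matchings (m + n)"
  using subsetD[OF RelG_carrier rs(1)] subsetD[OF RelG_carrier rs(2)] by simp_all
 thus ?case using C_closed(1)[OF sec_Hs sec_Hs eng.IH] by (simp add: sec_simps)
qed

text \<open>Commutators of homomorphisms lift to commutators in the algebra, and these are cut to
  elements of \<open>K12\<close>.\<close>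

lemma C_lift: "h : C ==> EX x:Hs. Theta x = h & cutH x : RelG" unfolding C_def
proof (induction h rule: generate.induct)
 case one
 show ?case by (intro bexI[of _ 0]) (simp_all add: Theta_zero RelG_closed(1))
next
 case (incl h)
 then obtain z w where zw: "z : Hs" "w : Hs" "h = Theta (w ** z - z ** w)" unfolding comms_eq by blast
 thus ?case using cut_commutator[OF zw(2,1)] K12_RelG Hs_diff[OF Hs_hmul[OF zw(2,1)] Hs_hmul[OF zw(1,2)]] by blast
next
 case (inv h)
 then obtain z w where zw: "z : Hs" "w : Hs" "h = Theta (w ** z - z ** w)" unfolding comms_eq by blast
 let ?x = "w ** z - z ** w"
 have x: "?x : Hs" by (rule Hs_diff[OF Hs_hmul[OF zw(2,1)] Hs_hmul[OF zw(1,2)]])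
 have "- ?x : Hs" using Hs_diff[OF Hs_0 x] by simp
 moreover have "Theta (- ?x) = inv\<^bsub>add_monoid R\<^esub> h" using Theta_minus(1)[OF x x] zw(3) by (simp add: a_inv_def)
 moreover have "cutH (- ?x) : RelG" using RelG_closed(3) cut_commutator[OF zw(2,1)] K12_RelG unfolding cutH_minus by blast
 ultimately show ?case by blast
next
 case (eng h h')
 then obtain x x' where x: "x : Hs" "Theta x = h" "cutH x : RelG" "x' : Hs" "Theta x' = h'" "cutH x' : RelG" by blast
 have "Theta (x + x') = h \<otimes>\<^bsub>add_monoid R\<^esub> h'" using Theta_plus[of x x'] x by simp
 moreover have "cutH (x + x') : RelG" using RelG_closed(2) x by (simp add: cutH_add)
 ultimately show ?case using Hs_add x by blast
qed

lemma beta_surj: "z : Hs ==> EX x. keys x <= arc_gens (m + n) & beta x = z"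
proof (induction z rule: Hs_induct)
 case zero
 show ?case by (intro exI[of _ 0]) (simp add: beta_def)
next
 case (bas x y D)
 have U: "\<Union>D <= V" using cm_Union[OF bas(1)] cm_Union[OF bas(2)] cc_subset[of _ "x Un y"] bas(3) by fastforce
 have inv: "bend m (unbend x) = x" "bend m (unbend y) = y" "bend m (unbend D) = D"
  using bend_unbend cm_Union[OF bas(1)] cm_Union[OF bas(2)] U by auto
 have um: "unbend x : matchings (m + n)" "unbend y : matchings (m + n)" using unbend_matching bas by auto
 have "circ (unbend y) (unbend x) = unbend (circ y x)" unfolding unbend_def image_Un[symmetric]
  by (rule cc_image_inj[OF inj_on_subset[OF inj_pos_V]]) (use cm_Union[OF bas(1)] cm_Union[OF bas(2)] in simp)
 hence "unbend D <= circ (unbend y) (unbend x)" using bas(3) by (simp add: unbend_def image_mono Un_commute)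
 hence "(unbend y, unbend x, unbend D) : arc_gens (m + n)" using um by (simp add: arc_gens_iff)
 thus ?case using inv by (intro exI[of _ "frag_of (unbend y, unbend x, unbend D)"]) (simp add: beta_def bend_def)
next
 case (diff u v)
 then obtain x x' where x: "keys x <= arc_gens (m + n)" "beta x = u" "keys x' <= arc_gens (m + n)" "beta x' = v"
  by blast
 thus ?case using keys_diff[of x x'] by (intro exI[of _ "x - x'"]) (auto simp: beta_def frag_extend_diff)
qed

text \<open>If the image of \<open>sec w\<close> is a combination of commutators, it has a lift
  whose cut is a combination of relations. The difference between this lift and \<open>sec w\<close>
  is killed by \<open>Theta\<close>, so its cut is a relation coming from the kernel of
  \<open>phi\<close>; together they express \<open>w\<close>.\<close>

lemma C_iff: assumes w: "keys w <= dotted_matchings (m + n)"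
 shows "Theta (sec w) : C \<longleftrightarrow> w : RelG"
proof
 assume "Theta (sec w) : C"
 then obtain x where x: "x : Hs" "Theta x = Theta (sec w)" "cutH x : RelG" using C_lift by blast
 have s: "sec w : Hs" by (rule sec_Hs[OF w])
 have "Theta (x - sec w) T1 T2 u = Theta 0 T1 T2 u" for T1 T2 u by (simp add: Theta_diff x(2) Theta_0)
 hence t0: "Theta (x - sec w) = Theta 0" by (intro ext)
 obtain v where v: "keys v <= arc_gens (m + n)" "beta v = x - sec w" using beta_surj[OF Hs_diff[OF x(1) s]] by blast
 have "cutH (beta v) : kernel_relations m n" unfolding kernel_relations_eq mem_Collect_eq
  by (intro exI[of _ v] conjI refl v(1)) (unfold v(2), rule t0)
 hence "cutH (x - sec w) : kernel_relations m n" unfolding v(2) .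
 hence a: "cutH (x - sec w) : RelG" unfolding RelG_def Rel_def by (intro generate.incl UnI2)
 have "cutH x - (cutH x - cutH (sec w)) : RelG" using RelG_closed(4)[OF x(3) a] unfolding cutH_diff .
 thus "w : RelG" using cut_sec[OF w] by simp
next
 show "w : RelG ==> Theta (sec w) : C" by (rule RelG_in_C)
qed

text \<open>The map sending \<open>w\<close> to the class of \<open>Theta (sec w)\<close> is onto,
  because every element of the algebra is its doubled cut up to commutators, and its kernel is
  \<open>RelG\<close> by \<open>C_iff\<close>.\<close>

theorem HH0_iso: "HH0 R \<cong> R_module m n"
proof -
 let ?A = "add_monoid R" and ?q = "%w. C #>\<^bsub>add_monoid R\<^esub> Theta (sec w)"
 interpret A: comm_group ?A by (rule abelian_group.a_comm_group[OF abelian_group_Hom])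
 interpret N: normal C ?A by (rule A.subgroup_imp_normal[OF subgroup_C])
 have car: "Theta (sec w) : carrier ?A" if "keys w <= dotted_matchings (m + n)" for w
  using Theta_carrier[OF sec_Hs[OF that]] by simp
 have hq: "?q : hom G (?A Mod C)"
 proof (rule homI)
  show "?q w : carrier (?A Mod C)" if "w : carrier G" for w
   using hom_in_carrier[OF N.r_coset_hom_Mod car[of w]] that by simp
  show "?q (v \<otimes>\<^bsub>G\<^esub> w) = ?q v \<otimes>\<^bsub>?A Mod C\<^esub> ?q w" if "v : carrier G" "w : carrier G" for v w
   using hom_mult[OF N.r_coset_hom_Mod car[of v] car[of w]] that by (simp add: sec_simps Theta_plus)
 qed
 interpret q: group_hom G "?A Mod C" ?q
  by (intro group_hom.intro group_hom_axioms.intro group_free_Abelian_group N.factorgroup_is_group hq)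
 have ker: "kernel G (?A Mod C) ?q = RelG"
 proof -
  have e: "?q w = C \<longleftrightarrow> w : RelG" if "keys w <= dotted_matchings (m + n)" for w
   using A.coset_join1[OF _ car[OF that] subgroup_C] A.coset_join2[OF car[OF that] subgroup_C] C_iff[OF that] by blast
  show ?thesis unfolding kernel_def one_FactGroup
  proof (rule Set.set_eqI)
   fix w
   show "w : {x : carrier G. ?q x = C} \<longleftrightarrow> w : RelG"
    unfolding mem_Collect_eq carrier_free_Abelian_group_iff
    using e[of w] subsetD[OF RelG_carrier, of w, unfolded carrier_free_Abelian_group_iff] by blast
  qed
 qed
 have img: "?q ` carrier G = carrier (?A Mod C)"
 proof
  show "?q ` carrier G <= carrier (?A Mod C)" using q.hom_closed by blast
  show "carrier (?A Mod C) <= ?q ` carrier G"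
  proof
   fix K assume "K : carrier (?A Mod C)"
   then obtain f where f: "f : carrier R" "K = C #>\<^bsub>?A\<^esub> f" unfolding carrier_FactGroup by auto
   obtain z where z: "z : Hs" "Theta z = f" using Theta_surj[OF f(1)] .
   have k: "keys (cutH z) <= dotted_matchings (m + n)" by (rule keys_cut[OF z(1)])
   have "f = Theta (z - sec (cutH z)) \<otimes>\<^bsub>?A\<^esub> Theta (sec (cutH z))"
    using z(2) by (simp add: Theta_plus)
   hence "f : C #>\<^bsub>?A\<^esub> Theta (sec (cutH z))" unfolding r_coset_def using sec_cut_C[OF z(1)] by blast
   hence "K = ?q (cutH z)" unfolding f(2) using A.repr_independence[OF _ car[OF k] subgroup_C] by simp
   thus "K : ?q ` carrier G" using k by auto
  qed
 qed
 have "G Mod RelG \<cong> ?A Mod C" using q.FactGroup_iso[OF img] unfolding ker .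
 moreover have "normal RelG G" by (rule comm_group.subgroup_imp_normal[OF abelian_free_Abelian_group])
   (unfold RelG_def, rule group.generate_is_subgroup[OF group_free_Abelian_group Rel_carrier])
 ultimately have "?A Mod C \<cong> G Mod RelG" using group.iso_sym[OF normal.factorgroup_is_group] by blast
 thus ?thesis unfolding HH0_def A_FactGroup_def R_module_def RelG_def Rel_def C_def comms_def .
qed

end

theorem proposition6p4p1: fixes m n :: nat shows "HH0 (Hom_ring m n) \<cong> R_module m n"
 by (rule tangle_setting.HH0_iso)

end
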